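(* Let $L=\mathbb{Q}[\alpha]/(\alpha^{24}-2)$. The polynomial $x^{24}-2$ is irreducible over $\mathbb{Q}$, so $L$ is a field extension of $\mathbb{Q}$ of degree $24$. For $i\ge 0$ let $L_i$ denote the $\mathbb{Q}$-subspace of $L$ spanned by $1,\alpha,\dots,\alpha^i$. Let $V$ be the $\mathbb{Q}$-subspace of $L$ spanned by the six elements $$1,\quad \alpha-\alpha^{15},\quad \alpha^2-\alpha^{12}-\alpha^{16},\quad \alpha^4-\alpha^{14},\quad \alpha^6-\alpha^{13}+\alpha^{20},\quad \alpha^9+\alpha^{16}+\alpha^{19}.$$ Then $V$ satisfies the following conditions: (1) $\operatorname{rank}_{\mathbb{Q}}V=6$; (2) the sum $V+\alpha V+\alpha^2V$ is direct; (3) $V^2=L_{20}$; (4) $L=VL_{21}$. Set $W=V\oplus\alpha V$, let $t$ be an indeterminate, and set $$R=\mathbb{Q}\oplus Wt\oplus L_{22}t^2\oplus\bigoplus_{i\ge3}Lt^i\subset L[t],$$ where $L[t]$ is graded with $|t|=1$. Then $R$ is a subring of $L[t]$ which is a standard graded Gorenstein $\mathbb{Q}$-algebra and a domain. Moreover, the ideal $I=(t,\alpha t)R$ of $R$ is rigid, but not principal. The ideal $I$ has the added property that the evaluation map $$I\otimes_R\operatorname{Hom}_R(I,R)\longrightarrow R,\qquad x\otimes f\mapsto f(x),$$ is an isomorphism onto $\mathfrak{m}=\bigoplus_{i\ge1}R_i$, the homogeneous maximal ideal of $R$, where $R_i$ denotes the degree $i$ component of $R$.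
   Context: An ideal $I$ of a commutative ring $R$ is rigid if $\operatorname{Ext}^1_R(I,I)=0$. A graded $\mathbb{Q}$-algebra $R=\bigoplus_{i\ge0}R_i$ with $R_0=\mathbb{Q}$ is standard graded if it is generated as a $\mathbb{Q}$-algebra by finitely many elements of degree one. For $\mathbb{Q}$-subspaces $U,U'$ of $L$, the product $UU'$ is the $\mathbb{Q}$-span of all products $uu'$ with $u\in U$ and $u'\in U'$, and $U^2=UU$; $\operatorname{rank}_{\mathbb{Q}}$ denotes vector space dimension over $\mathbb{Q}$. *)

theory Defs
  imports
    "HOL-Computational_Algebra.Polynomial"
    "HOL-Algebra.Ring_Divisibility"
    "HOL-Algebra.Generated_Rings"
    "HOL-Algebra.Module"
begin

definition ring_of :: "'a::comm_ring_1 set \<Rightarrow> 'a ring" where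
  "ring_of A = \<lparr>carrier = A, mult = (*), one = 1, zero = 0, add = (+)\<rparr>"

definition fraction :: "('a, 'b) ring_scheme \<Rightarrow> 'a set \<Rightarrow> 'a \<Rightarrow> 'a \<Rightarrow> ('a \<times> 'a) set" where
  "fraction R S a s =
     {(b, u). b \<in> carrier R \<and> u \<in> S \<and>
        (\<exists>w\<in>S. w \<otimes>\<^bsub>R\<^esub> (a \<otimes>\<^bsub>R\<^esub> u \<ominus>\<^bsub>R\<^esub> b \<otimes>\<^bsub>R\<^esub> s) = \<zero>\<^bsub>R\<^esub>)}"

text \<open>Sums and products of fractions do not depend on the representatives, so the unions below are
  unions of one and the same class.\<close>

definition localization :: "('a, 'b) ring_scheme \<Rightarrow> 'a set \<Rightarrow> ('a \<times> 'a) set ring" where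
  "localization R S =
     \<lparr>carrier = {fraction R S a s | a s. a \<in> carrier R \<and> s \<in> S},
      mult = (\<lambda>X Y. \<Union>(a, s)\<in>X. \<Union>(b, u)\<in>Y. fraction R S (a \<otimes>\<^bsub>R\<^esub> b) (s \<otimes>\<^bsub>R\<^esub> u)),
      one = fraction R S \<one>\<^bsub>R\<^esub> \<one>\<^bsub>R\<^esub>,
      zero = fraction R S \<zero>\<^bsub>R\<^esub> \<one>\<^bsub>R\<^esub>,
      add = (\<lambda>X Y. \<Union>(a, s)\<in>X. \<Union>(b, u)\<in>Y.
               fraction R S (a \<otimes>\<^bsub>R\<^esub> u \<oplus>\<^bsub>R\<^esub> b \<otimes>\<^bsub>R\<^esub> s) (s \<otimes>\<^bsub>R\<^esub> u))\<rparr>"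

text \<open>The record of modules extends the record of rings; the fields \<open>mult\<close> and \<open>one\<close> of a module
  play no role in the locale of modules and are filled in arbitrarily.\<close>

definition sub_mod :: "('r, 'm, 'c) module_scheme \<Rightarrow> 'm set \<Rightarrow> ('r, 'm, 'c) module_scheme" where
  "sub_mod M H = M\<lparr>carrier := H\<rparr>"

definition ideal_mod :: "('r, 'b) ring_scheme \<Rightarrow> 'r set \<Rightarrow> ('r, 'r) module" where
  "ideal_mod R I =
     \<lparr>carrier = I, mult = mult R, one = \<one>\<^bsub>R\<^esub>, zero = \<zero>\<^bsub>R\<^esub>, add = add R, smult = mult R\<rparr>"

abbreviation regular_mod :: "('r, 'b) ring_scheme \<Rightarrow> ('r, 'r) module" where
  "regular_mod R \<equiv> ideal_mod R (carrier R)"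

definition quot_mod :: "('r, 'm, 'c) module_scheme \<Rightarrow> 'm set \<Rightarrow> ('r, 'm set) module" where
  "quot_mod M H =
     \<lparr>carrier = a_rcosets\<^bsub>M\<^esub> H, mult = (\<lambda>X Y. H), one = H, zero = H,
      add = (\<lambda>X Y. X <+>\<^bsub>M\<^esub> Y),
      smult = (\<lambda>r X. \<Union>x\<in>X. H +>\<^bsub>M\<^esub> (r \<odot>\<^bsub>M\<^esub> x))\<rparr>"

definition lin_maps ::
  "('r, 'b) ring_scheme \<Rightarrow> ('r, 'm, 'c) module_scheme \<Rightarrow> ('r, 'n, 'd) module_scheme \<Rightarrow> ('m \<Rightarrow> 'n) set"
where
  "lin_maps R M N =
     {f \<in> carrier M \<rightarrow>\<^sub>E carrier N.
        (\<forall>x\<in>carrier M. \<forall>y\<in>carrier M. f (x \<oplus>\<^bsub>M\<^esub> y) = f x \<oplus>\<^bsub>N\<^esub> f y) \<and>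
        (\<forall>r\<in>carrier R. \<forall>x\<in>carrier M. f (r \<odot>\<^bsub>M\<^esub> x) = r \<odot>\<^bsub>N\<^esub> f x)}"

definition lin_kernel ::
  "('r, 'm, 'c) module_scheme \<Rightarrow> ('r, 'n, 'd) module_scheme \<Rightarrow> ('m \<Rightarrow> 'n) \<Rightarrow> 'm set" where
  "lin_kernel M N f = {x \<in> carrier M. f x = \<zero>\<^bsub>N\<^esub>}"

definition Hom_mod ::
  "('r, 'b) ring_scheme \<Rightarrow> ('r, 'm, 'c) module_scheme \<Rightarrow> ('r, 'n, 'd) module_scheme
     \<Rightarrow> ('r, 'm \<Rightarrow> 'n) module" where
  "Hom_mod R M N =
     \<lparr>carrier = lin_maps R M N,
      mult = (\<lambda>f g. \<lambda>x\<in>carrier M. \<zero>\<^bsub>N\<^esub>), one = (\<lambda>x\<in>carrier M. \<zero>\<^bsub>N\<^esub>),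
      zero = (\<lambda>x\<in>carrier M. \<zero>\<^bsub>N\<^esub>),
      add = (\<lambda>f g. \<lambda>x\<in>carrier M. f x \<oplus>\<^bsub>N\<^esub> g x),
      smult = (\<lambda>r f. \<lambda>x\<in>carrier M. r \<odot>\<^bsub>N\<^esub> f x)\<rparr>"

definition free_mod :: "('r, 'b) ring_scheme \<Rightarrow> 'x set \<Rightarrow> ('r, 'x \<Rightarrow> 'r) module" where
  "free_mod R X =
     \<lparr>carrier = {f \<in> X \<rightarrow>\<^sub>E carrier R. finite {x \<in> X. f x \<noteq> \<zero>\<^bsub>R\<^esub>}},
      mult = (\<lambda>f g. \<lambda>x\<in>X. \<zero>\<^bsub>R\<^esub>), one = (\<lambda>x\<in>X. \<zero>\<^bsub>R\<^esub>),
      zero = (\<lambda>x\<in>X. \<zero>\<^bsub>R\<^esub>),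
      add = (\<lambda>f g. \<lambda>x\<in>X. f x \<oplus>\<^bsub>R\<^esub> g x),
      smult = (\<lambda>r f. \<lambda>x\<in>X. r \<otimes>\<^bsub>R\<^esub> f x)\<rparr>"

definition free_basis :: "('r, 'b) ring_scheme \<Rightarrow> 'x set \<Rightarrow> 'x \<Rightarrow> 'x \<Rightarrow> 'r" where
  "free_basis R X x = (\<lambda>y\<in>X. if y = x then \<one>\<^bsub>R\<^esub> else \<zero>\<^bsub>R\<^esub>)"

text \<open>The linear map from the free module on \<open>X\<close> to \<open>M\<close> that sends the basis element of \<open>x\<close> to \<open>h x\<close>.\<close>

definition lin_extension ::
  "('r, 'b) ring_scheme \<Rightarrow> ('r, 'm, 'c) module_scheme \<Rightarrow> 'x set \<Rightarrow> ('x \<Rightarrow> 'm) \<Rightarrow> ('x \<Rightarrow> 'r) \<Rightarrow> 'm"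
where
  "lin_extension R M X h =
     (\<lambda>f\<in>carrier (free_mod R X).
        finsum M (\<lambda>x. f x \<odot>\<^bsub>M\<^esub> h x) {x \<in> X. f x \<noteq> \<zero>\<^bsub>R\<^esub>})"

definition generated_submodule ::
  "('r, 'b) ring_scheme \<Rightarrow> ('r, 'm) module \<Rightarrow> 'm set \<Rightarrow> 'm set" where
  "generated_submodule R M A = \<Inter>{H. submodule H R M \<and> A \<subseteq> H}"

definition tensor_relations ::
  "('r, 'b) ring_scheme \<Rightarrow> ('r, 'm) module \<Rightarrow> ('r, 'n) module \<Rightarrow> ('m \<times> 'n \<Rightarrow> 'r) set" where
  "tensor_relations R M N =
     (let X = carrier M \<times> carrier N; F = free_mod R X; e = (\<lambda>x y. free_basis R X (x, y)) in
        {e (x \<oplus>\<^bsub>M\<^esub> x') y \<ominus>\<^bsub>F\<^esub> (e x y \<oplus>\<^bsub>F\<^esub> e x' y) | x x' y.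
           x \<in> carrier M \<and> x' \<in> carrier M \<and> y \<in> carrier N} \<union>
        {e x (y \<oplus>\<^bsub>N\<^esub> y') \<ominus>\<^bsub>F\<^esub> (e x y \<oplus>\<^bsub>F\<^esub> e x y') | x y y'.
           x \<in> carrier M \<and> y \<in> carrier N \<and> y' \<in> carrier N} \<union>
        {e (r \<odot>\<^bsub>M\<^esub> x) y \<ominus>\<^bsub>F\<^esub> r \<odot>\<^bsub>F\<^esub> e x y | r x y.
           r \<in> carrier R \<and> x \<in> carrier M \<and> y \<in> carrier N} \<union>
        {e x (r \<odot>\<^bsub>N\<^esub> y) \<ominus>\<^bsub>F\<^esub> r \<odot>\<^bsub>F\<^esub> e x y | r x y.
           r \<in> carrier R \<and> x \<in> carrier M \<and> y \<in> carrier N})"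

definition tensor_null ::
  "('r, 'b) ring_scheme \<Rightarrow> ('r, 'm) module \<Rightarrow> ('r, 'n) module \<Rightarrow> ('m \<times> 'n \<Rightarrow> 'r) set" where
  "tensor_null R M N =
     generated_submodule R (free_mod R (carrier M \<times> carrier N)) (tensor_relations R M N)"

definition tensor_mod ::
  "('r, 'b) ring_scheme \<Rightarrow> ('r, 'm) module \<Rightarrow> ('r, 'n) module
     \<Rightarrow> ('r, ('m \<times> 'n \<Rightarrow> 'r) set) module" where
  "tensor_mod R M N =
     quot_mod (free_mod R (carrier M \<times> carrier N)) (tensor_null R M N)"

definition pure_tensor ::
  "('r, 'b) ring_scheme \<Rightarrow> ('r, 'm) module \<Rightarrow> ('r, 'n) module \<Rightarrow> 'm \<Rightarrow> 'n
     \<Rightarrow> ('m \<times> 'n \<Rightarrow> 'r) set" where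
  "pure_tensor R M N x y =
     tensor_null R M N +>\<^bsub>free_mod R (carrier M \<times> carrier N)\<^esub>
       free_basis R (carrier M \<times> carrier N) (x, y)"

abbreviation dual_mod :: "('r, 'b) ring_scheme \<Rightarrow> ('r, 'm) module \<Rightarrow> ('r, 'm \<Rightarrow> 'r) module" where
  "dual_mod R M \<equiv> Hom_mod R M (regular_mod R)"

text \<open>The map induced on the tensor product by the linear extension of \<open>(x, f) \<mapsto> f x\<close>; that extension
  is constant on each coset, which is what \<open>the_elem\<close> relies on.\<close>

definition evaluation_map ::
  "('r, 'b) ring_scheme \<Rightarrow> ('r, 'm) module \<Rightarrow> ('m \<times> ('m \<Rightarrow> 'r) \<Rightarrow> 'r) set \<Rightarrow> 'r" where
  "evaluation_map R M =
     (\<lambda>T\<in>carrier (tensor_mod R M (dual_mod R M)).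
        the_elem (lin_extension R (regular_mod R) (carrier M \<times> carrier (dual_mod R M))
                    (\<lambda>(x, f). f x) ` T))"

text \<open>The free module on the underlying set of \<open>M\<close>, its canonical map onto \<open>M\<close>, and the kernel of
  this map. Iterating gives the standard free resolution of \<open>M\<close>, with terms \<open>free_cover R M\<close>,
  \<open>free_cover R (syzygy R M)\<close>, \<open>free_cover R (syzygy R (syzygy R M))\<close> and so on; since each
  syzygy sits in the previous term, the differentials are again the maps \<open>cover_map\<close>.\<close>

abbreviation free_cover :: "('r, 'b) ring_scheme \<Rightarrow> ('r, 'm) module \<Rightarrow> ('r, 'm \<Rightarrow> 'r) module" where
  "free_cover R M \<equiv> free_mod R (carrier M)"

definition cover_map :: "('r, 'b) ring_scheme \<Rightarrow> ('r, 'm) module \<Rightarrow> ('m \<Rightarrow> 'r) \<Rightarrow> 'm" where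
  "cover_map R M = lin_extension R M (carrier M) (\<lambda>x. x)"

definition syzygy :: "('r, 'b) ring_scheme \<Rightarrow> ('r, 'm) module \<Rightarrow> ('r, 'm \<Rightarrow> 'r) module" where
  "syzygy R M = sub_mod (free_cover R M) (lin_kernel (free_cover R M) M (cover_map R M))"

definition Ext1_cocycles ::
  "('r, 'b) ring_scheme \<Rightarrow> ('r, 'm) module \<Rightarrow> ('r, 'n) module \<Rightarrow> ((('m \<Rightarrow> 'r) \<Rightarrow> 'r) \<Rightarrow> 'n) set"
where
  "Ext1_cocycles R M N =
     {\<phi> \<in> lin_maps R (free_cover R (syzygy R M)) N.
        \<forall>z\<in>carrier (free_cover R (syzygy R (syzygy R M))).
          \<phi> (cover_map R (syzygy R (syzygy R M)) z) = \<zero>\<^bsub>N\<^esub>}"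

definition Ext1_coboundaries ::
  "('r, 'b) ring_scheme \<Rightarrow> ('r, 'm) module \<Rightarrow> ('r, 'n) module \<Rightarrow> ((('m \<Rightarrow> 'r) \<Rightarrow> 'r) \<Rightarrow> 'n) set"
where
  "Ext1_coboundaries R M N =
     (\<lambda>\<psi>. \<lambda>z\<in>carrier (free_cover R (syzygy R M)). \<psi> (cover_map R (syzygy R M) z))
       ` lin_maps R (free_cover R M) N"

definition Ext1 ::
  "('r, 'b) ring_scheme \<Rightarrow> ('r, 'm) module \<Rightarrow> ('r, 'n) module
     \<Rightarrow> ('r, ((('m \<Rightarrow> 'r) \<Rightarrow> 'r) \<Rightarrow> 'n) set) module" where
  "Ext1 R M N =
     quot_mod (sub_mod (Hom_mod R (free_cover R (syzygy R M)) N) (Ext1_cocycles R M N))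
       (Ext1_coboundaries R M N)"

definition rigid_ideal :: "('r, 'b) ring_scheme \<Rightarrow> 'r set \<Rightarrow> bool" where
  "rigid_ideal R I \<longleftrightarrow>
     ideal I R \<and>
     carrier (Ext1 R (ideal_mod R I) (ideal_mod R I))
       = {\<zero>\<^bsub>Ext1 R (ideal_mod R I) (ideal_mod R I)\<^esub>}"

text \<open>HOL cannot quantify over modules of all types inside a definition, so all modules here have
  elements of type \<open>('a \<times> nat) set\<close>, where \<open>'a\<close> is the element type of the ring \<open>A\<close>. This loses
  nothing. The ideals of \<open>A\<close> embed in this type, so by Baer's criterion the test modules \<open>M, N\<close>
  detect injectivity among all modules. If \<open>\<kappa>\<close> is the cardinality of \<open>'a \<times> nat\<close> and a module \<open>M\<close>
  has at most \<open>2\<^sup>\<kappa>\<close> elements, then so has the injective module of additive maps from \<open>A\<close> to a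
  divisible hull of \<open>M\<close>; hence \<open>A\<close> has an injective resolution, of minimal length, inside this
  type.\<close>

definition injective_mod ::
  "('a, 'b) ring_scheme \<Rightarrow> ('a, ('a \<times> nat) set) module \<Rightarrow> bool" where
  "injective_mod A E \<longleftrightarrow>
     Module.module A E \<and>
     (\<forall>(M :: ('a, ('a \<times> nat) set) module) (N :: ('a, ('a \<times> nat) set) module).
        \<forall>i\<in>lin_maps A M N. \<forall>f\<in>lin_maps A M E.
          Module.module A M \<and> Module.module A N \<and> inj_on i (carrier M) \<longrightarrow>
          (\<exists>g\<in>lin_maps A N E. \<forall>x\<in>carrier M. g (i x) = f x))"

text \<open>The finite injective resolution is written as an infinite one
  \<open>0 \<rightarrow> A \<rightarrow> E 0 \<rightarrow> E 1 \<rightarrow> \<dots>\<close> with \<open>E i = 0\<close> for \<open>i > n\<close>.\<close>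

definition finite_self_injective_dimension :: "('a, 'b) ring_scheme \<Rightarrow> bool" where
  "finite_self_injective_dimension A \<longleftrightarrow>
     (\<exists>(n :: nat) (E :: nat \<Rightarrow> ('a, ('a \<times> nat) set) module) \<eta> d.
        (\<forall>i. injective_mod A (E i)) \<and>
        (\<forall>i>n. carrier (E i) = {\<zero>\<^bsub>E i\<^esub>}) \<and>
        \<eta> \<in> lin_maps A (regular_mod A) (E 0) \<and>
        (\<forall>i. d i \<in> lin_maps A (E i) (E (Suc i))) \<and>
        inj_on \<eta> (carrier A) \<and>
        \<eta> ` carrier A = lin_kernel (E 0) (E 1) (d 0) \<and>
        (\<forall>i. d i ` carrier (E i) = lin_kernel (E (Suc i)) (E (Suc (Suc i))) (d (Suc i))))"

text \<open>The localizations below are automatically noetherian local rings.\<close>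

definition gorenstein_ring :: "('a, 'b) ring_scheme \<Rightarrow> bool" where
  "gorenstein_ring R \<longleftrightarrow>
     cring R \<and> noetherian_ring R \<and>
     (\<forall>P. maximalideal P R \<longrightarrow>
        finite_self_injective_dimension (localization R (carrier R - P)))"

definition internal_grading :: "('a, 'b) ring_scheme \<Rightarrow> (nat \<Rightarrow> 'a set) \<Rightarrow> bool" where
  "internal_grading R G \<longleftrightarrow>
     (\<forall>i. additive_subgroup (G i) R) \<and>
     (\<forall>i j. \<forall>x\<in>G i. \<forall>y\<in>G j. x \<otimes>\<^bsub>R\<^esub> y \<in> G (i + j)) \<and>
     (\<forall>x\<in>carrier R. \<exists>!f. (\<forall>i. f i \<in> G i) \<and> finite {i. f i \<noteq> \<zero>\<^bsub>R\<^esub>} \<and>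
        x = finsum R f {i. f i \<noteq> \<zero>\<^bsub>R\<^esub>})"

text \<open>The algebra structure is given by the ring homomorphism \<open>\<iota>\<close>; it identifies \<open>\<rat>\<close> with \<open>G 0\<close>.\<close>

definition standard_graded_rat_algebra ::
  "('a, 'b) ring_scheme \<Rightarrow> (rat \<Rightarrow> 'a) \<Rightarrow> (nat \<Rightarrow> 'a set) \<Rightarrow> bool" where
  "standard_graded_rat_algebra R \<iota> G \<longleftrightarrow>
     cring R \<and> \<iota> \<in> ring_hom (ring_of UNIV) R \<and>
     internal_grading R G \<and> bij_betw \<iota> UNIV (G 0) \<and>
     (\<exists>S. finite S \<and> S \<subseteq> G 1 \<and> generate_ring R (range \<iota> \<union> S) = carrier R)"

definition L_modulus :: "rat poly" where
  "L_modulus = Polynomial.monom 1 24 - 2"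

quotient_type L = "rat poly" / "\<lambda>p q. L_modulus dvd (p - q)"
proof (rule equivpI)
  show "reflp (\<lambda>p q. L_modulus dvd (p - q))"
    by (simp add: reflp_def)
  show "symp (\<lambda>p q. L_modulus dvd (p - q))"
    by (auto simp: symp_def dvd_diff_commute)
  show "transp (\<lambda>p q. L_modulus dvd (p - q))"
    by (rule transpI) (metis dvd_add diff_add_cancel add_diff_eq)
qed

instantiation L :: comm_ring_1
begin

lift_definition zero_L :: L is 0 .
lift_definition one_L :: L is 1 .
lift_definition uminus_L :: "L \<Rightarrow> L" is uminus
  by (metis dvd_minus_iff minus_diff_minus)
lift_definition plus_L :: "L \<Rightarrow> L \<Rightarrow> L" is "(+)"
  by (metis dvd_add add_diff_add)
lift_definition minus_L :: "L \<Rightarrow> L \<Rightarrow> L" is "(-)"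
  by (metis dvd_diff diff_diff_eq2 add_diff_eq diff_add_eq diff_diff_add add.commute)
lift_definition times_L :: "L \<Rightarrow> L \<Rightarrow> L" is "(*)"
proof -
  fix p p' q q' :: "rat poly"
  assume "L_modulus dvd p - p'" "L_modulus dvd q - q'"
  moreover have "p * q - p' * q' = (p - p') * q + p' * (q - q')"
    by (simp add: algebra_simps)
  ultimately show "L_modulus dvd p * q - p' * q'"
    by simp
qed

lemma L_modulus_not_unit: "\<not> L_modulus dvd 1"
proof -
  have "Polynomial.coeff L_modulus 24 = 1"
    by (simp add: L_modulus_def numeral_poly coeff_eq_0)
  then have "Polynomial.degree L_modulus \<ge> 24"
    by (intro le_degree) simp
  then show ?thesis
    using dvd_imp_degree_le[of L_modulus 1] by auto
qed

instance
proof
  show "(0::L) \<noteq> 1"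
    by transfer (use L_modulus_not_unit in simp)
qed (transfer; simp add: algebra_simps)+

end

lift_definition \<alpha> :: L is "[:0, 1:]" .

lift_definition scale_L :: "rat \<Rightarrow> L \<Rightarrow> L" is Polynomial.smult
  by (simp add: dvd_smult flip: smult_diff_right)

global_interpretation L: vector_space scale_L
  defines span_L = L.span and dim_L = L.dim
  by unfold_locales (transfer; simp add: smult_add_right smult_add_left)+

definition L_upto :: "nat \<Rightarrow> L set" where
  "L_upto i = span_L {\<alpha> ^ j | j. j \<le> i}"

definition space_prod :: "L set \<Rightarrow> L set \<Rightarrow> L set" where
  "space_prod U U' = span_L {u * u' | u u'. u \<in> U \<and> u' \<in> U'}"

definition direct_sum_on :: "'i set \<Rightarrow> ('i \<Rightarrow> 'a::comm_monoid_add set) \<Rightarrow> bool" where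
  "direct_sum_on A U \<longleftrightarrow>
     (\<forall>u. (\<forall>i\<in>A. u i \<in> U i) \<and> (\<Sum>i\<in>A. u i) = 0 \<longrightarrow> (\<forall>i\<in>A. u i = 0))"

definition V :: "L set" where
  "V = span_L
     {1, \<alpha> - \<alpha> ^ 15, \<alpha> ^ 2 - \<alpha> ^ 12 - \<alpha> ^ 16, \<alpha> ^ 4 - \<alpha> ^ 14,
      \<alpha> ^ 6 - \<alpha> ^ 13 + \<alpha> ^ 20, \<alpha> ^ 9 + \<alpha> ^ 16 + \<alpha> ^ 19}"

definition W :: "L set" where
  "W = {v + \<alpha> * v' | v v'. v \<in> V \<and> v' \<in> V}"

text \<open>\<open>R_coeffs i\<close> is the space of coefficients of \<open>t ^ i\<close>; the indeterminate \<open>t\<close> is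
  \<open>Polynomial.monom 1 1\<close>.\<close>

definition R_coeffs :: "nat \<Rightarrow> L set" where
  "R_coeffs i =
     (if i = 0 then span_L {1} else if i = 1 then W else if i = 2 then L_upto 22 else UNIV)"

definition R_set :: "L poly set" where
  "R_set = {p. \<forall>i. Polynomial.coeff p i \<in> R_coeffs i}"

abbreviation L_poly_ring :: "L poly ring" where
  "L_poly_ring \<equiv> ring_of UNIV"

abbreviation R_ring :: "L poly ring" where
  "R_ring \<equiv> ring_of R_set"

definition R_component :: "nat \<Rightarrow> L poly set" where
  "R_component i = {Polynomial.monom c i | c. c \<in> R_coeffs i}"

definition R_scalar :: "rat \<Rightarrow> L poly" where
  "R_scalar q = Polynomial.monom (scale_L q 1) 0"

definition R_max_ideal :: "L poly set" where
  "R_max_ideal = {p \<in> R_set. Polynomial.coeff p 0 = 0}"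

definition I_ideal :: "L poly set" where
  "I_ideal = genideal R_ring {Polynomial.monom 1 1, Polynomial.monom \<alpha> 1}"

end

theory Submission
  imports
    Defs
    "HOL-Computational_Algebra.Polynomial_Factorial"
    "HOL-Computational_Algebra.Field_as_Ring"
    "HOL-Computational_Algebra.Fraction_Field"
begin

text \<open>Let \<open>lam x\<close> be the coefficient of \<open>\<alpha>\<^sup>2\<^sup>3\<close> in \<open>x \<in> L\<close>. The proof rests on the symmetric bilinear
  form \<open>(x, y) \<mapsto> lam (x y)\<close> on \<open>L\<close> over \<open>\<rat>\<close>. It is nondegenerate, and the orthogonal complement of \<open>L\<^sub>n\<close>
  is \<open>L\<^sub>2\<^sub>2\<^sub>-\<^sub>n\<close> for \<open>n \<le> 22\<close>. By biduality (\<open>double_perp\<close>) statements about spans are systems of linear equations. One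
  such system gives \<open>V + \<alpha> V + \<alpha>\<^sup>2 V + \<alpha>\<^sup>3 V = L\<close> (\<open>Vs_4\<close>), and since \<open>4 * 6 = 24\<close> this sum is direct and
  \<open>V\<close> has dimension 6; in particular \<open>V L\<^sub>2\<^sub>1 = L\<close>. A second system gives \<open>V\<^sup>2 = L\<^sub>2\<^sub>0\<close> (\<open>V_squared\<close>). It
  follows that the complement of \<open>V\<close> is \<open>V + \<alpha> V + \<alpha>\<^sup>2 V\<close>, that \<open>W\<close> is its own complement, and that the
  coefficient spaces \<open>\<rat>\<close>, \<open>W\<close>, \<open>L\<^sub>2\<^sub>2\<close> of \<open>R\<close> in degrees 0, 1, 2 are exchanged by taking complements.

  This symmetry is why \<open>R\<close> is Gorenstein. For monic \<open>a \<in> R\<close> a residue functional \<open>tau a\<close> on \<open>L[t]\<close>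
  vanishes on \<open>a R\<close> and induces a nondegenerate form on the finite-dimensional algebra \<open>R / a R\<close>
  (\<open>tau_vanishes\<close>, \<open>tau_nondegenerate\<close>), so \<open>R / a R\<close> is injective over itself. Let \<open>A\<close> be the
  localization of \<open>R\<close> at a maximal ideal and \<open>K\<close> its field of fractions. After a multiplication is
  subtracted, a homomorphism from an ideal containing \<open>a\<close> to \<open>K / A\<close> takes values in \<open>a\<^sup>-\<^sup>1 A / A\<close>, a copy of
  a quotient of \<open>R / a R\<close>, and duality shows that it is itself a multiplication (\<open>baer_localization\<close>). By
  Baer's criterion \<open>0 \<rightarrow> A \<rightarrow> K \<rightarrow> K / A \<rightarrow> 0\<close> is then an injective resolution.

  For the ideal \<open>I = (t, \<alpha> t)\<close>, a linear map from \<open>I\<close> to \<open>R\<close> is determined by the image of \<open>t\<close>, so the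
  dual of \<open>I\<close> is \<open>D = {q \<in> R. \<alpha> q \<in> R}\<close>, whose coefficient spaces are \<open>0\<close>, \<open>V\<close>, \<open>L\<^sub>2\<^sub>1\<close>, \<open>L\<close>, \<open>L\<close>, and so on.
  The relations between the two generators are the pairs \<open>(- \<alpha> q, q)\<close> with \<open>q \<in> D\<close>. A linear map from
  them to \<open>I\<close> is multiplication by some \<open>w\<close> with \<open>w D \<subseteq> I\<close>, and it extends to all pairs as soon as
  \<open>w \<in> I + \<alpha> I\<close>. That every such \<open>w\<close> lies in \<open>I + \<alpha> I\<close> (\<open>multiplier_D_I\<close>) follows from the duality between \<open>V\<close> and
  \<open>V + \<alpha> V + \<alpha>\<^sup>2 V\<close> and from \<open>(L\<^sub>1 : V) = 0\<close>; hence \<open>I\<close> is rigid.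

  Every element of \<open>I \<otimes> D\<close> has the form \<open>t \<otimes> a + \<alpha> t \<otimes> b\<close> and is evaluated to \<open>a + \<alpha> b\<close>. The image is
  \<open>D + \<alpha> D\<close>, which is the maximal ideal because \<open>W = V + \<alpha> V\<close> and \<open>L\<^sub>2\<^sub>2 = L\<^sub>2\<^sub>1 + \<alpha> L\<^sub>2\<^sub>1\<close>. If \<open>a + \<alpha> b = 0\<close>, then
  \<open>b \<in> D\<close> and \<open>\<alpha> b \<in> D\<close>; from \<open>V \<inter> \<alpha>\<^sup>-\<^sup>1 V = 0\<close>, \<open>V\<^sup>2 = L\<^sub>2\<^sub>0\<close> and \<open>V L\<^sub>2\<^sub>1 = L\<close> it follows that \<open>b\<close> is a combination
  of products \<open>c d\<close> with \<open>c, d \<in> D\<close>. For these \<open>\<alpha> t \<otimes> c d = \<alpha> c t \<otimes> d = t \<otimes> \<alpha> c d\<close>, so that \<open>\<alpha> t \<otimes> b = - t \<otimes> a\<close> and the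
  tensor vanishes (\<open>swapsI\<close>, \<open>ev_injective\<close>).\<close>

hide_const (open) UnivPoly.up_ring.coeff UnivPoly.up_ring.monom Module.module.smult

section \<open>The field \<open>L\<close> and its coordinates\<close>

lemma rat_poly_primitive_multiple:
  fixes g :: "rat poly"
  assumes "g \<noteq> 0"
  obtains d e G where "d \<noteq> 0" "e \<noteq> 0" "content G = 1"
    "smult (of_int d) g = smult (of_int e) (map_poly of_int G)"
proof -
  have "\<exists>d H. d \<noteq> 0 \<and> smult (of_int d) g = map_poly of_int H"
  proof (induction g rule: pCons_induct)
    case 0
    show ?case by (intro exI[of _ 1] exI[of _ 0]) simp
  next
    case (pCons a p)
    then obtain d H where d: "d \<noteq> 0" "smult (of_int d) p = map_poly of_int H" by blast
    obtain m n where mn: "quotient_of a = (m, n)" by fastforce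
    then have n: "n > 0" "a = of_int m / of_int n"
      using quotient_of_denom_pos quotient_of_div by auto
    have "smult (of_int (d * n)) (pCons a p) = map_poly of_int (pCons (d * m) (smult n H))"
    proof (rule poly_eqI)
      fix i
      have "of_int d * coeff p k = of_int (coeff H k)" for k
        using arg_cong[OF d(2), of "\<lambda>q. coeff q k"] by (simp add: coeff_map_poly)
      then show "coeff (smult (of_int (d * n)) (pCons a p)) i
          = coeff (map_poly of_int (pCons (d * m) (smult n H))) i"
        using n by (cases i) (simp_all add: coeff_map_poly mult_ac)
    qed
    with d(1) n(1) show ?case by (intro exI[of _ "d * n"] exI[of _ "pCons (d * m) (smult n H)"]) simp
  qed
  then obtain d H where d: "d \<noteq> 0" "smult (of_int d) g = map_poly of_int H" by blast
  then have "H \<noteq> 0" using assms by auto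
  have "map_poly of_int H = (smult (of_int (content H)) (map_poly of_int (primitive_part H)) :: rat poly)"
    by (rule poly_eqI) (metis coeff_map_poly coeff_smult content_times_primitive_part of_int_0 of_int_mult)
  with d \<open>H \<noteq> 0\<close> that[of d "content H" "primitive_part H"] show thesis by simp
qed

lemma lowest_odd_coeff:
  fixes G :: "int poly"
  assumes "odd (lead_coeff G)"
  obtains i where "i \<le> degree G" "odd (coeff G i)" "\<And>k. k < i \<Longrightarrow> even (coeff G k)"
proof -
  let ?i = "LEAST i. odd (coeff G i)"
  have "odd (coeff G ?i)" using assms by (rule LeastI)
  moreover have "?i \<le> degree G" using assms by (rule Least_le)
  moreover have "even (coeff G k)" if "k < ?i" for k using not_less_Least[OF that] by blast
  ultimately show thesis using that by blast
qed

text \<open>Eisenstein's argument at the prime 2: the lowest odd coefficients of two factors multiply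
  to an odd coefficient, which can only be the leading one, so both constant terms are even and
  their product is divisible by 4.\<close>

lemma no_int_factorization:
  fixes G H :: "int poly"
  assumes GH: "G * H = smult c (monom 1 24 - 2)" and c: "c = 1 \<or> c = - 1"
    and deg: "degree G > 0" "degree H > 0"
  shows False
proof -
  have co: "coeff (G * H) n = (if n = 24 then c else if n = 0 then - 2 * c else 0)" for n
    by (simp add: GH numeral_poly coeff_pCons split: nat.split)
  have dGH: "degree (G * H) = degree G + degree H"
    using deg by (intro degree_mult_eq) auto
  have "degree (G * H) = 24"
  proof (rule antisym)
    show "degree (G * H) \<le> 24" by (rule degree_le) (simp add: co)
    show "24 \<le> degree (G * H)" using c by (intro le_degree) (auto simp: co)
  qed
  with dGH have d24: "degree G + degree H = 24" by simp
  have "lead_coeff G * lead_coeff H = c"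
    using co[of 24] \<open>degree (G * H) = 24\<close> by (metis lead_coeff_mult)
  then have "odd (lead_coeff G)" "odd (lead_coeff H)"
    using c by (metis even_minus even_mult_iff odd_one)+
  obtain i where i: "i \<le> degree G" "odd (coeff G i)" "\<And>k. k < i \<Longrightarrow> even (coeff G k)"
    using lowest_odd_coeff[OF \<open>odd (lead_coeff G)\<close>] by blast
  obtain j where j: "j \<le> degree H" "odd (coeff H j)" "\<And>k. k < j \<Longrightarrow> even (coeff H k)"
    using lowest_odd_coeff[OF \<open>odd (lead_coeff H)\<close>] by blast
  have "coeff (G * H) (i + j) = (\<Sum>k\<le>i+j. coeff G k * coeff H (i + j - k))"
    by (rule coeff_mult)
  also have "\<dots> = coeff G i * coeff H j + (\<Sum>k\<in>{..i+j}-{i}. coeff G k * coeff H (i + j - k))"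
    by (subst sum.remove[of _ i]) auto
  finally have "odd (coeff (G * H) (i + j))"
  proof -
    assume eq: "coeff (G * H) (i + j)
      = coeff G i * coeff H j + (\<Sum>k\<in>{..i+j}-{i}. coeff G k * coeff H (i + j - k))"
    have "even (\<Sum>k\<in>{..i+j}-{i}. coeff G k * coeff H (i + j - k))"
    proof (rule dvd_sum)
      fix k assume "k \<in> {..i+j}-{i}"
      then have "k < i \<or> i + j - k < j" by auto
      then show "even (coeff G k * coeff H (i + j - k))" using i(3) j(3) by auto
    qed
    with eq i(2) j(2) show ?thesis by simp
  qed
  then have "i + j = 24" by (auto simp: co split: if_splits)
  with i(1) j(1) d24 deg have "i > 0" "j > 0" by auto
  then have "even (coeff G 0)" "even (coeff H 0)" using i(3) j(3) by blast+
  then obtain x y where "coeff G 0 = 2 * x" "coeff H 0 = 2 * y" by (auto elim!: evenE)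
  moreover have "coeff G 0 * coeff H 0 = - 2 * c"
    using co[of 0] by (simp add: coeff_mult)
  ultimately show False using c by auto presburger+
qed

lemma degree_L_modulus: "degree L_modulus = 24"
proof (rule antisym)
  show "degree L_modulus \<le> 24"
    by (rule degree_le) (auto simp: L_modulus_def numeral_poly coeff_pCons split: nat.split)
  show "24 \<le> degree L_modulus"
    by (intro le_degree) (simp add: L_modulus_def numeral_poly coeff_pCons)
qed

text \<open>A product of primitive integer polynomials is primitive, so a factorization over \<open>\<rat>\<close> rescales
  to one over the integers, up to sign.\<close>

lemma irreducible_L_modulus: "Factorial_Ring.irreducible L_modulus"
proof (rule Factorial_Ring.irreducibleI)
  show "L_modulus \<noteq> 0" using degree_L_modulus by auto
  show "\<not> L_modulus dvd 1" by (rule L_modulus_not_unit)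
  fix g h assume gh: "L_modulus = g * h"
  then have g0: "g \<noteq> 0" "h \<noteq> 0" using degree_L_modulus by auto
  show "g dvd 1 \<or> h dvd 1"
  proof (rule ccontr)
    assume "\<not> ?thesis"
    then have dpos: "degree g > 0" "degree h > 0"
      using g0 is_unit_iff_degree by blast+
    obtain d e G where G: "d \<noteq> 0" "e \<noteq> 0" "content G = 1"
      "smult (of_int d) g = smult (of_int e) (map_poly of_int G)"
      using rat_poly_primitive_multiple[OF g0(1)] by blast
    obtain d' e' H where H: "d' \<noteq> 0" "e' \<noteq> 0" "content H = 1"
      "smult (of_int d') h = smult (of_int e') (map_poly of_int H)"
      using rat_poly_primitive_multiple[OF g0(2)] by blast
    define f :: "int poly" where "f = monom 1 24 - 2"
    have cof: "coeff f n = (if n = 24 then 1 else if n = 0 then - 2 else 0)" for n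
      by (simp add: f_def numeral_poly coeff_pCons split: nat.split)
    have cf: "content f = 1"
    proof -
      have "content f dvd coeff f 24" by simp
      then have "is_unit (content f)" by (simp add: cof)
      then show ?thesis by (metis is_unit_normalize normalize_content)
    qed
    have degs: "degree G = degree g" "degree H = degree h"
    proof -
      have "degree (map_poly (of_int :: int \<Rightarrow> rat) p) = degree p" for p
        by (intro degree_map_poly) auto
      then show "degree G = degree g" "degree H = degree h"
        using G(1,2,4) H(1,2,4) by (metis degree_smult_eq of_int_eq_0_iff)+
    qed
    have "map_poly of_int (smult (d * d') f) = (map_poly of_int (smult (e * e') (G * H)) :: rat poly)"
    proof -
      have f': "map_poly of_int f = L_modulus"
        by (rule poly_eqI)
          (simp add: coeff_map_poly cof L_modulus_def numeral_poly coeff_pCons split: nat.split)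
      have hom_s: "map_poly of_int (smult k p) = (smult (of_int k) (map_poly of_int p) :: rat poly)" for k p
        by (rule poly_eqI) (simp add: coeff_map_poly)
      have hom_m: "map_poly of_int (p * q) = (map_poly of_int p * map_poly of_int q :: rat poly)" for p q
        by (rule poly_eqI) (simp add: coeff_map_poly coeff_mult)
      have "smult (of_int d * of_int d') L_modulus = smult (of_int d) g * smult (of_int d') h"
        by (simp add: gh mult_ac)
      also have "\<dots> = smult (of_int e * of_int e') (map_poly of_int G * map_poly of_int H)"
        unfolding G(4) H(4) by (simp add: mult_ac)
      finally show ?thesis by (simp add: hom_s hom_m f')
    qed
    then have eq: "smult (d * d') f = smult (e * e') (G * H)"
    proof (intro poly_eqI)
      fix n
      have "rat_of_int (coeff (smult (d * d') f) n)
          = rat_of_int (coeff (smult (e * e') (G * H)) n)"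
        using arg_cong[OF \<open>map_poly of_int (smult (d * d') f) = _\<close>, of "\<lambda>p. coeff p n"]
        by (simp only: coeff_map_poly of_int_0)
      then show "coeff (smult (d * d') f) n
          = coeff (smult (e * e') (G * H)) n"
        by (simp only: of_int_eq_iff)
    qed
    then have "content (smult (d * d') f) = content (smult (e * e') (G * H))" by simp
    then have "\<bar>d * d'\<bar> = \<bar>e * e'\<bar>"
      by (simp add: content_mult cf G(3) H(3))
    then have "e * e' = d * d' \<or> e * e' = - (d * d')" by (auto simp: abs_if split: if_splits)
    then have "G * H = smult 1 f \<or> G * H = smult (- 1) f"
    proof
      assume "e * e' = d * d'"
      with eq have "smult (e * e') (G * H) = smult (e * e') f" by simp
      then show ?thesis using G(2) H(2) by (metis mult_eq_0_iff smult_1_left smult_cancel)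
    next
      assume ee: "e * e' = - (d * d')"
      have "smult (e * e') (G * H) = smult (e * e') (smult (- 1) f)"
        using eq ee by simp
      then show ?thesis using G(2) H(2) by (metis mult_eq_0_iff smult_cancel)
    qed
    then show False
    proof
      assume "G * H = smult 1 f"
      then show False using no_int_factorization[of G H 1] dpos degs by (simp add: f_def)
    next
      assume "G * H = smult (- 1) f"
      then show False using no_int_factorization[of G H "- 1"] dpos degs by (simp add: f_def)
    qed
  qed
qed

lemma L_inverse_exists:
  fixes x :: L
  assumes "x \<noteq> 0"
  shows "\<exists>y. x * y = 1"
  using assms
proof (transfer)
  fix p :: "rat poly"
  assume "\<not> L_modulus dvd p - 0"
  then have "coprime p L_modulus"
    using irreducible_imp_prime_elem[OF irreducible_L_modulus] prime_elem_imp_coprime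
    by (metis coprime_commute diff_zero)
  then obtain a b where "a * p + b * L_modulus = 1"
    by (metis bezout_coefficients_fst_snd coprime_iff_gcd_eq_1)
  then have "p * a - 1 = L_modulus * (- b)" by (simp add: algebra_simps)
  then show "\<exists>y. L_modulus dvd p * y - 1" by (metis dvd_triv_left)
qed

instantiation L :: field
begin
definition inverse_L :: "L \<Rightarrow> L" where
  "inverse_L x = (if x = 0 then 0 else SOME y. x * y = 1)"
definition divide_L :: "L \<Rightarrow> L \<Rightarrow> L" where
  "divide_L x y = x * inverse y"
instance
proof
  fix x y :: L
  show "x \<noteq> 0 \<Longrightarrow> inverse x * x = 1"
    using someI_ex[OF L_inverse_exists[of x]] by (simp add: inverse_L_def mult.commute)
  show "x div y = x * inverse y" by (simp add: divide_L_def)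
  show "inverse (0::L) = 0" by (simp add: inverse_L_def)
qed
end

lemma alpha_24: "\<alpha> ^ 24 = 2"
proof -
  have p: "\<alpha> ^ n = abs_L (monom 1 n)" for n
    by (induction n) (simp_all add: \<alpha>_def one_L_def times_L.abs_eq monom_Suc)
  have two: "(2::L) = abs_L 2"
    by (metis numeral_Bit0 numeral_One one_L_def one_add_one plus_L.abs_eq)
  show ?thesis unfolding p two by (simp add: L.abs_eq_iff L_modulus_def)
qed

lift_definition lcoef :: "L \<Rightarrow> nat \<Rightarrow> rat" is "\<lambda>p. coeff (p mod L_modulus)"
proof (rule arg_cong[of _ _ coeff])
  fix p q :: "rat poly" assume "L_modulus dvd p - q"
  then have "(p - q) mod L_modulus = 0" by simp
  then show "p mod L_modulus = q mod L_modulus" by (simp add: poly_mod_diff_left)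
qed

lemma lcoef_0 [simp]: "lcoef 0 i = 0"
  by transfer simp
lemma lcoef_add [simp]: "lcoef (x + y) i = lcoef x i + lcoef y i"
  by transfer (simp add: poly_mod_add_left)
lemma lcoef_scale [simp]: "lcoef (scale_L q x) i = q * lcoef x i"
  by transfer (simp add: mod_smult_left)

lemma lcoef_diff [simp]: "lcoef (x - y) i = lcoef x i - lcoef y i"
  using lcoef_add[of "x - y" y i] by simp
lemma lcoef_sum: "lcoef (sum f A) i = (\<Sum>a\<in>A. lcoef (f a) i)"
  by (induction A rule: infinite_finite_induct) auto

lemma alpha_power: "\<alpha> ^ n = abs_L (monom 1 n)"
  by (induction n) (simp_all add: \<alpha>_def one_L_def times_L.abs_eq monom_Suc)

lemma lcoef_alpha_power: "j < 24 \<Longrightarrow> lcoef (\<alpha> ^ j) i = (if i = j then 1 else 0)"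
  unfolding alpha_power
  by (simp add: lcoef.abs_eq mod_poly_less degree_L_modulus degree_monom_eq)

lemma scale_L_mult: "scale_L q (x * y) = scale_L q x * y"
  by transfer simp

lemma scale_L_one_mult: "scale_L q x = scale_L q 1 * x"
  by (simp flip: scale_L_mult)

lemma scale_L_mult_right: "x * scale_L q y = scale_L q (x * y)"
  by (metis mult.commute scale_L_mult)

lemma scale_L_numeral: "scale_L (numeral n) x = numeral n * x"
proof -
  have "scale_L (of_nat k) x = of_nat k * x" for k
    by (induction k) (simp_all add: L.scale_left_distrib algebra_simps)
  from this[of "numeral n"] show ?thesis by simp
qed

lemma L_expansion: "x = (\<Sum>i<24. scale_L (lcoef x i) (\<alpha> ^ i))"
proof -
  obtain p where x: "x = abs_L p" by (metis L.abs_eq_iff Quotient_L Quotient_abs_rep)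
  define r where "r = p mod L_modulus"
  have xr: "x = abs_L r"
    unfolding x r_def L.abs_eq_iff by (simp add: minus_mod_eq_mult_div)
  have deg: "degree r \<le> 23"
    using degree_mod_less'[of L_modulus p] degree_L_modulus r_def
    by (cases "r = 0") force+
  have c: "lcoef x i = coeff r i" for i
    unfolding xr lcoef.abs_eq r_def by simp
  have s: "abs_L (sum f A) = (\<Sum>a\<in>A. abs_L (f a))" for f and A :: "nat set"
    by (induction A rule: infinite_finite_induct) (simp_all add: zero_L_def flip: plus_L.abs_eq)
  have "x = abs_L (\<Sum>i\<le>23. monom (coeff r i) i)"
    unfolding poly_as_sum_of_monoms'[OF deg] by (rule xr)
  also have "\<dots> = (\<Sum>i<24. abs_L (monom (coeff r i) i))"
    unfolding s by (rule sum.cong) auto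
  also have "\<dots> = (\<Sum>i<24. scale_L (lcoef x i) (\<alpha> ^ i))"
    unfolding c alpha_power by (simp add: scale_L.abs_eq smult_monom)
  finally show ?thesis .
qed

lemma L_eqI: "(\<And>i. i < 24 \<Longrightarrow> lcoef x i = lcoef y i) \<Longrightarrow> x = y"
  by (subst L_expansion[of x], subst L_expansion[of y]) simp

lemma lcoef_expansion:
  "i < 24 \<Longrightarrow> lcoef (\<Sum>j<24. scale_L (c j) (\<alpha> ^ j)) i = c i"
  by (simp add: lcoef_sum lcoef_alpha_power if_distrib cong: if_cong)

lemma L_upto_iff: "x \<in> L_upto n \<longleftrightarrow> (\<forall>i. n < i \<and> i < 24 \<longrightarrow> lcoef x i = 0)" if "n < 24"
proof
  assume "x \<in> L_upto n"
  then show "\<forall>i. n < i \<and> i < 24 \<longrightarrow> lcoef x i = 0"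
    unfolding L_upto_def
    by (induction rule: L.span_induct_alt) (use that in \<open>auto simp: lcoef_alpha_power\<close>)
next
  assume z: "\<forall>i. n < i \<and> i < 24 \<longrightarrow> lcoef x i = 0"
  have "scale_L (lcoef x i) (\<alpha> ^ i) \<in> L_upto n" if "i < 24" for i
  proof (cases "i \<le> n")
    case True
    then show ?thesis unfolding L_upto_def by (intro L.span_scale L.span_base) blast
  next
    case False
    with z that show ?thesis by (simp add: L_upto_def L.span_zero)
  qed
  then have "(\<Sum>i<24. scale_L (lcoef x i) (\<alpha> ^ i)) \<in> L_upto n"
    unfolding L_upto_def by (intro L.span_sum) auto
  then show "x \<in> L_upto n" by (simp flip: L_expansion)
qed

lemma L_upto_23: "L_upto 23 = UNIV"
  using L_upto_iff[of 23] by auto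

lemma inj_on_alpha_powers: "inj_on (\<lambda>i. \<alpha> ^ i) {..<24}"
proof (rule inj_onI)
  fix i j :: nat assume "i \<in> {..<24}" "j \<in> {..<24}" and e: "\<alpha> ^ i = \<alpha> ^ j"
  then have "lcoef (\<alpha> ^ i) i = 1" "lcoef (\<alpha> ^ j) i = (if i = j then 1 else 0)"
    using lcoef_alpha_power[of i i] lcoef_alpha_power[of j i] by (simp_all only: lessThan_iff if_True simp_thms)
  with e show "i = j" by (metis zero_neq_one)
qed

interpretation Lfin: finite_dimensional_vector_space scale_L "(\<lambda>i. \<alpha> ^ i) ` {..<24}"
proof unfold_locales
  note inj = inj_on_alpha_powers
  show "finite ((\<lambda>i. \<alpha> ^ i) ` {..<24::nat})" by simp
  show "L.independent ((\<lambda>i. \<alpha> ^ i) ` {..<24::nat})"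
  proof (rule L.independent_if_scalars_zero)
    fix f x assume z: "(\<Sum>x\<in>(\<lambda>i. \<alpha> ^ i) ` {..<24}. scale_L (f x) x) = 0" 
      and "x \<in> (\<lambda>i. \<alpha> ^ i) ` {..<24::nat}"
    then obtain i where i: "i < 24" "x = \<alpha> ^ i" by auto
    have "(\<Sum>j<24. scale_L (f (\<alpha> ^ j)) (\<alpha> ^ j)) = 0"
      using z by (simp add: sum.reindex[OF inj])
    then have "lcoef (\<Sum>j<24. scale_L (f (\<alpha> ^ j)) (\<alpha> ^ j)) i = 0" by simp
    then show "f x = 0" using lcoef_expansion[of i "\<lambda>j. f (\<alpha> ^ j)"] i by simp
  qed simp
  have "(\<lambda>i. \<alpha> ^ i) ` {..<24::nat} = {\<alpha> ^ j |j. j \<le> 23}" by auto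
  then have "span_L ((\<lambda>i. \<alpha> ^ i) ` {..<24::nat}) = UNIV"
    using L_upto_23 by (simp add: L_upto_def)
  then show "module.span scale_L ((\<lambda>i. \<alpha> ^ i) ` {..<24::nat}) = UNIV"
    by (simp add: span_L_def)
qed

lemma card_alpha_powers: "card ((\<lambda>i. \<alpha> ^ i) ` {..<24::nat}) = 24"
  by (simp add: card_image inj_on_alpha_powers)

lemma dim_L_UNIV: "dim_L (UNIV :: L set) = 24"
  using Lfin.dim_UNIV card_alpha_powers by simp

lemma lcoef_alpha_power_ge: "24 \<le> n \<Longrightarrow> \<alpha> ^ n = scale_L 2 (\<alpha> ^ (n - 24))"
  by (metis alpha_24 le_add_diff_inverse power_add scale_L_numeral)

text \<open>All duality below refers to the symmetric form \<open>(x, y) \<mapsto> lam (x * y)\<close>, for which \<open>L\<^sub>n\<close> and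
  \<open>L\<^sub>2\<^sub>2\<^sub>-\<^sub>n\<close> are orthogonal complements of each other for \<open>n \<le> 22\<close>.\<close>

definition lam :: "L \<Rightarrow> rat" where
  "lam x = lcoef x 23"

lemma lam_add [simp]: "lam (x + y) = lam x + lam y"
  and lam_diff [simp]: "lam (x - y) = lam x - lam y"
  and lam_0 [simp]: "lam 0 = 0"
  and lam_scale [simp]: "lam (scale_L q x) = q * lam x"
  by (simp_all add: lam_def)

lemma lam_sum: "lam (sum f A) = (\<Sum>a\<in>A. lam (f a))"
  by (simp add: lam_def lcoef_sum)

lemma lam_nondegenerate: "(\<And>y. lam (x * y) = 0) \<Longrightarrow> x = 0"
proof (rule ccontr)
  assume a: "\<And>y. lam (x * y) = 0" "x \<noteq> 0"
  then have "x * (\<alpha> ^ 23 / x) = \<alpha> ^ 23" by simp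
  with a(1)[of "\<alpha> ^ 23 / x"] show False by (simp add: lam_def lcoef_alpha_power)
qed

text \<open>The coordinates of \<open>x\<close> are thus values of the form: for \<open>j \<le> 23\<close> no term of \<open>x * \<alpha> ^ j\<close> that is
  reduced by \<open>\<alpha> ^ 24 = 2\<close> can reach the exponent 23.\<close>

lemma lam_mult_alpha_power: "j \<le> 23 \<Longrightarrow> lam (x * \<alpha> ^ j) = lcoef x (23 - j)"
proof -
  assume j: "j \<le> 23"
  have l: "lam (\<alpha> ^ (i + j)) = (if i = 23 - j then 1 else 0)" if "i < 24" for i
    using j that
    by (cases "i + j < 24")
      (auto simp: lam_def lcoef_alpha_power lcoef_alpha_power_ge)
  have "lam (x * \<alpha> ^ j) = (\<Sum>i<24. lcoef x i * lam (\<alpha> ^ (i + j)))"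
    by (subst L_expansion[of x]) (simp add: sum_distrib_right lam_sum power_add flip: scale_L_mult)
  also have "\<dots> = (\<Sum>i<24. if i = 23 - j then lcoef x i else 0)"
    by (rule sum.cong) (auto simp: l)
  also have "\<dots> = lcoef x (23 - j)" using j by simp
  finally show ?thesis .
qed

lemma alpha_power_L_upto: "j \<le> n \<Longrightarrow> \<alpha> ^ j \<in> L_upto n"
  unfolding L_upto_def by (intro L.span_base) blast

lemma L_upto_perp:
  assumes "n \<le> 22"
  shows "(\<forall>y\<in>L_upto n. lam (x * y) = 0) \<longleftrightarrow> x \<in> L_upto (22 - n)"
proof
  assume a: "\<forall>y\<in>L_upto n. lam (x * y) = 0"
  have "lcoef x i = 0" if i: "22 - n < i \<and> i < 24" for i
  proof -
    have "lcoef x i = lam (x * \<alpha> ^ (23 - i))" using i by (simp add: lam_mult_alpha_power)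
    also have "\<dots> = 0" using a i assms alpha_power_L_upto[of "23 - i" n] by auto
    finally show ?thesis .
  qed
  then show "x \<in> L_upto (22 - n)" by (subst L_upto_iff) auto
next
  assume x: "x \<in> L_upto (22 - n)"
  show "\<forall>y\<in>L_upto n. lam (x * y) = 0"
  proof
    fix y assume "y \<in> L_upto n"
    then show "lam (x * y) = 0"
      unfolding L_upto_def
    proof (induction rule: L.span_induct_alt)
      case (step c z y)
      then obtain j where "z = \<alpha> ^ j" "j \<le> n" by auto
      with x assms have "lam (x * z) = 0"
        using L_upto_iff[of "22 - n" x] by (simp add: lam_mult_alpha_power) (auto simp: less_diff_conv2)
      with step show ?case by (simp add: distrib_left scale_L_mult_right)
    qed simp
  qed
qed

lemma lam_represents:
  assumes f: "Vector_Spaces.linear scale_L (*) f"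
  shows "\<exists>x. \<forall>y. f y = lam (x * y)"
proof -
  interpret f: Vector_Spaces.linear scale_L "(*)" f by (rule f)
  define x where "x = (\<Sum>i<24. scale_L (f (\<alpha> ^ (23 - i))) (\<alpha> ^ i))"
  have "lam (x * y) = f y" for y
  proof -
    have x: "lam (x * \<alpha> ^ i) = f (\<alpha> ^ i)" if "i < 24" for i
      using that unfolding x_def
      by (subst lam_mult_alpha_power) (simp_all add: lcoef_expansion)
    have "lam (x * y) = lam (x * (\<Sum>i<24. scale_L (lcoef y i) (\<alpha> ^ i)))"
      by (simp flip: L_expansion)
    also have "\<dots> = (\<Sum>i<24. lcoef y i * lam (x * \<alpha> ^ i))"
      by (simp add: sum_distrib_left lam_sum scale_L_mult_right)
    also have "\<dots> = (\<Sum>i<24. lcoef y i * f (\<alpha> ^ i))" by (simp add: x)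
    also have "\<dots> = f (\<Sum>i<24. scale_L (lcoef y i) (\<alpha> ^ i))"
      by (simp add: f.sum f.scale)
    also have "\<dots> = f y"
      by (simp flip: L_expansion)
    finally show ?thesis .
  qed
  then show ?thesis by metis
qed

text \<open>A linear functional that separates \<open>z\<close> from \<open>S\<close> would have the form \<open>y \<mapsto> lam (x * y)\<close>. With this
  lemma a claim that certain products span a space becomes a homogeneous linear system in the
  coordinates of an orthogonal vector \<open>x\<close>.\<close>

lemma double_perp:
  assumes S: "L.subspace S" and z: "\<And>x. (\<forall>y\<in>S. lam (x * y) = 0) \<Longrightarrow> lam (x * z) = 0"
  shows "z \<in> S"
proof (rule ccontr)
  assume "z \<notin> S"
  interpret p: vector_space_pair scale_L "(*) :: rat \<Rightarrow> _"
    by unfold_locales (simp_all add: algebra_simps)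
  obtain B where B: "B \<subseteq> S" "L.independent B" "S \<subseteq> span_L B"
    using L.maximal_independent_subset by blast
  have "span_L B = S" using B S by (metis L.span_subspace)
  with \<open>z \<notin> S\<close> B have "L.independent (insert z B)" by (simp add: L.independent_insert)
  then obtain f where f: "Vector_Spaces.linear scale_L (*) f"
    "\<forall>y\<in>insert z B. f y = (if y = z then 1 else 0)"
    using p.linear_independent_extend[of _ "\<lambda>y. if y = z then 1 else 0"] by meson
  interpret f: Vector_Spaces.linear scale_L "(*)" f by (rule f)
  have fS: "f y = 0" if "y \<in> S" for y
  proof -
    have "y \<in> span_L B" using that B(3) by blast
    then show ?thesis
      by (induction rule: L.span_induct_alt)
        (use f(2) B \<open>z \<notin> S\<close> in \<open>auto simp: f.add f.scale\<close>)
  qed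
  obtain x where "\<forall>y. f y = lam (x * y)" using lam_represents[OF f(1)] by blast
  with z[of x] fS f(2) show False by auto
qed

section \<open>The subspace \<open>V\<close>\<close>

definition msum :: "(int \<times> nat) list \<Rightarrow> L" where
  "msum ts = (\<Sum>(c, e)\<leftarrow>ts. scale_L (of_int c) (\<alpha> ^ e))"

text \<open>The generators of \<open>V\<close> as lists of coefficients and exponents: simplification then turns
  orthogonality to products of generators into explicit linear equations.\<close>

definition vterms :: "(int \<times> nat) list list" where
  "vterms = [[(1,0)], [(1,1),(-1,15)], [(1,2),(-1,12),(-1,16)], [(1,4),(-1,14)],
     [(1,6),(-1,13),(1,20)], [(1,9),(1,16),(1,19)]]"

lemma V_eq: "V = span_L (msum ` set vterms)"
  by (simp add: V_def msum_def vterms_def algebra_simps)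

lemma lam_msum: "lam (x * msum s) = (\<Sum>(c, e)\<leftarrow>s. of_int c * lam (x * \<alpha> ^ e))"
  by (induction s) (auto simp: msum_def distrib_left scale_L_mult_right)

lemma alpha_powers_wrap: "lam (x * \<alpha> ^ (n + 24)) = 2 * lam (x * \<alpha> ^ n)"
  by (simp add: lcoef_alpha_power_ge scale_L_mult_right)

text \<open>For \<open>y n = lam (x * \<alpha> ^ n)\<close> the equations say that \<open>x\<close> is orthogonal to
  \<open>V + \<alpha> V + \<alpha>\<^sup>2 V + \<alpha>\<^sup>3 V\<close>; that this forces \<open>x = 0\<close> means that the sum is all of \<open>L\<close>.\<close>

lemma linear_system_4V:
  fixes y :: "nat \<Rightarrow> rat"
  assumes eqs: "\<And>k s. k < 4 \<Longrightarrow> s \<in> set vterms \<Longrightarrow> (\<Sum>(c, e)\<leftarrow>s. of_int c * y (k + e)) = 0"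
    and "n < 24"
  shows "y n = 0"
proof -
  have small: "y (Suc (Suc 0)) = y 2" "y (Suc (Suc (Suc 0))) = y 3" "y (Suc (Suc (Suc (Suc 0)))) = y 4"
    by (simp_all add: numeral_eq_Suc)
  have E: "(\<Sum>(c, e)\<leftarrow>vterms ! j. of_int c * y (k + e)) = 0" if "k < 4" "j < 6" for k j
    using that by (intro eqs) (auto simp: vterms_def nth_Cons split: nat.split)
  have e0: "y k = 0" if "k < 4" for k using E[of k 0] that by (simp add: vterms_def)
  have e1: "y (k + 1) = y (k + 15)" if "k < 4" for k using E[of k 1] that by (simp add: vterms_def)
  have e2: "y (k + 2) = y (k + 12) + y (k + 16)" if "k < 4" for k
    using E[of k 2] that by (simp add: vterms_def)
  have e3: "y (k + 4) = y (k + 14)" if "k < 4" for k using E[of k 3] that by (simp add: vterms_def)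
  have e4: "y (k + 6) + y (k + 20) = y (k + 13)" if "k < 4" for k
    using E[of k 4] that by (simp add: vterms_def)
  have e5: "y (k + 9) + y (k + 16) + y (k + 19) = 0" if "k < 4" for k
    using E[of k 5] that by (simp add: vterms_def)
  have s0: "y 0 = 0" "y 1 = 0" "y 2 = 0" "y 3 = 0"
    using e0[of 0] e0[of 1] e0[of 2] e0[of 3] by (simp_all add: small)
  then have s0': "y (Suc 0) = 0" by simp
  have s1: "y 15 = 0" "y 16 = 0" "y 17 = 0" "y 18 = y 4"
    using e1[of 0] e1[of 1] e1[of 2] e1[of 3] s0 s0' by (simp_all add: small)
  have s3: "y 14 = y 4" "y 5 = 0" "y 6 = 0" "y 7 = 0"
    using e3[of 0] e3[of 1] e3[of 2] e3[of 3] s1 by (simp_all add: small)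
  have s2: "y 12 = 0" "y 13 = 0" "y 4 = 0" "y 19 = 0"
    using e2[of 0] e2[of 1] e2[of 2] e2[of 3] s0 s0' s1 s3 by (simp_all add: small)
  have s4: "y 20 = 0" "y 21 = 0" "y 8 + y 22 = 0" "y 9 + y 23 = 0"
    using e4[of 0] e4[of 1] e4[of 2] e4[of 3] s1 s2 s3 by (simp_all add: small)
  have s5: "y 9 = 0" "y 10 = 0" "y 11 = 0" "y 22 = 0"
    using e5[of 0] e5[of 1] e5[of 2] e5[of 3] s1 s2 s4 by (simp_all add: small)
  have all: "\<forall>n\<in>set [2..<24]. y n = 0"
    using s0 s1 s2 s3 s4 s5 by simp
  show ?thesis
  proof (cases "n < 2")
    case True
    then have "n = 0 \<or> n = 1" by auto
    with s0 show ?thesis by blast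
  next
    case False
    with \<open>n < 24\<close> have "n \<in> set [2..<24]" by (simp only: set_upt atLeastLessThan_iff) simp
    with all show ?thesis by blast
  qed
qed

text \<open>For the same \<open>y\<close> the equations say that \<open>x\<close> is orthogonal to \<open>V\<^sup>2\<close>; the conclusion is that \<open>x\<close> is
  then orthogonal to \<open>L\<^sub>2\<^sub>0\<close>. The 21 products of two generators give 21 equations in the 21 unknowns
  \<open>y 0, \<dots>, y 20\<close>, because every product of generators lies in \<open>L\<^sub>2\<^sub>0\<close>.\<close>

lemma linear_system_VV:
  fixes y :: "nat \<Rightarrow> rat"
  assumes wrap: "\<And>n. y (n + 24) = 2 * y n"
    and eqs: "\<And>s s'. s \<in> set vterms \<Longrightarrow> s' \<in> set vterms \<Longrightarrow>
      (\<Sum>(c, e)\<leftarrow>s. of_int c * (\<Sum>(c', e')\<leftarrow>s'. of_int c' * y (e + e'))) = 0"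
    and "n < 21"
  shows "y n = 0"
proof -
  have small: "y (Suc (Suc 0)) = y 2" "y (Suc (Suc (Suc 0))) = y 3" "y (Suc (Suc (Suc (Suc 0)))) = y 4"
    by (simp_all add: numeral_eq_Suc)
  have wrap': "y (numeral k) = 2 * y (numeral k - 24)" if "24 \<le> (numeral k :: nat)" for k
    using wrap[of "numeral k - 24"] that by (metis le_add_diff_inverse2)
  have E: "(\<Sum>(c, e)\<leftarrow>vterms ! i. of_int c * (\<Sum>(c', e')\<leftarrow>vterms ! j. of_int c' * y (e + e'))) = 0"
    if "i < 6" "j < 6" for i j
    using that by (intro eqs) (auto simp: vterms_def nth_Cons split: nat.split)
  have e00: "y 0 = 0"
    using E[of 0 0] by (simp add: vterms_def wrap' small)
  have e01: "y 1 - y 15 = 0"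
    using E[of 0 1] by (simp add: vterms_def wrap' small)
  have e02: "y 2 - y 12 - y 16 = 0"
    using E[of 0 2] by (simp add: vterms_def wrap' small)
  have e03: "y 4 - y 14 = 0"
    using E[of 0 3] by (simp add: vterms_def wrap' small)
  have e04: "y 6 - y 13 + y 20 = 0"
    using E[of 0 4] by (simp add: vterms_def wrap' small)
  have e05: "y 9 + y 16 + y 19 = 0"
    using E[of 0 5] by (simp add: vterms_def wrap' small)
  have e11: "y 2 + 2 * y 6 - 2 * y 16 = 0"
    using E[of 1 1] by (simp add: vterms_def wrap' small)
  have e12: "3 * y 3 + 2 * y 7 - y 13 - 2 * y 17 = 0"
    using E[of 1 2] by (simp add: vterms_def wrap' small)
  have e13: "3 * y 5 - y 15 - y 19 = 0"
    using E[of 1 3] by (simp add: vterms_def wrap' small)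
  have e14: "2 * y 4 + y 7 - 2 * y 11 - y 14 = 0"
    using E[of 1 4] by (simp add: vterms_def wrap' small)
  have e15: "- 2 * y 0 - 2 * y 7 - y 10 + y 17 + y 20 = 0"
    using E[of 1 5] by (simp add: vterms_def wrap' small)
  have e22: "2 * y 0 + 5 * y 4 + 2 * y 8 - 2 * y 14 - 2 * y 18 = 0"
    using E[of 2 2] by (simp add: vterms_def wrap' small)
  have e23: "2 * y 2 + 3 * y 6 - 2 * y 16 - y 20 = 0"
    using E[of 2 3] by (simp add: vterms_def wrap' small)
  have e24: "2 * y 1 + 2 * y 5 - y 8 - 2 * y 12 - y 15 - y 18 = 0"
    using E[of 2 4] by (simp add: vterms_def wrap' small)
  have e25: "- 2 * y 1 - 2 * y 4 - 2 * y 7 - 2 * y 8 - y 11 + y 18 = 0"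
    using E[of 2 5] by (simp add: vterms_def wrap' small)
  have e33: "2 * y 4 + y 8 - 2 * y 18 = 0"
    using E[of 3 3] by (simp add: vterms_def wrap' small)
  have e34: "2 * y 0 + 2 * y 3 - y 10 - y 17 - y 20 = 0"
    using E[of 3 4] by (simp add: vterms_def wrap' small)
  have e35: "- 2 * y 6 - 2 * y 9 + y 13 + y 20 = 0"
    using E[of 3 5] by (simp add: vterms_def wrap' small)
  have e44: "6 * y 2 - 4 * y 9 + y 12 + 2 * y 16 - 2 * y 19 = 0"
    using E[of 4 4] by (simp add: vterms_def wrap' small)
  have e45: "2 * y 1 - 2 * y 8 + 2 * y 12 + 3 * y 15 = 0"
    using E[of 4 5] by (simp add: vterms_def wrap' small)
  have e55: "4 * y 1 + 4 * y 4 + 2 * y 8 + 4 * y 11 + 2 * y 14 + y 18 = 0"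
    using E[of 5 5] by (simp add: vterms_def wrap' small)
  have s0: "y 0 = 0" using e00 by linarith
  have s15: "y 15 = y 1" using e01 by linarith
  have s14: "y 14 = y 4" using e03 by linarith
  have s2: "y 2 = y 12 + y 16" using e02 by linarith
  have s13: "y 13 = y 6 + y 20" using e04 by linarith
  have s9: "y 9 = - y 16 - y 19" using e05 by linarith
  have s16: "y 16 = 2 * y 6 + y 12" using e11 s2 by linarith
  have s7: "y 7 = - y 4 + 2 * y 11" using e14 s14 by linarith
  have s8: "y 8 = - 2 * y 4 + 2 * y 18" using e33 by linarith
  have s4: "y 4 = 2 * y 18" using e22 s0 s8 s14 by linarith
  have s19: "y 19 = - y 1 + 3 * y 5" using e13 s15 by linarith
  have s20: "y 20 = 3 * y 6 + 2 * y 12" using e23 s2 by linarith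
  have s11: "y 11 = - 2 / 5 * y 1 + y 18" using e25 s4 s7 s8 by linarith
  have s18: "y 18 = - 12 / 65 * y 1" using e55 s4 s8 s11 s14 by linarith
  have s1: "y 1 = - 130 / 277 * y 12" using e45 s4 s8 s15 s18 by linarith
  have s5: "y 5 = 330 / 277 * y 12" using e24 s1 s4 s8 s15 s18 by linarith
  have s6: "y 6 = - 3902 / 2493 * y 12" using e35 s1 s5 s9 s13 s16 s19 s20 by linarith
  have s12: "y 12 = 0" using e44 s1 s2 s5 s6 s9 s16 s19 by linarith
  have s10: "y 10 = y 17" using e15 s0 s1 s4 s6 s7 s11 s12 s20 by linarith
  have s3: "y 3 = y 17" using e34 s0 s6 s10 s12 s20 by linarith
  have s17: "y 17 = 0" using e12 s1 s3 s4 s6 s7 s11 s12 s13 s20 by linarith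
  have "y 1 = 0" by (subst s1) (simp add: s12)
  then have y1: "y (Suc 0) = 0" by simp
  have all: "\<forall>n\<in>set [2..<21]. y n = 0"
    by (simp add: s0 y1 s2 s3 s4 s5 s6 s7 s8 s9 s10 s11 s12 s13 s14 s15 s16 s17 s18 s19 s20)
  show ?thesis
  proof (cases "n < 2")
    case True
    then have "n = 0 \<or> n = Suc 0" by auto
    with s0 y1 show ?thesis by blast
  next
    case False
    with \<open>n < 21\<close> have "n \<in> set [2..<21]" by (simp only: set_upt atLeastLessThan_iff) simp
    with all show ?thesis by blast
  qed
qed

lemma alpha_power_mult_subspace: "L.subspace S \<Longrightarrow> L.subspace {x * v | v. v \<in> S}"
  unfolding L.subspace_def
proof (intro conjI ballI allI)
  assume S: "0 \<in> S \<and> (\<forall>x\<in>S. \<forall>y\<in>S. x + y \<in> S) \<and> (\<forall>c. \<forall>x\<in>S. scale_L c x \<in> S)"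
  show "0 \<in> {x * v |v. v \<in> S}" using S by force
  fix a b c assume "a \<in> {x * v |v. v \<in> S}" 
  then obtain v where v: "a = x * v" "v \<in> S" by blast
  have "scale_L c a = x * scale_L c v" by (simp add: v scale_L_mult_right)
  with S v(2) show "scale_L c a \<in> {x * v |v. v \<in> S}" by blast
  assume "b \<in> {x * v |v. v \<in> S}"
  then obtain v' where "b = x * v'" "v' \<in> S" by blast
  with v S show "a + b \<in> {x * v |v. v \<in> S}" by (metis (mono_tags, lifting) distrib_left mem_Collect_eq)
qed

lemma V_subspace: "L.subspace V"
  by (simp add: V_eq)

lemma one_in_V: "1 \<in> V"
  unfolding V_eq by (rule L.span_base) (simp add: vterms_def msum_def)

text \<open>\<open>Vs n\<close> is \<open>V + \<alpha> V + \<dots> + \<alpha>\<^bsup>n-1\<^esup> V\<close>; in particular \<open>Vs 2 = W\<close>.\<close>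

definition Vs :: "nat \<Rightarrow> L set" where
  "Vs n = span_L {\<alpha> ^ k * v | k v. k < n \<and> v \<in> V}"

lemma Vs_subspace: "L.subspace (Vs n)"
  by (simp add: Vs_def)

lemma Vs_base: "k < n \<Longrightarrow> v \<in> V \<Longrightarrow> \<alpha> ^ k * v \<in> Vs n"
  unfolding Vs_def by (rule L.span_base) blast

lemma Vs_mono: "m \<le> n \<Longrightarrow> Vs m \<subseteq> Vs n"
  unfolding Vs_def by (rule L.span_mono) force

lemma Vs_Suc: "Vs (Suc n) = {y + \<alpha> ^ n * v | y v. y \<in> Vs n \<and> v \<in> V}"
proof -
  have "{\<alpha> ^ k * v | k v. k < Suc n \<and> v \<in> V}
      = {\<alpha> ^ k * v | k v. k < n \<and> v \<in> V} \<union> {\<alpha> ^ n * v | v. v \<in> V}"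
    by (auto simp: less_Suc_eq)
  moreover have "span_L {\<alpha> ^ n * v | v. v \<in> V} = {\<alpha> ^ n * v | v. v \<in> V}"
    by (simp add: L.span_eq_iff alpha_power_mult_subspace V_subspace)
  ultimately show ?thesis
    unfolding Vs_def by (simp only: L.span_Un) blast
qed

lemma Vs_1: "Vs (Suc 0) = V"
proof -
  have "Vs 0 = {0}" by (simp add: Vs_def)
  then show ?thesis by (simp add: Vs_Suc)
qed

lemma W_eq: "W = Vs 2"
  by (simp add: W_def numeral_2_eq_2 Vs_Suc[of "Suc 0"] Vs_1)

lemma Vs_Suc': "Vs (Suc n) = {v + \<alpha> * y | v y. v \<in> V \<and> y \<in> Vs n}"
proof (induction n)
  case 0
  have "Vs 0 = {0}" by (simp add: Vs_def)
  then show ?case by (simp add: Vs_1)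
next
  case (Suc n)
  show ?case
  proof (intro Set.set_eqI iffI)
    fix x assume "x \<in> Vs (Suc (Suc n))"
    then obtain v y u where "v \<in> V" "y \<in> Vs n" "u \<in> V" "x = v + \<alpha> * y + \<alpha> ^ Suc n * u"
      unfolding Vs_Suc[of "Suc n"] Suc by blast
    moreover from this have "x = v + \<alpha> * (y + \<alpha> ^ n * u)" by (simp add: algebra_simps)
    ultimately show "x \<in> {v + \<alpha> * y |v y. v \<in> V \<and> y \<in> Vs (Suc n)}"
      unfolding Vs_Suc by blast
  next
    fix x assume "x \<in> {v + \<alpha> * y |v y. v \<in> V \<and> y \<in> Vs (Suc n)}"
    then obtain v y u where "v \<in> V" "y \<in> Vs n" "u \<in> V" "x = v + \<alpha> * (y + \<alpha> ^ n * u)"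
      unfolding Vs_Suc by blast
    moreover from this have "x = v + \<alpha> * y + \<alpha> ^ Suc n * u" by (simp add: algebra_simps)
    ultimately show "x \<in> Vs (Suc (Suc n))"
      unfolding Vs_Suc[of "Suc n"] Suc by blast
  qed
qed

lemma lam_alpha_msum:
  "lam (x * (\<alpha> ^ k * msum s)) = (\<Sum>(c, e)\<leftarrow>s. of_int c * lam (x * \<alpha> ^ (k + e)))"
  using lam_msum[of "x * \<alpha> ^ k" s] by (simp add: power_add mult.assoc)

lemma lam_msum_msum:
  "lam (x * (msum s * msum s'))
    = (\<Sum>(c, e)\<leftarrow>s. of_int c * (\<Sum>(c', e')\<leftarrow>s'. of_int c' * lam (x * \<alpha> ^ (e + e'))))"
proof (induction s)
  case (Cons p s)
  obtain c e where p: "p = (c, e)" by fastforce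
  have "msum (p # s) = scale_L (of_int c) (\<alpha> ^ e) + msum s" by (simp add: msum_def p)
  then have "lam (x * (msum (p # s) * msum s'))
      = of_int c * lam (x * (\<alpha> ^ e * msum s')) + lam (x * (msum s * msum s'))"
    by (simp add: distrib_left distrib_right scale_L_mult_right flip: scale_L_mult)
  then show ?case by (simp add: p Cons lam_alpha_msum)
qed (simp add: msum_def)

lemma lam_V_eq_0:
  assumes "\<And>s. s \<in> set vterms \<Longrightarrow> lam (x * msum s) = 0" "v \<in> V"
  shows "lam (x * v) = 0"
  using assms(2) unfolding V_eq
  by (induction rule: L.span_induct_alt) (auto simp: distrib_left scale_L_mult_right assms(1))

lemma Vs_4: "Vs 4 = UNIV"
proof -
  have "z \<in> Vs 4" for z
  proof (rule double_perp[OF Vs_subspace])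
    fix x assume x: "\<forall>y\<in>Vs 4. lam (x * y) = 0"
    have "lam (x * \<alpha> ^ n) = 0" if "n < 24" for n
    proof (rule linear_system_4V[of "\<lambda>n. lam (x * \<alpha> ^ n)", OF _ that])
      fix k s assume "k < (4::nat)" "s \<in> set vterms"
      then have "lam (x * (\<alpha> ^ k * msum s)) = 0"
        using x Vs_base[of k 4 "msum s"] L.span_base[of "msum s"] by (simp add: V_eq)
      then show "(\<Sum>(c, e)\<leftarrow>s. of_int c * lam (x * \<alpha> ^ (k + e))) = 0"
        by (simp only: lam_alpha_msum)
    qed
    then have "lcoef x i = lcoef 0 i" if "i < 24" for i
      using lam_mult_alpha_power[of "23 - i" x] that by simp
    then have "x = 0" by (rule L_eqI)
    then show "lam (x * z) = 0" by simp
  qed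
  then show ?thesis by blast
qed

lemma lam_alpha_power: "n < 47 \<Longrightarrow> lam (\<alpha> ^ n) = (if n = 23 then 1 else 0)"
  by (cases "n < 24") (auto simp: lam_def lcoef_alpha_power lcoef_alpha_power_ge)

text \<open>Since \<open>L\<^sub>2\<^sub>0\<close> is the orthogonal complement of \<open>L\<^sub>2\<close>, only the values \<open>lam (\<alpha> ^ j * v * v')\<close> for
  \<open>j \<le> 2\<close> have to vanish, and these are computed on generators.\<close>

lemma V_mult_V: "v \<in> V \<Longrightarrow> v' \<in> V \<Longrightarrow> v * v' \<in> L_upto 20"
proof -
  assume v: "v \<in> V" "v' \<in> V"
  define q where "q n = lam (\<alpha> ^ n)" for n
  have q: "q n = (if n = 23 then 1 else 0)" if "n < 47" for n
    using that by (simp add: q_def lam_alpha_power)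
  have "\<forall>j\<in>{0,1,2}. \<forall>s\<in>set vterms. \<forall>s'\<in>set vterms.
      (\<Sum>(c, e)\<leftarrow>s. of_int c * (\<Sum>(c', e')\<leftarrow>s'. of_int c' * q (j + (e + e')))) = 0"
    by (simp add: vterms_def q)
  then have msums: "lam (\<alpha> ^ j * (msum s * msum s')) = 0"
    if "j \<le> 2" "s \<in> set vterms" "s' \<in> set vterms" for j s s'
  proof -
    have "j \<in> {0,1,2}" using that(1) by auto
    with \<open>\<forall>j\<in>{0,1,2}. _\<close> that show ?thesis
      unfolding lam_msum_msum q_def power_add[symmetric] by blast
  qed
  have "lam (\<alpha> ^ j * v' * v) = 0" if "j \<le> 2" for j
  proof (rule lam_V_eq_0[OF _ v(1)])
    fix s assume s: "s \<in> set vterms"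
    have "lam (\<alpha> ^ j * msum s * v') = 0"
      by (rule lam_V_eq_0[OF _ v(2)]) (simp add: mult.assoc msums[OF that s])
    then show "lam (\<alpha> ^ j * v' * msum s) = 0" by (simp add: mult_ac)
  qed
  then have p: "lam (v * v' * \<alpha> ^ j) = 0" if "j \<le> 2" for j
    using that by (simp add: mult_ac)
  have "lcoef (v * v') i = 0" if "20 < i" "i < 24" for i
    using p[of "23 - i"] lam_mult_alpha_power[of "23 - i" "v * v'"] that by simp
  then show ?thesis by (subst L_upto_iff) auto
qed

lemma L_upto_subspace: "L.subspace (L_upto n)"
  by (simp add: L_upto_def)

lemma V_squared: "space_prod V V = L_upto 20"
proof
  show "space_prod V V \<subseteq> L_upto 20"
    unfolding space_prod_def
    by (rule L.span_minimal[OF _ L_upto_subspace]) (auto intro: V_mult_V)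
  show "L_upto 20 \<subseteq> space_prod V V"
  proof
    fix z assume z: "z \<in> L_upto 20"
    show "z \<in> space_prod V V"
      unfolding space_prod_def
    proof (rule double_perp[OF L.subspace_span])
      fix x assume x: "\<forall>y\<in>span_L {u * u' |u u'. u \<in> V \<and> u' \<in> V}. lam (x * y) = 0"
      have y: "lam (x * \<alpha> ^ n) = 0" if "n < 21" for n
      proof (rule linear_system_VV[of "\<lambda>n. lam (x * \<alpha> ^ n)", OF _ _ that])
        show "lam (x * \<alpha> ^ (n + 24)) = 2 * lam (x * \<alpha> ^ n)" for n
          by (rule alpha_powers_wrap)
        fix s s' assume s: "s \<in> set vterms" "s' \<in> set vterms"
        then have "msum s \<in> V" "msum s' \<in> V" by (auto simp: V_eq intro: L.span_base)
        then have "lam (x * (msum s * msum s')) = 0" using x by (blast intro: L.span_base)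
        then show "(\<Sum>(c, e)\<leftarrow>s. of_int c *
          (\<Sum>(c', e')\<leftarrow>s'. of_int c' * lam (x * \<alpha> ^ (e + e')))) = 0"
          by (simp only: lam_msum_msum)
      qed
      have "lcoef x i = 0" if "2 < i" "i < 24" for i
        using y[of "23 - i"] lam_mult_alpha_power[of "23 - i" x] that by simp
      then have "x \<in> L_upto (22 - 20)" by (subst L_upto_iff) auto
      then show "lam (x * z) = 0" using z L_upto_perp[of 20 x] by simp
    qed
  qed
qed

lemma V_times_L_upto_21: "space_prod V (L_upto 21) = UNIV"
proof -
  have "{\<alpha> ^ k * v | k v. k < 4 \<and> v \<in> V} \<subseteq> {u * u' | u u'. u \<in> V \<and> u' \<in> L_upto 21}"
  proof
    fix x assume "x \<in> {\<alpha> ^ k * v | k v. k < 4 \<and> v \<in> V}"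
    then obtain k v where "x = v * \<alpha> ^ k" "k < 4" "v \<in> V" by (auto simp: mult.commute)
    then show "x \<in> {u * u' | u u'. u \<in> V \<and> u' \<in> L_upto 21}"
      using alpha_power_L_upto[of k 21] by auto
  qed
  then have "Vs 4 \<subseteq> space_prod V (L_upto 21)"
    unfolding Vs_def space_prod_def by (rule L.span_mono)
  then show ?thesis using Vs_4 by auto
qed

definition gen :: "nat \<times> nat \<Rightarrow> L" where
  "gen = (\<lambda>(k, j). \<alpha> ^ k * msum (vterms ! j))"

lemma V_gen: "V = span_L ((\<lambda>j. gen (0, j)) ` {..<6})"
proof -
  have "set vterms = (!) vterms ` {..<6}"
    by (auto simp: vterms_def set_conv_nth)
  then show ?thesis by (simp add: V_eq gen_def image_image)
qed

lemma V_explicit: "v \<in> V \<Longrightarrow> \<exists>c. v = (\<Sum>j<6. scale_L (c j) (gen (0, j)))"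
  unfolding V_gen
proof (induction rule: L.span_induct_alt)
  case base
  show ?case by (intro exI[of _ "\<lambda>_. 0"]) simp
next
  case (step q x y)
  then obtain i d where i: "i < 6" "x = gen (0, i)" "y = (\<Sum>j<6. scale_L (d j) (gen (0, j)))" by auto
  then have "scale_L q x = (\<Sum>j<6. scale_L (if j = i then q else 0) (gen (0, j)))"
    by (simp add: if_distrib[of "\<lambda>q. scale_L q _"] cong: if_cong)
  then have "scale_L q x + y = (\<Sum>j<6. scale_L ((if j = i then q else 0) + d j) (gen (0, j)))"
    by (simp add: i(3) L.scale_left_distrib sum.distrib)
  then show ?case by (intro exI[of _ "\<lambda>j. (if j = i then q else 0) + d j"])
qed

text \<open>The 24 products of a power of \<open>\<alpha>\<close> with a generator of \<open>V\<close> span the 24-dimensional space \<open>L\<close>, so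
  they are a basis; this is where \<open>dim V = 6\<close> and the directness of the sum come from.\<close>

lemma gen_basis:
  "inj_on gen ({..<4} \<times> {..<6})" "L.independent (gen ` ({..<4} \<times> {..<6}))"
proof -
  let ?B = "gen ` ({..<4} \<times> {..<6})"
  have "{\<alpha> ^ k * v | k v. k < 4 \<and> v \<in> V} \<subseteq> span_L ?B"
  proof
    fix x assume "x \<in> {\<alpha> ^ k * v | k v. k < 4 \<and> v \<in> V}"
    then obtain k v where x: "x = \<alpha> ^ k * v" "k < 4" "v \<in> V" by blast
    obtain c where "v = (\<Sum>j<6. scale_L (c j) (gen (0, j)))" using V_explicit x(3) by blast
    then have "x = (\<Sum>j<6. scale_L (c j) (gen (k, j)))"
      by (simp add: x(1) sum_distrib_left scale_L_mult_right gen_def)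
    also have "\<dots> \<in> span_L ?B"
      using x(2) by (intro L.span_sum L.span_scale L.span_base) auto
    finally show "x \<in> span_L ?B" .
  qed
  then have "Vs 4 \<subseteq> span_L ?B"
    unfolding Vs_def by (rule L.span_minimal) simp
  then have sp: "UNIV \<subseteq> span_L ?B" by (simp add: Vs_4)
  have "24 \<le> card ?B"
    using L.dim_le_card[OF sp] dim_L_UNIV by simp
  moreover have "card ?B \<le> 24"
    using card_image_le[of "{..<4} \<times> {..<6}" gen] by simp
  ultimately have c: "card ?B = 24" by simp
  then show "inj_on gen ({..<4} \<times> {..<6})" by (intro eq_card_imp_inj_on) simp_all
  show "L.independent ?B"
    using Lfin.card_le_dim_spanning[of ?B UNIV] sp c dim_L_UNIV by simp
qed

lemma dim_V: "dim_L V = 6"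
proof -
  have eq: "(\<lambda>j. gen (0, j)) ` {..<6} = gen ` ({0} \<times> {..<6})" by auto
  have "L.independent ((\<lambda>j. gen (0, j)) ` {..<6})"
    unfolding eq by (rule L.independent_mono[OF gen_basis(2)]) auto
  moreover have "card ((\<lambda>j. gen (0, j)) ` {..<6}) = 6"
    unfolding eq by (subst card_image) (auto intro: inj_on_subset[OF gen_basis(1)])
  ultimately show ?thesis
    unfolding V_gen by (simp add: L.dim_eq_card_independent)
qed

lemma V_direct:
  assumes u: "\<And>k. k < 4 \<Longrightarrow> u k \<in> V" and z: "(\<Sum>k<4. \<alpha> ^ k * u k) = 0" and "k < (4::nat)"
  shows "u k = 0"
proof -
  obtain c where c: "\<And>k. k < 4 \<Longrightarrow> u k = (\<Sum>j<6. scale_L (c k j) (gen (0, j)))"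
    using V_explicit[OF u] by metis
  have "0 = (\<Sum>k<4. \<Sum>j<6. scale_L (c k j) (gen (k, j)))"
    unfolding z[symmetric] by (simp add: c sum_distrib_left scale_L_mult_right gen_def)
  also have "\<dots> = (\<Sum>(k, j)\<in>{..<4}\<times>{..<6}. scale_L (c k j) (gen (k, j)))"
    by (rule sum.cartesian_product)
  also have "\<dots> = (\<Sum>p\<in>{..<4}\<times>{..<6}. scale_L (case_prod c (inv_into ({..<4}\<times>{..<6}) gen (gen p))) (gen p))"
    by (rule sum.cong) (auto simp: inv_into_f_f[OF gen_basis(1)])
  also have "\<dots> = (\<Sum>b\<in>gen ` ({..<4}\<times>{..<6}). scale_L (case_prod c (inv_into ({..<4}\<times>{..<6}) gen b)) b)"
    by (simp add: sum.reindex[OF gen_basis(1)])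
  finally have s: "(\<Sum>b\<in>gen ` ({..<4}\<times>{..<6}). scale_L (case_prod c (inv_into ({..<4}\<times>{..<6}) gen b)) b) = 0"
    by simp
  have "c k j = 0" if "j < 6" for j
  proof -
    have "gen (k, j) \<in> gen ` ({..<4}\<times>{..<6})" using that \<open>k < 4\<close> by auto
    from L.independentD[OF gen_basis(2) _ order_refl s this]
    show ?thesis using that \<open>k < 4\<close> by (simp add: inv_into_f_f[OF gen_basis(1)])
  qed
  then show ?thesis using c[OF \<open>k < 4\<close>] by simp
qed

lemma V_direct_3:
  assumes "v \<in> V" "v' \<in> V" "v'' \<in> V" "v + \<alpha> * v' + \<alpha> ^ 2 * v'' = 0"
  shows "v = 0" "v' = 0" "v'' = 0"
proof -
  define u where "u = (\<lambda>k::nat. if k = 0 then v else if k = 1 then v' else if k = 2 then v'' else 0)"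
  have u: "\<And>k. k < 4 \<Longrightarrow> u k \<in> V"
    using assms L.subspace_0[OF V_subspace] by (simp add: u_def)
  have "(\<Sum>k<4. \<alpha> ^ k * u k) = 0"
    using assms(4) by (simp add: u_def eval_nat_numeral add_ac)
  from V_direct[OF u this, of 0] V_direct[OF u this, of 1] V_direct[OF u this, of 2]
  show "v = 0" "v' = 0" "v'' = 0" by (simp_all add: u_def)
qed

lemma V_direct_sum: "direct_sum_on {0, 1, 2 :: nat} (\<lambda>i. {\<alpha> ^ i * v | v. v \<in> V})"
  unfolding direct_sum_on_def
proof (intro allI impI, elim conjE)
  fix u :: "nat \<Rightarrow> L"
  assume u: "\<forall>i\<in>{0, 1, 2}. u i \<in> {\<alpha> ^ i * v | v. v \<in> V}" and z: "(\<Sum>i\<in>{0, 1, 2}. u i) = 0"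
  obtain v v' v'' where v: "v \<in> V" "v' \<in> V" "v'' \<in> V"
    "u 0 = v" "u 1 = \<alpha> * v'" "u 2 = \<alpha> ^ 2 * v''" using u by auto
  have "v + \<alpha> * v' + \<alpha> ^ 2 * v'' = 0" using z v(4-6) by (simp add: add_ac)
  from V_direct_3[OF v(1-3) this] show "\<forall>i\<in>{0, 1, 2}. u i = 0" using v(4-6) by simp
qed

lemma alpha_mult_L_upto: "x \<in> L_upto n \<Longrightarrow> \<alpha> * x \<in> L_upto (Suc n)"
  unfolding L_upto_def
proof (induction rule: L.span_induct_alt)
  case (step c x y)
  then obtain j where "x = \<alpha> ^ j" "j \<le> n" by auto
  then have "\<alpha> * x = \<alpha> ^ Suc j" "Suc j \<le> Suc n" by auto
  then have "\<alpha> * x \<in> span_L {\<alpha> ^ j |j. j \<le> Suc n}" by (blast intro: L.span_base)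
  with step show ?case by (simp add: distrib_left scale_L_mult_right L.span_add L.span_scale)
qed (simp add: L.span_zero)

lemma L_upto_mono: "m \<le> n \<Longrightarrow> L_upto m \<subseteq> L_upto n"
  unfolding L_upto_def by (rule L.span_mono) auto

lemma V_mult_Vs: "v \<in> V \<Longrightarrow> x \<in> Vs (Suc n) \<Longrightarrow> v * x \<in> L_upto (20 + n)"
proof (induction n arbitrary: x)
  case 0
  then show ?case using V_mult_V by (simp add: Vs_1)
next
  case (Suc n)
  then obtain u y where uy: "u \<in> V" "y \<in> Vs (Suc n)" "x = u + \<alpha> * y"
    unfolding Vs_Suc'[of "Suc n"] by blast
  have "v * u \<in> L_upto (20 + Suc n)"
    using V_mult_V[OF Suc.prems(1) uy(1)] L_upto_mono[of 20 "20 + Suc n"] by auto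
  moreover have "\<alpha> * (v * y) \<in> L_upto (20 + Suc n)"
    using alpha_mult_L_upto[OF Suc.IH[OF Suc.prems(1) uy(2)]] by simp
  moreover have "v * x = v * u + \<alpha> * (v * y)" by (simp add: uy algebra_simps)
  ultimately show ?case by (simp add: L.subspace_add[OF L_upto_subspace])
qed

lemma L_upto_22_iff: "x \<in> L_upto 22 \<longleftrightarrow> lam x = 0"
proof -
  have "(\<forall>i. 22 < i \<and> i < 24 \<longrightarrow> lcoef x i = 0) \<longleftrightarrow> lcoef x 23 = 0"
  proof
    assume z: "lcoef x 23 = 0"
    show "\<forall>i. 22 < i \<and> i < 24 \<longrightarrow> lcoef x i = 0"
    proof (intro allI impI)
      fix i :: nat assume "22 < i \<and> i < 24"
      then have "i = 23" by auto
      with z show "lcoef x i = 0" by simp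
    qed
  qed simp
  then show ?thesis using L_upto_iff[of 22 x] by (simp add: lam_def)
qed

lemma Vs_Suc_numeral:
  "Vs 2 = {v + \<alpha> * v' | v v'. v \<in> V \<and> v' \<in> V}"
  "Vs 3 = {y + \<alpha> ^ 2 * v | y v. y \<in> Vs 2 \<and> v \<in> V}"
  "Vs 4 = {y + \<alpha> ^ 3 * v | y v. y \<in> Vs 3 \<and> v \<in> V}"
proof -
  show "Vs 2 = {v + \<alpha> * v' | v v'. v \<in> V \<and> v' \<in> V}" by (simp add: W_def flip: W_eq)
  show "Vs 3 = {y + \<alpha> ^ 2 * v | y v. y \<in> Vs 2 \<and> v \<in> V}" using Vs_Suc[of 2] by simp
  show "Vs 4 = {y + \<alpha> ^ 3 * v | y v. y \<in> Vs 3 \<and> v \<in> V}" using Vs_Suc[of 3] by simp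
qed

lemma lam_V_Vs3: "v \<in> V \<Longrightarrow> x \<in> Vs 3 \<Longrightarrow> lam (v * x) = 0"
  using V_mult_Vs[of v x 2] by (simp add: L_upto_22_iff)

lemma V_mult_W: "v \<in> V \<Longrightarrow> w \<in> W \<Longrightarrow> v * w \<in> L_upto 21"
  using V_mult_Vs[of v w 1] by (simp add: W_eq numeral_2_eq_2)

text \<open>\<open>V\<close> is orthogonal to \<open>V + \<alpha> V + \<alpha>\<^sup>2 V\<close> because \<open>V\<^sup>2 \<subseteq> L\<^sub>2\<^sub>0\<close>. Under the hypothesis \<open>v\<close> is orthogonal
  to \<open>\<alpha>\<^sup>3 V\<close> as well, hence to all of \<open>L\<close>. The orthogonal complements of \<open>V\<close> and \<open>W\<close> are found by
  excluding the last summand of \<open>Vs 4\<close> and \<open>Vs 3\<close> in this way.\<close>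

lemma V_perp_L:
  assumes v: "v \<in> V" and z: "\<And>u. u \<in> V \<Longrightarrow> lam (\<alpha> ^ 3 * v * u) = 0"
  shows "v = 0"
proof (rule lam_nondegenerate)
  fix y
  have "y \<in> Vs 4" using Vs_4 by simp
  then obtain x u where x: "y = x + \<alpha> ^ 3 * u" "x \<in> Vs 3" "u \<in> V"
    unfolding Vs_Suc_numeral(3) by blast
  have "lam (v * x) = 0" by (rule lam_V_Vs3[OF v x(2)])
  moreover have "lam (v * (\<alpha> ^ 3 * u)) = 0" using z[OF x(3)] by (simp add: mult_ac)
  ultimately show "lam (v * y) = 0" by (simp add: x(1) distrib_left)
qed

lemma V_perp:
  assumes "\<And>v. v \<in> V \<Longrightarrow> lam (x * v) = 0"
  shows "x \<in> Vs 3"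
proof -
  have "x \<in> Vs 4" using Vs_4 by simp
  then obtain y v where x: "x = y + \<alpha> ^ 3 * v" "y \<in> Vs 3" "v \<in> V"
    unfolding Vs_Suc_numeral(3) by blast
  have "v = 0"
  proof (rule V_perp_L[OF x(3)])
    fix u assume u: "u \<in> V"
    have "lam (y * u) = 0" using lam_V_Vs3[OF u x(2)] by (simp add: mult.commute)
    then show "lam (\<alpha> ^ 3 * v * u) = 0"
      using assms[OF u] by (simp add: x(1) distrib_right)
  qed
  then show ?thesis using x by simp
qed

lemma V_subset_W: "v \<in> V \<Longrightarrow> v \<in> W" "v \<in> V \<Longrightarrow> \<alpha> * v \<in> W"
  using L.subspace_0[OF V_subspace] by (force simp: W_def)+

lemma W_perp:
  assumes "\<And>w. w \<in> W \<Longrightarrow> lam (x * w) = 0"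
  shows "x \<in> W"
proof -
  have "x \<in> Vs 3" using V_perp[of x] assms V_subset_W by simp
  then obtain y v where x: "x = y + \<alpha> ^ 2 * v" "y \<in> W" "v \<in> V"
    unfolding Vs_Suc_numeral(2) W_eq by blast
  have "v = 0"
  proof (rule V_perp_L[OF x(3)])
    fix u assume u: "u \<in> V"
    have "\<alpha> * (u * y) \<in> L_upto (Suc 21)" using alpha_mult_L_upto V_mult_W[OF u x(2)] by blast
    then have "lam (y * (\<alpha> * u)) = 0" by (simp add: L_upto_22_iff mult_ac)
    moreover have "\<alpha> ^ 3 * v * u = x * (\<alpha> * u) - y * (\<alpha> * u)"
      by (simp add: x(1) algebra_simps power2_eq_square power3_eq_cube)
    ultimately show "lam (\<alpha> ^ 3 * v * u) = 0"
      using assms[OF V_subset_W(2)[OF u]] by simp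
  qed
  then show ?thesis using x by simp
qed

lemma W_mult_W: "w \<in> W \<Longrightarrow> w' \<in> W \<Longrightarrow> w * w' \<in> L_upto 22"
proof -
  assume w: "w \<in> W" "w' \<in> W"
  then obtain v v' where v: "v \<in> V" "v' \<in> V" "w = v + \<alpha> * v'" by (auto simp: W_def)
  have "v * w' \<in> L_upto 22"
    using V_mult_W[OF v(1) w(2)] L_upto_mono[of 21 22] by auto
  moreover have "\<alpha> * (v' * w') \<in> L_upto 22"
    using alpha_mult_L_upto[OF V_mult_W[OF v(2) w(2)]] by simp
  moreover have "w * w' = v * w' + \<alpha> * (v' * w')" by (simp add: v algebra_simps)
  ultimately show ?thesis by (simp add: L.subspace_add[OF L_upto_subspace])
qed

text \<open>\<open>V + \<alpha> V + \<alpha>\<^sup>2 V\<close> annihilates \<open>V\<close>, so a multiplier of \<open>V\<close> into it annihilates \<open>V\<^sup>2\<close>.\<close>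

lemma V_multiplier:
  assumes "\<And>v. v \<in> V \<Longrightarrow> x * v \<in> Vs 3"
  shows "x \<in> L_upto 2"
proof -
  have "lam (x * y) = 0" if "y \<in> L_upto 20" for y
    using that unfolding V_squared[symmetric] space_prod_def
  proof (induction rule: L.span_induct_alt)
    case (step c z y)
    then obtain u u' where "z = u * u'" "u \<in> V" "u' \<in> V" by auto
    then have "lam (u' * (x * u)) = 0" using lam_V_Vs3 assms by blast
    moreover have "x * z = u' * (x * u)" by (simp add: \<open>z = u * u'\<close> mult_ac)
    ultimately have "lam (x * z) = 0" by metis
    with step show ?case by (simp add: distrib_left scale_L_mult_right)
  qed simp
  then show ?thesis using L_upto_perp[of 20 x] by simp
qed

lemma W_alpha_W: "w \<in> W \<Longrightarrow> \<alpha> * w \<in> W \<Longrightarrow> w \<in> V"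
proof -
  assume "w \<in> W" "\<alpha> * w \<in> W"
  then obtain v v' u u' where v: "v \<in> V" "v' \<in> V" "u \<in> V" "u' \<in> V"
    "w = v + \<alpha> * v'" "\<alpha> * w = u + \<alpha> * u'" by (auto simp: W_def)
  then have "- u + \<alpha> * (v - u') + \<alpha> ^ 2 * v' = 0"
    by (simp add: algebra_simps power2_eq_square)
  then have "v' = 0"
    using V_direct_3[of "- u" "v - u'" v'] v V_subspace
    by (simp add: L.subspace_neg L.subspace_diff)
  with v show "w \<in> V" by simp
qed

lemma V_alpha_V: "v \<in> V \<Longrightarrow> \<alpha> * v \<in> V \<Longrightarrow> v = 0"
  using V_direct_3[of "- (\<alpha> * v)" v 0] V_subspace by (simp add: L.subspace_neg L.subspace_0)

lemma lcoef_alpha_mult: "lcoef (\<alpha> * x) (Suc i) = lcoef x i" if "i < 23"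
proof -
  have "lcoef (\<alpha> * x) (Suc i) = lam (\<alpha> * x * \<alpha> ^ (22 - i))"
    using that by (subst lam_mult_alpha_power) auto
  also have "\<alpha> * x * \<alpha> ^ (22 - i) = x * \<alpha> ^ (23 - i)"
  proof -
    have "23 - i = Suc (22 - i)" using that by auto
    then show ?thesis by (simp add: mult_ac)
  qed
  also have "lam \<dots> = lcoef x i"
    using that by (subst lam_mult_alpha_power) auto
  finally show ?thesis .
qed

lemma L_upto_alpha:
  assumes "n < 22" "x \<in> L_upto (Suc n)" "\<alpha> * x \<in> L_upto (Suc n)" 
  shows "x \<in> L_upto n"
proof -
  have "lcoef x i = 0" if "n < i" "i < 24" for i
  proof (cases "i = Suc n")
    case True
    have "lcoef (\<alpha> * x) (Suc i) = 0"
      using assms(1,3) that True L_upto_iff[of "Suc n"] by auto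
    then show ?thesis using lcoef_alpha_mult[of i x] True assms(1) by simp
  next
    case False
    then show ?thesis using assms(1,2) that L_upto_iff[of "Suc n" x] by auto
  qed
  then show ?thesis using assms(1) by (subst L_upto_iff) auto
qed

lemma L_upto_decomp:
  assumes "x \<in> L_upto (Suc n)"
  obtains y z where "x = y + \<alpha> * z" "y \<in> L_upto n" "z \<in> L_upto n"
proof -
  have "\<exists>y z. x = y + \<alpha> * z \<and> y \<in> L_upto n \<and> z \<in> L_upto n"
    using assms unfolding L_upto_def[of "Suc n"]
  proof (induction rule: L.span_induct_alt)
    case base
    show ?case by (intro exI[of _ 0]) (simp add: L.subspace_0[OF L_upto_subspace])
  next
    case (step c b x)
    then obtain j y z where j: "b = \<alpha> ^ j" "j \<le> Suc n"
      and yz: "x = y + \<alpha> * z" "y \<in> L_upto n" "z \<in> L_upto n" by auto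
    show ?case
    proof (cases j)
      case 0
      have "scale_L c b + x = (scale_L c b + y) + \<alpha> * z" by (simp add: yz add_ac)
      moreover have "scale_L c b + y \<in> L_upto n"
        using alpha_power_L_upto[of 0 n] yz j 0
        by (intro L.subspace_add[OF L_upto_subspace] L.subspace_scale[OF L_upto_subspace]) auto
      ultimately show ?thesis using yz(3) by blast
    next
      case (Suc i)
      have "scale_L c b + x = y + \<alpha> * (scale_L c (\<alpha> ^ i) + z)"
        by (simp add: yz j Suc distrib_left scale_L_mult_right add_ac)
      moreover have "scale_L c (\<alpha> ^ i) + z \<in> L_upto n"
        using alpha_power_L_upto[of i n] yz j Suc
        by (intro L.subspace_add[OF L_upto_subspace] L.subspace_scale[OF L_upto_subspace]) auto
      ultimately show ?thesis using yz(2) by blast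
    qed
  qed
  with that show thesis by blast
qed

lemma L_upto_0: "L_upto 0 = span_L {1}"
  by (simp add: L_upto_def)

section \<open>Subrings of a commutative ring as records\<close>

lemma ring_of_simps [simp]:
  "carrier (ring_of A) = A" "x \<otimes>\<^bsub>ring_of A\<^esub> y = x * y" "\<one>\<^bsub>ring_of A\<^esub> = 1"
  "\<zero>\<^bsub>ring_of A\<^esub> = 0" "x \<oplus>\<^bsub>ring_of A\<^esub> y = x + y"
  by (simp_all add: ring_of_def)

locale concrete_ring =
  fixes A :: "'a::comm_ring_1 set"
  assumes zero_in: "0 \<in> A" and one_in: "1 \<in> A"
    and add_in: "x \<in> A \<Longrightarrow> y \<in> A \<Longrightarrow> x + y \<in> A"
    and uminus_in: "x \<in> A \<Longrightarrow> - x \<in> A"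
    and mult_in: "x \<in> A \<Longrightarrow> y \<in> A \<Longrightarrow> x * y \<in> A"
begin

lemma diff_in: "x \<in> A \<Longrightarrow> y \<in> A \<Longrightarrow> x - y \<in> A"
  using add_in[of x "- y"] uminus_in[of y] by simp

lemma sum_in: "(\<And>i. i \<in> S \<Longrightarrow> f i \<in> A) \<Longrightarrow> sum f S \<in> A"
  by (induction S rule: infinite_finite_induct) (auto simp: zero_in add_in)

sublocale R: cring "ring_of A"
proof (rule cringI)
  show "abelian_group (ring_of A)"
  proof (rule abelian_groupI)
    fix x assume "x \<in> carrier (ring_of A)"
    then show "\<exists>y\<in>carrier (ring_of A). y \<oplus>\<^bsub>ring_of A\<^esub> x = \<zero>\<^bsub>ring_of A\<^esub>"
      using uminus_in by (intro bexI[of _ "- x"]) auto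
  qed (simp_all add: zero_in add_in algebra_simps)
  show "Group.comm_monoid (ring_of A)"
    by (rule comm_monoidI) (simp_all add: one_in mult_in algebra_simps)
qed (simp add: algebra_simps)

lemma a_inv_eq [simp]: "x \<in> A \<Longrightarrow> \<ominus>\<^bsub>ring_of A\<^esub> x = - x"
  using R.minus_equality[of "- x" x] uminus_in by simp

lemma a_minus_eq [simp]: "x \<in> A \<Longrightarrow> y \<in> A \<Longrightarrow> x \<ominus>\<^bsub>ring_of A\<^esub> y = x - y"
  by (simp add: a_minus_def)

lemma additive_subgroupI:
  assumes "H \<subseteq> A" "0 \<in> H" "\<And>a b. a \<in> H \<Longrightarrow> b \<in> H \<Longrightarrow> a + b \<in> H" "\<And>a. a \<in> H \<Longrightarrow> - a \<in> H"
  shows "additive_subgroup H (ring_of A)"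
proof (intro additive_subgroup.intro subgroup.intro)
  fix x assume x: "x \<in> H"
  then have "inv\<^bsub>add_monoid (ring_of A)\<^esub> x = - x"
    using a_inv_eq[of x] assms(1) by (auto simp: a_inv_def)
  then show "inv\<^bsub>add_monoid (ring_of A)\<^esub> x \<in> H" using assms(4)[OF x] by simp
qed (use assms in auto)

lemma idealI:
  assumes "H \<subseteq> A" "0 \<in> H" "\<And>a b. a \<in> H \<Longrightarrow> b \<in> H \<Longrightarrow> a + b \<in> H"
    "\<And>r a. r \<in> A \<Longrightarrow> a \<in> H \<Longrightarrow> r * a \<in> H"
  shows "ideal H (ring_of A)"
proof (intro ideal.intro ideal_axioms.intro R.ring_axioms additive_subgroupI)
  fix a assume a: "a \<in> H"
  then show "- a \<in> H" using assms(4)[of "- 1" a] one_in uminus_in by simp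
  fix x assume x: "x \<in> carrier (ring_of A)"
  then show "x \<otimes>\<^bsub>ring_of A\<^esub> a \<in> H" using a assms(4) by simp
  then show "a \<otimes>\<^bsub>ring_of A\<^esub> x \<in> H" by (simp add: mult.commute)
qed (use assms in simp_all)

lemma idealD:
  assumes "ideal H (ring_of A)"
  shows "H \<subseteq> A" "0 \<in> H" "\<And>a b. a \<in> H \<Longrightarrow> b \<in> H \<Longrightarrow> a + b \<in> H" "\<And>a. a \<in> H \<Longrightarrow> - a \<in> H"
    "\<And>r a. r \<in> A \<Longrightarrow> a \<in> H \<Longrightarrow> r * a \<in> H" "\<And>a b. a \<in> H \<Longrightarrow> b \<in> H \<Longrightarrow> a - b \<in> H"
proof -
  interpret H: ideal H "ring_of A" by (rule assms)
  show sub: "H \<subseteq> A" using H.a_subset by simp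
  show "0 \<in> H" using H.zero_closed by simp
  show add: "a + b \<in> H" if "a \<in> H" "b \<in> H" for a b using H.a_closed[OF that] by simp
  show mult: "r * a \<in> H" if "r \<in> A" "a \<in> H" for r a using H.I_l_closed[of a r] that by simp
  show neg: "- a \<in> H" if "a \<in> H" for a using mult[of "- 1" a] that one_in uminus_in by simp
  show "a - b \<in> H" if "a \<in> H" "b \<in> H" for a b using add[OF that(1) neg[OF that(2)]] by simp
qed

lemma finsum_eq: "(\<And>i. i \<in> S \<Longrightarrow> f i \<in> A) \<Longrightarrow> finsum (ring_of A) f S = sum f S"
proof (induction S rule: infinite_finite_induct)
  case (insert x F)
  then show ?case by (subst R.finsum_insert) auto
qed simp_all

end

interpretation L_poly: concrete_ring "UNIV :: L poly set"
  by unfold_locales auto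

lemma field_L: "field (ring_of (UNIV :: L set))"
proof -
  interpret U: concrete_ring "UNIV :: L set" by unfold_locales auto
  show ?thesis
  proof (rule U.R.cring_fieldI2)
    show "\<zero>\<^bsub>ring_of (UNIV :: L set)\<^esub> \<noteq> \<one>\<^bsub>ring_of (UNIV :: L set)\<^esub>" by simp
    fix x :: L assume "x \<noteq> \<zero>\<^bsub>ring_of (UNIV :: L set)\<^esub>"
    then have "x * inverse x = 1" by simp
    then show "\<exists>y\<in>carrier (ring_of UNIV). x \<otimes>\<^bsub>ring_of UNIV\<^esub> y = \<one>\<^bsub>ring_of UNIV\<^esub>" by auto
  qed
qed

section \<open>The ring \<open>R\<close>\<close>

lemma span_one: "span_L {1} = {scale_L q 1 | q. True}"
  using L.span_singleton[of 1] by auto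

lemma R_coeffs_subspace: "L.subspace (R_coeffs i)"
  by (simp add: R_coeffs_def W_eq Vs_subspace L_upto_subspace L.subspace_UNIV)

lemma scale_R_coeffs: "x \<in> R_coeffs i \<Longrightarrow> scale_L q x \<in> R_coeffs i"
  by (rule L.subspace_scale[OF R_coeffs_subspace])

lemma R_coeffs_simps:
  "R_coeffs 0 = {scale_L q 1 | q. True}" "R_coeffs 1 = W" "R_coeffs (Suc 0) = W"
  "R_coeffs 2 = L_upto 22" "3 \<le> i \<Longrightarrow> R_coeffs i = UNIV"
  unfolding span_one[symmetric] by (simp_all add: R_coeffs_def)

lemma R_coeffs_mult: "x \<in> R_coeffs i \<Longrightarrow> y \<in> R_coeffs j \<Longrightarrow> x * y \<in> R_coeffs (i + j)"
proof -
  assume xy: "x \<in> R_coeffs i" "y \<in> R_coeffs j"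
  consider "i = 0" | "j = 0" | "i = 1" "j = 1" | "i + j \<ge> 3" by linarith
  then show ?thesis
  proof cases
    case 1
    then obtain q where "x = scale_L q 1" using xy(1) by (auto simp: R_coeffs_simps(1))
    then show ?thesis using 1 scale_R_coeffs[OF xy(2), of q] by (metis add_0 scale_L_one_mult)
  next
    case 2
    then obtain q where "y = scale_L q 1" using xy(2) by (auto simp: R_coeffs_simps(1))
    then show ?thesis using 2 scale_R_coeffs[OF xy(1), of q]
      by (metis add_0_right mult.commute scale_L_one_mult)
  next
    case 3
    then show ?thesis using xy W_mult_W by (simp add: R_coeffs_def)
  next
    case 4
    then show ?thesis by (simp add: R_coeffs_simps(5))
  qed
qed

lemma one_R_coeffs: "1 \<in> R_coeffs i"
proof -
  have "1 \<in> L_upto 22" using alpha_power_L_upto[of 0 22] by simp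
  then show ?thesis
    using V_subset_W(1)[OF one_in_V] by (simp add: R_coeffs_def L.span_base)
qed

lemma R_setI: "(\<And>i. coeff p i \<in> R_coeffs i) \<Longrightarrow> p \<in> R_set"
  by (simp add: R_set_def)

lemma R_setD: "p \<in> R_set \<Longrightarrow> coeff p i \<in> R_coeffs i"
  by (simp add: R_set_def)

lemma monom_in_R: "monom c i \<in> R_set \<longleftrightarrow> c \<in> R_coeffs i"
  using L.subspace_0[OF R_coeffs_subspace] by (auto simp: R_set_def)

interpretation R: concrete_ring R_set
proof unfold_locales
  fix p q assume pq: "p \<in> R_set" "q \<in> R_set"
  show "p + q \<in> R_set" "- p \<in> R_set"
    using pq by (auto simp: R_set_def L.subspace_add[OF R_coeffs_subspace]
        L.subspace_neg[OF R_coeffs_subspace])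
  show "p * q \<in> R_set"
  proof (rule R_setI)
    fix i
    have "coeff p k * coeff q (i - k) \<in> R_coeffs i" if "k \<le> i" for k
      using R_coeffs_mult[OF R_setD[OF pq(1)] R_setD[OF pq(2)], of k "i - k"] that by simp
    then show "coeff (p * q) i \<in> R_coeffs i"
      unfolding coeff_mult by (intro L.subspace_sum[OF R_coeffs_subspace]) auto
  qed
next
  show "1 \<in> R_set" using monom_in_R[of 1 0] one_R_coeffs[of 0] by simp
qed (simp add: R_set_def L.subspace_0[OF R_coeffs_subspace])

lemma R_ring_domain: "domain R_ring"
  by (intro domain.intro R.R.cring_axioms domain_axioms.intro) auto

lemma subring_R_set: "subring R_set L_poly_ring"
  by (rule L_poly.R.subringI) (auto simp: R.one_in R.uminus_in R.add_in R.mult_in)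

text \<open>\<open>R\<close> contains \<open>t\<^sup>3 L[t]\<close>, which is what ties its arithmetic to that of the Euclidean
  ring \<open>L[t]\<close>.\<close>

lemma conductor: "monom 1 3 * p \<in> R_set" "p * monom 1 3 \<in> R_set"
proof -
  have "coeff (monom 1 3 * p) i \<in> R_coeffs i" for i
    by (simp add: coeff_monom_mult R_coeffs_simps(5) L.subspace_0[OF R_coeffs_subspace])
  then show "monom 1 3 * p \<in> R_set" by (rule R_setI)
  then show "p * monom 1 3 \<in> R_set" by (simp add: mult.commute)
qed

lemma monom_1_in_R: "monom 1 i \<in> R_set"
  by (simp add: monom_in_R one_R_coeffs)

lemma monom_alpha_in_R: "monom \<alpha> 1 \<in> R_set"
  using V_subset_W(2)[OF one_in_V] by (simp add: monom_in_R R_coeffs_def)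

subsection \<open>Grading and generators\<close>

lemma const_in_R: "monom (scale_L q 1) 0 \<in> R_set"
  by (auto simp: monom_in_R R_coeffs_simps(1))

lemma internal_grading_R: "internal_grading R_ring R_component"
  unfolding internal_grading_def
proof (intro conjI allI ballI)
  fix i
  have sub: "R_component i \<subseteq> R_set" by (auto simp: R_component_def monom_in_R)
  show "additive_subgroup (R_component i) R_ring"
  proof (rule R.additive_subgroupI)
    show "0 \<in> R_component i"
      using L.subspace_0[OF R_coeffs_subspace] by (force simp: R_component_def)
    fix a b assume "a \<in> R_component i" "b \<in> R_component i"
    then show "a + b \<in> R_component i" "- a \<in> R_component i"
      using L.subspace_add[OF R_coeffs_subspace] L.subspace_neg[OF R_coeffs_subspace]
      by (auto simp: R_component_def add_monom minus_monom)
  qed (rule sub)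
next
  fix i j x y assume "x \<in> R_component i" "y \<in> R_component j"
  then show "x \<otimes>\<^bsub>R_ring\<^esub> y \<in> R_component (i + j)"
    by (auto simp: R_component_def mult_monom R_coeffs_mult)
next
  fix x assume "x \<in> carrier R_ring"
  then have x: "x \<in> R_set" by simp
  define F where "F = (\<lambda>i. monom (coeff x i) i)"
  have finF: "{i. F i \<noteq> 0} \<subseteq> {..degree x}"
    by (auto simp: F_def monom_eq_0_iff le_degree)
  show "\<exists>!f. (\<forall>i. f i \<in> R_component i) \<and> finite {i. f i \<noteq> \<zero>\<^bsub>R_ring\<^esub>} \<and>
      x = finsum R_ring f {i. f i \<noteq> \<zero>\<^bsub>R_ring\<^esub>}"
  proof (rule ex1I[of _ F])
    have "x = sum F {..degree x}" by (simp add: F_def poly_as_sum_of_monoms)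
    also have "\<dots> = sum F {i. F i \<noteq> 0}"
      using finF by (intro sum.mono_neutral_right) auto
    finally show "(\<forall>i. F i \<in> R_component i) \<and> finite {i. F i \<noteq> \<zero>\<^bsub>R_ring\<^esub>} \<and>
      x = finsum R_ring F {i. F i \<noteq> \<zero>\<^bsub>R_ring\<^esub>}"
      using finite_subset[OF finF] R_setD[OF x]
      by (subst R.finsum_eq) (auto simp: F_def R_component_def monom_in_R)
  next
    fix f assume f: "(\<forall>i. f i \<in> R_component i) \<and> finite {i. f i \<noteq> \<zero>\<^bsub>R_ring\<^esub>} \<and>
      x = finsum R_ring f {i. f i \<noteq> \<zero>\<^bsub>R_ring\<^esub>}"
    then obtain c where c: "\<And>i. f i = monom (c i) i \<and> c i \<in> R_coeffs i"
      unfolding R_component_def by simp metis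
    have "x = sum f {i. f i \<noteq> 0}"
      using f c by (subst (asm) R.finsum_eq) (auto simp: monom_in_R)
    then have "coeff x k = (\<Sum>i\<in>{i. f i \<noteq> 0}. if i = k then c i else 0)" for k
      by (simp add: coeff_sum c)
    then have "coeff x k = c k" for k using f c[of k] by simp
    then show "f = F" using c by (auto simp: F_def)
  qed
qed

text \<open>\<open>L\<^sub>2\<^sub>2 = L\<^sub>2\<^sub>0 + \<alpha> L\<^sub>2\<^sub>0 + \<alpha>\<^sup>2 L\<^sub>2\<^sub>0\<close> and \<open>L\<^sub>2\<^sub>0 = V\<^sup>2\<close>, while \<open>W\<close> contains \<open>V\<close> and \<open>\<alpha> V\<close>.\<close>

lemma span_WW: "L_upto 22 = span_L {w * w' | w w'. w \<in> W \<and> w' \<in> W}"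
proof
  let ?S = "span_L {w * w' | w w'. w \<in> W \<and> w' \<in> W}"
  show "?S \<subseteq> L_upto 22" by (rule L.span_minimal[OF _ L_upto_subspace]) (auto intro: W_mult_W)
  have mult: "x \<in> ?S \<and> \<alpha> * x \<in> ?S \<and> \<alpha> * (\<alpha> * x) \<in> ?S" if "x \<in> L_upto 20" for x
    using that unfolding V_squared[symmetric] space_prod_def
  proof (induction rule: L.span_induct_alt)
    case (step c x y)
    then obtain v v' where v: "x = v * v'" "v \<in> V" "v' \<in> V" by auto
    have "x \<in> ?S"
      unfolding v(1) using v V_subset_W by (intro L.span_base) blast
    moreover have "\<alpha> * x = (\<alpha> * v) * v'" "\<alpha> * (\<alpha> * x) = (\<alpha> * v) * (\<alpha> * v')"
      by (simp_all add: v(1))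
    then have "\<alpha> * x \<in> ?S" "\<alpha> * (\<alpha> * x) \<in> ?S"
      using v V_subset_W by (metis (mono_tags, lifting) L.span_base mem_Collect_eq)+
    ultimately show ?case using step
      by (simp add: distrib_left scale_L_mult_right L.span_add L.span_scale)
  qed (simp add: L.span_zero)
  show "L_upto 22 \<subseteq> ?S"
  proof
    fix x assume "x \<in> L_upto 22"
    then obtain y z where x: "x = y + \<alpha> * z" "y \<in> L_upto 21" "z \<in> L_upto 21"
      using L_upto_decomp[of x 21] by auto
    obtain a b where y: "y = a + \<alpha> * b" "a \<in> L_upto 20" "b \<in> L_upto 20"
      using L_upto_decomp[of y 20] x by auto
    obtain c d where z: "z = c + \<alpha> * d" "c \<in> L_upto 20" "d \<in> L_upto 20"
      using L_upto_decomp[of z 20] x by auto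
    show "x \<in> ?S"
      unfolding x(1) y(1) z(1) distrib_left
      using mult[OF y(2)] mult[OF y(3)] mult[OF z(2)] mult[OF z(3)]
      by (intro L.span_add) auto
  qed
qed

lemma W_gen: "W = span_L (gen ` ({..<2} \<times> {..<6}))"
proof
  show "W \<subseteq> span_L (gen ` ({..<2} \<times> {..<6}))"
  proof
    fix w assume "w \<in> W"
    then obtain v v' where w: "w = v + \<alpha> * v'" "v \<in> V" "v' \<in> V" by (auto simp: W_def)
    obtain c c' where "v = (\<Sum>j<6. scale_L (c j) (gen (0, j)))" "v' = (\<Sum>j<6. scale_L (c' j) (gen (0, j)))"
      using V_explicit w by meson
    then have "w = (\<Sum>j<6. scale_L (c j) (gen (0, j))) + (\<Sum>j<6. scale_L (c' j) (gen (1, j)))"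
      by (simp add: w(1) sum_distrib_left scale_L_mult_right gen_def)
    also have "\<dots> \<in> span_L (gen ` ({..<2} \<times> {..<6}))"
      by (intro L.span_add L.span_sum L.span_scale L.span_base) auto
    finally show "w \<in> span_L (gen ` ({..<2} \<times> {..<6}))" .
  qed
  have "gen (k, j) \<in> W" if "k < 2" "j < 6" for k j
  proof -
    have "gen (0, j) \<in> V" unfolding V_gen using that by (intro L.span_base) auto
    moreover have "gen (k, j) = gen (0, j) \<or> gen (k, j) = \<alpha> * gen (0, j)"
      using that by (auto simp: gen_def less_2_cases_iff)
    ultimately show ?thesis using V_subset_W by auto
  qed
  then show "span_L (gen ` ({..<2} \<times> {..<6})) \<subseteq> W"
    using Vs_subspace[of 2] by (intro L.span_minimal) (auto simp: W_eq)
qed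

lemma standard_graded_R: "standard_graded_rat_algebra R_ring R_scalar R_component"
  unfolding standard_graded_rat_algebra_def
proof (intro conjI)
  show "cring R_ring" by (rule R.R.cring_axioms)
  have scalar_mult: "scale_L (a * b) 1 = scale_L a 1 * scale_L b 1" for a b
    by (simp flip: scale_L_one_mult)
  show "R_scalar \<in> ring_hom (ring_of UNIV) R_ring"
    by (rule ring_hom_memI)
      (auto simp: R_scalar_def const_in_R const_in_R[unfolded monom_0] mult_monom add_monom scalar_mult L.scale_left_distrib
        one_pCons monom_0)
  show "internal_grading R_ring R_component" by (rule internal_grading_R)
  show "bij_betw R_scalar UNIV (R_component 0)"
  proof (rule bij_betwI')
    fix a b
    show "(R_scalar a = R_scalar b) = (a = b)"
      by (simp add: R_scalar_def L.scale_cancel_right)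
    show "R_scalar a \<in> R_component 0"
      by (auto simp: R_scalar_def R_component_def R_coeffs_simps(1))
  next
    fix y assume "y \<in> R_component 0"
    then show "\<exists>x\<in>UNIV. y = R_scalar x"
      by (auto simp: R_scalar_def R_component_def R_coeffs_simps(1))
  qed
  define S where "S = (\<lambda>b. monom b 1) ` gen ` ({..<2} \<times> {..<6})"
  have S1: "S \<subseteq> R_component 1"
    unfolding S_def R_component_def R_coeffs_simps W_gen by (auto intro: L.span_base)
  define G where "G = generate_ring R_ring (range R_scalar \<union> S)"
  have GR: "G \<subseteq> R_set"
    unfolding G_def using S1
    by (intro R.R.generate_ring_incl[simplified]) (auto simp: R_scalar_def R_component_def monom_in_R R_coeffs_simps(1))
  have add: "x + y \<in> G" if "x \<in> G" "y \<in> G" for x y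
    using generate_ring.eng_add[of x R_ring _ y] that by (simp add: G_def)
  have mult: "x * y \<in> G" if "x \<in> G" "y \<in> G" for x y
    using generate_ring.eng_mult[of x R_ring _ y] that by (simp add: G_def)
  have zero: "0 \<in> G"
    using R.R.zero_in_generate by (simp add: G_def)
  have sc: "monom (scale_L q 1) 0 \<in> G" for q
    unfolding G_def R_scalar_def[symmetric] by (intro generate_ring.incl) auto
  have scale: "monom (scale_L q x) i \<in> G" if "monom x i \<in> G" for q x i
    using mult[OF sc[of q] that] by (simp add: mult_monom flip: scale_L_one_mult)
  have span: "monom x i \<in> G" if "x \<in> span_L B" "\<And>b. b \<in> B \<Longrightarrow> monom b i \<in> G" for x i B
    using that(1)
  proof (induction rule: L.span_induct_alt)
    case (step c x y)
    then show ?case using add[OF scale[OF that(2)]] by (simp flip: add_monom)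
  qed (simp add: zero)
  have G1: "monom w 1 \<in> G" if "w \<in> W" for w
    using that unfolding W_gen
    by (rule span) (auto simp: G_def S_def intro!: generate_ring.incl)
  have G2: "monom x 2 \<in> G" if "x \<in> L_upto 22" for x
    using that unfolding span_WW
  proof (rule span)
    fix b assume "b \<in> {w * w' |w w'. w \<in> W \<and> w' \<in> W}"
    then obtain w w' where "b = w * w'" "w \<in> W" "w' \<in> W" by blast
    then show "monom b 2 \<in> G" using mult[OF G1 G1, of w w'] by (simp add: mult_monom numeral_2_eq_2)
  qed
  have G3: "monom x (3 + i) \<in> G" for x i
  proof (induction i)
    case 0
    have "x \<in> space_prod V (L_upto 21)" by (simp add: V_times_L_upto_21)
    then show ?case
      unfolding space_prod_def
    proof (rule span)
      fix b assume "b \<in> {u * u' |u u'. u \<in> V \<and> u' \<in> L_upto 21}"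
      then obtain w x where "b = w * x" "w \<in> W" "x \<in> L_upto 22"
        using V_subset_W L_upto_mono[of 21 22] by auto
      then show "monom b (3 + 0) \<in> G"
        using mult[OF G1 G2, of w x] by (simp add: mult_monom numeral_3_eq_3)
    qed
  next
    case (Suc i)
    show ?case
      using mult[OF G1[of 1] Suc] V_subset_W(1)[OF one_in_V] by (simp add: mult_monom)
  qed
  have Gm: "monom x i \<in> G" if x: "x \<in> R_coeffs i" for x i
  proof -
    consider "i = 0" | "i = 1" | "i = 2" | "i \<ge> 3" by linarith
    then show ?thesis
    proof cases
      case 1
      then show ?thesis using x sc by (auto simp: R_coeffs_simps(1))
    next
      case 2
      then show ?thesis using x G1 by (simp add: R_coeffs_def)
    next
      case 3
      then show ?thesis using x G2 by (simp add: R_coeffs_def)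
    next
      case 4
      then show ?thesis using G3[of x "i - 3"] by simp
    qed
  qed
  have "R_set \<subseteq> G"
  proof
    fix p assume p: "p \<in> R_set"
    have sumG: "sum f A \<in> G" if "\<And>i. i \<in> A \<Longrightarrow> f i \<in> G" for f and A :: "nat set"
      using that by (induction A rule: infinite_finite_induct) (auto simp: zero add)
    have "(\<Sum>i\<le>degree p. monom (coeff p i) i) \<in> G"
      by (rule sumG) (rule Gm[OF R_setD[OF p]])
    then show "p \<in> G" by (simp add: poly_as_sum_of_monoms)
  qed
  with GR have "G = carrier R_ring" by auto
  moreover have "finite S" by (simp add: S_def)
  ultimately show "\<exists>S. finite S \<and> S \<subseteq> R_component 1 \<and>
      generate_ring R_ring (range R_scalar \<union> S) = carrier R_ring"
    using S1 unfolding G_def by blast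
qed

subsection \<open>Finite-dimensional pieces and the noetherian property\<close>

global_interpretation P: vector_space "\<lambda>q (p :: L poly). smult (scale_L q 1) p"
  by unfold_locales
    (simp_all add: smult_add_right smult_add_left L.scale_left_distrib flip: scale_L_one_mult)

lemma finite_spanning_set:
  assumes S: "P.subspace S" and deg: "\<And>p. p \<in> S \<Longrightarrow> degree p < N"
  obtains F where "finite F" "F \<subseteq> S" "S = P.span F"
proof -
  let ?E = "(\<lambda>(i, j). monom (\<alpha> ^ j) i) ` ({..<N} \<times> {..<24})"
  have E: "S \<subseteq> P.span ?E"
  proof
    fix p assume "p \<in> S"
    then have d: "degree p < N" by (rule deg)
    have "monom x i \<in> P.span ?E" if "i < N" for x i
    proof -
      have s: "monom (sum f {..<24}) i = (\<Sum>j<24. monom (f j) i)" for f :: "nat \<Rightarrow> L"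
        by (intro poly_eqI) (simp add: coeff_sum)
      have "monom x i = monom (\<Sum>j<24. scale_L (lcoef x j) (\<alpha> ^ j)) i"
        by (simp flip: L_expansion)
      also have "\<dots> = (\<Sum>j<24. smult (scale_L (lcoef x j) 1) (monom (\<alpha> ^ j) i))"
        unfolding s by (rule sum.cong) (simp_all add: smult_monom flip: scale_L_one_mult)
      also have "\<dots> \<in> P.span ?E"
        using that by (intro P.span_sum P.span_scale P.span_base) auto
      finally show ?thesis .
    qed
    then have "(\<Sum>i\<le>degree p. monom (coeff p i) i) \<in> P.span ?E"
      using d by (intro P.span_sum) auto
    then show "p \<in> P.span ?E" by (simp add: poly_as_sum_of_monoms)
  qed
  obtain B where B: "B \<subseteq> S" "P.independent B" "S \<subseteq> P.span B"
    using P.maximal_independent_subset by blast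
  have "finite B"
    using P.independent_span_bound[of ?E B] B E by auto
  moreover have "S = P.span B"
    using B S by (metis P.span_subspace)
  ultimately show thesis using that B(1) by blast
qed

lemma smult_scale_in_R: "p \<in> R_set \<Longrightarrow> smult (scale_L q 1) p \<in> R_set"
  using R.mult_in[OF const_in_R[of q], of p] by (simp add: monom_0)

lemma ideal_smult_scale:
  "ideal J R_ring \<Longrightarrow> p \<in> J \<Longrightarrow> smult (scale_L q 1) p \<in> J"
  using R.idealD(5)[of J "monom (scale_L q 1) 0" p] const_in_R by (simp add: monom_0)

lemma R_subspace: "P.subspace R_set"
  by (intro P.subspaceI) (simp_all add: R.zero_in R.add_in smult_scale_in_R)

lemma ideal_subspace: "ideal J R_ring \<Longrightarrow> P.subspace J"
  by (intro P.subspaceI) (simp_all add: R.idealD ideal_smult_scale)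

lemma bounded_degree_subspace: "P.subspace S \<Longrightarrow> 0 < N \<Longrightarrow> P.subspace {p \<in> S. degree p < N}"
proof (rule P.subspaceI)
  assume S: "P.subspace S" and N: "0 < N"
  show "0 \<in> {p \<in> S. degree p < N}" using P.subspace_0[OF S] N by simp
  fix p q assume pq: "p \<in> {p \<in> S. degree p < N}"
  show "smult (scale_L c 1) p \<in> {p \<in> S. degree p < N}" for c
    using pq P.subspace_scale[OF S, of p c] degree_smult_le[of "scale_L c 1" p] by simp
  assume "q \<in> {p \<in> S. degree p < N}"
  then show "p + q \<in> {p \<in> S. degree p < N}"
    using pq P.subspace_add[OF S, of p q] degree_add_less[of p N q] by simp
qed

text \<open>Division with remainder by \<open>a t\<^sup>3\<close> stays inside \<open>R\<close>, since the multiple of \<open>a t\<^sup>3\<close> that is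
  subtracted lies in \<open>a R\<close>.\<close>

lemma division_in_R:
  assumes "a \<noteq> 0"
  obtains q r where "p = a * (monom 1 3 * q) + r" "degree r < degree a + 3" "monom 1 3 * q \<in> R_set"
proof
  let ?b = "a * monom 1 3"
  have b0: "?b \<noteq> 0" using assms by (simp add: monom_eq_0_iff)
  have db: "degree ?b = degree a + 3"
    using assms by (simp add: degree_mult_eq degree_monom_eq monom_eq_0_iff)
  show "p = a * (monom 1 3 * (p div ?b)) + p mod ?b"
    by (metis mult.assoc mult_div_mod_eq)
  show "degree (p mod ?b) < degree a + 3"
    using degree_mod_less'[OF b0, of p] db by (cases "p mod ?b = 0") auto
  show "monom 1 3 * (p div ?b) \<in> R_set" by (rule conductor)
qed

text \<open>Division with remainder: an ideal is generated by any nonzero element \<open>a\<close> of it together with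
  its elements of degree less than \<open>degree a + 3\<close>, a finite-dimensional space.\<close>

lemma noetherian_R: "noetherian_ring R_ring"
proof (rule R.R.noetherian_ringI)
  fix J assume J: "ideal J R_ring"
  show "\<exists>A\<subseteq>carrier R_ring. finite A \<and> J = Idl\<^bsub>R_ring\<^esub> A"
  proof (cases "J = {0}")
    case True
    have "Idl\<^bsub>R_ring\<^esub> {0} = {0}" using R.R.genideal_zero by simp
    then show ?thesis using True by (intro exI[of _ "{0}"]) (simp add: R.zero_in)
  next
    case False
    then obtain a where a: "a \<in> J" "a \<noteq> 0" using R.idealD(2)[OF J] by blast
    let ?S = "{p \<in> J. degree p < degree a + 3}"
    obtain F where F: "finite F" "F \<subseteq> ?S" "?S = P.span F"
      using finite_spanning_set[OF bounded_degree_subspace[OF ideal_subspace[OF J], of "degree a + 3"]] by auto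
    let ?A = "insert a F"
    have AJ: "?A \<subseteq> J" using a F(2) by auto
    then have AR: "?A \<subseteq> carrier R_ring" using R.idealD(1)[OF J] unfolding ring_of_simps by (rule subset_trans)
    let ?I = "Idl\<^bsub>R_ring\<^esub> ?A"
    have I: "ideal ?I R_ring" by (rule R.R.genideal_ideal[OF AR])
    have AI: "?A \<subseteq> ?I" by (rule R.R.genideal_self[OF AR])
    have "J \<subseteq> ?I"
    proof
      fix p assume p: "p \<in> J"
      obtain q r where qr: "p = a * (monom 1 3 * q) + r" "degree r < degree a + 3" "monom 1 3 * q \<in> R_set"
        using division_in_R[OF a(2)] .
      have aq: "(monom 1 3 * q) * a \<in> H" if "ideal H R_ring" "a \<in> H" for H
        using R.idealD(5)[OF that(1) qr(3) that(2)] .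
      have "r = p - (monom 1 3 * q) * a" by (simp add: qr(1) mult_ac)
      then have "r \<in> ?S" using R.idealD(6)[OF J p aq[OF J a(1)]] qr(2) by simp
      then have "r \<in> ?I"
        using P.span_minimal[OF _ ideal_subspace[OF I], of F] AI F(3) by blast
      then show "p \<in> ?I"
        using R.idealD(3)[OF I aq[OF I]] AI qr(1) by (simp add: mult_ac)
    qed
    moreover have "?I \<subseteq> J" by (rule R.R.genideal_minimal[OF J AJ])
    ultimately show ?thesis using F(1) AR by (intro exI[of _ ?A]) auto
  qed
qed

subsection \<open>The maximal ideal and the ideal \<open>I\<close>\<close>

lemma R_max_ideal_ideal: "ideal R_max_ideal R_ring"
  by (rule R.idealI) (auto simp: R_max_ideal_def R.zero_in R.add_in R.mult_in coeff_mult)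

lemma maximalideal_R_max_ideal: "maximalideal R_max_ideal R_ring"
proof (rule maximalidealI[OF R_max_ideal_ideal])
  show "carrier R_ring \<noteq> R_max_ideal"
  proof
    assume "carrier R_ring = R_max_ideal"
    then have "1 \<in> R_max_ideal" using R.one_in by simp
    then show False by (simp add: R_max_ideal_def)
  qed
  fix J assume J: "ideal J R_ring" "R_max_ideal \<subseteq> J" "J \<subseteq> carrier R_ring"
  show "J = R_max_ideal \<or> J = carrier R_ring"
  proof (cases "J \<subseteq> R_max_ideal")
    case False
    then obtain p where p: "p \<in> J" "p \<notin> R_max_ideal" by blast
    have pR: "p \<in> R_set" using p(1) J(3) by auto
    then have "coeff p 0 \<noteq> 0" using p(2) by (simp add: R_max_ideal_def)
    moreover obtain q where q: "coeff p 0 = scale_L q 1"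
      using R_setD[OF pR, of 0] by (auto simp: R_coeffs_simps(1))
    ultimately have "q \<noteq> 0" by auto
    have "monom (coeff p 0) 0 \<in> R_set" unfolding q by (rule const_in_R)
    then have "monom (coeff p 0) 0 - p \<in> R_max_ideal"
      using R.diff_in pR by (simp add: R_max_ideal_def)
    then have "monom (coeff p 0) 0 \<in> J" 
      using R.idealD(3)[OF J(1), of "monom (coeff p 0) 0 - p" p] p(1) J(2) by auto
    then have "smult (scale_L (inverse q) 1) (monom (coeff p 0) 0) \<in> J"
      by (rule ideal_smult_scale[OF J(1)])
    then have "1 \<in> J"
      using \<open>q \<noteq> 0\<close> by (simp add: q smult_monom monom_0 one_pCons flip: scale_L_one_mult)
    then have "R_set \<subseteq> J" using R.idealD(5)[OF J(1), of _ 1] by auto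
    then show ?thesis using J(3) by auto
  qed (use J in auto)
qed

lemma I_ideal_gen: "I_ideal = {r * monom 1 1 + s * monom \<alpha> 1 | r s. r \<in> R_set \<and> s \<in> R_set}"
  (is "_ = ?I")
proof
  have gens: "{monom 1 1, monom \<alpha> 1} \<subseteq> carrier R_ring"
    using monom_1_in_R[of 1] monom_alpha_in_R by simp
  have I: "ideal ?I R_ring"
  proof (rule R.idealI)
    show "?I \<subseteq> R_set" using monom_1_in_R monom_alpha_in_R by (blast intro: R.add_in R.mult_in)
    show "0 \<in> ?I" using R.zero_in by force
    fix a b assume "a \<in> ?I" "b \<in> ?I"
    then obtain r s r' s' where rs: "a = r * monom 1 1 + s * monom \<alpha> 1"
      "b = r' * monom 1 1 + s' * monom \<alpha> 1" "{r, s, r', s'} \<subseteq> R_set" by auto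
    then have "a + b = (r + r') * monom 1 1 + (s + s') * monom \<alpha> 1"
      by (simp add: algebra_simps)
    moreover have "r + r' \<in> R_set" "s + s' \<in> R_set" using rs(3) by (auto intro: R.add_in)
    ultimately show "a + b \<in> ?I" by blast
  next
    fix c a assume c: "c \<in> R_set" "a \<in> ?I"
    then obtain r s where rs: "a = r * monom 1 1 + s * monom \<alpha> 1" "r \<in> R_set" "s \<in> R_set" by auto
    then have "c * a = (c * r) * monom 1 1 + (c * s) * monom \<alpha> 1" by (simp add: algebra_simps)
    moreover have "c * r \<in> R_set" "c * s \<in> R_set" using rs c(1) by (auto intro: R.mult_in)
    ultimately show "c * a \<in> ?I" by blast
  qed
  have "monom 1 1 = 1 * monom 1 1 + 0 * monom \<alpha> 1" "monom \<alpha> 1 = 0 * monom 1 1 + 1 * monom \<alpha> 1"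
    by simp_all
  then have "{monom 1 1, monom \<alpha> 1} \<subseteq> ?I" using R.zero_in R.one_in by blast
  then show "I_ideal \<subseteq> ?I" unfolding I_ideal_def by (rule R.R.genideal_minimal[OF I])
  have J: "ideal I_ideal R_ring" unfolding I_ideal_def by (rule R.R.genideal_ideal[OF gens])
  have "{monom 1 1, monom \<alpha> 1} \<subseteq> I_ideal" unfolding I_ideal_def by (rule R.R.genideal_self[OF gens])
  then show "?I \<subseteq> I_ideal"
    using R.idealD(3,5)[OF J] by auto
qed

lemma I_ideal_ideal: "ideal I_ideal R_ring"
  unfolding I_ideal_def
  by (rule R.R.genideal_ideal) (use monom_1_in_R[of 1] monom_alpha_in_R in simp)

lemma L_upto_22_decomp: "\<exists>y z. x = y + \<alpha> * z \<and> y \<in> L_upto 22 \<and> z \<in> L_upto 22"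
  using L_upto_decomp[of x 22] L_upto_23 by (metis UNIV_I eval_nat_numeral(3) numeral_eq_Suc pred_numeral_simps(3))

lemma Vs_3_iff: "x \<in> Vs 3 \<longleftrightarrow> (\<exists>w w'. x = w + \<alpha> * w' \<and> w \<in> W \<and> w' \<in> W)"
proof
  assume "x \<in> Vs 3"
  then obtain v v' v'' where "x = v + \<alpha> * v' + \<alpha> ^ 2 * v''" "v \<in> V" "v' \<in> V" "v'' \<in> V"
    unfolding Vs_Suc_numeral by blast
  moreover from this have "x = v + \<alpha> * (v' + \<alpha> * v'')"
    by (simp add: distrib_left power2_eq_square mult.assoc add.assoc)
  moreover have "v \<in> W" "v' + \<alpha> * v'' \<in> W"
    using V_subset_W(1) calculation unfolding W_def by blast+
  ultimately show "\<exists>w w'. x = w + \<alpha> * w' \<and> w \<in> W \<and> w' \<in> W" by blast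
next
  assume "\<exists>w w'. x = w + \<alpha> * w' \<and> w \<in> W \<and> w' \<in> W"
  then obtain w w' where w: "x = w + \<alpha> * w'" "w \<in> W" "w' \<in> W" by blast
  then obtain u u' where "w' = u + \<alpha> * u'" "u \<in> V" "u' \<in> V" unfolding W_def by blast
  with w have x: "x = w + \<alpha> * (u + \<alpha> * u')" "w \<in> W" "u \<in> V" "u' \<in> V" by simp_all
  have "\<alpha> * u \<in> Vs 3" "\<alpha> ^ 2 * u' \<in> Vs 3"
    using x Vs_base[of 1 3 u] Vs_base[of 2 3 u'] by simp_all
  moreover have "w \<in> Vs 3" using x(2) Vs_mono[of 2 3] by (auto simp: W_eq)
  ultimately have "w + \<alpha> * u + \<alpha> ^ 2 * u' \<in> Vs 3"
    by (intro L.subspace_add[OF Vs_subspace])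
  then show "x \<in> Vs 3"
    by (simp add: x(1) distrib_left power2_eq_square mult.assoc add.assoc)
qed

definition I_coeffs :: "nat \<Rightarrow> L set" where
  "I_coeffs i = (if i = 0 then {0} else if i = 1 then L_upto 1 else if i = 2 then Vs 3 else UNIV)"

lemma I_coeffs_decomp:
  "x \<in> I_coeffs (Suc i) \<longleftrightarrow> (\<exists>y z. x = y + \<alpha> * z \<and> y \<in> R_coeffs i \<and> z \<in> R_coeffs i)"
proof -
  consider "i = 0" | "i = 1" | "i = 2" | "i \<ge> 3" by linarith
  then show ?thesis
  proof cases
    case 1
    have "x \<in> L_upto 1 \<longleftrightarrow> (\<exists>y z. x = y + \<alpha> * z \<and> y \<in> L_upto 0 \<and> z \<in> L_upto 0)"
    proof
      assume "x \<in> L_upto 1"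
      then show "\<exists>y z. x = y + \<alpha> * z \<and> y \<in> L_upto 0 \<and> z \<in> L_upto 0"
        using L_upto_decomp[of x 0] by (metis One_nat_def)
    next
      assume "\<exists>y z. x = y + \<alpha> * z \<and> y \<in> L_upto 0 \<and> z \<in> L_upto 0"
      then obtain y z where yz: "x = y + \<alpha> * z" "y \<in> L_upto 0" "z \<in> L_upto 0" by blast
      have "y \<in> L_upto 1" "\<alpha> * z \<in> L_upto 1"
        using yz alpha_mult_L_upto[of z 0] L_upto_mono[of 0 1] by auto
      then show "x \<in> L_upto 1"
        unfolding yz(1) by (rule L.subspace_add[OF L_upto_subspace])
    qed
    then show ?thesis using 1 by (simp add: I_coeffs_def R_coeffs_def L_upto_0)
  next
    case 2
    then show ?thesis by (simp add: I_coeffs_def R_coeffs_def Vs_3_iff)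
  next
    case 3
    then show ?thesis using L_upto_22_decomp[of x] by (simp add: I_coeffs_def R_coeffs_def)
  next
    case 4
    then have "I_coeffs (Suc i) = UNIV" "R_coeffs i = UNIV" by (simp_all add: I_coeffs_def R_coeffs_def)
    moreover have "x = x + \<alpha> * 0" by simp
    ultimately show ?thesis by blast
  qed
qed

lemma coefficientwise_combination:
  assumes "\<And>i. 0 \<in> C i"
    and "\<And>i. \<exists>y z. coeff p i = y + c * z \<and> y \<in> C i \<and> z \<in> C i"
  obtains r s where "p = r + smult c s" "\<And>i. coeff r i \<in> C i" "\<And>i. coeff s i \<in> C i"
proof -
  obtain y z where yz: "\<And>i. coeff p i = y i + c * z i" "\<And>i. y i \<in> C i" "\<And>i. z i \<in> C i"
    using assms(2) by metis
  define r where "r = (\<Sum>i\<le>degree p. monom (y i) i)"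
  define s where "s = (\<Sum>i\<le>degree p. monom (z i) i)"
  have cr: "coeff r i = (if i \<le> degree p then y i else 0)" for i
    by (simp add: r_def coeff_sum)
  have cs: "coeff s i = (if i \<le> degree p then z i else 0)" for i
    by (simp add: s_def coeff_sum)
  have "p = r + smult c s"
    by (intro poly_eqI) (simp add: cr cs flip: yz(1), simp add: coeff_eq_0)
  moreover have "coeff r i \<in> C i" "coeff s i \<in> C i" for i
    using yz(2,3) assms(1) by (auto simp: cr cs)
  ultimately show thesis by (rule that)
qed

lemma I_ideal_iff: "p \<in> I_ideal \<longleftrightarrow> (\<forall>i. coeff p i \<in> I_coeffs i)"
proof
  assume "p \<in> I_ideal"
  then obtain r s where rs: "p = r * monom 1 1 + s * monom \<alpha> 1" "r \<in> R_set" "s \<in> R_set"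
    by (auto simp: I_ideal_gen)
  show "\<forall>i. coeff p i \<in> I_coeffs i"
  proof
    fix i
    show "coeff p i \<in> I_coeffs i"
    proof (cases i)
      case 0
      then show ?thesis by (simp add: rs(1) I_coeffs_def coeff_mult)
    next
      case (Suc k)
      have "coeff p i = coeff r k + \<alpha> * coeff s k"
        unfolding rs(1) Suc
        by (simp add: mult.commute[of r] mult.commute[of s] coeff_monom_mult)
      then show ?thesis using R_setD rs(2,3) unfolding Suc I_coeffs_decomp by blast
    qed
  qed
next
  assume p: "\<forall>i. coeff p i \<in> I_coeffs i"
  then have "coeff p 0 \<in> I_coeffs 0" by blast
  then have "coeff p 0 = 0" by (simp add: I_coeffs_def)
  then obtain q where q: "p = pCons 0 q" by (cases p) auto
  have "\<exists>y z. coeff q i = y + \<alpha> * z \<and> y \<in> R_coeffs i \<and> z \<in> R_coeffs i" for i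
    using p[rule_format, of "Suc i"] unfolding q by (simp add: I_coeffs_decomp)
  then obtain r s where rs: "q = r + smult \<alpha> s" "r \<in> R_set" "s \<in> R_set"
    using coefficientwise_combination[of R_coeffs q \<alpha>] L.subspace_0[OF R_coeffs_subspace] R_setI
    by metis
  have "p = r * monom 1 1 + s * monom \<alpha> 1"
    unfolding q rs(1) by (intro poly_eqI)
      (simp add: mult.commute[of r] mult.commute[of s] coeff_monom_mult coeff_pCons split: nat.split)
  then show "p \<in> I_ideal" using rs(2,3) by (auto simp: I_ideal_gen)
qed

lemma gens_in_I: "monom 1 1 \<in> I_ideal" "monom \<alpha> 1 \<in> I_ideal"
proof -
  have "1 \<in> L_upto 1" "\<alpha> \<in> L_upto 1"
    using alpha_power_L_upto[of 0 1] alpha_power_L_upto[of 1 1] by simp_all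
  then show "monom 1 1 \<in> I_ideal" "monom \<alpha> 1 \<in> I_ideal"
    by (auto simp: I_ideal_iff I_coeffs_def L.subspace_0[OF Vs_subspace])
qed

text \<open>A generator of \<open>I\<close> would have to divide \<open>t\<close> and \<open>\<alpha> t\<close> with quotients in degree 0, that is
  rational ones.\<close>

lemma not_principal_I: "\<not> principalideal I_ideal R_ring"
proof
  assume "principalideal I_ideal R_ring"
  then obtain g where g: "g \<in> R_set" "I_ideal = Idl\<^bsub>R_ring\<^esub> {g}"
    unfolding principalideal_def principalideal_axioms_def by auto
  have gI: "g \<in> I_ideal" using R.R.genideal_self'[of g] g by simp
  have mult: "\<exists>r\<in>R_set. p = r * g" if "p \<in> I_ideal" for p
    using that g R.R.cgenideal_eq_genideal[of g] by (auto simp: cgenideal_def)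
  have g0: "coeff g 0 = 0" using gI by (auto simp: I_ideal_iff I_coeffs_def dest: spec[of _ 0])
  have "\<exists>q. c = scale_L q (coeff g 1)" if cI: "monom c 1 \<in> I_ideal" for c
  proof -
    obtain r where r: "r \<in> R_set" "monom c 1 = r * g" using mult[OF cI] by blast
    have "c = coeff (r * g) 1" by (simp flip: r(2))
    also have "\<dots> = coeff r 0 * coeff g 1" by (simp add: coeff_mult g0)
    finally have "c = coeff r 0 * coeff g 1" .
    moreover obtain q where "coeff r 0 = scale_L q 1"
      using R_setD[OF r(1), of 0] by (auto simp: R_coeffs_simps(1))
    ultimately show ?thesis by (metis scale_L_one_mult)
  qed
  from this[OF gens_in_I(1)] this[OF gens_in_I(2)] obtain q q' where
    q: "1 = scale_L q (coeff g 1)" "\<alpha> = scale_L q' (coeff g 1)" by auto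
  then have "scale_L q \<alpha> = scale_L q' 1" by (metis L.scale_left_commute)
  then have "lcoef (scale_L q (\<alpha> ^ 1)) 1 = lcoef (scale_L q' (\<alpha> ^ 0)) 1" by simp
  then have "q = 0" unfolding lcoef_scale by (subst (asm) (1 2) lcoef_alpha_power) auto
  then show False using q(1) by simp
qed

section \<open>Linear maps, free modules and \<open>Ext\<^sup>1\<close>\<close>

lemma (in abelian_group) eq_if_minus_zero:
  assumes "x \<in> carrier G" "y \<in> carrier G" "x \<ominus> y = \<zero>"
  shows "x = y"
  using minus_equality[of x "\<ominus> y"] assms by (simp add: a_minus_def)

lemma lin_mapsD:
  assumes "f \<in> lin_maps R M N"
  shows "f \<in> extensional (carrier M)"
    and "x \<in> carrier M \<Longrightarrow> f x \<in> carrier N"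
    and "x \<in> carrier M \<Longrightarrow> y \<in> carrier M \<Longrightarrow> f (x \<oplus>\<^bsub>M\<^esub> y) = f x \<oplus>\<^bsub>N\<^esub> f y"
    and "r \<in> carrier R \<Longrightarrow> x \<in> carrier M \<Longrightarrow> f (r \<odot>\<^bsub>M\<^esub> x) = r \<odot>\<^bsub>N\<^esub> f x"
  using assms by (auto simp: lin_maps_def PiE_iff)

lemma lin_mapsI:
  assumes "f \<in> extensional (carrier M)"
    and "\<And>x. x \<in> carrier M \<Longrightarrow> f x \<in> carrier N"
    and "\<And>x y. x \<in> carrier M \<Longrightarrow> y \<in> carrier M \<Longrightarrow> f (x \<oplus>\<^bsub>M\<^esub> y) = f x \<oplus>\<^bsub>N\<^esub> f y"
    and "\<And>r x. r \<in> carrier R \<Longrightarrow> x \<in> carrier M \<Longrightarrow> f (r \<odot>\<^bsub>M\<^esub> x) = r \<odot>\<^bsub>N\<^esub> f x"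
  shows "f \<in> lin_maps R M N"
  using assms by (auto simp: lin_maps_def PiE_iff)

lemma lin_map_zero:
  assumes "Module.module R M" "Module.module R N" "f \<in> lin_maps R M N"
  shows "f \<zero>\<^bsub>M\<^esub> = \<zero>\<^bsub>N\<^esub>"
proof -
  interpret M: module R M by fact
  interpret N: module R N by fact
  have "f \<zero>\<^bsub>M\<^esub> = f (\<zero>\<^bsub>R\<^esub> \<odot>\<^bsub>M\<^esub> \<zero>\<^bsub>M\<^esub>)" by simp
  also have "\<dots> = \<zero>\<^bsub>R\<^esub> \<odot>\<^bsub>N\<^esub> f \<zero>\<^bsub>M\<^esub>" by (rule lin_mapsD(4)[OF assms(3)]) auto
  also have "\<dots> = \<zero>\<^bsub>N\<^esub>" using lin_mapsD(2)[OF assms(3)] by simp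
  finally show ?thesis .
qed

lemma lin_map_neg:
  assumes "Module.module R M" "Module.module R N" "f \<in> lin_maps R M N" "x \<in> carrier M"
  shows "f (\<ominus>\<^bsub>M\<^esub> x) = \<ominus>\<^bsub>N\<^esub> f x"
proof -
  interpret M: module R M by fact
  interpret N: module R N by fact
  have "f (\<ominus>\<^bsub>M\<^esub> x) = f ((\<ominus>\<^bsub>R\<^esub> \<one>\<^bsub>R\<^esub>) \<odot>\<^bsub>M\<^esub> x)" using assms(4) by (simp add: M.smult_l_minus)
  also have "\<dots> = (\<ominus>\<^bsub>R\<^esub> \<one>\<^bsub>R\<^esub>) \<odot>\<^bsub>N\<^esub> f x" by (rule lin_mapsD(4)[OF assms(3)]) (use assms in auto)
  also have "\<dots> = \<ominus>\<^bsub>N\<^esub> f x" using lin_mapsD(2)[OF assms(3,4)] by (simp add: N.smult_l_minus)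
  finally show ?thesis .
qed

lemma lin_map_minus:
  assumes "Module.module R M" "Module.module R N" "f \<in> lin_maps R M N" "x \<in> carrier M" "y \<in> carrier M"
  shows "f (x \<ominus>\<^bsub>M\<^esub> y) = f x \<ominus>\<^bsub>N\<^esub> f y"
proof -
  interpret M: module R M by fact
  show ?thesis
    using assms lin_map_neg[OF assms(1-3,5)] by (simp add: a_minus_def lin_mapsD(3))
qed

lemma lin_map_comp:
  assumes "f \<in> lin_maps R M N" "g \<in> lin_maps R N P" "Module.module R M"
  shows "(\<lambda>x\<in>carrier M. g (f x)) \<in> lin_maps R M P"
proof -
  interpret M: module R M by fact
  show ?thesis
    by (rule lin_mapsI) (simp_all add: lin_mapsD[OF assms(1)] lin_mapsD[OF assms(2)])
qed

lemma lin_kernel_submodule: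
  assumes "Module.module R M" "Module.module R N" "f \<in> lin_maps R M N"
  shows "submodule (lin_kernel M N f) R M"
proof -
  interpret M: module R M by fact
  interpret N: module R N by fact
  show ?thesis
    by (rule M.submoduleI)
      (auto simp: lin_kernel_def lin_map_zero[OF assms] lin_map_neg[OF assms] lin_mapsD[OF assms(3)])
qed

lemma free_mod_simps [simp]:
  "\<zero>\<^bsub>free_mod R X\<^esub> = (\<lambda>x\<in>X. \<zero>\<^bsub>R\<^esub>)"
  "f \<oplus>\<^bsub>free_mod R X\<^esub> g = (\<lambda>x\<in>X. f x \<oplus>\<^bsub>R\<^esub> g x)"
  "r \<odot>\<^bsub>free_mod R X\<^esub> f = (\<lambda>x\<in>X. r \<otimes>\<^bsub>R\<^esub> f x)"
  by (simp_all add: free_mod_def)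

lemma free_mod_carrier:
  "f \<in> carrier (free_mod R X) \<longleftrightarrow> f \<in> X \<rightarrow>\<^sub>E carrier R \<and> finite {x \<in> X. f x \<noteq> \<zero>\<^bsub>R\<^esub>}"
  by (simp add: free_mod_def)

lemma free_mod_closed: "f \<in> carrier (free_mod R X) \<Longrightarrow> x \<in> X \<Longrightarrow> f x \<in> carrier R"
  by (auto simp: free_mod_carrier)

lemma free_mod_eqI:
  assumes "f \<in> carrier (free_mod R X)" "g \<in> carrier (free_mod R X)" "\<And>x. x \<in> X \<Longrightarrow> f x = g x"
  shows "f = g"
  using assms by (auto simp: free_mod_carrier intro: PiE_ext)

context cring
begin

lemma free_mod_module: "Module.module R (free_mod R X)"
proof (rule moduleI)
  let ?F = "free_mod R X"
  have add: "f \<oplus>\<^bsub>?F\<^esub> g \<in> carrier ?F" if "f \<in> carrier ?F" "g \<in> carrier ?F" for f g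
  proof -
    have "finite {x \<in> X. (\<lambda>x\<in>X. f x \<oplus> g x) x \<noteq> \<zero>}"
    proof (rule finite_subset)
      show "{x \<in> X. (\<lambda>x\<in>X. f x \<oplus> g x) x \<noteq> \<zero>} \<subseteq> {x \<in> X. f x \<noteq> \<zero>} \<union> {x \<in> X. g x \<noteq> \<zero>}"
        by auto
      show "finite ({x \<in> X. f x \<noteq> \<zero>} \<union> {x \<in> X. g x \<noteq> \<zero>})"
        using that by (simp add: free_mod_carrier)
    qed
    moreover have "(\<lambda>x\<in>X. f x \<oplus> g x) \<in> X \<rightarrow>\<^sub>E carrier R"
      using that by (auto simp: free_mod_carrier)
    ultimately show ?thesis unfolding free_mod_carrier free_mod_simps by blast
  qed
  have scl: "r \<odot>\<^bsub>?F\<^esub> f \<in> carrier ?F" if "r \<in> carrier R" "f \<in> carrier ?F" for r f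
  proof -
    have "finite {x \<in> X. (\<lambda>x\<in>X. r \<otimes> f x) x \<noteq> \<zero>}"
    proof (rule finite_subset)
      show "{x \<in> X. (\<lambda>x\<in>X. r \<otimes> f x) x \<noteq> \<zero>} \<subseteq> {x \<in> X. f x \<noteq> \<zero>}"
        using that by auto
      show "finite {x \<in> X. f x \<noteq> \<zero>}"
        using that by (simp add: free_mod_carrier)
    qed
    moreover have "(\<lambda>x\<in>X. r \<otimes> f x) \<in> X \<rightarrow>\<^sub>E carrier R"
      using that by (auto simp: free_mod_carrier)
    ultimately show ?thesis unfolding free_mod_carrier free_mod_simps by blast
  qed
  show "cring R" by (rule is_cring)
  note cl = free_mod_closed
  show "abelian_group ?F"
  proof (rule abelian_groupI)
    show zero: "\<zero>\<^bsub>?F\<^esub> \<in> carrier ?F" by (auto simp: free_mod_carrier)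
    fix x assume x: "x \<in> carrier ?F"
    then show "\<zero>\<^bsub>?F\<^esub> \<oplus>\<^bsub>?F\<^esub> x = x"
      by (intro free_mod_eqI[OF add[OF zero]]) (auto simp: cl)
    have n: "(\<ominus> \<one>) \<odot>\<^bsub>?F\<^esub> x \<in> carrier ?F" by (rule scl) (use x in auto)
    show "\<exists>y\<in>carrier ?F. y \<oplus>\<^bsub>?F\<^esub> x = \<zero>\<^bsub>?F\<^esub>"
      by (rule bexI[OF _ n], intro free_mod_eqI[OF add[OF n x] zero])
        (use x in \<open>simp_all add: cl l_minus l_neg\<close>)
    fix y assume y: "y \<in> carrier ?F"
    show "x \<oplus>\<^bsub>?F\<^esub> y \<in> carrier ?F" by (rule add[OF x y])
    show "x \<oplus>\<^bsub>?F\<^esub> y = y \<oplus>\<^bsub>?F\<^esub> x"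
      by (intro free_mod_eqI[OF add[OF x y] add[OF y x]]) (use x y in \<open>simp_all add: cl a_comm\<close>)
    fix z assume z: "z \<in> carrier ?F"
    show "x \<oplus>\<^bsub>?F\<^esub> y \<oplus>\<^bsub>?F\<^esub> z = x \<oplus>\<^bsub>?F\<^esub> (y \<oplus>\<^bsub>?F\<^esub> z)"
      by (intro free_mod_eqI[OF add[OF add[OF x y] z] add[OF x add[OF y z]]])
        (use x y z in \<open>simp_all add: cl a_assoc\<close>)
  qed
  fix a b x y assume ab: "a \<in> carrier R" "b \<in> carrier R" and x: "x \<in> carrier ?F"
  show "a \<odot>\<^bsub>?F\<^esub> x \<in> carrier ?F" by (rule scl[OF ab(1) x])
  show "(a \<oplus> b) \<odot>\<^bsub>?F\<^esub> x = a \<odot>\<^bsub>?F\<^esub> x \<oplus>\<^bsub>?F\<^esub> b \<odot>\<^bsub>?F\<^esub> x"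
    by (intro free_mod_eqI[OF scl add[OF scl scl]])
      (use ab x in \<open>simp_all add: cl l_distr\<close>)
  show "(a \<otimes> b) \<odot>\<^bsub>?F\<^esub> x = a \<odot>\<^bsub>?F\<^esub> (b \<odot>\<^bsub>?F\<^esub> x)"
    by (intro free_mod_eqI[OF scl scl[OF _ scl]])
      (use ab x in \<open>simp_all add: cl m_assoc\<close>)
  assume y: "y \<in> carrier ?F"
  show "a \<odot>\<^bsub>?F\<^esub> (x \<oplus>\<^bsub>?F\<^esub> y) = a \<odot>\<^bsub>?F\<^esub> x \<oplus>\<^bsub>?F\<^esub> a \<odot>\<^bsub>?F\<^esub> y"
    by (intro free_mod_eqI[OF scl[OF _ add] add[OF scl scl]])
      (use ab x y in \<open>simp_all add: cl r_distr\<close>)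
next
  fix x assume x: "x \<in> carrier (free_mod R X)"
  then show "\<one> \<odot>\<^bsub>free_mod R X\<^esub> x = x"
    by (auto simp: free_mod_carrier PiE_iff extensional_def restrict_def)
qed

lemma free_basis_closed: "free_basis R X x \<in> carrier (free_mod R X)"
proof -
  have "{y \<in> X. free_basis R X x y \<noteq> \<zero>} \<subseteq> {x}" by (auto simp: free_basis_def)
  then show ?thesis using finite_subset by (auto simp: free_mod_carrier free_basis_def)
qed

lemma free_mod_induct [consumes 1, case_names zero add scl basis]:
  assumes "f \<in> carrier (free_mod R X)"
    and zero: "P \<zero>\<^bsub>free_mod R X\<^esub>"
    and add: "\<And>f g. f \<in> carrier (free_mod R X) \<Longrightarrow> g \<in> carrier (free_mod R X) \<Longrightarrow> P f \<Longrightarrow> P g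
      \<Longrightarrow> P (f \<oplus>\<^bsub>free_mod R X\<^esub> g)"
    and scl: "\<And>r f. r \<in> carrier R \<Longrightarrow> f \<in> carrier (free_mod R X) \<Longrightarrow> P f \<Longrightarrow> P (r \<odot>\<^bsub>free_mod R X\<^esub> f)"
    and basis: "\<And>x. x \<in> X \<Longrightarrow> P (free_basis R X x)"
  shows "P f"
proof -
  let ?F = "free_mod R X"
  interpret F: module R ?F by (rule free_mod_module)
  have "finite S \<Longrightarrow> f \<in> carrier ?F \<Longrightarrow> S \<subseteq> X \<Longrightarrow> {x \<in> X. f x \<noteq> \<zero>} \<subseteq> S \<Longrightarrow> P f" for S f
  proof (induction S arbitrary: f rule: finite_induct)
    case empty
    then have "f = \<zero>\<^bsub>?F\<^esub>" by (intro free_mod_eqI[OF _ F.zero_closed]) auto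
    then show ?case using zero by (simp only:)
  next
    case (insert a S)
    then have a: "a \<in> X" by auto
    define g where "g = (\<lambda>x\<in>X. if x = a then \<zero> else f x)"
    have "finite {x \<in> X. g x \<noteq> \<zero>}"
    proof (rule finite_subset)
      show "{x \<in> X. g x \<noteq> \<zero>} \<subseteq> {x \<in> X. f x \<noteq> \<zero>}" by (auto simp: g_def)
      show "finite {x \<in> X. f x \<noteq> \<zero>}" using insert.prems(1) by (simp add: free_mod_carrier)
    qed
    moreover have "g \<in> X \<rightarrow>\<^sub>E carrier R"
      using insert.prems(1) by (auto simp: free_mod_carrier g_def)
    ultimately have g: "g \<in> carrier ?F" unfolding free_mod_carrier by blast
    have fa: "f a \<in> carrier R" by (rule free_mod_closed[OF insert.prems(1) a])
    have "P g" by (rule insert.IH[OF g]) (use insert.prems in \<open>auto simp: g_def\<close>)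
    moreover have "P (f a \<odot>\<^bsub>?F\<^esub> free_basis R X a)"
      by (rule scl[OF fa free_basis_closed basis[OF a]])
    ultimately have "P (g \<oplus>\<^bsub>?F\<^esub> (f a \<odot>\<^bsub>?F\<^esub> free_basis R X a))"
      by (intro add g F.smult_closed fa free_basis_closed)
    moreover have "g \<oplus>\<^bsub>?F\<^esub> (f a \<odot>\<^bsub>?F\<^esub> free_basis R X a) = f"
      by (intro free_mod_eqI[of _ R X] F.a_closed F.smult_closed g fa free_basis_closed insert.prems(1))
        (use fa free_mod_closed[OF insert.prems(1)] in \<open>auto simp: g_def free_basis_def\<close>)
    ultimately show ?case by simp
  qed
  from this[of "{x \<in> X. f x \<noteq> \<zero>}" f] assms(1) show ?thesis by (simp add: free_mod_carrier)
qed

lemma lin_maps_free_eqI: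
  assumes "Module.module R M" "f \<in> lin_maps R (free_mod R X) M" "g \<in> lin_maps R (free_mod R X) M"
    and "\<And>x. x \<in> X \<Longrightarrow> f (free_basis R X x) = g (free_basis R X x)"
    and "u \<in> carrier (free_mod R X)"
  shows "f u = g u"
  using assms(5)
proof (induction rule: free_mod_induct)
  case zero
  then show ?case
    using lin_map_zero[OF free_mod_module assms(1)] assms(2,3) by metis
next
  case (add f' g')
  then show ?case using lin_mapsD(3)[OF assms(2)] lin_mapsD(3)[OF assms(3)] by metis
next
  case (scl r f')
  then show ?case using lin_mapsD(4)[OF assms(2)] lin_mapsD(4)[OF assms(3)] by metis
qed (rule assms(4))

lemma lin_extension_eq:
  assumes M: "Module.module R M" and h: "h \<in> X \<rightarrow> carrier M" and f: "f \<in> carrier (free_mod R X)"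
    and S: "finite S" "S \<subseteq> X" "{x \<in> X. f x \<noteq> \<zero>} \<subseteq> S"
  shows "lin_extension R M X h f = finsum M (\<lambda>x. f x \<odot>\<^bsub>M\<^esub> h x) S"
proof -
  interpret M: module R M by fact
  have "finsum M (\<lambda>x. f x \<odot>\<^bsub>M\<^esub> h x) {x \<in> X. f x \<noteq> \<zero>} = finsum M (\<lambda>x. f x \<odot>\<^bsub>M\<^esub> h x) S"
  proof (rule M.add.finprod_mono_neutral_cong_left[OF S(1,3)])
    show "(\<lambda>x. f x \<odot>\<^bsub>M\<^esub> h x) \<in> S \<rightarrow> carrier M"
      using S(2) Pi_mem[OF h] free_mod_closed[OF f] by (auto intro!: M.smult_closed)
    fix i assume "i \<in> S - {x \<in> X. f x \<noteq> \<zero>}"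
    then have "f i = \<zero>" "h i \<in> carrier M" using S h by auto
    then show "f i \<odot>\<^bsub>M\<^esub> h i = \<zero>\<^bsub>M\<^esub>" by simp
  qed simp
  then show ?thesis using f by (simp add: lin_extension_def)
qed

lemma lin_extension_linear:
  assumes M: "Module.module R M" and h: "h \<in> X \<rightarrow> carrier M"
  shows "lin_extension R M X h \<in> lin_maps R (free_mod R X) M"
proof -
  let ?F = "free_mod R X" and ?l = "lin_extension R M X h"
  interpret M: module R M by fact
  interpret F: module R ?F by (rule free_mod_module)
  have cl: "f x \<odot>\<^bsub>M\<^esub> h x \<in> carrier M" if "f \<in> carrier ?F" "x \<in> X" for f x
    by (rule M.smult_closed[OF free_mod_closed[OF that] Pi_mem[OF h that(2)]])
  show ?thesis
  proof (rule lin_mapsI)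
    show "?l \<in> extensional (carrier ?F)" by (simp add: lin_extension_def)
    fix f assume f: "f \<in> carrier ?F"
    let ?S = "{x \<in> X. f x \<noteq> \<zero>}"
    have S: "finite ?S" using f by (simp add: free_mod_carrier)
    show "?l f \<in> carrier M"
      using f by (auto simp: lin_extension_def intro!: M.finsum_closed cl)
    {
    fix r assume r: "r \<in> carrier R"
    have sub: "{x \<in> X. (r \<odot>\<^bsub>?F\<^esub> f) x \<noteq> \<zero>} \<subseteq> ?S" using r by auto
    have "?l (r \<odot>\<^bsub>?F\<^esub> f) = finsum M (\<lambda>x. (r \<odot>\<^bsub>?F\<^esub> f) x \<odot>\<^bsub>M\<^esub> h x) ?S"
      by (rule lin_extension_eq[OF M h F.smult_closed[OF r f] S _ sub]) auto
    also have "\<dots> = finsum M (\<lambda>x. r \<odot>\<^bsub>M\<^esub> (f x \<odot>\<^bsub>M\<^esub> h x)) ?S"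
      using r h free_mod_closed[OF f]
      by (intro M.finsum_cong') (auto simp: M.smult_assoc1 Pi_iff)
    also have "\<dots> = r \<odot>\<^bsub>M\<^esub> finsum M (\<lambda>x. f x \<odot>\<^bsub>M\<^esub> h x) ?S"
      by (rule M.finsum_smult_ldistr[OF S r, symmetric]) (use cl[OF f] in auto)
    also have "\<dots> = r \<odot>\<^bsub>M\<^esub> ?l f" using f by (simp add: lin_extension_def)
    finally show "?l (r \<odot>\<^bsub>?F\<^esub> f) = r \<odot>\<^bsub>M\<^esub> ?l f" .
    }
    fix g assume g: "g \<in> carrier ?F"
    let ?T = "?S \<union> {x \<in> X. g x \<noteq> \<zero>}"
    have T: "finite ?T" using f g by (simp add: free_mod_carrier)
    have e: "?l u = finsum M (\<lambda>x. u x \<odot>\<^bsub>M\<^esub> h x) ?T"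
      if "u \<in> carrier ?F" "{x \<in> X. u x \<noteq> \<zero>} \<subseteq> ?T" for u
      by (rule lin_extension_eq[OF M h that(1) T _ that(2)]) auto
    have "?l (f \<oplus>\<^bsub>?F\<^esub> g) = finsum M (\<lambda>x. (f \<oplus>\<^bsub>?F\<^esub> g) x \<odot>\<^bsub>M\<^esub> h x) ?T"
      by (rule e[OF F.a_closed[OF f g]]) auto
    also have "\<dots> = finsum M (\<lambda>x. f x \<odot>\<^bsub>M\<^esub> h x \<oplus>\<^bsub>M\<^esub> g x \<odot>\<^bsub>M\<^esub> h x) ?T"
      using h free_mod_closed[OF f] free_mod_closed[OF g]
      by (intro M.finsum_cong') (auto simp: M.smult_l_distr Pi_iff)
    also have "\<dots> = finsum M (\<lambda>x. f x \<odot>\<^bsub>M\<^esub> h x) ?T \<oplus>\<^bsub>M\<^esub> finsum M (\<lambda>x. g x \<odot>\<^bsub>M\<^esub> h x) ?T"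
      by (rule M.finsum_addf) (use cl f g in auto)
    also have "\<dots> = ?l f \<oplus>\<^bsub>M\<^esub> ?l g" using e[OF f] e[OF g] by simp
    finally show "?l (f \<oplus>\<^bsub>?F\<^esub> g) = ?l f \<oplus>\<^bsub>M\<^esub> ?l g" .
  qed
qed

lemma lin_extension_basis:
  assumes M: "Module.module R M" and h: "h \<in> X \<rightarrow> carrier M" and x: "x \<in> X"
  shows "lin_extension R M X h (free_basis R X x) = h x"
proof -
  interpret M: module R M by fact
  have hx: "h x \<in> carrier M" using h x by auto
  have "lin_extension R M X h (free_basis R X x)
      = finsum M (\<lambda>y. free_basis R X x y \<odot>\<^bsub>M\<^esub> h y) {x}"
    by (rule lin_extension_eq[OF M h free_basis_closed]) (use x in \<open>auto simp: free_basis_def\<close>)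
  also have "\<dots> = h x" using x hx by (simp add: free_basis_def)
  finally show ?thesis .
qed

lemma cover_map_linear: "Module.module R M \<Longrightarrow> cover_map R M \<in> lin_maps R (free_cover R M) M"
  unfolding cover_map_def by (rule lin_extension_linear) auto

lemma cover_map_basis:
  "Module.module R M \<Longrightarrow> x \<in> carrier M \<Longrightarrow> cover_map R M (free_basis R (carrier M) x) = x"
  unfolding cover_map_def by (rule lin_extension_basis) auto

lemma syzygy_carrier:
  "carrier (syzygy R M) = {u \<in> carrier (free_cover R M). cover_map R M u = \<zero>\<^bsub>M\<^esub>}"
  by (simp add: syzygy_def sub_mod_def lin_kernel_def)

lemma syzygy_simps [simp]:
  "\<zero>\<^bsub>syzygy R M\<^esub> = \<zero>\<^bsub>free_cover R M\<^esub>" "add (syzygy R M) = add (free_cover R M)"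
  "Module.smult (syzygy R M) = Module.smult (free_cover R M)"
  by (simp_all add: syzygy_def sub_mod_def)

lemma syzygy_module: "Module.module R M \<Longrightarrow> Module.module R (syzygy R M)"
  unfolding syzygy_def sub_mod_def
  by (intro submodule.submodule_is_module lin_kernel_submodule[where R = R] free_mod_module cover_map_linear)

end

text \<open>A cocycle on the free cover of the first syzygy descends to a linear map on that syzygy. If
  all such maps extend to the free cover of \<open>M\<close>, then every cocycle is a coboundary.\<close>

lemma (in cring) Ext1_trivialI:
  assumes M: "Module.module R M" and N: "Module.module R N"
    and extension: "\<And>f. f \<in> lin_maps R (syzygy R M) N \<Longrightarrow>
      \<exists>g\<in>lin_maps R (free_cover R M) N. \<forall>z\<in>carrier (syzygy R M). g z = f z"
  shows "carrier (Ext1 R M N) = {\<zero>\<^bsub>Ext1 R M N\<^esub>}"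
proof -
  let ?F = "free_cover R M" and ?Z = "syzygy R M"
  let ?FZ = "free_cover R ?Z" and ?H = "Hom_mod R (free_cover R (syzygy R M)) N"
  let ?B = "Ext1_coboundaries R M N" and ?C = "Ext1_cocycles R M N"
  interpret M: module R M by fact
  interpret N: module R N by fact
  have Zm: "Module.module R ?Z" by (rule syzygy_module[OF M])
  interpret Z: module R ?Z by (rule Zm)
  interpret FZ: module R ?FZ by (rule free_mod_module)
  have Fm: "Module.module R ?F" and FZm: "Module.module R ?FZ" by (rule free_mod_module)+
  have cZ: "cover_map R ?Z \<in> lin_maps R ?FZ ?Z" by (rule cover_map_linear[OF Zm])
  have ZF: "z \<in> carrier ?F" if "z \<in> carrier ?Z" for z using that by (simp add: syzygy_carrier)
  let ?e = "free_basis R (carrier ?Z)"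
  have CB: "\<phi> \<in> ?B" if "\<phi> \<in> ?C" for \<phi>
  proof -
    have \<phi>: "\<phi> \<in> lin_maps R ?FZ N"
      and \<phi>0: "\<And>z. z \<in> carrier (free_cover R (syzygy R ?Z)) \<Longrightarrow> \<phi> (cover_map R (syzygy R ?Z) z) = \<zero>\<^bsub>N\<^esub>"
      using that by (auto simp: Ext1_cocycles_def)
    have ker: "\<phi> u = \<phi> u'" if u: "u \<in> carrier ?FZ" "u' \<in> carrier ?FZ"
      "cover_map R ?Z u = cover_map R ?Z u'" for u u'
    proof -
      let ?w = "u \<ominus>\<^bsub>?FZ\<^esub> u'"
      have "cover_map R ?Z ?w = cover_map R ?Z u \<ominus>\<^bsub>?Z\<^esub> cover_map R ?Z u'"
        by (rule lin_map_minus[OF FZm Zm cZ u(1,2)])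
      also have "\<dots> = \<zero>\<^bsub>?Z\<^esub>"
        using lin_mapsD(2)[OF cZ u(2)] u(3) Z.r_neg by (simp add: a_minus_def)
      finally have w: "?w \<in> carrier (syzygy R ?Z)"
        using FZ.minus_closed[OF u(1,2)] by (simp add: syzygy_carrier[of ?Z])
      have "\<phi> ?w = \<zero>\<^bsub>N\<^esub>"
        using \<phi>0[OF free_basis_closed[of _ ?w]] cover_map_basis[OF syzygy_module[OF Zm] w] by simp
      moreover have "\<phi> ?w = \<phi> u \<ominus>\<^bsub>N\<^esub> \<phi> u'" by (rule lin_map_minus[OF FZm N \<phi> u(1,2)])
      ultimately show ?thesis
        using lin_mapsD(2)[OF \<phi> u(1)] lin_mapsD(2)[OF \<phi> u(2)] by (metis N.eq_if_minus_zero)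
    qed
    define f where "f = (\<lambda>z\<in>carrier ?Z. \<phi> (?e z))"
    have e: "?e z \<in> carrier ?FZ" for z by (rule free_basis_closed)
    have ce: "cover_map R ?Z (?e z) = z" if "z \<in> carrier ?Z" for z
      by (rule cover_map_basis[OF Zm that])
    have f: "f \<in> lin_maps R ?Z N"
    proof (rule lin_mapsI)
      show "f \<in> extensional (carrier ?Z)" by (simp add: f_def)
      fix x assume x: "x \<in> carrier ?Z"
      then show "f x \<in> carrier N" using lin_mapsD(2)[OF \<phi> e] by (simp add: f_def)
      {
        fix y assume y: "y \<in> carrier ?Z"
        have "\<phi> (?e (x \<oplus>\<^bsub>?Z\<^esub> y)) = \<phi> (?e x \<oplus>\<^bsub>?FZ\<^esub> ?e y)"
        proof (rule ker[OF e FZ.a_closed[OF e e]])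
          show "cover_map R ?Z (?e (x \<oplus>\<^bsub>?Z\<^esub> y)) = cover_map R ?Z (?e x \<oplus>\<^bsub>?FZ\<^esub> ?e y)"
            using ce[OF Z.a_closed[OF x y]] ce[OF x] ce[OF y] lin_mapsD(3)[OF cZ e e] by metis
        qed
        then show "f (x \<oplus>\<^bsub>?Z\<^esub> y) = f x \<oplus>\<^bsub>N\<^esub> f y"
          using Z.a_closed[OF x y] x y lin_mapsD(3)[OF \<phi> e e] by (simp add: f_def)
      }
      fix r assume r: "r \<in> carrier R"
      have "\<phi> (?e (r \<odot>\<^bsub>?Z\<^esub> x)) = \<phi> (r \<odot>\<^bsub>?FZ\<^esub> ?e x)"
      proof (rule ker[OF e FZ.smult_closed[OF r e]])
        show "cover_map R ?Z (?e (r \<odot>\<^bsub>?Z\<^esub> x)) = cover_map R ?Z (r \<odot>\<^bsub>?FZ\<^esub> ?e x)"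
          using ce[OF Z.smult_closed[OF r x]] ce[OF x] lin_mapsD(4)[OF cZ r e] by metis
      qed
      then show "f (r \<odot>\<^bsub>?Z\<^esub> x) = r \<odot>\<^bsub>N\<^esub> f x"
        using Z.smult_closed[OF r x] x lin_mapsD(4)[OF \<phi> r e] by (simp add: f_def)
    qed
    obtain g where g: "g \<in> lin_maps R ?F N" "\<And>z. z \<in> carrier ?Z \<Longrightarrow> g z = f z"
      using extension[OF f] by blast
    let ?d = "\<lambda>z\<in>carrier ?FZ. f (cover_map R ?Z z)"
    have d: "?d \<in> lin_maps R ?FZ N" by (rule lin_map_comp[OF cZ f FZm])
    have "\<phi> u = ?d u" if "u \<in> carrier ?FZ" for u
      by (rule lin_maps_free_eqI[OF N \<phi> d _ that]) (simp add: free_basis_closed ce f_def)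
    then have "\<phi> = (\<lambda>z\<in>carrier ?FZ. g (cover_map R ?Z z))"
      using lin_mapsD(1)[OF \<phi>] g(2)[OF lin_mapsD(2)[OF cZ]] by (auto simp: extensional_def)
    with g(1) show ?thesis by (auto simp: Ext1_coboundaries_def)
  qed
  have closed: "b \<oplus>\<^bsub>?H\<^esub> c \<in> ?B" if "b \<in> ?B" "c \<in> ?B" for b c
  proof -
    obtain \<psi> \<chi> where p: "\<psi> \<in> lin_maps R ?F N" "\<chi> \<in> lin_maps R ?F N"
      "b = (\<lambda>z\<in>carrier ?FZ. \<psi> (cover_map R ?Z z))" "c = (\<lambda>z\<in>carrier ?FZ. \<chi> (cover_map R ?Z z))"
      using \<open>b \<in> ?B\<close> \<open>c \<in> ?B\<close> by (auto simp: Ext1_coboundaries_def)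
    interpret F: module R ?F by (rule Fm)
    let ?s = "\<lambda>z\<in>carrier ?F. \<psi> z \<oplus>\<^bsub>N\<^esub> \<chi> z"
    have s: "?s \<in> lin_maps R ?F N"
    proof (rule lin_mapsI)
      fix x y assume "x \<in> carrier ?F" "y \<in> carrier ?F"
      then show "?s (x \<oplus>\<^bsub>?F\<^esub> y) = ?s x \<oplus>\<^bsub>N\<^esub> ?s y"
        using F.a_closed[of x y]
        by (simp del: free_mod_simps add: lin_mapsD[OF p(1)] lin_mapsD[OF p(2)] N.a_ac)
    next
      fix r x assume "r \<in> carrier R" "x \<in> carrier ?F"
      then show "?s (r \<odot>\<^bsub>?F\<^esub> x) = r \<odot>\<^bsub>N\<^esub> ?s x"
        using F.smult_closed[of r x]
        by (simp del: free_mod_simps add: lin_mapsD[OF p(1)] lin_mapsD[OF p(2)] N.smult_r_distr)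
    qed (simp_all add: lin_mapsD[OF p(1)] lin_mapsD[OF p(2)])
    have "b \<oplus>\<^bsub>?H\<^esub> c = (\<lambda>z\<in>carrier ?FZ. ?s (cover_map R ?Z z))"
      using ZF[OF lin_mapsD(2)[OF cZ]] by (auto simp: Hom_mod_def p(3,4) intro!: restrict_ext)
    then show ?thesis unfolding Ext1_coboundaries_def by (rule image_eqI[OF _ s])
  qed
  have inverse: "\<exists>c\<in>?B. c \<oplus>\<^bsub>?H\<^esub> b = a" if "a \<in> ?B" "b \<in> ?B" for a b
  proof -
    obtain \<psi> where p: "\<psi> \<in> lin_maps R ?F N" "b = (\<lambda>z\<in>carrier ?FZ. \<psi> (cover_map R ?Z z))"
      using \<open>b \<in> ?B\<close> by (auto simp: Ext1_coboundaries_def)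
    interpret F: module R ?F by (rule Fm)
    let ?s = "\<lambda>z\<in>carrier ?F. \<ominus>\<^bsub>N\<^esub> \<psi> z"
    have s: "?s \<in> lin_maps R ?F N"
    proof (rule lin_mapsI)
      fix x y assume "x \<in> carrier ?F" "y \<in> carrier ?F"
      then show "?s (x \<oplus>\<^bsub>?F\<^esub> y) = ?s x \<oplus>\<^bsub>N\<^esub> ?s y"
        using F.a_closed[of x y] by (simp del: free_mod_simps add: lin_mapsD[OF p(1)] N.minus_add)
    next
      fix r x assume "r \<in> carrier R" "x \<in> carrier ?F"
      then show "?s (r \<odot>\<^bsub>?F\<^esub> x) = r \<odot>\<^bsub>N\<^esub> ?s x"
        using F.smult_closed[of r x] by (simp del: free_mod_simps add: lin_mapsD[OF p(1)] N.smult_r_minus)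
    qed (simp_all add: lin_mapsD[OF p(1)])
    let ?nb = "\<lambda>z\<in>carrier ?FZ. ?s (cover_map R ?Z z)"
    have nb: "?nb \<in> ?B" unfolding Ext1_coboundaries_def by (rule image_eqI[OF refl s])
    have aN: "a z \<in> carrier N" if "z \<in> carrier ?FZ" for z
      using \<open>a \<in> ?B\<close> that lin_mapsD(2) ZF[OF lin_mapsD(2)[OF cZ]] by (fastforce simp: Ext1_coboundaries_def)
    have "(a \<oplus>\<^bsub>?H\<^esub> ?nb) \<oplus>\<^bsub>?H\<^esub> b = a"
    proof (rule HOL.ext)
      fix z
      show "((a \<oplus>\<^bsub>?H\<^esub> ?nb) \<oplus>\<^bsub>?H\<^esub> b) z = a z"
        using aN[of z] ZF[OF lin_mapsD(2)[OF cZ], of z] lin_mapsD(2)[OF p(1)] \<open>a \<in> ?B\<close>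
        by (auto simp: Hom_mod_def p(2) N.a_assoc N.l_neg Ext1_coboundaries_def)
    qed
    then show ?thesis using closed[OF \<open>a \<in> ?B\<close> nb] by blast
  qed
  have zeroC: "(\<lambda>z\<in>carrier ?FZ. \<zero>\<^bsub>N\<^esub>) \<in> ?C"
  proof -
    have "cover_map R (syzygy R ?Z) z \<in> carrier ?FZ" if "z \<in> carrier (free_cover R (syzygy R ?Z))" for z
      using lin_mapsD(2)[OF cover_map_linear[OF syzygy_module[OF Zm]] that] by (simp add: syzygy_carrier)
    moreover have "(\<lambda>z\<in>carrier ?FZ. \<zero>\<^bsub>N\<^esub>) \<in> lin_maps R ?FZ N"
      by (rule lin_mapsI) (simp_all del: free_mod_simps)
    ultimately show ?thesis by (simp add: Ext1_cocycles_def)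
  qed
  let ?S = "sub_mod ?H ?C"
  have coset: "?B +>\<^bsub>?S\<^esub> \<phi> = ?B" if "\<phi> \<in> ?C" for \<phi>
  proof -
    have eq: "?B +>\<^bsub>?S\<^esub> \<phi> = {b \<oplus>\<^bsub>?H\<^esub> \<phi> | b. b \<in> ?B}"
      by (auto simp: a_r_coset_def' sub_mod_def)
    show ?thesis unfolding eq using closed[OF _ CB[OF that]] inverse[OF _ CB[OF that]] by blast
  qed
  have "carrier (Ext1 R M N) = (\<lambda>\<phi>. ?B +>\<^bsub>?S\<^esub> \<phi>) ` ?C"
    by (auto simp: Ext1_def quot_mod_def A_RCOSETS_def' sub_mod_def)
  also have "\<dots> = {?B}" using coset zeroC by auto
  finally show ?thesis by (simp add: Ext1_def quot_mod_def)
qed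

section \<open>Cosets and tensor products\<close>

definition mod_cong :: "('r, 'm, 'c) module_scheme \<Rightarrow> 'm set \<Rightarrow> 'm \<Rightarrow> 'm \<Rightarrow> bool" where
  "mod_cong M H u v \<longleftrightarrow> u \<in> carrier M \<and> v \<in> carrier M \<and> u \<ominus>\<^bsub>M\<^esub> v \<in> H"

locale module_with_submodule = module R M + H: submodule H R M
  for R (structure) and M (structure) and H
begin

lemma H_closed:
  "h \<in> H \<Longrightarrow> h \<in> carrier M" "\<zero>\<^bsub>M\<^esub> \<in> H"
  "h \<in> H \<Longrightarrow> h' \<in> H \<Longrightarrow> h \<oplus>\<^bsub>M\<^esub> h' \<in> H" "h \<in> H \<Longrightarrow> \<ominus>\<^bsub>M\<^esub> h \<in> H"
  "r \<in> carrier R \<Longrightarrow> h \<in> H \<Longrightarrow> r \<odot>\<^bsub>M\<^esub> h \<in> H"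
  using submoduleE[OF H.submodule_axioms] H.one_closed by auto

lemma cong_refl: "u \<in> carrier M \<Longrightarrow> mod_cong M H u u"
  using H_closed(2) by (simp add: mod_cong_def a_minus_def r_neg)

lemma cong_sym: "mod_cong M H u v \<Longrightarrow> mod_cong M H v u"
  unfolding mod_cong_def
proof (elim conjE, intro conjI)
  assume c: "u \<in> carrier M" "v \<in> carrier M" "u \<ominus>\<^bsub>M\<^esub> v \<in> H"
  have "v \<ominus>\<^bsub>M\<^esub> u = \<ominus>\<^bsub>M\<^esub> (u \<ominus>\<^bsub>M\<^esub> v)"
    using c(1,2) by (simp add: a_minus_def minus_add a_comm)
  then show "v \<ominus>\<^bsub>M\<^esub> u \<in> H" using H_closed(4)[OF c(3)] by simp
qed

lemma cong_add:
  "mod_cong M H u v \<Longrightarrow> mod_cong M H u' v' \<Longrightarrow> mod_cong M H (u \<oplus>\<^bsub>M\<^esub> u') (v \<oplus>\<^bsub>M\<^esub> v')"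
  unfolding mod_cong_def
proof (elim conjE, intro conjI)
  assume c: "u \<in> carrier M" "v \<in> carrier M" "u \<ominus>\<^bsub>M\<^esub> v \<in> H"
    "u' \<in> carrier M" "v' \<in> carrier M" "u' \<ominus>\<^bsub>M\<^esub> v' \<in> H"
  have "(u \<oplus>\<^bsub>M\<^esub> u') \<ominus>\<^bsub>M\<^esub> (v \<oplus>\<^bsub>M\<^esub> v') = (u \<ominus>\<^bsub>M\<^esub> v) \<oplus>\<^bsub>M\<^esub> (u' \<ominus>\<^bsub>M\<^esub> v')"
    using c(1,2,4,5) by (simp add: a_minus_def minus_add M.a_ac)
  then show "(u \<oplus>\<^bsub>M\<^esub> u') \<ominus>\<^bsub>M\<^esub> (v \<oplus>\<^bsub>M\<^esub> v') \<in> H" using H_closed(3)[OF c(3,6)] by simp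
qed simp_all

lemma cong_smult:
  "r \<in> carrier R \<Longrightarrow> mod_cong M H u v \<Longrightarrow> mod_cong M H (r \<odot>\<^bsub>M\<^esub> u) (r \<odot>\<^bsub>M\<^esub> v)"
  unfolding mod_cong_def
proof (elim conjE, intro conjI)
  assume c: "r \<in> carrier R" "u \<in> carrier M" "v \<in> carrier M" "u \<ominus>\<^bsub>M\<^esub> v \<in> H"
  have "r \<odot>\<^bsub>M\<^esub> u \<ominus>\<^bsub>M\<^esub> r \<odot>\<^bsub>M\<^esub> v = r \<odot>\<^bsub>M\<^esub> (u \<ominus>\<^bsub>M\<^esub> v)"
    using c(1,2,3) by (simp add: a_minus_def smult_r_distr smult_r_minus)
  then show "r \<odot>\<^bsub>M\<^esub> u \<ominus>\<^bsub>M\<^esub> r \<odot>\<^bsub>M\<^esub> v \<in> H" using H_closed(5)[OF c(1,4)] by simp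
qed simp_all

lemma cong_trans: "mod_cong M H u v \<Longrightarrow> mod_cong M H v w \<Longrightarrow> mod_cong M H u w"
  unfolding mod_cong_def
proof (elim conjE, intro conjI)
  assume c: "u \<in> carrier M" "v \<in> carrier M" "w \<in> carrier M" "u \<ominus>\<^bsub>M\<^esub> v \<in> H" "v \<ominus>\<^bsub>M\<^esub> w \<in> H"
  have "(u \<ominus>\<^bsub>M\<^esub> v) \<oplus>\<^bsub>M\<^esub> (v \<ominus>\<^bsub>M\<^esub> w) = u \<oplus>\<^bsub>M\<^esub> ((\<ominus>\<^bsub>M\<^esub> v \<oplus>\<^bsub>M\<^esub> v) \<oplus>\<^bsub>M\<^esub> \<ominus>\<^bsub>M\<^esub> w)"
    using c(1-3) by (simp add: a_minus_def M.a_assoc)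
  also have "\<dots> = u \<ominus>\<^bsub>M\<^esub> w" using c(1-3) by (simp add: a_minus_def l_neg)
  finally show "u \<ominus>\<^bsub>M\<^esub> w \<in> H" using H_closed(3)[OF c(4,5)] by simp
qed

lemma coset_def: "H +>\<^bsub>M\<^esub> u = {h \<oplus>\<^bsub>M\<^esub> u | h. h \<in> H}"
  by (auto simp: a_r_coset_def')

lemma coset_iff:
  assumes "u \<in> carrier M"
  shows "v \<in> H +>\<^bsub>M\<^esub> u \<longleftrightarrow> mod_cong M H v u"
proof
  assume "v \<in> H +>\<^bsub>M\<^esub> u"
  then obtain h where h: "h \<in> H" "v = h \<oplus>\<^bsub>M\<^esub> u" by (auto simp: coset_def)
  then have "v \<ominus>\<^bsub>M\<^esub> u = h"
    using assms H_closed(1) by (simp add: a_minus_def M.a_assoc r_neg)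
  then show "mod_cong M H v u" using h assms H_closed(1) by (simp add: mod_cong_def)
next
  assume c: "mod_cong M H v u"
  then have "v = (v \<ominus>\<^bsub>M\<^esub> u) \<oplus>\<^bsub>M\<^esub> u"
    by (simp add: mod_cong_def a_minus_def M.a_assoc l_neg)
  with c show "v \<in> H +>\<^bsub>M\<^esub> u" by (auto simp: coset_def mod_cong_def)
qed

lemma coset_eq_iff:
  assumes "u \<in> carrier M" "v \<in> carrier M"
  shows "H +>\<^bsub>M\<^esub> u = H +>\<^bsub>M\<^esub> v \<longleftrightarrow> mod_cong M H u v"
proof
  assume "H +>\<^bsub>M\<^esub> u = H +>\<^bsub>M\<^esub> v"
  moreover have "u \<in> H +>\<^bsub>M\<^esub> u" using coset_iff[OF assms(1)] cong_refl[OF assms(1)] by simp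
  ultimately show "mod_cong M H u v" using coset_iff[OF assms(2)] by simp
next
  assume uv: "mod_cong M H u v"
  show "H +>\<^bsub>M\<^esub> u = H +>\<^bsub>M\<^esub> v"
  proof (rule Set.set_eqI)
    fix w
    have "mod_cong M H w u \<longleftrightarrow> mod_cong M H w v"
      using cong_trans[OF _ uv, of w] cong_trans[OF _ cong_sym[OF uv], of w] by (rule iffI)
    then show "w \<in> H +>\<^bsub>M\<^esub> u \<longleftrightarrow> w \<in> H +>\<^bsub>M\<^esub> v"
      by (simp add: coset_iff assms)
  qed
qed

lemma quot_carrier: "carrier (quot_mod M H) = {H +>\<^bsub>M\<^esub> u | u. u \<in> carrier M}"
  by (auto simp: quot_mod_def A_RCOSETS_def')

lemma quot_add:
  assumes "u \<in> carrier M" "v \<in> carrier M"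
  shows "(H +>\<^bsub>M\<^esub> u) \<oplus>\<^bsub>quot_mod M H\<^esub> (H +>\<^bsub>M\<^esub> v) = H +>\<^bsub>M\<^esub> (u \<oplus>\<^bsub>M\<^esub> v)"
proof -
  have eq: "(H +>\<^bsub>M\<^esub> u) \<oplus>\<^bsub>quot_mod M H\<^esub> (H +>\<^bsub>M\<^esub> v)
      = (\<Union>a\<in>H +>\<^bsub>M\<^esub> u. \<Union>b\<in>H +>\<^bsub>M\<^esub> v. {a \<oplus>\<^bsub>M\<^esub> b})"
    by (simp add: quot_mod_def set_add_def')
  show ?thesis
    unfolding eq
  proof (intro equalityI subsetI)
    fix w assume "w \<in> (\<Union>a\<in>H +>\<^bsub>M\<^esub> u. \<Union>b\<in>H +>\<^bsub>M\<^esub> v. {a \<oplus>\<^bsub>M\<^esub> b})"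
    then obtain a b where "mod_cong M H a u" "mod_cong M H b v" and w: "w = a \<oplus>\<^bsub>M\<^esub> b"
      using coset_iff assms by auto
    then have "mod_cong M H w (u \<oplus>\<^bsub>M\<^esub> v)" unfolding w by (intro cong_add)
    then show "w \<in> H +>\<^bsub>M\<^esub> (u \<oplus>\<^bsub>M\<^esub> v)" using coset_iff[of "u \<oplus>\<^bsub>M\<^esub> v" w] assms by simp
  next
    fix w assume "w \<in> H +>\<^bsub>M\<^esub> (u \<oplus>\<^bsub>M\<^esub> v)"
    then obtain h where h: "h \<in> H" "w = h \<oplus>\<^bsub>M\<^esub> (u \<oplus>\<^bsub>M\<^esub> v)" unfolding coset_def by blast
    have "w = (h \<oplus>\<^bsub>M\<^esub> u) \<oplus>\<^bsub>M\<^esub> v" using h assms H_closed(1)[OF h(1)] by (simp add: M.a_assoc)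
    moreover have "h \<oplus>\<^bsub>M\<^esub> u \<in> H +>\<^bsub>M\<^esub> u" unfolding coset_def using h(1) by blast
    moreover have "v \<in> H +>\<^bsub>M\<^esub> v" using coset_iff[of v v] cong_refl assms by simp
    ultimately show "w \<in> (\<Union>a\<in>H +>\<^bsub>M\<^esub> u. \<Union>b\<in>H +>\<^bsub>M\<^esub> v. {a \<oplus>\<^bsub>M\<^esub> b})" by blast
  qed
qed

lemma quot_smult:
  assumes "r \<in> carrier R" "u \<in> carrier M"
  shows "r \<odot>\<^bsub>quot_mod M H\<^esub> (H +>\<^bsub>M\<^esub> u) = H +>\<^bsub>M\<^esub> (r \<odot>\<^bsub>M\<^esub> u)"
proof -
  have c: "H +>\<^bsub>M\<^esub> (r \<odot>\<^bsub>M\<^esub> x) = H +>\<^bsub>M\<^esub> (r \<odot>\<^bsub>M\<^esub> u)" if "x \<in> H +>\<^bsub>M\<^esub> u" for x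
  proof -
    have x: "mod_cong M H x u" using that coset_iff[OF assms(2)] by simp
    then have "x \<in> carrier M" by (simp add: mod_cong_def)
    then show ?thesis
      using coset_eq_iff[of "r \<odot>\<^bsub>M\<^esub> x" "r \<odot>\<^bsub>M\<^esub> u"] cong_smult[OF assms(1) x] assms by simp
  qed
  have "u \<in> H +>\<^bsub>M\<^esub> u" using coset_iff[OF assms(2)] cong_refl[OF assms(2)] by simp
  then have ne: "H +>\<^bsub>M\<^esub> u \<noteq> {}" by blast
  have "r \<odot>\<^bsub>quot_mod M H\<^esub> (H +>\<^bsub>M\<^esub> u) = (\<Union>x\<in>H +>\<^bsub>M\<^esub> u. H +>\<^bsub>M\<^esub> (r \<odot>\<^bsub>M\<^esub> x))"
    by (simp add: quot_mod_def)
  also have "\<dots> = (\<Union>x\<in>H +>\<^bsub>M\<^esub> u. H +>\<^bsub>M\<^esub> (r \<odot>\<^bsub>M\<^esub> u))"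
    by (rule SUP_cong[OF refl c])
  also have "\<dots> = H +>\<^bsub>M\<^esub> (r \<odot>\<^bsub>M\<^esub> u)" using ne by (rule cSUP_const)
  finally show ?thesis .
qed

end

lemma generated_submodule:
  fixes M :: "('r, 'm) module"
  assumes M: "Module.module R M" and "A \<subseteq> carrier M"
  shows "submodule (generated_submodule R M A) R M" "A \<subseteq> generated_submodule R M A"
    "submodule K R M \<Longrightarrow> A \<subseteq> K \<Longrightarrow> generated_submodule R M A \<subseteq> K"
proof -
  interpret module R M by (rule M)
  let ?C = "{K. submodule K R M \<and> A \<subseteq> K}"
  have top: "carrier M \<in> ?C" using assms carrier_is_submodule by auto
  have K: "\<zero>\<^bsub>M\<^esub> \<in> K" "a \<in> K \<Longrightarrow> \<ominus>\<^bsub>M\<^esub> a \<in> K" "a \<in> K \<Longrightarrow> b \<in> K \<Longrightarrow> a \<oplus>\<^bsub>M\<^esub> b \<in> K"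
    "r \<in> carrier R \<Longrightarrow> a \<in> K \<Longrightarrow> r \<odot>\<^bsub>M\<^esub> a \<in> K" if "K \<in> ?C" for K a b r
  proof -
    interpret K: submodule K R M using that by simp
    interpret module_with_submodule R M K ..
    show "\<zero>\<^bsub>M\<^esub> \<in> K" "a \<in> K \<Longrightarrow> \<ominus>\<^bsub>M\<^esub> a \<in> K" "a \<in> K \<Longrightarrow> b \<in> K \<Longrightarrow> a \<oplus>\<^bsub>M\<^esub> b \<in> K"
      "r \<in> carrier R \<Longrightarrow> a \<in> K \<Longrightarrow> r \<odot>\<^bsub>M\<^esub> a \<in> K" using H_closed by auto
  qed
  show "submodule (generated_submodule R M A) R M"
    unfolding generated_submodule_def
  proof (rule submoduleI)
    show "\<Inter>?C \<subseteq> carrier M" using top by blast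
    show "\<zero>\<^bsub>M\<^esub> \<in> \<Inter>?C" by (rule InterI) (rule K(1))
    show "\<ominus>\<^bsub>M\<^esub> a \<in> \<Inter>?C" if "a \<in> \<Inter>?C" for a
      by (rule InterI) (rule K(2)[OF _ InterD[OF that]])
    show "a \<oplus>\<^bsub>M\<^esub> b \<in> \<Inter>?C" if "a \<in> \<Inter>?C" "b \<in> \<Inter>?C" for a b
      by (rule InterI) (rule K(3)[OF _ InterD[OF that(1)] InterD[OF that(2)]])
    show "r \<odot>\<^bsub>M\<^esub> a \<in> \<Inter>?C" if "r \<in> carrier R" "a \<in> \<Inter>?C" for r a
      by (rule InterI) (rule K(4)[OF _ that(1) InterD[OF that(2)]])
  qed
  show "A \<subseteq> generated_submodule R M A" by (auto simp: generated_submodule_def)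
  show "submodule K R M \<Longrightarrow> A \<subseteq> K \<Longrightarrow> generated_submodule R M A \<subseteq> K"
    by (auto simp: generated_submodule_def)
qed

lemma ideal_mod_simps [simp]:
  "carrier (ideal_mod R I) = I" "\<zero>\<^bsub>ideal_mod R I\<^esub> = \<zero>\<^bsub>R\<^esub>"
  "x \<oplus>\<^bsub>ideal_mod R I\<^esub> y = x \<oplus>\<^bsub>R\<^esub> y" "r \<odot>\<^bsub>ideal_mod R I\<^esub> x = r \<otimes>\<^bsub>R\<^esub> x"
  by (simp_all add: ideal_mod_def)

lemma Hom_mod_carrier: "carrier (Hom_mod R M N) = lin_maps R M N"
  by (simp add: Hom_mod_def)

lemma Hom_mod_simps [simp]:
  "\<zero>\<^bsub>Hom_mod R M N\<^esub> = (\<lambda>x\<in>carrier M. \<zero>\<^bsub>N\<^esub>)"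
  "f \<oplus>\<^bsub>Hom_mod R M N\<^esub> g = (\<lambda>x\<in>carrier M. f x \<oplus>\<^bsub>N\<^esub> g x)"
  "r \<odot>\<^bsub>Hom_mod R M N\<^esub> f = (\<lambda>x\<in>carrier M. r \<odot>\<^bsub>N\<^esub> f x)"
  by (simp_all add: Hom_mod_def)

lemma (in cring) ideal_mod_module:
  assumes "ideal I R"
  shows "Module.module R (ideal_mod R I)"
proof -
  interpret I: ideal I R by fact
  have c: "x \<in> I \<Longrightarrow> x \<in> carrier R" for x by (rule I.a_Hcarr)
  show ?thesis
  proof (rule moduleI)
    show "cring R" by (rule is_cring)
    show "abelian_group (ideal_mod R I)"
    proof (rule abelian_groupI)
      fix x assume "x \<in> carrier (ideal_mod R I)"
      then show "\<exists>y\<in>carrier (ideal_mod R I). y \<oplus>\<^bsub>ideal_mod R I\<^esub> x = \<zero>\<^bsub>ideal_mod R I\<^esub>"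
        by (intro bexI[of _ "\<ominus> x"]) (simp_all add: c l_neg)
    qed (use c in \<open>simp_all add: a_ac\<close>)
  qed (use c in \<open>simp_all add: l_distr r_distr m_assoc I.I_l_closed\<close>)
qed

lemma lin_maps_add_closed:
  assumes M: "Module.module R M" and N: "Module.module R N"
    and f: "f \<in> lin_maps R M N" and g: "g \<in> lin_maps R M N"
  shows "(\<lambda>x\<in>carrier M. f x \<oplus>\<^bsub>N\<^esub> g x) \<in> lin_maps R M N"
proof -
  interpret M: module R M by fact
  interpret N: module R N by fact
  show ?thesis
    by (rule lin_mapsI)
      (simp_all add: lin_mapsD[OF f] lin_mapsD[OF g] N.a_ac N.smult_r_distr)
qed

lemma lin_maps_smult_closed:
  assumes M: "Module.module R M" and N: "Module.module R N"
    and f: "f \<in> lin_maps R M N" and r: "r \<in> carrier R"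
  shows "(\<lambda>x\<in>carrier M. r \<odot>\<^bsub>N\<^esub> f x) \<in> lin_maps R M N"
proof -
  interpret M: module R M by fact
  interpret N: module R N by fact
  have "r \<odot>\<^bsub>N\<^esub> (s \<odot>\<^bsub>N\<^esub> y) = s \<odot>\<^bsub>N\<^esub> (r \<odot>\<^bsub>N\<^esub> y)" if "s \<in> carrier R" "y \<in> carrier N" for s y
  proof -
    note comm = Group.comm_monoid.m_comm[OF cring.axioms(2)[OF module.axioms(1)[OF N]]]
    show ?thesis using that r N.smult_assoc1 comm by metis
  qed
  then show ?thesis
    using r by (intro lin_mapsI) (simp_all add: lin_mapsD[OF f] N.smult_r_distr)
qed

text \<open>The linear extension of evaluation kills the tensor relations, so the evaluation map may be
  computed on any representative of a coset.\<close>

locale evaluation_setup = cring R for R (structure) +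
  fixes M :: "('a, 'm) module"
  assumes M: "Module.module R M"
begin

abbreviation "dual \<equiv> dual_mod R M"
abbreviation "XX \<equiv> carrier M \<times> carrier dual"
abbreviation "FF \<equiv> free_mod R XX"
abbreviation "NN \<equiv> tensor_null R M dual"
abbreviation "reg \<equiv> regular_mod R"
abbreviation "ev \<equiv> lin_extension R reg XX (\<lambda>(x, f). f x)"
abbreviation "bb x f \<equiv> free_basis R XX (x, f)"

lemma reg: "Module.module R reg" by (rule ideal_mod_module[OF oneideal])

sublocale M: module R M by (rule M)
sublocale FF: module R FF by (rule free_mod_module)
sublocale reg: module R reg by (rule reg)

lemma dualD:
  assumes "f \<in> carrier dual"
  shows "x \<in> carrier M \<Longrightarrow> f x \<in> carrier R"
    "x \<in> carrier M \<Longrightarrow> x' \<in> carrier M \<Longrightarrow> f (x \<oplus>\<^bsub>M\<^esub> x') = f x \<oplus> f x'"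
    "r \<in> carrier R \<Longrightarrow> x \<in> carrier M \<Longrightarrow> f (r \<odot>\<^bsub>M\<^esub> x) = r \<otimes> f x"
  using assms lin_mapsD(2-4)[of f R M reg] by (simp_all add: Hom_mod_carrier)

lemma evaluation_closed: "(\<lambda>(x, f). f x) \<in> XX \<rightarrow> carrier reg"
proof
  fix p assume "p \<in> XX"
  then obtain x f where "p = (x, f)" "x \<in> carrier M" "f \<in> carrier dual" by blast
  then show "(case p of (x, f) \<Rightarrow> f x) \<in> carrier reg" using dualD(1)[of f x] by simp
qed

lemma ev_linear: "ev \<in> lin_maps R FF reg"
  by (rule lin_extension_linear[OF reg evaluation_closed])

lemma ev_basis: "x \<in> carrier M \<Longrightarrow> f \<in> carrier dual \<Longrightarrow> ev (bb x f) = f x"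
  using lin_extension_basis[OF reg evaluation_closed, of "(x, f)"] by simp

lemma bb_closed: "bb x f \<in> carrier FF"
  by (rule free_basis_closed)

lemma relations_closed: "tensor_relations R M dual \<subseteq> carrier FF"
  unfolding tensor_relations_def Let_def
  by (rule subsetI, elim UnE; clarify; (intro FF.minus_closed FF.a_closed FF.smult_closed bb_closed | assumption)+)

sublocale NN: module_with_submodule R FF NN
  by (intro module_with_submodule.intro FF.module_axioms)
    (simp add: tensor_null_def generated_submodule(1)[OF FF.module_axioms relations_closed])

lemma relations_in_NN: "u \<in> tensor_relations R M dual \<Longrightarrow> u \<in> NN"
  using generated_submodule(2)[OF FF.module_axioms relations_closed] by (auto simp: tensor_null_def)

lemma tensor_cong:
  "x \<in> carrier M \<Longrightarrow> x' \<in> carrier M \<Longrightarrow> f \<in> carrier dual \<Longrightarrow>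
    mod_cong FF NN (bb (x \<oplus>\<^bsub>M\<^esub> x') f) (bb x f \<oplus>\<^bsub>FF\<^esub> bb x' f)"
  "x \<in> carrier M \<Longrightarrow> f \<in> carrier dual \<Longrightarrow> f' \<in> carrier dual \<Longrightarrow>
    mod_cong FF NN (bb x (f \<oplus>\<^bsub>dual\<^esub> f')) (bb x f \<oplus>\<^bsub>FF\<^esub> bb x f')"
  "r \<in> carrier R \<Longrightarrow> x \<in> carrier M \<Longrightarrow> f \<in> carrier dual \<Longrightarrow>
    mod_cong FF NN (bb (r \<odot>\<^bsub>M\<^esub> x) f) (r \<odot>\<^bsub>FF\<^esub> bb x f)"
  "r \<in> carrier R \<Longrightarrow> x \<in> carrier M \<Longrightarrow> f \<in> carrier dual \<Longrightarrow>
    mod_cong FF NN (bb x (r \<odot>\<^bsub>dual\<^esub> f)) (r \<odot>\<^bsub>FF\<^esub> bb x f)"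
proof -
  have rel: "mod_cong FF NN u v" if "u \<ominus>\<^bsub>FF\<^esub> v \<in> tensor_relations R M dual" "u \<in> carrier FF" "v \<in> carrier FF"
    for u v
    using that relations_in_NN by (simp add: mod_cong_def)
  note cl = bb_closed FF.a_closed[OF bb_closed bb_closed] FF.smult_closed[OF _ bb_closed]
  show "mod_cong FF NN (bb (x \<oplus>\<^bsub>M\<^esub> x') f) (bb x f \<oplus>\<^bsub>FF\<^esub> bb x' f)"
    if "x \<in> carrier M" "x' \<in> carrier M" "f \<in> carrier dual"
    by (rule rel[OF _ cl(1,2)], unfold tensor_relations_def Let_def, rule UnI1, rule UnI1, rule UnI1)
      (rule CollectI, rule exI[of _ x], rule exI[of _ x'], rule exI[of _ f], intro conjI refl that)
  show "mod_cong FF NN (bb x (f \<oplus>\<^bsub>dual\<^esub> f')) (bb x f \<oplus>\<^bsub>FF\<^esub> bb x f')"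
    if "x \<in> carrier M" "f \<in> carrier dual" "f' \<in> carrier dual"
    by (rule rel[OF _ cl(1,2)], unfold tensor_relations_def Let_def, rule UnI1, rule UnI1, rule UnI2)
      (rule CollectI, rule exI[of _ x], rule exI[of _ f], rule exI[of _ f'], intro conjI refl that)
  show "mod_cong FF NN (bb (r \<odot>\<^bsub>M\<^esub> x) f) (r \<odot>\<^bsub>FF\<^esub> bb x f)"
    if "r \<in> carrier R" "x \<in> carrier M" "f \<in> carrier dual"
    by (rule rel[OF _ cl(1) cl(3)[OF that(1)]], unfold tensor_relations_def Let_def, rule UnI1, rule UnI2)
      (rule CollectI, rule exI[of _ r], rule exI[of _ x], rule exI[of _ f], intro conjI refl that)
  show "mod_cong FF NN (bb x (r \<odot>\<^bsub>dual\<^esub> f)) (r \<odot>\<^bsub>FF\<^esub> bb x f)"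
    if "r \<in> carrier R" "x \<in> carrier M" "f \<in> carrier dual"
    by (rule rel[OF _ cl(1) cl(3)[OF that(1)]], unfold tensor_relations_def Let_def, rule UnI2)
      (rule CollectI, rule exI[of _ r], rule exI[of _ x], rule exI[of _ f], intro conjI refl that)
qed

lemma ev_null: "u \<in> NN \<Longrightarrow> ev u = \<zero>"
proof -
  have dual_add: "f \<oplus>\<^bsub>dual\<^esub> f' \<in> carrier dual" if "f \<in> carrier dual" "f' \<in> carrier dual" for f f'
    using lin_maps_add_closed[OF M reg] that by (simp add: Hom_mod_carrier)
  have dual_smult: "r \<odot>\<^bsub>dual\<^esub> f \<in> carrier dual" if "f \<in> carrier dual" "r \<in> carrier R" for f r
    using lin_maps_smult_closed[OF M reg] that by (simp add: Hom_mod_carrier)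
  have c: "f x \<in> carrier R" if "x \<in> carrier M" "f \<in> carrier dual" for x f
    using dualD(1) that by simp
  have ker: "u \<ominus>\<^bsub>FF\<^esub> v \<in> lin_kernel FF reg ev" 
    if "ev u = ev v" "u \<in> carrier FF" "v \<in> carrier FF" for u v
    using that lin_map_minus[OF FF.module_axioms reg ev_linear that(2,3)]
      lin_mapsD(2)[OF ev_linear that(3)] reg.r_neg[of "ev v"]
    by (simp add: lin_kernel_def a_minus_def[of reg])
  note cl = bb_closed FF.a_closed[OF bb_closed bb_closed] FF.smult_closed[OF _ bb_closed]
  note evs = ev_basis lin_mapsD(3)[OF ev_linear bb_closed bb_closed] lin_mapsD(4)[OF ev_linear _ bb_closed]
  have "tensor_relations R M dual \<subseteq> lin_kernel FF reg ev"
  proof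
    fix u assume "u \<in> tensor_relations R M dual"
    then consider
        x x' f where "u = bb (x \<oplus>\<^bsub>M\<^esub> x') f \<ominus>\<^bsub>FF\<^esub> (bb x f \<oplus>\<^bsub>FF\<^esub> bb x' f)"
          "x \<in> carrier M" "x' \<in> carrier M" "f \<in> carrier dual"
      | x f f' where "u = bb x (f \<oplus>\<^bsub>dual\<^esub> f') \<ominus>\<^bsub>FF\<^esub> (bb x f \<oplus>\<^bsub>FF\<^esub> bb x f')"
          "x \<in> carrier M" "f \<in> carrier dual" "f' \<in> carrier dual"
      | r x f where "u = bb (r \<odot>\<^bsub>M\<^esub> x) f \<ominus>\<^bsub>FF\<^esub> r \<odot>\<^bsub>FF\<^esub> bb x f"
          "r \<in> carrier R" "x \<in> carrier M" "f \<in> carrier dual"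
      | r x f where "u = bb x (r \<odot>\<^bsub>dual\<^esub> f) \<ominus>\<^bsub>FF\<^esub> r \<odot>\<^bsub>FF\<^esub> bb x f"
          "r \<in> carrier R" "x \<in> carrier M" "f \<in> carrier dual"
      unfolding tensor_relations_def Let_def by blast
    then show "u \<in> lin_kernel FF reg ev"
    proof cases
      case 1
      show ?thesis unfolding 1(1)
        by (rule ker[OF _ cl(1,2)])
          (use 1 in \<open>simp add: evs dualD(2) del: free_mod_simps\<close>)
    next
      case 2
      show ?thesis unfolding 2(1)
      proof (rule ker[OF _ cl(1,2)])
        have "ev (bb x (f \<oplus>\<^bsub>dual\<^esub> f')) = (f \<oplus>\<^bsub>dual\<^esub> f') x"
          by (rule ev_basis[OF 2(2) dual_add[OF 2(3,4)]])
        then show "ev (bb x (f \<oplus>\<^bsub>dual\<^esub> f')) = ev (bb x f \<oplus>\<^bsub>FF\<^esub> bb x f')"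
          using 2 by (simp add: evs del: free_mod_simps)
      qed
    next
      case 3
      show ?thesis unfolding 3(1)
        by (rule ker[OF _ cl(1,3)])
          (use 3 in \<open>simp_all add: evs dualD(3) del: free_mod_simps\<close>)
    next
      case 4
      show ?thesis unfolding 4(1)
      proof (rule ker[OF _ cl(1,3)])
        have "ev (bb x (r \<odot>\<^bsub>dual\<^esub> f)) = (r \<odot>\<^bsub>dual\<^esub> f) x"
          by (rule ev_basis[OF 4(3) dual_smult[OF 4(4,2)]])
        then show "ev (bb x (r \<odot>\<^bsub>dual\<^esub> f)) = ev (r \<odot>\<^bsub>FF\<^esub> bb x f)"
          using 4 by (simp add: evs del: free_mod_simps)
      qed (rule 4(2))
    qed
  qed
  then have "NN \<subseteq> lin_kernel FF reg ev"
    unfolding tensor_null_def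
    by (intro generated_submodule(3)[OF FF.module_axioms relations_closed] lin_kernel_submodule FF.module_axioms reg ev_linear)
  then show "u \<in> NN \<Longrightarrow> ev u = \<zero>" by (auto simp: lin_kernel_def)
qed

lemma evaluation_map_coset:
  assumes u: "u \<in> carrier FF"
  shows "evaluation_map R M (NN +>\<^bsub>FF\<^esub> u) = ev u"
proof -
  have const: "ev v = ev u" if "v \<in> NN +>\<^bsub>FF\<^esub> u" for v
  proof -
    obtain h where h: "h \<in> NN" "v = h \<oplus>\<^bsub>FF\<^esub> u" using \<open>v \<in> NN +>\<^bsub>FF\<^esub> u\<close> NN.coset_def by auto
    have "ev v = ev h \<oplus>\<^bsub>reg\<^esub> ev u"
      unfolding h(2) by (rule lin_mapsD(3)[OF ev_linear NN.H_closed(1)[OF h(1)] u])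
    then show ?thesis using ev_null[OF h(1)] lin_mapsD(2)[OF ev_linear u] by simp
  qed
  have mem: "u \<in> NN +>\<^bsub>FF\<^esub> u" using NN.coset_iff[OF u] NN.cong_refl[OF u] by simp
  have "ev ` (NN +>\<^bsub>FF\<^esub> u) = (\<lambda>_. ev u) ` (NN +>\<^bsub>FF\<^esub> u)"
    by (rule image_cong[OF refl const])
  also have "\<dots> = {ev u}" by (rule image_constant[OF mem])
  finally have "ev ` (NN +>\<^bsub>FF\<^esub> u) = {ev u}" .
  moreover have "NN +>\<^bsub>FF\<^esub> u \<in> carrier (tensor_mod R M dual)"
    using u by (auto simp: tensor_mod_def NN.quot_carrier)
  ultimately show ?thesis by (simp add: evaluation_map_def)
qed

lemma tensor_carrier: "carrier (tensor_mod R M dual) = {NN +>\<^bsub>FF\<^esub> u | u. u \<in> carrier FF}"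
  by (simp add: tensor_mod_def NN.quot_carrier)

lemma evaluation_pure_tensor:
  "x \<in> carrier M \<Longrightarrow> f \<in> carrier dual \<Longrightarrow> evaluation_map R M (pure_tensor R M dual x f) = f x"
  unfolding pure_tensor_def using evaluation_map_coset[OF bb_closed] ev_basis by simp

lemma evaluation_map_linear:
  assumes J: "\<And>u. u \<in> carrier FF \<Longrightarrow> ev u \<in> J"
  shows "evaluation_map R M \<in> lin_maps R (tensor_mod R M dual) (ideal_mod R J)"
proof (rule lin_mapsI)
  show "evaluation_map R M \<in> extensional (carrier (tensor_mod R M dual))"
    by (simp add: evaluation_map_def)
  fix X assume "X \<in> carrier (tensor_mod R M dual)"
  then obtain u where u: "X = NN +>\<^bsub>FF\<^esub> u" "u \<in> carrier FF" by (auto simp: tensor_carrier)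
  show "evaluation_map R M X \<in> carrier (ideal_mod R J)"
    using J[OF u(2)] by (simp add: u evaluation_map_coset)
  {
    fix Y assume "Y \<in> carrier (tensor_mod R M dual)"
    then obtain v where v: "Y = NN +>\<^bsub>FF\<^esub> v" "v \<in> carrier FF" by (auto simp: tensor_carrier)
    show "evaluation_map R M (X \<oplus>\<^bsub>tensor_mod R M dual\<^esub> Y)
        = evaluation_map R M X \<oplus>\<^bsub>ideal_mod R J\<^esub> evaluation_map R M Y"
      unfolding u v tensor_mod_def NN.quot_add[OF u(2) v(2)]
      using lin_mapsD(3)[OF ev_linear u(2) v(2)]
        evaluation_map_coset[OF u(2)] evaluation_map_coset[OF v(2)]
        evaluation_map_coset[OF FF.a_closed[OF u(2) v(2)]]
      by (simp del: free_mod_simps)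
  }
  fix r assume r: "r \<in> carrier R"
  show "evaluation_map R M (r \<odot>\<^bsub>tensor_mod R M dual\<^esub> X) = r \<odot>\<^bsub>ideal_mod R J\<^esub> evaluation_map R M X"
    unfolding u tensor_mod_def NN.quot_smult[OF r u(2)]
    using lin_mapsD(4)[OF ev_linear r u(2)] evaluation_map_coset[OF u(2)]
      evaluation_map_coset[OF FF.smult_closed[OF r u(2)]]
    by (simp del: free_mod_simps)
qed

lemma evaluation_map_bij:
  assumes J: "\<And>u. u \<in> carrier FF \<Longrightarrow> ev u \<in> J"
    and surj: "\<And>y. y \<in> J \<Longrightarrow> \<exists>u\<in>carrier FF. ev u = y"
    and inj: "\<And>u. u \<in> carrier FF \<Longrightarrow> ev u = \<zero> \<Longrightarrow> u \<in> NN"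
  shows "bij_betw (evaluation_map R M) (carrier (tensor_mod R M dual)) J"
proof (rule bij_betwI')
  fix X Y assume "X \<in> carrier (tensor_mod R M dual)" "Y \<in> carrier (tensor_mod R M dual)"
  then obtain u v where u: "X = NN +>\<^bsub>FF\<^esub> u" "u \<in> carrier FF" and v: "Y = NN +>\<^bsub>FF\<^esub> v" "v \<in> carrier FF"
    by (auto simp: tensor_carrier)
  show "(evaluation_map R M X = evaluation_map R M Y) = (X = Y)"
  proof
    assume "evaluation_map R M X = evaluation_map R M Y"
    then have "ev u = ev v" by (simp add: u v evaluation_map_coset)
    then have "ev (u \<ominus>\<^bsub>FF\<^esub> v) = \<zero>"
      using lin_map_minus[OF FF.module_axioms reg ev_linear u(2) v(2)]
        lin_mapsD(2)[OF ev_linear v(2)] reg.r_neg[of "ev v"] by (simp add: a_minus_def[of reg])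
    then have "mod_cong FF NN u v"
      using inj[OF FF.minus_closed[OF u(2) v(2)]] u(2) v(2) by (simp add: mod_cong_def)
    then show "X = Y" using NN.coset_eq_iff[OF u(2) v(2)] u v by simp
  qed simp
next
  fix X assume "X \<in> carrier (tensor_mod R M dual)"
  then obtain u where "X = NN +>\<^bsub>FF\<^esub> u" "u \<in> carrier FF" by (auto simp: tensor_carrier)
  then show "evaluation_map R M X \<in> J" using J[of u] by (simp add: evaluation_map_coset)
next
  fix y assume "y \<in> J"
  then obtain u where "u \<in> carrier FF" "ev u = y" using surj by blast
  then have "NN +>\<^bsub>FF\<^esub> u \<in> carrier (tensor_mod R M dual)" "y = evaluation_map R M (NN +>\<^bsub>FF\<^esub> u)"
    by (auto simp: tensor_carrier evaluation_map_coset)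
  then show "\<exists>X\<in>carrier (tensor_mod R M dual). y = evaluation_map R M X" by blast
qed

end

section \<open>The ideal \<open>I\<close> is rigid\<close>

text \<open>\<open>D\<close> is the dual of \<open>I\<close>: since \<open>I = (t, \<alpha> t) R\<close>, a linear map from \<open>I\<close> to \<open>R\<close> is determined by the
  image \<open>a\<close> of \<open>t\<close>, and \<open>a\<close> is subject only to \<open>\<alpha> a \<in> R\<close>.\<close>

definition D :: "L poly set" where
  "D = {q \<in> R_set. smult \<alpha> q \<in> R_set}"

definition D_coeffs :: "nat \<Rightarrow> L set" where
  "D_coeffs i = (if i = 0 then {0} else if i = 1 then V else if i = 2 then L_upto 21 else UNIV)"

lemma D_coeffs_iff: "x \<in> D_coeffs i \<longleftrightarrow> x \<in> R_coeffs i \<and> \<alpha> * x \<in> R_coeffs i"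
proof -
  consider "i = 0" | "i = 1" | "i = 2" | "i \<ge> 3" by linarith
  then show ?thesis
  proof cases
    case 1
    have "x = 0" if x: "x \<in> L_upto 0" "\<alpha> * x \<in> L_upto 0"
    proof (rule L_eqI)
      fix i :: nat assume "i < 24"
      show "lcoef x i = lcoef 0 i"
      proof (cases "i = 0")
        case True
        have "lcoef (\<alpha> * x) (Suc 0) = 0" using x(2) L_upto_iff[of 0] by auto
        then show ?thesis using lcoef_alpha_mult[of 0 x] True by simp
      next
        case False
        then show ?thesis using x(1) \<open>i < 24\<close> L_upto_iff[of 0 x] by auto
      qed
    qed
    then show ?thesis
      using 1 L.subspace_0[OF L_upto_subspace] by (auto simp: D_coeffs_def R_coeffs_def L_upto_0 L.span_zero)
  next
    case 2
    then show ?thesis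
      using W_alpha_W[of x] V_subset_W[of x] by (auto simp: D_coeffs_def R_coeffs_def)
  next
    case 3
    then show ?thesis
      using L_upto_alpha[of 21 x] alpha_mult_L_upto[of x 21] L_upto_mono[of 21 22]
      by (auto simp: D_coeffs_def R_coeffs_def)
  next
    case 4
    then show ?thesis by (simp add: D_coeffs_def R_coeffs_def)
  qed
qed

lemma D_iff: "q \<in> D \<longleftrightarrow> (\<forall>i. coeff q i \<in> D_coeffs i)"
  by (auto simp: D_def R_set_def D_coeffs_iff)

lemma D_subset: "q \<in> D \<Longrightarrow> q \<in> R_set" "q \<in> D \<Longrightarrow> smult \<alpha> q \<in> R_set"
  by (simp_all add: D_def)

lemma D_add: "a \<in> D \<Longrightarrow> b \<in> D \<Longrightarrow> a + b \<in> D"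
  by (simp add: D_def R.add_in smult_add_right)

lemma D_mult: "r \<in> R_set \<Longrightarrow> a \<in> D \<Longrightarrow> r * a \<in> D"
  using R.mult_in[of r a] R.mult_in[of r "smult \<alpha> a"] by (simp add: D_def)

lemma D_uminus: "a \<in> D \<Longrightarrow> - a \<in> D"
  using R.uminus_in[of a] R.uminus_in[of "smult \<alpha> a"] by (simp add: D_def)

lemma D_coeffs_subspace: "L.subspace (D_coeffs i)"
  by (simp add: D_coeffs_def V_subspace L_upto_subspace L.subspace_UNIV L.subspace_single_0)

lemma D_0: "0 \<in> D"
  by (simp add: D_def R.zero_in)

lemma monom_in_D: "monom c i \<in> D \<longleftrightarrow> c \<in> D_coeffs i"
  using L.subspace_0[OF D_coeffs_subspace] by (auto simp: D_iff)

abbreviation "tt \<equiv> monom (1::L) 1"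
abbreviation "ta \<equiv> monom \<alpha> 1"

lemma ta_eq: "p * ta = tt * smult \<alpha> p" "ta = smult \<alpha> tt"
proof -
  show "ta = smult \<alpha> tt" by (simp add: smult_monom)
  then show "p * ta = tt * smult \<alpha> p" by (metis mult.commute mult_smult_left mult_smult_right)
qed

lemma tt_in_D: "tt \<in> D"
  by (simp add: monom_in_D D_coeffs_def one_in_V)

abbreviation "tdiv \<equiv> poly_shift 1 :: L poly \<Rightarrow> L poly"

lemma tt_tdiv: "coeff x 0 = 0 \<Longrightarrow> tt * tdiv x = x"
  by (intro poly_eqI) (simp add: coeff_monom_mult coeff_poly_shift)

lemma I_coeff_0: "x \<in> I_ideal \<Longrightarrow> coeff x 0 = 0"
  by (auto simp: I_ideal_iff I_coeffs_def dest: spec[of _ 0])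

lemma I_tdiv: "x \<in> I_ideal \<Longrightarrow> tt * tdiv x = x"
  by (rule tt_tdiv[OF I_coeff_0])

lemma tt_cancel: "tt * p = tt * q \<Longrightarrow> p = q"
  by (simp add: monom_eq_0_iff)

lemmas I_D = R.idealD[OF I_ideal_ideal]

lemma I_subset: "x \<in> I_ideal \<Longrightarrow> x \<in> R_set"
  using I_D(1) by blast

text \<open>For \<open>x = p + q \<alpha>\<close> the product has the coefficients \<open>- p\<close> and \<open>- q\<close> at \<open>\<alpha>\<^sup>1\<^sup>5\<close> and \<open>\<alpha>\<^sup>1\<^sup>6\<close>.\<close>

lemma L_upto_1_multiplier:
  assumes x: "x \<in> L_upto 1" and m: "(\<alpha> - \<alpha> ^ 15) * x \<in> L_upto 1"
  shows "x = 0"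
proof -
  have c: "lam ((\<alpha> - \<alpha> ^ 15) * x * \<alpha> ^ j) = lcoef x (22 - j) - lcoef x (8 - j)" if "j \<le> 8" for j
  proof -
    have "(\<alpha> - \<alpha> ^ 15) * x * \<alpha> ^ j = x * \<alpha> ^ (j + 1) - x * \<alpha> ^ (j + 15)"
      by (simp add: algebra_simps power_add)
    then show ?thesis using that lam_mult_alpha_power[of "j + 1" x] lam_mult_alpha_power[of "j + 15" x]
      by (simp add: eval_nat_numeral)
  qed
  have z: "lcoef x i = 0" if "1 < i" "i < 24" for i
    using x that L_upto_iff[of 1 x] by auto
  have m': "lcoef ((\<alpha> - \<alpha> ^ 15) * x) i = 0" if "1 < i" "i < 24" for i
    using m that L_upto_iff[of 1 "(\<alpha> - \<alpha> ^ 15) * x"] by auto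
  have "lcoef x 0 = 0" using c[of 8] lam_mult_alpha_power[of 8 "(\<alpha> - \<alpha> ^ 15) * x"] m'[of 15] z[of 14] by simp
  moreover have "lcoef x 1 = 0"
    using c[of 7] lam_mult_alpha_power[of 7 "(\<alpha> - \<alpha> ^ 15) * x"] m'[of 16] z[of 15] by simp
  ultimately have "lcoef x i = lcoef 0 i" if "i < 24" for i
  proof -
    consider "i = 0" | "i = 1" | "i > 1" by linarith
    then show ?thesis using \<open>lcoef x 0 = 0\<close> \<open>lcoef x 1 = 0\<close> z that by cases auto
  qed
  then show ?thesis by (rule L_eqI)
qed

text \<open>This is where rigidity comes from: degree by degree the claim is \<open>(L\<^sub>1 : V) = 0\<close>,
  \<open>(V + \<alpha> V + \<alpha>\<^sup>2 V : V) \<subseteq> L\<^sub>2\<close> and \<open>V + \<alpha> V + \<alpha>\<^sup>2 V + \<alpha>\<^sup>3 V = L\<close>.\<close>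

lemma multiplier_D_I:
  assumes w: "\<And>q. q \<in> D \<Longrightarrow> q * w \<in> I_ideal"
  obtains y z where "w = y + smult \<alpha> z" "y \<in> I_ideal" "z \<in> I_ideal"
proof -
  have v: "v * coeff w i \<in> I_coeffs (Suc i)" if "v \<in> V" for v i
  proof -
    have "monom v 1 * w \<in> I_ideal"
      using that by (intro w) (simp add: monom_in_D D_coeffs_def)
    then have "coeff (monom v 1 * w) (Suc i) \<in> I_coeffs (Suc i)" by (simp only: I_ideal_iff)
    then show ?thesis by (simp add: coeff_monom_mult)
  qed
  have "1 * coeff w 0 \<in> I_coeffs (Suc 0)" by (rule v[OF one_in_V])
  moreover have "\<alpha> - \<alpha> ^ 15 \<in> V" unfolding V_def by (rule L.span_base) simp
  then have "(\<alpha> - \<alpha> ^ 15) * coeff w 0 \<in> I_coeffs (Suc 0)" by (rule v)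
  ultimately have w0: "coeff w 0 = 0"
    by (intro L_upto_1_multiplier) (simp_all add: I_coeffs_def)
  have w1: "coeff w 1 \<in> L_upto 2"
  proof (rule V_multiplier)
    fix u assume "u \<in> V"
    then show "coeff w 1 * u \<in> Vs 3"
      using v[of u 1] by (simp add: I_coeffs_def mult.commute)
  qed
  have dec: "\<exists>y z. coeff w i = y + \<alpha> * z \<and> y \<in> I_coeffs i \<and> z \<in> I_coeffs i" for i
  proof -
    consider "i = 0" | "i = 1" | "i = 2" | "i \<ge> 3" by linarith
    then show ?thesis
    proof cases
      case 1
      then show ?thesis using w0 by (simp add: I_coeffs_def)
    next
      case 2
      then show ?thesis using L_upto_decomp[of "coeff w 1" 1] w1
        by (simp add: I_coeffs_def numeral_2_eq_2) metis
    next
      case 3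
      have "coeff w 2 \<in> Vs (Suc 3)" using Vs_4 by simp
      then obtain u y where "coeff w 2 = u + \<alpha> * y" "u \<in> V" "y \<in> Vs 3"
        unfolding Vs_Suc' by blast
      moreover have "u \<in> Vs 3" using \<open>u \<in> V\<close> Vs_1 Vs_mono[of "Suc 0" 3] by auto
      ultimately show ?thesis unfolding 3 by (auto simp: I_coeffs_def)
    next
      case 4
      then have "I_coeffs i = UNIV" by (simp add: I_coeffs_def)
      moreover have "coeff w i = coeff w i + \<alpha> * 0" by simp
      ultimately show ?thesis by blast
    qed
  qed
  have zero: "0 \<in> I_coeffs i" for i
    by (simp add: I_coeffs_def L.subspace_0[OF L_upto_subspace] L.subspace_0[OF Vs_subspace])
  obtain y z where "w = y + smult \<alpha> z" "\<And>i. coeff y i \<in> I_coeffs i" "\<And>i. coeff z i \<in> I_coeffs i"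
    using coefficientwise_combination[of I_coeffs w \<alpha>, OF zero dec] by blast
  with that show thesis by (simp add: I_ideal_iff)
qed

abbreviation "I_mod \<equiv> ideal_mod R_ring I_ideal"

lemma I_mod: "Module.module R_ring I_mod"
  by (rule R.R.ideal_mod_module[OF I_ideal_ideal])

lemma reg_mod: "Module.module R_ring (regular_mod R_ring)"
  by (rule R.R.ideal_mod_module[OF R.R.oneideal])

lemma I_coordinates:
  obtains rr ss where "\<And>x. x \<in> I_ideal \<Longrightarrow> rr x \<in> R_set" "\<And>x. x \<in> I_ideal \<Longrightarrow> ss x \<in> R_set"
    "\<And>x. x \<in> I_ideal \<Longrightarrow> x = rr x * tt + ss x * ta"
proof -
  have "\<forall>x. \<exists>r s. x \<in> I_ideal \<longrightarrow> r \<in> R_set \<and> s \<in> R_set \<and> x = r * tt + s * ta"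
    by (auto simp: I_ideal_gen)
  then obtain rr ss where "\<forall>x. x \<in> I_ideal \<longrightarrow> rr x \<in> R_set \<and> ss x \<in> R_set \<and> x = rr x * tt + ss x * ta"
    by metis
  with that show thesis by blast
qed

text \<open>The relations between the generators \<open>t\<close> and \<open>\<alpha> t\<close> are the pairs \<open>(- \<alpha> q, q)\<close> with \<open>q \<in> D\<close>, so a
  linear map from these relations to \<open>I\<close> amounts to an \<open>R\<close>-linear map \<open>D \<rightarrow> I\<close>, which is
  multiplication by some \<open>w\<close>. If \<open>w = y + \<alpha> z\<close>, the map \<open>(p, q) \<mapsto> q y - p z\<close> on all pairs restricts to
  it. The remaining relations in the free cover are split off by a linear retraction.\<close>

lemma extend_from_syzygy:
  assumes f: "f \<in> lin_maps R_ring (syzygy R_ring I_mod) I_mod"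
  shows "\<exists>g\<in>lin_maps R_ring (free_cover R_ring I_mod) I_mod.
    \<forall>z\<in>carrier (syzygy R_ring I_mod). g z = f z"
proof -
  let ?F = "free_cover R_ring I_mod" and ?Z = "syzygy R_ring I_mod"
  let ?e = "free_basis R_ring I_ideal"
  obtain rr ss where rs: "\<And>x. x \<in> I_ideal \<Longrightarrow> rr x \<in> R_set" "\<And>x. x \<in> I_ideal \<Longrightarrow> ss x \<in> R_set"
    "\<And>x. x \<in> I_ideal \<Longrightarrow> x = rr x * tt + ss x * ta"
    using I_coordinates by blast
  have Fm: "Module.module R_ring ?F" by (rule R.R.free_mod_module)
  interpret F: module R_ring ?F by (rule Fm)
  have clF: "u x \<in> R_set" if "u \<in> carrier ?F" "x \<in> I_ideal" for u x
    using free_mod_closed[OF that(1), of x] that(2) by simp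
  have c: "cover_map R_ring I_mod \<in> lin_maps R_ring ?F I_mod"
    by (rule R.R.cover_map_linear[OF I_mod])
  have ce: "cover_map R_ring I_mod (?e x) = x" if "x \<in> I_ideal" for x
    using R.R.cover_map_basis[OF I_mod, of x] that by simp
  have e: "?e x \<in> carrier ?F" for x using R.R.free_basis_closed[of I_ideal x] by simp
  \<comment> \<open>coordinates with respect to \<open>t\<close> and \<open>\<alpha> t\<close>, linear on the free cover although \<open>rr\<close>, \<open>ss\<close> are arbitrary choices\<close>
  define P where "P = lin_extension R_ring (regular_mod R_ring) I_ideal rr"
  define Q where "Q = lin_extension R_ring (regular_mod R_ring) I_ideal ss"
  have rrPi: "rr \<in> I_ideal \<rightarrow> carrier (regular_mod R_ring)" and ssPi: "ss \<in> I_ideal \<rightarrow> carrier (regular_mod R_ring)"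
    using rs by auto
  have P: "P \<in> lin_maps R_ring ?F (regular_mod R_ring)" and Q: "Q \<in> lin_maps R_ring ?F (regular_mod R_ring)"
    using R.R.lin_extension_linear[OF reg_mod rrPi] R.R.lin_extension_linear[OF reg_mod ssPi]
    by (simp_all add: P_def Q_def)
  have Pe: "P (?e x) = rr x" and Qe: "Q (?e x) = ss x" if "x \<in> I_ideal" for x
    using R.R.lin_extension_basis[OF reg_mod rrPi that] R.R.lin_extension_basis[OF reg_mod ssPi that]
    by (simp_all add: P_def Q_def)
  have PR: "P u \<in> R_set" and QR: "Q u \<in> R_set" if "u \<in> carrier ?F" for u
    using lin_mapsD(2)[OF P that] lin_mapsD(2)[OF Q that] by simp_all
  have Padd: "P (u \<oplus>\<^bsub>?F\<^esub> v) = P u + P v" and Qadd: "Q (u \<oplus>\<^bsub>?F\<^esub> v) = Q u + Q v"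
    if "u \<in> carrier ?F" "v \<in> carrier ?F" for u v
    using lin_mapsD(3)[OF P that] lin_mapsD(3)[OF Q that] by simp_all
  have Psm: "P (r \<odot>\<^bsub>?F\<^esub> u) = r * P u" and Qsm: "Q (r \<odot>\<^bsub>?F\<^esub> u) = r * Q u"
    if "r \<in> R_set" "u \<in> carrier ?F" for u r
    using lin_mapsD(4)[OF P _ that(2), of r] lin_mapsD(4)[OF Q _ that(2), of r] that(1) by simp_all
  have tI: "tt \<in> I_ideal" and aI: "ta \<in> I_ideal" using gens_in_I by simp_all
  \<comment> \<open>both sides are linear in \<open>u\<close> and agree on the basis\<close>
  have cover: "cover_map R_ring I_mod u = P u * tt + Q u * ta" if u: "u \<in> carrier ?F" for u
  proof -
    let ?g = "\<lambda>u\<in>carrier ?F. P u * tt + Q u * ta"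
    have cl: "P u * tt + Q u * ta \<in> I_ideal" if "u \<in> carrier ?F" for u
      using PR[OF that] QR[OF that] tI aI by (intro I_D(3) I_D(5))
    have g: "?g \<in> lin_maps R_ring ?F I_mod"
    proof (rule lin_mapsI)
      fix u v assume uv: "u \<in> carrier ?F" "v \<in> carrier ?F"
      show "?g (u \<oplus>\<^bsub>?F\<^esub> v) = ?g u \<oplus>\<^bsub>I_mod\<^esub> ?g v"
        using uv F.a_closed[OF uv] Padd[OF uv] Qadd[OF uv] by (simp del: free_mod_simps add: algebra_simps)
    next
      fix r u assume ru: "r \<in> carrier R_ring" "u \<in> carrier ?F"
      show "?g (r \<odot>\<^bsub>?F\<^esub> u) = r \<odot>\<^bsub>I_mod\<^esub> ?g u"
        using ru F.smult_closed[OF ru] Psm[of r u] Qsm[of r u]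
        by (simp del: free_mod_simps add: algebra_simps)
    qed (use cl in auto)
    have "cover_map R_ring I_mod u = ?g u"
    proof (rule R.R.lin_maps_free_eqI[OF I_mod c g _ u])
      fix x assume "x \<in> carrier I_mod"
      then show "cover_map R_ring I_mod (free_basis R_ring (carrier I_mod) x)
          = ?g (free_basis R_ring (carrier I_mod) x)"
        using ce[of x] rs(3)[of x] e[of x] Pe[of x] Qe[of x] by simp
    qed
    then show ?thesis using u by simp
  qed
  \<comment> \<open>the lift of \<open>p t + q \<alpha> t\<close> that is supported on the two generators\<close>
  define U where "U p q = p \<odot>\<^bsub>?F\<^esub> ?e tt \<oplus>\<^bsub>?F\<^esub> q \<odot>\<^bsub>?F\<^esub> ?e ta" for p q
  have UF: "U p q \<in> carrier ?F" if "p \<in> R_set" "q \<in> R_set" for p q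
    unfolding U_def using that by (intro F.a_closed F.smult_closed e) simp_all
  have Uc: "cover_map R_ring I_mod (U p q) = p * tt + q * ta" if pq: "p \<in> R_set" "q \<in> R_set" for p q
  proof -
    have p: "p \<odot>\<^bsub>?F\<^esub> ?e tt \<in> carrier ?F" and q: "q \<odot>\<^bsub>?F\<^esub> ?e ta \<in> carrier ?F"
      using pq by (intro F.smult_closed e, simp)+
    show ?thesis
      unfolding U_def lin_mapsD(3)[OF c p q]
      using lin_mapsD(4)[OF c _ e, of p tt] lin_mapsD(4)[OF c _ e, of q ta] ce[OF tI] ce[OF aI] pq
      by (simp del: free_mod_simps)
  qed
  have Zeq: "carrier ?Z = {u \<in> carrier ?F. cover_map R_ring I_mod u = 0}"
    by (simp add: R.R.syzygy_carrier)
  have Uval: "U p q x = p * ?e tt x + q * ?e ta x" if "x \<in> I_ideal" for p q x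
    using that by (simp add: U_def)
  have U_add: "U (p + p') (q + q') = U p q \<oplus>\<^bsub>?F\<^esub> U p' q'" if "p \<in> R_set" "p' \<in> R_set" "q \<in> R_set" "q' \<in> R_set" for p p' q q'
    by (rule free_mod_eqI[OF UF F.a_closed[OF UF UF]])
      (use that in \<open>simp_all add: Uval R.add_in algebra_simps\<close>)
  have U_smult: "U (r * p) (r * q) = r \<odot>\<^bsub>?F\<^esub> U p q" if "r \<in> R_set" "p \<in> R_set" "q \<in> R_set" for r p q
    by (rule free_mod_eqI[OF UF F.smult_closed[OF _ UF]])
      (use that in \<open>simp_all add: Uval R.mult_in algebra_simps\<close>)
  have UZ: "U (- smult \<alpha> q) q \<in> carrier ?Z" if "q \<in> D" for q
  proof -
    have R: "- smult \<alpha> q \<in> R_set" "q \<in> R_set" using D_subset[OF that] R.uminus_in by auto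
    have "(- smult \<alpha> q) * tt + q * ta = 0" unfolding ta_eq(1) by (simp add: mult.commute)
    then show ?thesis using UF[OF R] Uc[OF R] by (simp only: Zeq mem_Collect_eq)
  qed
  define \<kappa> where "\<kappa> q = f (U (- smult \<alpha> q) q)" for q
  have \<kappa>I: "\<kappa> q \<in> I_ideal" if "q \<in> D" for q
    using lin_mapsD(2)[OF f UZ[OF that]] by (simp add: \<kappa>_def)
  have \<kappa>_mult: "\<kappa> (r * q) = r * \<kappa> q" if "r \<in> R_set" "q \<in> D" for r q
  proof -
    have "U (- smult \<alpha> (r * q)) (r * q) = r \<odot>\<^bsub>?Z\<^esub> U (- smult \<alpha> q) q"
      using U_smult[of r "- smult \<alpha> q" q] that D_subset[OF that(2)] R.uminus_in by simp
    then show ?thesis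
      using lin_mapsD(4)[OF f _ UZ[OF that(2)], of r] that(1) by (simp add: \<kappa>_def)
  qed
  \<comment> \<open>\<open>\<kappa>\<close> is multiplication by a fixed \<open>w\<close>, because \<open>t * \<kappa> q = q * \<kappa> t\<close>\<close>
  define w where "w = tdiv (\<kappa> tt)"
  have \<kappa>_eq: "\<kappa> q = q * w" if "q \<in> D" for q
  proof (rule tt_cancel)
    have "tt * \<kappa> q = \<kappa> (tt * q)" using \<kappa>_mult[OF D_subset(1)[OF tt_in_D] that] by simp
    also have "\<dots> = q * \<kappa> tt"
      using \<kappa>_mult[OF D_subset(1)[OF that] tt_in_D] by (simp add: mult.commute)
    also have "\<kappa> tt = tt * w" unfolding w_def by (rule I_tdiv[OF \<kappa>I[OF tt_in_D], symmetric])
    finally show "tt * \<kappa> q = tt * (q * w)" by (simp add: mult_ac)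
  qed
  have "q * w \<in> I_ideal" if "q \<in> D" for q using \<kappa>I[OF that] \<kappa>_eq[OF that] by simp
  then obtain y z where wyz: "w = y + smult \<alpha> z" "y \<in> I_ideal" "z \<in> I_ideal"
    using multiplier_D_I by blast
  \<comment> \<open>\<open>\<theta> u\<close> is a relation, and \<open>u\<close> differs from it by a lift supported on the two generators\<close>
  define \<theta> where "\<theta> u = u \<oplus>\<^bsub>?F\<^esub> U (- P u) (- Q u)" for u
  have \<theta>F: "\<theta> u \<in> carrier ?F" if "u \<in> carrier ?F" for u
    unfolding \<theta>_def by (intro F.a_closed UF R.uminus_in PR QR that)
  have \<theta>Z: "\<theta> u \<in> carrier ?Z" if u: "u \<in> carrier ?F" for u
  proof -
    have n: "- P u \<in> R_set" "- Q u \<in> R_set" using PR[OF u] QR[OF u] R.uminus_in by auto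
    have "cover_map R_ring I_mod (\<theta> u) = 0"
      unfolding \<theta>_def lin_mapsD(3)[OF c u UF[OF n]]
      using Uc[OF n] cover[OF u] by (simp add: algebra_simps)
    then show ?thesis using \<theta>F[OF u] by (simp add: Zeq)
  qed
  have \<theta>val: "\<theta> u x = u x - (P u * ?e tt x + Q u * ?e ta x)" if "u \<in> carrier ?F" "x \<in> I_ideal" for u x
    using that by (simp add: \<theta>_def Uval algebra_simps)
  have \<theta>_add: "\<theta> (u \<oplus>\<^bsub>?F\<^esub> v) = \<theta> u \<oplus>\<^bsub>?Z\<^esub> \<theta> v" if uv: "u \<in> carrier ?F" "v \<in> carrier ?F" for u v
    unfolding R.R.syzygy_simps
  proof (rule free_mod_eqI[OF \<theta>F[OF F.a_closed[OF uv]] F.a_closed[OF \<theta>F[OF uv(1)] \<theta>F[OF uv(2)]]])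
    fix x assume "x \<in> carrier I_mod"
    then have x: "x \<in> I_ideal" by simp
    have "(u \<oplus>\<^bsub>?F\<^esub> v) x = u x + v x" "(\<theta> u \<oplus>\<^bsub>?F\<^esub> \<theta> v) x = \<theta> u x + \<theta> v x" using x by simp_all
    then show "\<theta> (u \<oplus>\<^bsub>?F\<^esub> v) x = (\<theta> u \<oplus>\<^bsub>?F\<^esub> \<theta> v) x"
      unfolding \<theta>val[OF F.a_closed[OF uv] x] \<theta>val[OF uv(1) x] \<theta>val[OF uv(2) x] Padd[OF uv] Qadd[OF uv]
      by (simp add: algebra_simps del: free_mod_simps)
  qed
  have \<theta>_smult: "\<theta> (r \<odot>\<^bsub>?F\<^esub> u) = r \<odot>\<^bsub>?Z\<^esub> \<theta> u" if ru: "r \<in> carrier R_ring" "u \<in> carrier ?F" for r u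
    unfolding R.R.syzygy_simps
  proof (rule free_mod_eqI[OF \<theta>F[OF F.smult_closed[OF ru]] F.smult_closed[OF ru(1) \<theta>F[OF ru(2)]]])
    fix x assume "x \<in> carrier I_mod"
    then have x: "x \<in> I_ideal" by simp
    have r: "r \<in> R_set" using ru(1) by simp
    have "(r \<odot>\<^bsub>?F\<^esub> u) x = r * u x" "(r \<odot>\<^bsub>?F\<^esub> \<theta> u) x = r * \<theta> u x" using x by simp_all
    then show "\<theta> (r \<odot>\<^bsub>?F\<^esub> u) x = (r \<odot>\<^bsub>?F\<^esub> \<theta> u) x"
      unfolding \<theta>val[OF F.smult_closed[OF ru] x] \<theta>val[OF ru(2) x] Psm[OF r ru(2)] Qsm[OF r ru(2)]
      by (simp add: algebra_simps del: free_mod_simps)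
  qed
  define g where "g = (\<lambda>u\<in>carrier ?F. f (\<theta> u) + (Q u * y - P u * z))"
  have "g \<in> lin_maps R_ring ?F I_mod"
  proof (rule lin_mapsI)
    fix u assume u: "u \<in> carrier ?F"
    show "g u \<in> carrier I_mod"
      using lin_mapsD(2)[OF f \<theta>Z[OF u]] PR[OF u] QR[OF u] wyz u I_D(3,5,6)
      by (simp add: g_def)
  next
    fix u v assume uv: "u \<in> carrier ?F" "v \<in> carrier ?F"
    have "f (\<theta> (u \<oplus>\<^bsub>?F\<^esub> v)) = f (\<theta> u) + f (\<theta> v)"
      using lin_mapsD(3)[OF f \<theta>Z[OF uv(1)] \<theta>Z[OF uv(2)]] \<theta>_add[OF uv] by simp
    then show "g (u \<oplus>\<^bsub>?F\<^esub> v) = g u \<oplus>\<^bsub>I_mod\<^esub> g v"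
      using uv F.a_closed[OF uv] Padd[OF uv] Qadd[OF uv]
      by (simp del: free_mod_simps add: g_def algebra_simps)
  next
    fix r u assume ru: "r \<in> carrier R_ring" "u \<in> carrier ?F"
    have "f (\<theta> (r \<odot>\<^bsub>?F\<^esub> u)) = r * f (\<theta> u)"
      using lin_mapsD(4)[OF f ru(1) \<theta>Z[OF ru(2)]] \<theta>_smult[OF ru] by simp
    then show "g (r \<odot>\<^bsub>?F\<^esub> u) = r \<odot>\<^bsub>I_mod\<^esub> g u"
      using ru F.smult_closed[OF ru] Psm[of r u] Qsm[of r u]
      by (simp del: free_mod_simps add: g_def algebra_simps)
  qed (simp add: g_def)
  moreover have "g u = f u" if u: "u \<in> carrier ?Z" for u
  proof -
    have uF: "u \<in> carrier ?F" and u0: "P u * tt + Q u * ta = 0"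
      using u cover by (auto simp: Zeq)
    have "tt * P u = tt * (- smult \<alpha> (Q u))"
      using u0 unfolding ta_eq(1) by (simp add: mult.commute[of "P u"] eq_neg_iff_add_eq_0)
    then have Pu: "P u = - smult \<alpha> (Q u)" by (rule tt_cancel)
    then have "smult \<alpha> (Q u) = - P u" by simp
    then have QD: "Q u \<in> D" using QR[OF uF] PR[OF uF] R.uminus_in by (simp add: D_def)
    have "u = \<theta> u \<oplus>\<^bsub>?Z\<^esub> U (P u) (Q u)"
      unfolding R.R.syzygy_simps
      by (rule free_mod_eqI[OF uF F.a_closed[OF \<theta>F[OF uF] UF[OF PR[OF uF] QR[OF uF]]]])
        (use \<theta>val[OF uF] Uval in simp)
    then have "f u = f (\<theta> u) + \<kappa> (Q u)"
      using lin_mapsD(3)[OF f \<theta>Z[OF uF] UZ[OF QD]] Pu by (simp add: \<kappa>_def)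
    also have "\<kappa> (Q u) = Q u * y - P u * z"
      by (simp add: \<kappa>_eq[OF QD] wyz(1) Pu algebra_simps)
    finally show ?thesis using uF by (simp add: g_def)
  qed
  ultimately show ?thesis by blast
qed

lemma rigid_I: "rigid_ideal R_ring I_ideal"
  unfolding rigid_ideal_def
  using I_ideal_ideal R.R.Ext1_trivialI[OF I_mod I_mod extend_from_syzygy] by blast

section \<open>The evaluation map of \<open>I\<close>\<close>

lemma I_tdiv_form:
  assumes "x \<in> I_ideal"
  obtains r s where "r \<in> R_set" "s \<in> R_set" "x = r * tt + s * ta" "tdiv x = r + smult \<alpha> s"
proof -
  obtain r s where rs: "r \<in> R_set" "s \<in> R_set" "x = r * tt + s * ta"
    using assms unfolding I_ideal_gen by blast
  have "tt * tdiv x = x" by (rule I_tdiv[OF assms])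
  also have "x = tt * (r + smult \<alpha> s)" unfolding rs(3) ta_eq(1) by (simp add: algebra_simps)
  finally have "tdiv x = r + smult \<alpha> s" by (rule tt_cancel)
  with rs that show thesis by blast
qed

interpretation ES: evaluation_setup R_ring I_mod
  by (intro evaluation_setup.intro evaluation_setup_axioms.intro R.R.cring_axioms I_mod)

text \<open>The functional on \<open>I\<close> with \<open>t \<mapsto> a\<close>.\<close>

definition fa :: "L poly \<Rightarrow> L poly \<Rightarrow> L poly" where
  "fa a = (\<lambda>x\<in>I_ideal. a * tdiv x)"

lemma tdiv_add: "tdiv (x + y) = tdiv x + tdiv y"
  by (intro poly_eqI) (simp add: coeff_poly_shift)

lemma tdiv_mult: "x \<in> I_ideal \<Longrightarrow> r \<in> R_set \<Longrightarrow> tdiv (r * x) = r * tdiv x"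
proof (rule tt_cancel)
  assume x: "x \<in> I_ideal" "r \<in> R_set"
  have "tt * tdiv (r * x) = r * x" by (rule I_tdiv[OF I_D(5)[OF x(2,1)]])
  also have "\<dots> = tt * (r * tdiv x)"
    using I_tdiv[OF x(1)] by (metis mult.left_commute)
  finally show "tt * tdiv (r * x) = tt * (r * tdiv x)" .
qed

lemma tdiv_gens: "tdiv tt = 1" "tdiv ta = [:\<alpha>:]"
proof -
  show "tdiv tt = 1" by (intro poly_eqI) (simp add: coeff_poly_shift)
  show "tdiv ta = [:\<alpha>:]" by (intro poly_eqI) (simp add: coeff_poly_shift coeff_pCons split: nat.split)
qed

lemma fa_gens: "fa a tt = a" "fa a ta = smult \<alpha> a"
  by (simp_all only: fa_def restrict_apply gens_in_I if_True tdiv_gens) simp_all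

lemma fa_dual: "a \<in> D \<Longrightarrow> fa a \<in> carrier ES.dual"
proof -
  assume a: "a \<in> D"
  have cl: "a * tdiv x \<in> R_set" if xI: "x \<in> I_ideal" for x
  proof -
    obtain r s where rs: "r \<in> R_set" "s \<in> R_set" "tdiv x = r + smult \<alpha> s"
      using I_tdiv_form[OF xI] by metis
    have "a * tdiv x = r * a + s * smult \<alpha> a" unfolding rs(3) by (simp add: algebra_simps)
    also have "\<dots> \<in> R_set"
      by (intro R.add_in R.mult_in rs D_subset[OF a])
    finally show ?thesis .
  qed
  show ?thesis
    unfolding Hom_mod_carrier
  proof (rule lin_mapsI)
    fix x y assume "x \<in> carrier I_mod" "y \<in> carrier I_mod"
    then show "fa a (x \<oplus>\<^bsub>I_mod\<^esub> y) = fa a x \<oplus>\<^bsub>regular_mod R_ring\<^esub> fa a y"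
      using I_D(3)[of x y] by (simp add: fa_def tdiv_add[unfolded One_nat_def] distrib_left)
  next
    fix r x assume "r \<in> carrier R_ring" "x \<in> carrier I_mod"
    then show "fa a (r \<odot>\<^bsub>I_mod\<^esub> x) = r \<odot>\<^bsub>regular_mod R_ring\<^esub> fa a x"
      using I_D(5)[of r x] by (simp add: fa_def tdiv_mult[unfolded One_nat_def] mult.left_commute)
  qed (use cl in \<open>simp_all add: fa_def\<close>)
qed

lemma dual_fa:
  assumes f: "f \<in> carrier ES.dual"
  shows "f tt \<in> D" "f = fa (f tt)"
proof -
  have tI: "tt \<in> I_ideal" and aI: "ta \<in> I_ideal" using gens_in_I by simp_all
  have fR: "f x \<in> R_set" if "x \<in> I_ideal" for x using ES.dualD(1)[OF f, of x] that by simp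
  have key: "f x = f tt * tdiv x" if x: "x \<in> I_ideal" for x
  proof (rule tt_cancel)
    have "tt * f x = f (tt * x)" using ES.dualD(3)[OF f, of tt x] I_subset[OF tI] x by simp
    also have "\<dots> = f (x * tt)" by (simp add: mult.commute)
    also have "\<dots> = x * f tt" using ES.dualD(3)[OF f, of x tt] I_subset[OF x] tI by simp
    also have "\<dots> = tt * (f tt * tdiv x)" using I_tdiv[OF x] by (metis mult.assoc mult.commute)
    finally show "tt * f x = tt * (f tt * tdiv x)" .
  qed
  have "f ta = smult \<alpha> (f tt)" using key[OF aI] by (simp only: tdiv_gens) simp
  then show "f tt \<in> D" using fR[OF tI] fR[OF aI] by (simp add: D_def)
  have "f \<in> extensional I_ideal" using f lin_mapsD(1)[of f R_ring I_mod] by (simp add: Hom_mod_carrier)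
  then show "f = fa (f tt)" using key by (intro extensionalityI[of _ I_ideal]) (simp_all add: fa_def)
qed

lemma fa_add: "fa (a + b) = fa a \<oplus>\<^bsub>ES.dual\<^esub> fa b"
  by (auto simp: fa_def distrib_right)

lemma fa_mult: "fa (r * a) = r \<odot>\<^bsub>ES.dual\<^esub> fa a"
  by (auto simp: fa_def mult.assoc)

text \<open>In the tensor product \<open>e1 a\<close> and \<open>e2 a\<close> stand for \<open>t \<otimes> a\<close> and \<open>\<alpha> t \<otimes> a\<close>.\<close>

abbreviation tcong (infix "\<approx>" 50) where "u \<approx> v \<equiv> mod_cong ES.FF ES.NN u v"
abbreviation "e1 a \<equiv> ES.bb tt (fa a)"
abbreviation "e2 a \<equiv> ES.bb ta (fa a)"
abbreviation tplus (infixl "\<boxplus>" 65) where "u \<boxplus> v \<equiv> u \<oplus>\<^bsub>ES.FF\<^esub> v"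
abbreviation tsmult (infixr "\<boxdot>" 70) where "r \<boxdot> u \<equiv> r \<odot>\<^bsub>ES.FF\<^esub> u"

lemma e_add:
  assumes "a \<in> D" "b \<in> D"
  shows "e1 (a + b) \<approx> e1 a \<boxplus> e1 b" "e2 (a + b) \<approx> e2 a \<boxplus> e2 b"
  unfolding fa_add
  using ES.tensor_cong(2)[OF _ fa_dual[OF assms(1)] fa_dual[OF assms(2)]] gens_in_I by simp_all

lemma e_mult:
  assumes "a \<in> D" "r \<in> R_set"
  shows "e1 (r * a) \<approx> r \<boxdot> e1 a" "e2 (r * a) \<approx> r \<boxdot> e2 a"
  unfolding fa_mult
  using ES.tensor_cong(4)[OF _ _ fa_dual[OF assms(1)], of r] gens_in_I assms(2) by simp_all

text \<open>\<open>swaps b\<close> says that \<open>\<alpha> t \<otimes> b = t \<otimes> \<alpha> b\<close>. This holds for products of two elements of \<open>D\<close>, since one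
  factor can be moved across the tensor sign on either side.\<close>

definition swaps :: "L poly \<Rightarrow> bool" where
  "swaps b \<longleftrightarrow> b \<in> D \<and> smult \<alpha> b \<in> D \<and> e2 b \<approx> e1 (smult \<alpha> b)"

lemmas bb_simps = ES.bb_closed ES.FF.a_closed ES.FF.smult_closed

lemma swaps_add:
  assumes "swaps a" "swaps b"
  shows "swaps (a + b)"
proof -
  have ab: "a \<in> D" "b \<in> D" "smult \<alpha> a \<in> D" "smult \<alpha> b \<in> D" using assms by (auto simp: swaps_def)
  have "e2 a \<boxplus> e2 b \<approx> e1 (smult \<alpha> a) \<boxplus> e1 (smult \<alpha> b)"
    using assms by (intro ES.NN.cong_add) (auto simp: swaps_def)
  with e_add(2)[OF ab(1,2)] have "e2 (a + b) \<approx> e1 (smult \<alpha> a) \<boxplus> e1 (smult \<alpha> b)"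
    by (rule ES.NN.cong_trans)
  then have "e2 (a + b) \<approx> e1 (smult \<alpha> a + smult \<alpha> b)"
    by (rule ES.NN.cong_trans[OF _ ES.NN.cong_sym[OF e_add(1)[OF ab(3,4)]]])
  then show ?thesis using ab by (simp add: swaps_def D_add smult_add_right)
qed

lemma swaps_mult:
  assumes "r \<in> R_set" "swaps a"
  shows "swaps (r * a)"
proof -
  have a: "a \<in> D" "smult \<alpha> a \<in> D" using assms by (auto simp: swaps_def)
  have "r \<boxdot> e2 a \<approx> r \<boxdot> e1 (smult \<alpha> a)"
    using assms by (intro ES.NN.cong_smult) (auto simp: swaps_def)
  with e_mult(2)[OF a(1) assms(1)] have "e2 (r * a) \<approx> r \<boxdot> e1 (smult \<alpha> a)"
    by (rule ES.NN.cong_trans)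
  then have "e2 (r * a) \<approx> e1 (r * smult \<alpha> a)"
    by (rule ES.NN.cong_trans[OF _ ES.NN.cong_sym[OF e_mult(1)[OF a(2) assms(1)]]])
  then show ?thesis using a assms(1) D_mult[OF assms(1)] by (simp add: swaps_def mult_smult_right[symmetric] del: mult_smult_right)
qed

lemma swaps_product:
  assumes "c \<in> D" "d \<in> D"
  shows "swaps (c * d)"
proof -
  have c: "c \<in> R_set" "smult \<alpha> c \<in> R_set" using D_subset assms(1) by auto
  have f: "fa d \<in> carrier ES.dual" by (rule fa_dual[OF assms(2)])
  have eq: "c * ta = smult \<alpha> c * tt" unfolding ta_eq(1) by (rule mult.commute)
  have "e2 (c * d) \<approx> c \<boxdot> e2 d" by (rule e_mult(2)[OF assms(2) c(1)])
  moreover have "c \<boxdot> e2 d \<approx> ES.bb (c * ta) (fa d)"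
    using ES.NN.cong_sym[OF ES.tensor_cong(3)[OF _ _ f, of c ta]] c gens_in_I by simp
  moreover have "ES.bb (smult \<alpha> c * tt) (fa d) \<approx> smult \<alpha> c \<boxdot> e1 d"
    using ES.tensor_cong(3)[OF _ _ f, of "smult \<alpha> c" tt] c gens_in_I by simp
  moreover have "smult \<alpha> c \<boxdot> e1 d \<approx> e1 (smult \<alpha> c * d)"
    by (rule ES.NN.cong_sym[OF e_mult(1)[OF assms(2) c(2)]])
  ultimately have "e2 (c * d) \<approx> e1 (smult \<alpha> c * d)"
    unfolding eq using ES.NN.cong_trans by metis
  moreover have "c * d \<in> D" by (rule D_mult[OF c(1) assms(2)])
  moreover have "smult \<alpha> c * d \<in> D" by (rule D_mult[OF c(2) assms(2)])
  ultimately show ?thesis by (simp add: swaps_def)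
qed

lemma swaps_span:
  assumes "x \<in> span_L {u * u' | u u'. u \<in> A \<and> u' \<in> B}"
    and "\<And>u u'. u \<in> A \<Longrightarrow> u' \<in> B \<Longrightarrow> swaps (monom (u * u') i)"
  shows "swaps (monom x i)"
  using assms(1)
proof (induction rule: L.span_induct_alt)
  case base
  show ?case using swaps_product[OF D_0 D_0] by simp
next
  case (step c x y)
  then have "swaps (monom x i)" using assms(2) by auto
  then have "swaps (monom (scale_L c 1) 0 * monom x i + monom y i)"
    using step.IH const_in_R by (intro swaps_add swaps_mult)
  then show ?case by (simp add: mult_monom add_monom flip: scale_L_one_mult)
qed

text \<open>Such a \<open>b\<close> is a sum of \<open>R\<close>-multiples of products of two elements of \<open>D\<close>: in degree 1 this is
  \<open>V \<inter> \<alpha>\<^sup>-\<^sup>1 V = 0\<close>, in degree 2 it is \<open>V\<^sup>2 = L\<^sub>2\<^sub>0\<close>, in degree 3 and above it is \<open>V L\<^sub>2\<^sub>1 = L\<close>.\<close>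

lemma swapsI:
  assumes b: "b \<in> D" "smult \<alpha> b \<in> D"
  shows "swaps b"
proof -
  have c: "coeff b i \<in> D_coeffs i" "\<alpha> * coeff b i \<in> D_coeffs i" for i
    using b by (auto simp: D_iff)
  have zero: "swaps 0" using swaps_product[OF D_0 D_0] by simp
  have deg3: "swaps (monom x 3)" for x
  proof (rule swaps_span)
    show "x \<in> span_L {u * u' |u u'. u \<in> V \<and> u' \<in> L_upto 21}"
      using V_times_L_upto_21 unfolding space_prod_def by blast
    fix u u' assume "u \<in> V" "u' \<in> L_upto 21"
    then have "swaps (monom u 1 * monom u' 2)"
      by (intro swaps_product) (simp_all add: monom_in_D D_coeffs_def)
    then show "swaps (monom (u * u') 3)" by (simp add: mult_monom numeral_3_eq_3)
  qed
  have m: "swaps (monom (coeff b i) i)" for i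
  proof -
    consider "i = 0" | "i = 1" | "i = 2" | "i \<ge> 3" by linarith
    then show ?thesis
    proof cases
      case 1
      then show ?thesis using c[of 0] zero by (simp add: D_coeffs_def)
    next
      case 2
      have "coeff b 1 = 0"
        using c[of 1] by (intro V_alpha_V) (simp_all add: D_coeffs_def)
      then show ?thesis using 2 zero by simp
    next
      case 3
      have "coeff b 2 \<in> L_upto 20"
        using L_upto_alpha[of 20 "coeff b 2"] c[of 2] by (simp add: D_coeffs_def)
      then have "coeff b 2 \<in> span_L {u * u' |u u'. u \<in> V \<and> u' \<in> V}"
        using V_squared by (simp add: space_prod_def)
      then show ?thesis unfolding 3
      proof (rule swaps_span)
        fix u u' assume "u \<in> V" "u' \<in> V"
        then have "swaps (monom u 1 * monom u' 1)"
          by (intro swaps_product) (simp_all add: monom_in_D D_coeffs_def)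
        then show "swaps (monom (u * u') 2)" by (simp add: mult_monom numeral_2_eq_2)
      qed
    next
      case 4
      have "swaps (monom 1 (i - 3) * monom (coeff b i) 3)"
        by (rule swaps_mult[OF monom_1_in_R deg3])
      then show ?thesis using 4 by (simp add: mult_monom)
    qed
  qed
  have "swaps (sum f S)" if "\<And>i. i \<in> S \<Longrightarrow> swaps (f i)" for f and S :: "nat set"
    using that by (induction S rule: infinite_finite_induct) (simp_all add: zero swaps_add)
  from this[of "{..degree b}" "\<lambda>i. monom (coeff b i) i"] m
  show ?thesis by (simp add: poly_as_sum_of_monoms)
qed

lemma (in abelian_group) add_add_swap:
  assumes "a \<in> carrier G" "b \<in> carrier G" "c \<in> carrier G" "d \<in> carrier G"
  shows "(a \<oplus> b) \<oplus> (c \<oplus> d) = (a \<oplus> c) \<oplus> (b \<oplus> d)"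
  using assms by (simp add: a_ac)

lemma e_zero: "e1 0 \<approx> \<zero>\<^bsub>ES.FF\<^esub>"
proof -
  have "e1 (0 * 0) \<approx> 0 \<boxdot> e1 0" by (rule e_mult(1)[OF D_0 R.zero_in])
  moreover have "0 \<boxdot> e1 0 = \<zero>\<^bsub>ES.FF\<^esub>" using ES.FF.smult_l_null[OF ES.bb_closed] by simp
  ultimately show ?thesis by simp
qed

lemma e2_zero: "e2 0 \<approx> \<zero>\<^bsub>ES.FF\<^esub>"
proof -
  have "e2 (0 * 0) \<approx> 0 \<boxdot> e2 0" by (rule e_mult(2)[OF D_0 R.zero_in])
  moreover have "0 \<boxdot> e2 0 = \<zero>\<^bsub>ES.FF\<^esub>" using ES.FF.smult_l_null[OF ES.bb_closed] by simp
  ultimately show ?thesis by simp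
qed

text \<open>Every pure tensor has this form because \<open>t\<close> and \<open>\<alpha> t\<close> generate \<open>I\<close>.\<close>

lemma tensor_normal_form:
  assumes "u \<in> carrier ES.FF"
  shows "\<exists>a\<in>D. \<exists>b\<in>D. u \<approx> e1 a \<boxplus> e2 b"
  using assms
proof (induction rule: R.R.free_mod_induct)
  case zero
  have "e1 0 \<boxplus> e2 0 \<approx> \<zero>\<^bsub>ES.FF\<^esub> \<boxplus> \<zero>\<^bsub>ES.FF\<^esub>" by (rule ES.NN.cong_add[OF e_zero e2_zero])
  then have "\<zero>\<^bsub>ES.FF\<^esub> \<approx> e1 0 \<boxplus> e2 0"
    using ES.NN.cong_sym ES.FF.l_zero[OF ES.FF.zero_closed] by metis
  then show ?case by (intro bexI[of _ 0] D_0)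
next
  case (add u v)
  from add(3) obtain a b where u: "a \<in> D" "b \<in> D" "u \<approx> e1 a \<boxplus> e2 b" by (elim bexE)
  from add(4) obtain a' b' where v: "a' \<in> D" "b' \<in> D" "v \<approx> e1 a' \<boxplus> e2 b'" by (elim bexE)
  note ab = u(1,2) v(1,2) u(3) v(3)
  have eq: "(e1 a \<boxplus> e2 b) \<boxplus> (e1 a' \<boxplus> e2 b') = (e1 a \<boxplus> e1 a') \<boxplus> (e2 b \<boxplus> e2 b')"
    by (rule ES.FF.add_add_swap) (rule ES.bb_closed)+
  have "u \<boxplus> v \<approx> (e1 a \<boxplus> e1 a') \<boxplus> (e2 b \<boxplus> e2 b')"
    unfolding eq[symmetric] by (rule ES.NN.cong_add[OF ab(5,6)])
  moreover have "(e1 a \<boxplus> e1 a') \<boxplus> (e2 b \<boxplus> e2 b') \<approx> e1 (a + a') \<boxplus> e2 (b + b')"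
    by (intro ES.NN.cong_add ES.NN.cong_sym[OF e_add(1)] ES.NN.cong_sym[OF e_add(2)] ab)
  ultimately have "u \<boxplus> v \<approx> e1 (a + a') \<boxplus> e2 (b + b')" by (rule ES.NN.cong_trans)
  then show ?case by (intro bexI[of _ "a + a'"] bexI[of _ "b + b'"] D_add ab)
next
  case (scl r u)
  from scl(3) obtain a b where ab: "a \<in> D" "b \<in> D" "u \<approx> e1 a \<boxplus> e2 b" by (elim bexE)
  have r: "r \<in> carrier R_ring" "r \<in> R_set" using scl by auto
  have "r \<boxdot> u \<approx> r \<boxdot> (e1 a \<boxplus> e2 b)" by (rule ES.NN.cong_smult[OF r(1) ab(3)])
  moreover have "r \<boxdot> (e1 a \<boxplus> e2 b) = r \<boxdot> e1 a \<boxplus> r \<boxdot> e2 b"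
    by (rule ES.FF.smult_r_distr[OF r(1) ES.bb_closed ES.bb_closed])
  moreover have "r \<boxdot> e1 a \<boxplus> r \<boxdot> e2 b \<approx> e1 (r * a) \<boxplus> e2 (r * b)"
    by (intro ES.NN.cong_add ES.NN.cong_sym[OF e_mult(1)] ES.NN.cong_sym[OF e_mult(2)] ab r)
  ultimately have "r \<boxdot> u \<approx> e1 (r * a) \<boxplus> e2 (r * b)" using ES.NN.cong_trans by metis
  then show ?case by (intro bexI[of _ "r * a"] bexI[of _ "r * b"] D_mult[OF r(2)] ab)
next
  case (basis p)
  then obtain x f where p: "p = (x, f)" "x \<in> I_ideal" "f \<in> carrier ES.dual" by auto
  obtain r s where rs: "r \<in> R_set" "s \<in> R_set" "x = r * tt + s * ta"
    using I_tdiv_form[OF p(2)] by metis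
  have d: "f tt \<in> D" and f: "f = fa (f tt)" using dual_fa[OF p(3)] by auto
  have tI: "tt \<in> I_ideal" "ta \<in> I_ideal" using gens_in_I by auto
  have xs: "r * tt \<in> I_ideal" "s * ta \<in> I_ideal" using I_D(5) rs tI by auto
  have 1: "ES.bb x f \<approx> ES.bb (r * tt) f \<boxplus> ES.bb (s * ta) f"
    using ES.tensor_cong(1)[OF _ _ p(3), of "r * tt" "s * ta"] xs by (simp add: rs(3))
  have 2: "ES.bb (r * tt) f \<approx> r \<boxdot> ES.bb tt f"
    using ES.tensor_cong(3)[OF _ _ p(3), of r tt] rs tI by simp
  have 3: "ES.bb (s * ta) f \<approx> s \<boxdot> ES.bb ta f"
    using ES.tensor_cong(3)[OF _ _ p(3), of s ta] rs tI by simp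
  have 4: "r \<boxdot> ES.bb tt f \<approx> e1 (r * f tt)"
    using ES.NN.cong_sym[OF e_mult(1)[OF d rs(1)]] f by simp
  have 5: "s \<boxdot> ES.bb ta f \<approx> e2 (s * f tt)"
    using ES.NN.cong_sym[OF e_mult(2)[OF d rs(2)]] f by simp
  have "ES.bb x f \<approx> e1 (r * f tt) \<boxplus> e2 (s * f tt)"
    by (rule ES.NN.cong_trans[OF 1 ES.NN.cong_add[OF ES.NN.cong_trans[OF 2 4] ES.NN.cong_trans[OF 3 5]]])
  then show ?case unfolding p(1)
    by (intro bexI[of _ "r * f tt"] bexI[of _ "s * f tt"] D_mult rs d)
qed

lemma ev_cong: "u \<approx> v \<Longrightarrow> ES.ev u = ES.ev v"
proof -
  assume uv: "u \<approx> v"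
  then have c: "u \<in> carrier ES.FF" "v \<in> carrier ES.FF" by (auto simp: mod_cong_def)
  have "ES.NN +>\<^bsub>ES.FF\<^esub> u = ES.NN +>\<^bsub>ES.FF\<^esub> v" using ES.NN.coset_eq_iff[OF c] uv by simp
  then show ?thesis using ES.evaluation_map_coset[OF c(1)] ES.evaluation_map_coset[OF c(2)] by metis
qed

lemma ev_normal_form: "a \<in> D \<Longrightarrow> b \<in> D \<Longrightarrow> ES.ev (e1 a \<boxplus> e2 b) = a + smult \<alpha> b"
  using lin_mapsD(3)[OF ES.ev_linear ES.bb_closed ES.bb_closed, of tt "fa a" ta "fa b"]
    ES.ev_basis[of tt "fa a"] ES.ev_basis[of ta "fa b"] fa_dual gens_in_I fa_gens
  by (simp del: free_mod_simps)

lemma D_max_ideal: "a \<in> D \<Longrightarrow> b \<in> D \<Longrightarrow> a + smult \<alpha> b \<in> R_max_ideal"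
proof -
  assume ab: "a \<in> D" "b \<in> D"
  then have "coeff a 0 = 0" "coeff b 0 = 0"
    by (auto simp: D_iff D_coeffs_def dest: spec[of _ 0])
  then show ?thesis using D_subset[OF ab(1)] D_subset[OF ab(2)] by (simp add: R_max_ideal_def R.add_in)
qed

lemma max_ideal_D:
  assumes "p \<in> R_max_ideal"
  obtains a b where "p = a + smult \<alpha> b" "a \<in> D" "b \<in> D"
proof -
  have "\<exists>y z. coeff p i = y + \<alpha> * z \<and> y \<in> D_coeffs i \<and> z \<in> D_coeffs i" for i
  proof -
    have pi: "coeff p i \<in> R_coeffs i" "coeff p 0 = 0"
      using assms R_setD by (auto simp: R_max_ideal_def)
    consider "i = 0" | "i = 1" | "i = 2" | "i \<ge> 3" by linarith
    then show ?thesis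
    proof cases
      case 1
      then show ?thesis using pi by (simp add: D_coeffs_def)
    next
      case 2
      then show ?thesis using pi by (auto simp: D_coeffs_def R_coeffs_def W_def)
    next
      case 3
      then show ?thesis using pi L_upto_decomp[of "coeff p 2" 21] by (simp add: D_coeffs_def R_coeffs_def) metis
    next
      case 4
      then have "D_coeffs i = UNIV" by (simp add: D_coeffs_def)
      moreover have "coeff p i = coeff p i + \<alpha> * 0" by simp
      ultimately show ?thesis by blast
    qed
  qed
  then obtain a b where "p = a + smult \<alpha> b" "\<And>i. coeff a i \<in> D_coeffs i" "\<And>i. coeff b i \<in> D_coeffs i"
    using coefficientwise_combination[of D_coeffs p \<alpha>, OF L.subspace_0[OF D_coeffs_subspace]] by blast
  with that show thesis by (simp add: D_iff)
qed

lemma ev_in_max_ideal: "u \<in> carrier ES.FF \<Longrightarrow> ES.ev u \<in> R_max_ideal"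
proof -
  assume "u \<in> carrier ES.FF"
  then obtain a b where "a \<in> D" "b \<in> D" "u \<approx> e1 a \<boxplus> e2 b" using tensor_normal_form by meson
  then show ?thesis using ev_cong[of u "e1 a \<boxplus> e2 b"] ev_normal_form[of a b] D_max_ideal[of a b] by simp
qed

text \<open>If \<open>t \<otimes> a + \<alpha> t \<otimes> b\<close> is mapped to \<open>a + \<alpha> b = 0\<close>, then \<open>b\<close> and \<open>\<alpha> b = - a\<close> lie in \<open>D\<close>, and \<open>\<alpha> t \<otimes> b\<close> is
  \<open>t \<otimes> \<alpha> b = - t \<otimes> a\<close>.\<close>

lemma ev_injective:
  assumes u: "u \<in> carrier ES.FF" "ES.ev u = 0"
  shows "u \<in> ES.NN"
proof -
  obtain a b where ab: "a \<in> D" "b \<in> D" "u \<approx> e1 a \<boxplus> e2 b" using tensor_normal_form[OF u(1)] by (elim bexE)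
  have "a + smult \<alpha> b = 0" using u(2) ev_cong[OF ab(3)] ev_normal_form[OF ab(1,2)] by simp
  then have sb: "smult \<alpha> b = - a" by (simp add: eq_neg_iff_add_eq_0 add.commute)
  then have "swaps b" using ab D_uminus by (intro swapsI) simp_all
  then have "e2 b \<approx> e1 (- a)" by (simp add: swaps_def sb)
  then have "e1 a \<boxplus> e2 b \<approx> e1 a \<boxplus> e1 (- a)" by (intro ES.NN.cong_add ES.NN.cong_refl ES.bb_closed)
  moreover have "e1 a \<boxplus> e1 (- a) \<approx> e1 0"
    using ES.NN.cong_sym[OF e_add(1)[OF ab(1) D_uminus[OF ab(1)]]] by simp
  ultimately have "u \<approx> \<zero>\<^bsub>ES.FF\<^esub>"
    using ab(3) e_zero ES.NN.cong_trans by metis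
  then have "u \<in> ES.NN +>\<^bsub>ES.FF\<^esub> \<zero>\<^bsub>ES.FF\<^esub>"
    using ES.NN.coset_iff[OF ES.FF.zero_closed] by simp
  then obtain h where "h \<in> ES.NN" "u = h \<oplus>\<^bsub>ES.FF\<^esub> \<zero>\<^bsub>ES.FF\<^esub>" unfolding ES.NN.coset_def by blast
  then show ?thesis using ES.FF.r_zero[OF ES.NN.H_closed(1)] by simp
qed

lemma evaluation_iso:
  shows "\<forall>x\<in>carrier I_mod. \<forall>f\<in>carrier (dual_mod R_ring I_mod).
          evaluation_map R_ring I_mod (pure_tensor R_ring I_mod (dual_mod R_ring I_mod) x f) = f x"
    and "evaluation_map R_ring I_mod
      \<in> lin_maps R_ring (tensor_mod R_ring I_mod (dual_mod R_ring I_mod)) (ideal_mod R_ring R_max_ideal)"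
    and "bij_betw (evaluation_map R_ring I_mod)
      (carrier (tensor_mod R_ring I_mod (dual_mod R_ring I_mod))) R_max_ideal"
proof -
  show "\<forall>x\<in>carrier I_mod. \<forall>f\<in>carrier (dual_mod R_ring I_mod).
          evaluation_map R_ring I_mod (pure_tensor R_ring I_mod (dual_mod R_ring I_mod) x f) = f x"
    by (intro ballI ES.evaluation_pure_tensor)
  show "evaluation_map R_ring I_mod
      \<in> lin_maps R_ring (tensor_mod R_ring I_mod (dual_mod R_ring I_mod)) (ideal_mod R_ring R_max_ideal)"
    by (rule ES.evaluation_map_linear[OF ev_in_max_ideal])
  show "bij_betw (evaluation_map R_ring I_mod)
      (carrier (tensor_mod R_ring I_mod (dual_mod R_ring I_mod))) R_max_ideal"
  proof (rule ES.evaluation_map_bij[OF ev_in_max_ideal])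
    fix y assume "y \<in> R_max_ideal"
    then obtain a b where ab: "y = a + smult \<alpha> b" "a \<in> D" "b \<in> D" by (rule max_ideal_D)
    show "\<exists>u\<in>carrier ES.FF. ES.ev u = y"
      using ev_normal_form[OF ab(2,3)] ES.FF.a_closed[OF ES.bb_closed ES.bb_closed]
      unfolding ab(1) by blast
  next
    fix u assume "u \<in> carrier ES.FF" "ES.ev u = \<zero>\<^bsub>R_ring\<^esub>"
    then show "u \<in> ES.NN" by (intro ev_injective) simp_all
  qed
qed

section \<open>Baer's criterion\<close>

locale extension_problem = M: module A M + N: module A N + E: module A E
  for A (structure) and M and N and E +
  fixes i f
  assumes i: "i \<in> lin_maps A M N" and f: "f \<in> lin_maps A M E" and inj: "inj_on i (carrier M)"
    and baer: "\<And>J h. ideal J A \<Longrightarrow> (\<And>a. a \<in> J \<Longrightarrow> h a \<in> carrier E) \<Longrightarrow>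
      (\<And>a b. a \<in> J \<Longrightarrow> b \<in> J \<Longrightarrow> h (a \<oplus> b) = h a \<oplus>\<^bsub>E\<^esub> h b) \<Longrightarrow>
      (\<And>r a. r \<in> carrier A \<Longrightarrow> a \<in> J \<Longrightarrow> h (r \<otimes> a) = r \<odot>\<^bsub>E\<^esub> h a) \<Longrightarrow>
      \<exists>e\<in>carrier E. \<forall>a\<in>J. h a = a \<odot>\<^bsub>E\<^esub> e"
begin

text \<open>Graphs of linear maps from a submodule of \<open>N\<close> containing the image of \<open>i\<close>.\<close>

definition partial_ext where
  "partial_ext G \<longleftrightarrow> G \<subseteq> carrier N \<times> carrier E \<and> (\<forall>x\<in>carrier M. (i x, f x) \<in> G) \<and>
     (\<forall>x e y e'. (x, e) \<in> G \<and> (y, e') \<in> G \<longrightarrow> (x \<oplus>\<^bsub>N\<^esub> y, e \<oplus>\<^bsub>E\<^esub> e') \<in> G) \<and>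
     (\<forall>r\<in>carrier A. \<forall>x e. (x, e) \<in> G \<longrightarrow> (r \<odot>\<^bsub>N\<^esub> x, r \<odot>\<^bsub>E\<^esub> e) \<in> G) \<and>
     (\<forall>e. (\<zero>\<^bsub>N\<^esub>, e) \<in> G \<longrightarrow> e = \<zero>\<^bsub>E\<^esub>)"

lemma partial_extD:
  assumes "partial_ext G"
  shows "(x, e) \<in> G \<Longrightarrow> x \<in> carrier N" "(x, e) \<in> G \<Longrightarrow> e \<in> carrier E"
    "x' \<in> carrier M \<Longrightarrow> (i x', f x') \<in> G"
    "(x, e) \<in> G \<Longrightarrow> (y, e') \<in> G \<Longrightarrow> (x \<oplus>\<^bsub>N\<^esub> y, e \<oplus>\<^bsub>E\<^esub> e') \<in> G"
    "r \<in> carrier A \<Longrightarrow> (x, e) \<in> G \<Longrightarrow> (r \<odot>\<^bsub>N\<^esub> x, r \<odot>\<^bsub>E\<^esub> e) \<in> G"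
    "(\<zero>\<^bsub>N\<^esub>, e) \<in> G \<Longrightarrow> e = \<zero>\<^bsub>E\<^esub>"
  using assms by (auto simp: partial_ext_def)

lemma partial_ext_unique:
  assumes G: "partial_ext G" and e: "(x, e) \<in> G" "(x, e') \<in> G"
  shows "e = e'"
proof -
  note c = partial_extD(1,2)[OF G e(1)] partial_extD(2)[OF G e(2)]
  have one: "\<ominus> \<one> \<in> carrier A" by simp
  have "(x \<oplus>\<^bsub>N\<^esub> (\<ominus> \<one>) \<odot>\<^bsub>N\<^esub> x, e \<oplus>\<^bsub>E\<^esub> (\<ominus> \<one>) \<odot>\<^bsub>E\<^esub> e') \<in> G"
    by (intro partial_extD(4)[OF G e(1)] partial_extD(5)[OF G one] e(2))
  then have "(\<zero>\<^bsub>N\<^esub>, e \<ominus>\<^bsub>E\<^esub> e') \<in> G"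
    using c by (simp add: N.smult_l_minus E.smult_l_minus N.r_neg a_minus_def)
  then have "e \<ominus>\<^bsub>E\<^esub> e' = \<zero>\<^bsub>E\<^esub>" by (rule partial_extD(6)[OF G])
  then show ?thesis by (rule E.eq_if_minus_zero[OF c(2,3)])
qed

lemma partial_ext_neg: "partial_ext G \<Longrightarrow> (x, e) \<in> G \<Longrightarrow> (\<ominus>\<^bsub>N\<^esub> x, \<ominus>\<^bsub>E\<^esub> e) \<in> G"
  using partial_extD(5)[of G "\<ominus> \<one>" x e] partial_extD(1,2)[of G x e]
  by (simp add: N.smult_l_minus E.smult_l_minus)

lemma initial_graph: "partial_ext {(i x, f x) | x. x \<in> carrier M}"
proof -
  have "i \<zero>\<^bsub>M\<^esub> = \<zero>\<^bsub>N\<^esub>" "f \<zero>\<^bsub>M\<^esub> = \<zero>\<^bsub>E\<^esub>"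
    using lin_map_zero[OF M.module_axioms N.module_axioms i] lin_map_zero[OF M.module_axioms E.module_axioms f]
    by auto
  then have z: "f x = \<zero>\<^bsub>E\<^esub>" if "x \<in> carrier M" "i x = \<zero>\<^bsub>N\<^esub>" for x
    using that inj_onD[OF inj, of x "\<zero>\<^bsub>M\<^esub>"] by simp
  have add: "(i x \<oplus>\<^bsub>N\<^esub> i y, f x \<oplus>\<^bsub>E\<^esub> f y) \<in> {(i x, f x) | x. x \<in> carrier M}"
    if xy: "x \<in> carrier M" "y \<in> carrier M" for x y
    unfolding lin_mapsD(3)[OF i xy, symmetric] lin_mapsD(3)[OF f xy, symmetric]
    using M.a_closed[OF xy] by blast
  have scl: "(r \<odot>\<^bsub>N\<^esub> i x, r \<odot>\<^bsub>E\<^esub> f x) \<in> {(i x, f x) | x. x \<in> carrier M}"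
    if rx: "r \<in> carrier A" "x \<in> carrier M" for r x
    unfolding lin_mapsD(4)[OF i rx, symmetric] lin_mapsD(4)[OF f rx, symmetric]
    using M.smult_closed[OF rx] by blast
  show ?thesis
    unfolding partial_ext_def
  proof (intro conjI allI ballI impI)
    show "{(i x, f x) | x. x \<in> carrier M} \<subseteq> carrier N \<times> carrier E"
      using lin_mapsD(2)[OF i] lin_mapsD(2)[OF f] by auto
    show "e = \<zero>\<^bsub>E\<^esub>" if "(\<zero>\<^bsub>N\<^esub>, e) \<in> {(i x, f x) | x. x \<in> carrier M}" for e
      using that z by auto
  qed (use add scl in auto)
qed

lemma union_of_chain:
  assumes "C \<noteq> {}" "subset.chain {G. partial_ext G} C"
  shows "partial_ext (\<Union>C)"
proof -
  have C: "partial_ext G" if "G \<in> C" for G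
    using assms(2) that by (auto simp: subset.chain_def)
  have two: "\<exists>G\<in>C. p \<in> G \<and> q \<in> G" if "p \<in> \<Union>C" "q \<in> \<Union>C" for p q
  proof -
    obtain G H where "p \<in> G" "G \<in> C" "q \<in> H" "H \<in> C" using \<open>p \<in> \<Union>C\<close> \<open>q \<in> \<Union>C\<close> by blast
    moreover have "G \<subseteq> H \<or> H \<subseteq> G"
      using assms(2) \<open>G \<in> C\<close> \<open>H \<in> C\<close> by (rule subset_chain_def[THEN iffD1, THEN conjunct2, rule_format])
    ultimately show ?thesis by blast
  qed
  show ?thesis
    unfolding partial_ext_def
  proof (intro conjI allI ballI impI)
    show "\<Union>C \<subseteq> carrier N \<times> carrier E"
    proof (rule Union_least)
      show "G \<subseteq> carrier N \<times> carrier E" if "G \<in> C" for G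
        using C[OF that] by (simp add: partial_ext_def)
    qed
    fix x assume x: "x \<in> carrier M"
    obtain G where G: "G \<in> C" using assms(1) by blast
    show "(i x, f x) \<in> \<Union>C" by (rule UnionI[OF G partial_extD(3)[OF C[OF G] x]])
  next
    fix x e y e' assume "(x, e) \<in> \<Union>C \<and> (y, e') \<in> \<Union>C"
    then obtain G where G: "G \<in> C" "(x, e) \<in> G" "(y, e') \<in> G" using two[of "(x, e)" "(y, e')"] by auto
    show "(x \<oplus>\<^bsub>N\<^esub> y, e \<oplus>\<^bsub>E\<^esub> e') \<in> \<Union>C"
      by (rule UnionI[OF G(1) partial_extD(4)[OF C[OF G(1)] G(2,3)]])
  next
    fix r x e assume r: "r \<in> carrier A" and "(x, e) \<in> \<Union>C"
    then obtain G where G: "G \<in> C" "(x, e) \<in> G" by auto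
    show "(r \<odot>\<^bsub>N\<^esub> x, r \<odot>\<^bsub>E\<^esub> e) \<in> \<Union>C"
      by (rule UnionI[OF G(1) partial_extD(5)[OF C[OF G(1)] r G(2)]])
  next
    fix e assume "(\<zero>\<^bsub>N\<^esub>, e) \<in> \<Union>C"
    then obtain G where G: "G \<in> C" "(\<zero>\<^bsub>N\<^esub>, e) \<in> G" by auto
    show "e = \<zero>\<^bsub>E\<^esub>" by (rule partial_extD(6)[OF C[OF G(1)] G(2)])
  qed
qed

text \<open>The criterion is applied to the ideal of all \<open>a\<close> for which the multiple \<open>a n\<close> already has a value; it
  provides a value for \<open>n\<close> that is compatible with these.\<close>

lemma enlarge:
  assumes G: "partial_ext G" and n: "n \<in> carrier N"
  obtains e where "e \<in> carrier E"
    "partial_ext {(x \<oplus>\<^bsub>N\<^esub> a \<odot>\<^bsub>N\<^esub> n, y \<oplus>\<^bsub>E\<^esub> a \<odot>\<^bsub>E\<^esub> e) | x y a. (x, y) \<in> G \<and> a \<in> carrier A}"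
proof -
  define J where "J = {a \<in> carrier A. \<exists>y. (a \<odot>\<^bsub>N\<^esub> n, y) \<in> G}"
  define h where "h a = (SOME y. (a \<odot>\<^bsub>N\<^esub> n, y) \<in> G)" for a
  have h: "(a \<odot>\<^bsub>N\<^esub> n, h a) \<in> G" if "a \<in> J" for a
    using that someI_ex[of "\<lambda>y. (a \<odot>\<^bsub>N\<^esub> n, y) \<in> G"] by (auto simp: J_def h_def)
  have hI: "h a = y" if "(a \<odot>\<^bsub>N\<^esub> n, y) \<in> G" for a y
    using partial_ext_unique[OF G _ that] someI[of "\<lambda>y. (a \<odot>\<^bsub>N\<^esub> n, y) \<in> G", OF that] by (simp add: h_def)
  have JI: "a \<in> J" if "a \<in> carrier A" "(a \<odot>\<^bsub>N\<^esub> n, y) \<in> G" for a y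
    unfolding J_def using that by blast
  have JA: "a \<in> carrier A" if "a \<in> J" for a using that by (simp add: J_def)
  have zeroG: "(\<zero>\<^bsub>N\<^esub>, \<zero>\<^bsub>E\<^esub>) \<in> G"
    using partial_extD(3)[OF G M.zero_closed] lin_map_zero[OF M.module_axioms N.module_axioms i]
      lin_map_zero[OF M.module_axioms E.module_axioms f] by simp
  have addG: "((a \<oplus> b) \<odot>\<^bsub>N\<^esub> n, h a \<oplus>\<^bsub>E\<^esub> h b) \<in> G" if "a \<in> J" "b \<in> J" for a b
    using partial_extD(4)[OF G h[OF that(1)] h[OF that(2)]] JA[OF that(1)] JA[OF that(2)] n
    by (simp add: N.smult_l_distr)
  have mulG: "((r \<otimes> a) \<odot>\<^bsub>N\<^esub> n, r \<odot>\<^bsub>E\<^esub> h a) \<in> G" if "r \<in> carrier A" "a \<in> J" for r a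
    using partial_extD(5)[OF G that(1) h[OF that(2)]] that(1) JA[OF that(2)] n
    by (simp add: N.smult_assoc1)
  have idl: "ideal J A"
  proof (rule idealI)
    show "ring A" by (rule M.ring_axioms)
    have "\<zero> \<in> J" using JI[of \<zero> "\<zero>\<^bsub>E\<^esub>"] zeroG n by simp
    show "subgroup J (add_monoid A)"
    proof (rule M.R.add.subgroupI)
      show "J \<subseteq> carrier A" using JA by blast
      show "J \<noteq> {}" using \<open>\<zero> \<in> J\<close> by blast
      fix a assume a: "a \<in> J"
      have "((\<ominus> \<one>) \<otimes> a) \<in> J" using JI[OF _ mulG[OF _ a, of "\<ominus> \<one>"]] JA[OF a] by simp
      then show "\<ominus> a \<in> J" using JA[OF a] by (simp add: M.l_minus)
      fix b assume b: "b \<in> J"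
      then show "a \<oplus> b \<in> J" using JI[OF _ addG[OF a b]] JA[OF a] JA[OF b] by simp
    qed
    fix a x assume ax: "a \<in> J" "x \<in> carrier A"
    show "x \<otimes> a \<in> J" using JI[OF _ mulG[OF ax(2,1)]] ax(2) JA[OF ax(1)] by simp
    then show "a \<otimes> x \<in> J" using ax(2) JA[OF ax(1)] by (simp add: M.m_comm)
  qed
  obtain e where e: "e \<in> carrier E" "\<And>a. a \<in> J \<Longrightarrow> h a = a \<odot>\<^bsub>E\<^esub> e"
  proof -
    have "\<exists>e\<in>carrier E. \<forall>a\<in>J. h a = a \<odot>\<^bsub>E\<^esub> e"
    proof (rule baer[OF idl])
      show "h a \<in> carrier E" if "a \<in> J" for a by (rule partial_extD(2)[OF G h[OF that]])
      show "h (a \<oplus> b) = h a \<oplus>\<^bsub>E\<^esub> h b" if "a \<in> J" "b \<in> J" for a b by (rule hI[OF addG[OF that]])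
      show "h (r \<otimes> a) = r \<odot>\<^bsub>E\<^esub> h a" if "r \<in> carrier A" "a \<in> J" for r a by (rule hI[OF mulG[OF that]])
    qed
    with that show ?thesis by blast
  qed
  let ?G = "{(x \<oplus>\<^bsub>N\<^esub> a \<odot>\<^bsub>N\<^esub> n, y \<oplus>\<^bsub>E\<^esub> a \<odot>\<^bsub>E\<^esub> e) | x y a. (x, y) \<in> G \<and> a \<in> carrier A}"
  note cN = partial_extD(1)[OF G] and cE = partial_extD(2)[OF G]
  have "partial_ext ?G"
    unfolding partial_ext_def
  proof (intro conjI allI ballI impI)
    show "?G \<subseteq> carrier N \<times> carrier E" using cN cE n e(1) by auto
    fix x assume x: "x \<in> carrier M"
    have "i x = i x \<oplus>\<^bsub>N\<^esub> \<zero> \<odot>\<^bsub>N\<^esub> n" "f x = f x \<oplus>\<^bsub>E\<^esub> \<zero> \<odot>\<^bsub>E\<^esub> e"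
      using lin_mapsD(2)[OF i x] lin_mapsD(2)[OF f x] n e(1) by simp_all
    then show "(i x, f x) \<in> ?G" using partial_extD(3)[OF G x] M.zero_closed by blast
  next
    fix p q p' q' assume "(p, q) \<in> ?G \<and> (p', q') \<in> ?G"
    then obtain x y a x' y' a' where
      p: "p = x \<oplus>\<^bsub>N\<^esub> a \<odot>\<^bsub>N\<^esub> n" "q = y \<oplus>\<^bsub>E\<^esub> a \<odot>\<^bsub>E\<^esub> e" "(x, y) \<in> G" "a \<in> carrier A" and
      p': "p' = x' \<oplus>\<^bsub>N\<^esub> a' \<odot>\<^bsub>N\<^esub> n" "q' = y' \<oplus>\<^bsub>E\<^esub> a' \<odot>\<^bsub>E\<^esub> e" "(x', y') \<in> G" "a' \<in> carrier A"
      by blast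
    have "p \<oplus>\<^bsub>N\<^esub> p' = (x \<oplus>\<^bsub>N\<^esub> x') \<oplus>\<^bsub>N\<^esub> (a \<oplus> a') \<odot>\<^bsub>N\<^esub> n"
      unfolding p(1) p'(1) using cN[OF p(3)] cN[OF p'(3)] p(4) p'(4) n
      by (simp add: N.smult_l_distr N.add_add_swap)
    moreover have "q \<oplus>\<^bsub>E\<^esub> q' = (y \<oplus>\<^bsub>E\<^esub> y') \<oplus>\<^bsub>E\<^esub> (a \<oplus> a') \<odot>\<^bsub>E\<^esub> e"
      unfolding p(2) p'(2) using cE[OF p(3)] cE[OF p'(3)] p(4) p'(4) e(1)
      by (simp add: E.smult_l_distr E.add_add_swap)
    moreover have "(x \<oplus>\<^bsub>N\<^esub> x', y \<oplus>\<^bsub>E\<^esub> y') \<in> G" by (rule partial_extD(4)[OF G p(3) p'(3)])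
    moreover have "a \<oplus> a' \<in> carrier A" using p(4) p'(4) by simp
    ultimately show "(p \<oplus>\<^bsub>N\<^esub> p', q \<oplus>\<^bsub>E\<^esub> q') \<in> ?G" by blast
  next
    fix r p q assume r: "r \<in> carrier A" and "(p, q) \<in> ?G"
    then obtain x y a where
      p: "p = x \<oplus>\<^bsub>N\<^esub> a \<odot>\<^bsub>N\<^esub> n" "q = y \<oplus>\<^bsub>E\<^esub> a \<odot>\<^bsub>E\<^esub> e" "(x, y) \<in> G" "a \<in> carrier A"
      by blast
    have "r \<odot>\<^bsub>N\<^esub> p = (r \<odot>\<^bsub>N\<^esub> x) \<oplus>\<^bsub>N\<^esub> (r \<otimes> a) \<odot>\<^bsub>N\<^esub> n"
      unfolding p(1) using cN[OF p(3)] p(4) n r by (simp add: N.smult_r_distr N.smult_assoc1)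
    moreover have "r \<odot>\<^bsub>E\<^esub> q = (r \<odot>\<^bsub>E\<^esub> y) \<oplus>\<^bsub>E\<^esub> (r \<otimes> a) \<odot>\<^bsub>E\<^esub> e"
      unfolding p(2) using cE[OF p(3)] p(4) e(1) r by (simp add: E.smult_r_distr E.smult_assoc1)
    moreover have "(r \<odot>\<^bsub>N\<^esub> x, r \<odot>\<^bsub>E\<^esub> y) \<in> G" by (rule partial_extD(5)[OF G r p(3)])
    moreover have "r \<otimes> a \<in> carrier A" using p(4) r by simp
    ultimately show "(r \<odot>\<^bsub>N\<^esub> p, r \<odot>\<^bsub>E\<^esub> q) \<in> ?G" by blast
  next
    fix q assume "(\<zero>\<^bsub>N\<^esub>, q) \<in> ?G"
    then obtain x y a where
      p: "\<zero>\<^bsub>N\<^esub> = x \<oplus>\<^bsub>N\<^esub> a \<odot>\<^bsub>N\<^esub> n" "q = y \<oplus>\<^bsub>E\<^esub> a \<odot>\<^bsub>E\<^esub> e" "(x, y) \<in> G" "a \<in> carrier A"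
      by blast
    have an: "a \<odot>\<^bsub>N\<^esub> n \<in> carrier N" using p(4) n by simp
    have "\<ominus>\<^bsub>N\<^esub> x = a \<odot>\<^bsub>N\<^esub> n"
      using N.minus_equality[of "a \<odot>\<^bsub>N\<^esub> n" x] p(1) an cN[OF p(3)] by (simp add: N.a_comm)
    then have g: "(a \<odot>\<^bsub>N\<^esub> n, \<ominus>\<^bsub>E\<^esub> y) \<in> G" using partial_ext_neg[OF G p(3)] by simp
    then have "a \<in> J" by (rule JI[OF p(4)])
    then have "a \<odot>\<^bsub>E\<^esub> e = \<ominus>\<^bsub>E\<^esub> y" using e(2) hI[OF g] by simp
    then show "q = \<zero>\<^bsub>E\<^esub>" using cE[OF p(3)] by (simp add: p(2) E.r_neg)
  qed
  with e(1) that show thesis by blast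
qed

text \<open>A partial extension that is maximal by Zorn's lemma is defined on all of \<open>N\<close>.\<close>

lemma extension_exists: "\<exists>g\<in>lin_maps A N E. \<forall>x\<in>carrier M. g (i x) = f x"
proof -
  have "{G. partial_ext G} \<noteq> {}" using initial_graph by blast
  moreover have "\<Union>C \<in> {G. partial_ext G}" if "C \<noteq> {}" "subset.chain {G. partial_ext G} C" for C
    using union_of_chain[OF that] by simp
  ultimately obtain G where G: "partial_ext G" and max: "\<And>H. partial_ext H \<Longrightarrow> G \<subseteq> H \<Longrightarrow> H = G"
    using subset_Zorn_nonempty[of "{G. partial_ext G}"] by auto
  have total: "\<exists>y. (n, y) \<in> G" if n: "n \<in> carrier N" for n
  proof -
    obtain e where e: "e \<in> carrier E"
      "partial_ext {(x \<oplus>\<^bsub>N\<^esub> a \<odot>\<^bsub>N\<^esub> n, y \<oplus>\<^bsub>E\<^esub> a \<odot>\<^bsub>E\<^esub> e) | x y a. (x, y) \<in> G \<and> a \<in> carrier A}"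
      (is "partial_ext ?G") using enlarge[OF G n] by blast
    have "G \<subseteq> ?G"
    proof
      fix p assume p: "p \<in> G"
      then obtain x y where xy: "p = (x, y)" "(x, y) \<in> G" by (cases p) auto
      have "x = x \<oplus>\<^bsub>N\<^esub> \<zero> \<odot>\<^bsub>N\<^esub> n" "y = y \<oplus>\<^bsub>E\<^esub> \<zero> \<odot>\<^bsub>E\<^esub> e"
        using partial_extD(1,2)[OF G xy(2)] n e(1) by simp_all
      then show "p \<in> ?G" using xy M.zero_closed by blast
    qed
    then have GG: "?G = G" by (rule max[OF e(2)])
    have z: "(\<zero>\<^bsub>N\<^esub>, \<zero>\<^bsub>E\<^esub>) \<in> G"
      using partial_extD(3)[OF G M.zero_closed] lin_map_zero[OF M.module_axioms N.module_axioms i]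
        lin_map_zero[OF M.module_axioms E.module_axioms f] by simp
    have "n = \<zero>\<^bsub>N\<^esub> \<oplus>\<^bsub>N\<^esub> \<one> \<odot>\<^bsub>N\<^esub> n" using n by simp
    then have "(n, \<zero>\<^bsub>E\<^esub> \<oplus>\<^bsub>E\<^esub> \<one> \<odot>\<^bsub>E\<^esub> e) \<in> ?G" using z M.one_closed by blast
    then show ?thesis using GG by auto
  qed
  define g where "g = (\<lambda>n\<in>carrier N. SOME y. (n, y) \<in> G)"
  have g: "(n, g n) \<in> G" if "n \<in> carrier N" for n
    using that someI_ex[OF total[OF that]] by (simp add: g_def)
  have gI: "g n = y" if "(n, y) \<in> G" for n y
    using partial_ext_unique[OF G g[OF partial_extD(1)[OF G that]] that] .
  have "g \<in> lin_maps A N E"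
  proof (rule lin_mapsI)
    show "g \<in> extensional (carrier N)" by (simp add: g_def)
    show "g x \<in> carrier E" if "x \<in> carrier N" for x by (rule partial_extD(2)[OF G g[OF that]])
    show "g (x \<oplus>\<^bsub>N\<^esub> y) = g x \<oplus>\<^bsub>E\<^esub> g y" if "x \<in> carrier N" "y \<in> carrier N" for x y
      by (rule gI[OF partial_extD(4)[OF G g[OF that(1)] g[OF that(2)]]])
    show "g (r \<odot>\<^bsub>N\<^esub> x) = r \<odot>\<^bsub>E\<^esub> g x" if "r \<in> carrier A" "x \<in> carrier N" for r x
      by (rule gI[OF partial_extD(5)[OF G that(1) g[OF that(2)]]])
  qed
  moreover have "g (i x) = f x" if "x \<in> carrier M" for x by (rule gI[OF partial_extD(3)[OF G that]])
  ultimately show ?thesis by blast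
qed

end

text \<open>Used in place of dimension counts for finite-dimensional quotients. In the induction the claim is
  applied to the kernel of one of the functionals, on which the others have the same property.\<close>

lemma (in vector_space) functional_combination:
  assumes "finite F" "subspace X"
    and "\<And>u x y. u \<in> F \<Longrightarrow> x \<in> X \<Longrightarrow> y \<in> X \<Longrightarrow> \<phi> u (x + y) = \<phi> u x + (\<phi> u y :: 'a)"
    and "\<And>u c x. u \<in> F \<Longrightarrow> x \<in> X \<Longrightarrow> \<phi> u (c *s x) = c * \<phi> u x"
    and "\<And>x y. x \<in> X \<Longrightarrow> y \<in> X \<Longrightarrow> \<psi> (x + y) = \<psi> x + \<psi> y"
    and "\<And>c x. x \<in> X \<Longrightarrow> \<psi> (c *s x) = c * \<psi> x"
    and "\<And>x. x \<in> X \<Longrightarrow> (\<And>u. u \<in> F \<Longrightarrow> \<phi> u x = 0) \<Longrightarrow> \<psi> x = 0"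
  shows "\<exists>c. \<forall>x\<in>X. \<psi> x = (\<Sum>u\<in>F. c u * \<phi> u x)"
  using assms
proof (induction F arbitrary: X \<psi> rule: finite_induct)
  case empty
  then show ?case by auto
next
  case (insert v F)
  note X = insert.prems(1)
  note \<phi>a = insert.prems(2) and \<phi>s = insert.prems(3) and \<psi>a = insert.prems(4) and \<psi>s = insert.prems(5)
  let ?X = "{x \<in> X. \<phi> v x = 0}"
  have zero: "\<phi> v 0 = 0" using \<phi>s[of v 0 0] subspace_0[OF X] by simp
  have sX: "subspace ?X"
    by (rule subspaceI) (use zero subspace_0[OF X] subspace_add[OF X] subspace_scale[OF X] \<phi>a \<phi>s in auto)
  have "\<exists>c. \<forall>x\<in>?X. \<psi> x = (\<Sum>u\<in>F. c u * \<phi> u x)"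
  proof (rule insert.IH[OF sX])
    fix x assume "x \<in> ?X" and "\<And>u. u \<in> F \<Longrightarrow> \<phi> u x = 0"
    then show "\<psi> x = 0" using insert.prems(6)[of x] by auto
  qed (use \<phi>a \<phi>s \<psi>a \<psi>s in auto)
  then obtain c where c: "\<And>x. x \<in> X \<Longrightarrow> \<phi> v x = 0 \<Longrightarrow> \<psi> x = (\<Sum>u\<in>F. c u * \<phi> u x)" by auto
  define \<chi> where "\<chi> x = \<psi> x - (\<Sum>u\<in>F. c u * \<phi> u x)" for x
  have \<chi>0: "\<chi> x = 0" if "x \<in> X" "\<phi> v x = 0" for x using c that by (simp add: \<chi>_def)
  have \<chi>a: "\<chi> (x + y) = \<chi> x + \<chi> y" if "x \<in> X" "y \<in> X" for x y
    using that \<psi>a \<phi>a by (simp add: \<chi>_def distrib_left sum.distrib)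
  have \<chi>s: "\<chi> (a *s x) = a * \<chi> x" if "x \<in> X" for a x
    using that \<psi>s \<phi>s by (simp add: \<chi>_def sum_distrib_left right_diff_distrib mult_ac)
  have "\<exists>d. \<forall>x\<in>X. \<chi> x = d * \<phi> v x"
  proof (cases "\<forall>x\<in>X. \<phi> v x = 0")
    case True
    then show ?thesis using \<chi>0 by auto
  next
    case False
    then obtain z where z: "z \<in> X" "\<phi> v z \<noteq> 0" by blast
    have "\<chi> x = (\<chi> z / \<phi> v z) * \<phi> v x" if x: "x \<in> X" for x
    proof -
      let ?r = "- (\<phi> v x / \<phi> v z)"
      have rz: "?r *s z \<in> X" by (rule subspace_scale[OF X z(1)])
      have "\<phi> v (x + ?r *s z) = 0"
        using \<phi>a[OF _ x rz, of v] \<phi>s[OF _ z(1), of v ?r] z(2) by simp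
      then have "\<chi> (x + ?r *s z) = 0" using \<chi>0 subspace_add[OF X x rz] by blast
      then show ?thesis using \<chi>a[OF x rz] \<chi>s[OF z(1), of ?r] by (simp add: field_simps)
    qed
    then show ?thesis by blast
  qed
  then obtain d where d: "\<And>x. x \<in> X \<Longrightarrow> \<chi> x = d * \<phi> v x" by blast
  have "\<psi> x = (\<Sum>u\<in>insert v F. (c(v := d)) u * \<phi> u x)" if "x \<in> X" for x
  proof -
    have "(\<Sum>u\<in>F. (c(v := d)) u * \<phi> u x) = (\<Sum>u\<in>F. c u * \<phi> u x)"
      using insert.hyps by (intro sum.cong) auto
    then show ?thesis using d[OF that] insert.hyps by (simp add: \<chi>_def algebra_simps)
  qed
  then show ?case by blast
qed

section \<open>The injective modules \<open>K / H\<close>\<close>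

text \<open>\<open>A\<close> is a ring given abstractly, \<open>val\<close> an isomorphism onto a subring \<open>A'\<close> of a field \<open>K\<close>. For an
  \<open>A'\<close>-submodule \<open>H\<close> of \<open>K\<close>, the quotient \<open>K / H\<close> is realized on a prescribed type by means of an
  injection \<open>emb\<close> of the subsets of \<open>K\<close>.\<close>

locale fraction_model = concrete_ring A' for A' :: "'k::field set" +
  fixes A :: "('a, 'b) ring_scheme" (structure) and val :: "'a \<Rightarrow> 'k"
    and emb :: "'k set \<Rightarrow> ('a \<times> nat) set"
  assumes bij: "bij_betw val (carrier A) A'"
    and add: "x \<in> carrier A \<Longrightarrow> y \<in> carrier A \<Longrightarrow> x \<oplus> y \<in> carrier A \<and> val (x \<oplus> y) = val x + val y"
    and mult: "x \<in> carrier A \<Longrightarrow> y \<in> carrier A \<Longrightarrow> x \<otimes> y \<in> carrier A \<and> val (x \<otimes> y) = val x * val y"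
    and zero: "\<zero> \<in> carrier A \<and> val \<zero> = 0" and one: "\<one> \<in> carrier A \<and> val \<one> = 1"
    and emb: "inj emb"
begin

lemma val_closed: "x \<in> carrier A \<Longrightarrow> val x \<in> A'"
  using bij by (auto simp: bij_betw_def)

lemma val_inj: "x \<in> carrier A \<Longrightarrow> y \<in> carrier A \<Longrightarrow> val x = val y \<Longrightarrow> x = y"
  using bij by (auto simp: bij_betw_def inj_on_def)

lemma val_surj: "k \<in> A' \<Longrightarrow> \<exists>x\<in>carrier A. val x = k"
  using bij by (auto simp: bij_betw_def)

lemma A_cring: "cring A"
proof (rule cringI)
  show "abelian_group A"
  proof (rule abelian_groupI)
    fix x assume x: "x \<in> carrier A"
    obtain y where y: "y \<in> carrier A" "val y = - val x" using val_surj[OF uminus_in[OF val_closed[OF x]]] by blast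
    then have "y \<oplus> x = \<zero>" using x add zero by (intro val_inj) auto
    with y(1) show "\<exists>y\<in>carrier A. y \<oplus> x = \<zero>" by blast
    fix y assume y: "y \<in> carrier A"
    show "x \<oplus> y \<in> carrier A" using add[OF x y] by simp
    show "x \<oplus> y = y \<oplus> x" using add[OF x y] add[OF y x] by (intro val_inj) auto
    fix z assume z: "z \<in> carrier A"
    show "x \<oplus> y \<oplus> z = x \<oplus> (y \<oplus> z)"
      using x y z add by (intro val_inj) (auto simp: add.assoc)
  next
    fix x assume x: "x \<in> carrier A"
    show "\<zero> \<oplus> x = x" using x add zero by (intro val_inj) auto
  qed (use zero in auto)
  show "Group.comm_monoid A"
  proof (rule comm_monoidI)
    fix x y z assume xyz: "x \<in> carrier A" "y \<in> carrier A" "z \<in> carrier A"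
    then show "x \<otimes> y \<otimes> z = x \<otimes> (y \<otimes> z)" using mult by (intro val_inj) (auto simp: mult.assoc)
  next
    fix x y assume xy: "x \<in> carrier A" "y \<in> carrier A"
    then show "x \<otimes> y \<in> carrier A" using mult by auto
    show "x \<otimes> y = y \<otimes> x" using mult[OF xy] mult[OF xy(2,1)] by (intro val_inj) auto
  next
    fix x assume x: "x \<in> carrier A"
    then show "\<one> \<otimes> x = x" using mult one by (intro val_inj) auto
  qed (use one in auto)
  fix x y z assume xyz: "x \<in> carrier A" "y \<in> carrier A" "z \<in> carrier A"
  then show "(x \<oplus> y) \<otimes> z = x \<otimes> z \<oplus> y \<otimes> z"
    using add mult by (intro val_inj) (auto simp: distrib_right)
qed

definition submod :: "'k set \<Rightarrow> bool" where
  "submod H \<longleftrightarrow> 0 \<in> H \<and> (\<forall>x\<in>H. \<forall>y\<in>H. x + y \<in> H) \<and> (\<forall>a\<in>A'. \<forall>x\<in>H. a * x \<in> H)"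

lemma submodD:
  assumes "submod H"
  shows "0 \<in> H" "x \<in> H \<Longrightarrow> y \<in> H \<Longrightarrow> x + y \<in> H" "a \<in> A' \<Longrightarrow> x \<in> H \<Longrightarrow> a * x \<in> H"
    "x \<in> H \<Longrightarrow> - x \<in> H" "x \<in> H \<Longrightarrow> y \<in> H \<Longrightarrow> x - y \<in> H"
proof -
  have c: "x + y \<in> H" if "x \<in> H" "y \<in> H" for x y using assms that by (auto simp: submod_def)
  have m: "a * x \<in> H" if "a \<in> A'" "x \<in> H" for a x using assms that by (auto simp: submod_def)
  have n: "- x \<in> H" if "x \<in> H" for x using m[OF uminus_in[OF one_in] that] by simp
  show "0 \<in> H" using assms by (simp add: submod_def)
  show "x \<in> H \<Longrightarrow> y \<in> H \<Longrightarrow> x + y \<in> H" "a \<in> A' \<Longrightarrow> x \<in> H \<Longrightarrow> a * x \<in> H" "x \<in> H \<Longrightarrow> - x \<in> H"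
    using c m n by auto
  show "x \<in> H \<Longrightarrow> y \<in> H \<Longrightarrow> x - y \<in> H" using c[OF _ n, of x y] by simp
qed

lemma submods: "submod {0}" "submod A'" "submod UNIV"
  by (simp_all add: submod_def zero_in add_in mult_in)

text \<open>\<open>qc H k\<close> encodes the coset \<open>k + H\<close>.\<close>

definition qc :: "'k set \<Rightarrow> 'k \<Rightarrow> ('a \<times> nat) set" where
  "qc H k = emb {l. l - k \<in> H}"

definition rep :: "'k set \<Rightarrow> ('a \<times> nat) set \<Rightarrow> 'k" where
  "rep H X = (SOME k. qc H k = X)"

definition Q_mod :: "'k set \<Rightarrow> ('a, ('a \<times> nat) set) module" where
  "Q_mod H = \<lparr>carrier = range (qc H), mult = (\<lambda>X Y. qc H 0), one = qc H 0, zero = qc H 0,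
     add = (\<lambda>X Y. qc H (rep H X + rep H Y)), Module.module.smult = (\<lambda>x X. qc H (val x * rep H X))\<rparr>"

lemma qc_eq_iff:
  assumes H: "submod H"
  shows "qc H k = qc H l \<longleftrightarrow> k - l \<in> H"
proof -
  have "{x. x - k \<in> H} = {x. x - l \<in> H} \<longleftrightarrow> k - l \<in> H"
  proof
    assume "{x. x - k \<in> H} = {x. x - l \<in> H}"
    moreover have "k \<in> {x. x - k \<in> H}" using submodD(1)[OF H] by simp
    ultimately have "k \<in> {x. x - l \<in> H}" by simp
    then show "k - l \<in> H" by simp
  next
    assume kl: "k - l \<in> H"
    have "x - k \<in> H \<longleftrightarrow> x - l \<in> H" for x
      using submodD(2)[OF H _ kl, of "x - k"] submodD(5)[OF H _ kl, of "x - l"] by auto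
    then show "{x. x - k \<in> H} = {x. x - l \<in> H}" by simp
  qed
  then show ?thesis by (simp add: qc_def inj_eq[OF emb])
qed

lemma rep: "submod H \<Longrightarrow> rep H (qc H k) - k \<in> H"
  using someI[of "\<lambda>l. qc H l = qc H k" k] qc_eq_iff[of H "rep H (qc H k)" k] by (simp add: rep_def)

lemma qc_rep: "X \<in> range (qc H) \<Longrightarrow> qc H (rep H X) = X"
  unfolding rep_def by (rule someI_ex) auto

lemma Q_simps:
  "carrier (Q_mod H) = range (qc H)" "\<zero>\<^bsub>Q_mod H\<^esub> = qc H 0"
  by (simp_all add: Q_mod_def)

lemma Q_add: "submod H \<Longrightarrow> qc H k \<oplus>\<^bsub>Q_mod H\<^esub> qc H l = qc H (k + l)"
proof -
  assume H: "submod H"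
  have "(rep H (qc H k) - k) + (rep H (qc H l) - l) \<in> H" by (intro submodD(2)[OF H] rep[OF H])
  then show ?thesis by (simp add: Q_mod_def qc_eq_iff[OF H] algebra_simps)
qed

lemma Q_smult: "submod H \<Longrightarrow> x \<in> carrier A \<Longrightarrow> x \<odot>\<^bsub>Q_mod H\<^esub> qc H k = qc H (val x * k)"
proof -
  assume H: "submod H" and x: "x \<in> carrier A"
  have "val x * (rep H (qc H k) - k) \<in> H" by (rule submodD(3)[OF H val_closed[OF x] rep[OF H]])
  then show ?thesis by (simp add: Q_mod_def qc_eq_iff[OF H] algebra_simps)
qed

lemma Q_module:
  assumes H: "submod H"
  shows "Module.module A (Q_mod H)"
proof (rule moduleI)
  show "cring A" by (rule A_cring)
  note ops = Q_add[OF H] Q_smult[OF H]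
  show "abelian_group (Q_mod H)"
  proof (rule abelian_groupI)
    fix X assume "X \<in> carrier (Q_mod H)"
    then obtain k where X: "X = qc H k" by (auto simp: Q_simps)
    have "qc H (- k) \<oplus>\<^bsub>Q_mod H\<^esub> X = \<zero>\<^bsub>Q_mod H\<^esub>" by (simp add: X ops Q_simps)
    then show "\<exists>Y\<in>carrier (Q_mod H). Y \<oplus>\<^bsub>Q_mod H\<^esub> X = \<zero>\<^bsub>Q_mod H\<^esub>"
      by (rule bexI) (simp add: Q_simps)
  qed (auto simp: Q_simps ops algebra_simps)
  fix a b X assume ab: "a \<in> carrier A" "b \<in> carrier A" and "X \<in> carrier (Q_mod H)"
  then obtain k where X: "X = qc H k" by (auto simp: Q_simps)
  show "a \<odot>\<^bsub>Q_mod H\<^esub> X \<in> carrier (Q_mod H)" using ab by (simp add: X ops Q_simps)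
  show "(a \<oplus> b) \<odot>\<^bsub>Q_mod H\<^esub> X = a \<odot>\<^bsub>Q_mod H\<^esub> X \<oplus>\<^bsub>Q_mod H\<^esub> b \<odot>\<^bsub>Q_mod H\<^esub> X"
    using ab add[OF ab] by (simp add: X ops distrib_right)
  show "(a \<otimes> b) \<odot>\<^bsub>Q_mod H\<^esub> X = a \<odot>\<^bsub>Q_mod H\<^esub> (b \<odot>\<^bsub>Q_mod H\<^esub> X)"
    using ab mult[OF ab] by (simp add: X ops mult.assoc)
  fix Y assume "Y \<in> carrier (Q_mod H)"
  then obtain l where Y: "Y = qc H l" by (auto simp: Q_simps)
  show "a \<odot>\<^bsub>Q_mod H\<^esub> (X \<oplus>\<^bsub>Q_mod H\<^esub> Y) = a \<odot>\<^bsub>Q_mod H\<^esub> X \<oplus>\<^bsub>Q_mod H\<^esub> a \<odot>\<^bsub>Q_mod H\<^esub> Y"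
    using ab by (simp add: X Y ops distrib_left)
next
  fix X assume "X \<in> carrier (Q_mod H)"
  then obtain k where X: "X = qc H k" by (auto simp: Q_simps)
  show "\<one> \<odot>\<^bsub>Q_mod H\<^esub> X = X" using one by (simp add: X Q_smult[OF H])
qed

lemma ideal_val:
  assumes J: "ideal J A"
  shows "val ` J \<subseteq> A'" "0 \<in> val ` J" "x \<in> val ` J \<Longrightarrow> y \<in> val ` J \<Longrightarrow> x + y \<in> val ` J"
    "a \<in> A' \<Longrightarrow> x \<in> val ` J \<Longrightarrow> a * x \<in> val ` J"
proof -
  interpret J: ideal J A by (rule J)
  show "val ` J \<subseteq> A'" using val_closed J.a_Hcarr by auto
  show "0 \<in> val ` J" using zero J.zero_closed by (intro image_eqI[where x = \<zero>]) auto
  show "x + y \<in> val ` J" if "x \<in> val ` J" "y \<in> val ` J" for x y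
  proof -
    obtain a b where "a \<in> J" "b \<in> J" "x = val a" "y = val b" using \<open>x \<in> val ` J\<close> \<open>y \<in> val ` J\<close> by blast
    then have "x + y = val (a \<oplus> b)" "a \<oplus> b \<in> J" using add J.a_Hcarr by auto
    then show ?thesis by blast
  qed
  show "a * x \<in> val ` J" if a: "a \<in> A'" "x \<in> val ` J" for a x
  proof -
    obtain b c where "b \<in> carrier A" "a = val b" "c \<in> J" "x = val c" using a val_surj by blast
    then have "a * x = val (b \<otimes> c)" "b \<otimes> c \<in> J" using mult J.a_Hcarr J.I_l_closed by auto
    then show ?thesis by blast
  qed
qed

text \<open>Baer's condition for \<open>K / H\<close>; homomorphisms into \<open>K / H\<close> are represented by functions into \<open>K\<close> that
  are linear modulo \<open>H\<close>.\<close>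

definition baer_condition :: "'k set \<Rightarrow> bool" where
  "baer_condition H \<longleftrightarrow> (\<forall>J f. J \<subseteq> A' \<longrightarrow> 0 \<in> J \<longrightarrow> (\<forall>x\<in>J. \<forall>y\<in>J. x + y \<in> J) \<longrightarrow>
     (\<forall>a\<in>A'. \<forall>x\<in>J. a * x \<in> J) \<longrightarrow> (\<forall>x\<in>J. \<forall>y\<in>J. f (x + y) - (f x + f y) \<in> H) \<longrightarrow>
     (\<forall>a\<in>A'. \<forall>x\<in>J. f (a * x) - a * f x \<in> H) \<longrightarrow> (\<exists>k. \<forall>x\<in>J. f x - x * k \<in> H))"

lemma Q_injective:
  assumes H: "submod H" and B: "baer_condition H"
  shows "injective_mod A (Q_mod H)"
  unfolding injective_mod_def
proof (intro conjI allI ballI impI Q_module[OF H])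
  fix M N :: "('a, ('a \<times> nat) set) module" and i f
  assume i: "i \<in> lin_maps A M N" and f: "f \<in> lin_maps A M (Q_mod H)"
    and mods: "Module.module A M \<and> Module.module A N \<and> inj_on i (carrier M)"
  have "extension_problem A M N (Q_mod H) i f"
  proof (intro extension_problem.intro extension_problem_axioms.intro Q_module[OF H] i f)
    show "Module.module A M" "Module.module A N" "inj_on i (carrier M)" using mods by auto
    fix J h
    assume J: "ideal J A" and h: "\<And>a. a \<in> J \<Longrightarrow> h a \<in> carrier (Q_mod H)"
      and ha: "\<And>a b. a \<in> J \<Longrightarrow> b \<in> J \<Longrightarrow> h (a \<oplus> b) = h a \<oplus>\<^bsub>Q_mod H\<^esub> h b"
      and hm: "\<And>r a. r \<in> carrier A \<Longrightarrow> a \<in> J \<Longrightarrow> h (r \<otimes> a) = r \<odot>\<^bsub>Q_mod H\<^esub> h a"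
    interpret J: ideal J A by (rule J)
    define g where "g k = rep H (h (inv_into (carrier A) val k))" for k
    have g: "qc H (g (val a)) = h a" if "a \<in> J" for a
    proof -
      have "inv_into (carrier A) val (val a) = a"
        using J.a_Hcarr[OF that] bij by (simp add: bij_betw_def inv_into_f_f)
      then show ?thesis using h[OF that] by (simp add: g_def qc_rep Q_simps)
    qed
    have "\<exists>k. \<forall>x\<in>val ` J. g x - x * k \<in> H"
    proof (rule B[unfolded baer_condition_def, rule_format])
      show "val ` J \<subseteq> A'" "0 \<in> val ` J" using ideal_val[OF J] by auto
      show "x + y \<in> val ` J" if "x \<in> val ` J" "y \<in> val ` J" for x y using ideal_val(3)[OF J that] .
      show "a * x \<in> val ` J" if "a \<in> A'" "x \<in> val ` J" for a x using ideal_val(4)[OF J that] .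
      show "g (x + y) - (g x + g y) \<in> H" if xy: "x \<in> val ` J" "y \<in> val ` J" for x y
      proof -
        obtain a b where ab: "a \<in> J" "b \<in> J" "x = val a" "y = val b" using xy by blast
        have "qc H (g (val (a \<oplus> b))) = qc H (g x + g y)"
          using g[OF additive_subgroup.a_closed[OF ideal.axioms(1)[OF J] ab(1,2)]] ha[OF ab(1,2)] g[OF ab(1)] g[OF ab(2)]
          by (simp add: ab Q_add[OF H, symmetric])
        then show ?thesis
          using add[OF J.a_Hcarr[OF ab(1)] J.a_Hcarr[OF ab(2)]] by (simp add: qc_eq_iff[OF H] ab)
      qed
      show "g (c * x) - c * g x \<in> H" if cx: "c \<in> A'" "x \<in> val ` J" for c x
      proof -
        obtain r where r: "r \<in> carrier A" "val r = c" using val_surj[OF cx(1)] by blast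
        obtain a where a: "a \<in> J" "x = val a" using cx by blast
        have "qc H (g (val (r \<otimes> a))) = qc H (c * g x)"
          using g[OF J.I_l_closed[OF a(1) r(1)]] hm[OF r(1) a(1)] g[OF a(1)] r
            Q_smult[OF H r(1), of "g (val a)"]
          by (simp add: a)
        then show ?thesis
          using mult[OF r(1) J.a_Hcarr[OF a(1)]] by (simp add: qc_eq_iff[OF H] a r)
      qed
    qed
    then obtain k where k: "\<And>a. a \<in> J \<Longrightarrow> g (val a) - val a * k \<in> H" by blast
    have "h a = a \<odot>\<^bsub>Q_mod H\<^esub> qc H k" if "a \<in> J" for a
      using k[OF that] g[OF that] Q_smult[OF H J.a_Hcarr[OF that]] qc_eq_iff[OF H] by metis
    then show "\<exists>e\<in>carrier (Q_mod H). \<forall>a\<in>J. h a = a \<odot>\<^bsub>Q_mod H\<^esub> e"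
      by (intro bexI[of _ "qc H k"]) (auto simp: Q_simps)
  qed
  then show "\<exists>g\<in>lin_maps A N (Q_mod H). \<forall>x\<in>carrier M. g (i x) = f x"
    by (rule extension_problem.extension_exists)
qed

text \<open>A homomorphism \<open>f\<close> from an ideal to \<open>K\<close> is multiplication by \<open>f z / z\<close> for any nonzero \<open>z\<close> in the
  ideal.\<close>

lemma baer_trivial: "baer_condition {0}" "baer_condition UNIV"
proof -
  show "baer_condition UNIV" by (simp add: baer_condition_def)
  show "baer_condition {0}"
    unfolding baer_condition_def
  proof (intro allI impI)
    fix J :: "'k set" and f :: "'k \<Rightarrow> 'k"
    assume J: "J \<subseteq> A'" "0 \<in> J" and a: "\<forall>x\<in>J. \<forall>y\<in>J. f (x + y) - (f x + f y) \<in> {0}"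
      and m: "\<forall>a\<in>A'. \<forall>x\<in>J. f (a * x) - a * f x \<in> {0}"
    show "\<exists>k. \<forall>x\<in>J. f x - x * k \<in> {0}"
    proof (cases "J = {0}")
      case True
      have "f 0 = 0" using a J(2) by force
      with True show ?thesis by auto
    next
      case False
      then obtain z where z: "z \<in> J" "z \<noteq> 0" using J(2) by blast
      have "f x = x * (f z / z)" if "x \<in> J" for x
      proof -
        have "z * f x = f (z * x)" using m z(1) J(1) that by force
        also have "\<dots> = f (x * z)" by (simp add: mult.commute)
        also have "\<dots> = x * f z" using m z(1) J(1) that by force
        finally show ?thesis using z(2) by (simp add: field_simps)
      qed
      then show ?thesis by (intro exI[of _ "f z / z"]) simp
    qed
  qed
qed

definition Hs :: "nat \<Rightarrow> 'k set" where
  "Hs i = (if i = 0 then {0} else if i = 1 then A' else UNIV)"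

text \<open>The resolution is \<open>0 \<rightarrow> A \<rightarrow> K \<rightarrow> K / A \<rightarrow> 0\<close>.\<close>

lemma finite_dimension:
  assumes B: "baer_condition A'"
  shows "finite_self_injective_dimension A"
proof -
  let ?E = "\<lambda>i. Q_mod (Hs i)"
  let ?\<eta> = "\<lambda>x\<in>carrier A. qc {0} (val x)"
  let ?d = "\<lambda>i. \<lambda>X\<in>carrier (?E i). qc (Hs (Suc i)) (rep (Hs i) X)"
  have H: "submod (Hs i)" for i using submods by (simp add: Hs_def)
  have mono: "x \<in> Hs i \<Longrightarrow> x \<in> Hs (Suc i)" for x i using zero_in by (auto simp: Hs_def split: if_splits)
  have d: "?d i (qc (Hs i) k) = qc (Hs (Suc i)) k" for i k
  proof -
    have "?d i (qc (Hs i) k) = qc (Hs (Suc i)) (rep (Hs i) (qc (Hs i) k))" by (simp add: Q_simps)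
    also have "\<dots> = qc (Hs (Suc i)) k" unfolding qc_eq_iff[OF H] by (rule mono[OF rep[OF H]])
    finally show ?thesis .
  qed
  have ker: "lin_kernel (?E i) (?E (Suc i)) (?d i) = qc (Hs i) ` Hs (Suc i)" for i
  proof -
    have "?d i (qc (Hs i) k) = \<zero>\<^bsub>?E (Suc i)\<^esub> \<longleftrightarrow> k \<in> Hs (Suc i)" for k
      unfolding d by (simp add: Q_simps qc_eq_iff[OF H])
    then show ?thesis unfolding lin_kernel_def Q_simps by auto
  qed
  have "?\<eta> ` carrier A = qc {0} ` (val ` carrier A)" by (simp add: image_image)
  also have "val ` carrier A = A'" using bij by (simp add: bij_betw_def)
  finally have img: "?\<eta> ` carrier A = qc {0} ` A'" .
  have Hs: "Hs 0 = {0}" "Hs 1 = A'" "Hs (Suc 0) = A'" "Hs (Suc (Suc i)) = UNIV" for i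
    by (simp_all add: Hs_def)
  show ?thesis
    unfolding finite_self_injective_dimension_def
  proof (rule exI[of _ 1], rule exI[of _ ?E], rule exI[of _ ?\<eta>], rule exI[of _ ?d], intro conjI allI impI)
    show "injective_mod A (?E i)" for i
      using Q_injective submods baer_trivial B by (simp add: Hs_def)
    show "carrier (?E i) = {\<zero>\<^bsub>?E i\<^esub>}" if "1 < i" for i
    proof -
      have "Hs i = UNIV" using that by (simp add: Hs_def)
      then have "qc (Hs i) k = qc (Hs i) 0" for k unfolding qc_eq_iff[OF H] by simp
      then show ?thesis unfolding Q_simps by auto
    qed
    show "?\<eta> \<in> lin_maps A (regular_mod A) (?E 0)"
      by (rule lin_mapsI) (auto simp: Hs Q_simps add mult Q_add[OF submods(1)] Q_smult[OF submods(1)])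
    show "?d i \<in> lin_maps A (?E i) (?E (Suc i))" for i
    proof (rule lin_mapsI)
      fix X Y assume "X \<in> carrier (?E i)" "Y \<in> carrier (?E i)"
      then obtain k l where XY: "X = qc (Hs i) k" "Y = qc (Hs i) l" by (auto simp: Q_simps)
      show "?d i (X \<oplus>\<^bsub>?E i\<^esub> Y) = ?d i X \<oplus>\<^bsub>?E (Suc i)\<^esub> ?d i Y"
        unfolding XY Q_add[OF H] d ..
    next
      fix r X assume r: "r \<in> carrier A" and "X \<in> carrier (?E i)"
      then obtain k where X: "X = qc (Hs i) k" by (auto simp: Q_simps)
      show "?d i (r \<odot>\<^bsub>?E i\<^esub> X) = r \<odot>\<^bsub>?E (Suc i)\<^esub> ?d i X"
        unfolding X Q_smult[OF H r] d ..
    qed (simp_all add: Q_simps)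
    show "inj_on ?\<eta> (carrier A)"
      by (rule inj_onI) (simp add: qc_eq_iff[OF submods(1)] val_inj)
    show "?\<eta> ` carrier A = lin_kernel (?E 0) (?E 1) (?d 0)"
      using img ker[of 0] by (simp add: Hs)
    show "?d i ` carrier (?E i) = lin_kernel (?E (Suc i)) (?E (Suc (Suc i))) (?d (Suc i))" for i
    proof -
      have "?d i ` carrier (?E i) = range (\<lambda>k. ?d i (qc (Hs i) k))" unfolding Q_simps by (rule image_image)
      also have "\<dots> = range (qc (Hs (Suc i)))" unfolding d ..
      finally show ?thesis by (subst ker) (simp only: Hs(4))
    qed
  qed
qed

end

section \<open>Duality for the quotients \<open>R / a R\<close>\<close>

text \<open>For monic \<open>a\<close>, the number \<open>tau a w\<close> is a residue at infinity: \<open>lam\<close> of the coefficient of \<open>t\<^sup>-\<^sup>1\<close>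
  in the expansion of \<open>w / (t\<^sup>3 a)\<close>. For monic \<open>a\<close> in \<open>R\<close> this functional makes \<open>R / a R\<close> a Frobenius
  algebra.\<close>

definition tau :: "L poly \<Rightarrow> L poly \<Rightarrow> rat" where
  "tau a w = lam (coeff (w mod (monom 1 3 * a)) (degree a + 2))"

lemma tau_add: "tau a (v + w) = tau a v + tau a w"
  by (simp add: tau_def poly_mod_add_left)

lemma tau_smult: "tau a (smult (scale_L q 1) w) = q * tau a w"
  by (simp add: tau_def mod_smult_left flip: scale_L_one_mult)

lemma tau_diff: "tau a (v - w) = tau a v - tau a w"
  using tau_add[of a "v - w" w] by simp

lemma tau_0: "tau a 0 = 0"
  by (simp add: tau_def)

lemma coeff_mult_bounded:
  fixes p q :: "'c::comm_semiring_0 poly"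
  assumes "degree p \<le> m" "degree q \<le> n"
  shows "coeff (p * q) (m + n) = coeff p m * coeff q n"
proof -
  have "coeff p k * coeff q (m + n - k) = (if k = m then coeff p m * coeff q n else 0)" if "k \<le> m + n" for k
  proof (cases "k < m")
    case True
    then have "n < m + n - k" using that by simp
    then show ?thesis using assms(2) True by (simp add: coeff_eq_0)
  next
    case False
    then show ?thesis using assms(1) by (auto simp: coeff_eq_0)
  qed
  then show ?thesis by (simp add: coeff_mult)
qed

text \<open>The residue of \<open>a q / (t\<^sup>3 a) = q / t\<^sup>3\<close>.\<close>

lemma tau_multiple:
  assumes a: "lead_coeff a = 1"
  shows "tau a (a * q) = lam (coeff q 2)"
proof -
  let ?c = "q mod monom 1 3"
  have "degree (monom (1::L) 3) = 3" by (simp add: degree_monom_eq)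
  then have "degree ?c \<le> 2"
    using degree_mod_less'[of "monom 1 3" q] by (cases "?c = 0") (auto simp: monom_eq_0_iff)
  have "(a * q) mod (monom 1 3 * a) = a * ?c"
    by (simp add: mult.commute[of "monom 1 3"] mod_mult_mult1)
  then have "tau a (a * q) = lam (coeff (a * ?c) (degree a + 2))" by (simp add: tau_def)
  also have "\<dots> = lam (coeff ?c 2)"
    using coeff_mult_bounded[of a "degree a" ?c 2] \<open>degree ?c \<le> 2\<close> a by simp
  also have "coeff ?c 2 = coeff q 2"
  proof -
    have "coeff q 2 = coeff (monom 1 3 * (q div monom 1 3) + ?c) 2" by simp
    then show ?thesis by (simp only: coeff_add) (simp add: coeff_monom_mult)
  qed
  finally show ?thesis .
qed

lemma tau_vanishes: "lead_coeff a = 1 \<Longrightarrow> r \<in> R_set \<Longrightarrow> tau a (a * r) = 0"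
  using R_setD[of r 2] by (simp add: tau_multiple R_coeffs_def L_upto_22_iff)

text \<open>Nondegeneracy. The multiples of \<open>t\<^sup>3\<close> already show that \<open>a\<close> divides \<open>u\<close> in \<open>L[t]\<close>; the three
  lowest coefficients of the quotient are then tested against \<open>R\<^sub>0\<close>, \<open>R\<^sub>1\<close>, \<open>R\<^sub>2\<close>, where the symmetric
  relations between \<open>\<rat>\<close>, \<open>W\<close> and \<open>L\<^sub>2\<^sub>2\<close> with respect to \<open>lam\<close> come in.\<close>

lemma tau_nondegenerate:
  assumes a: "lead_coeff a = 1" and u: "\<And>r. r \<in> R_set \<Longrightarrow> tau a (u * r) = 0"
  obtains q where "u = a * q" "q \<in> R_set"
proof -
  let ?B = "monom 1 3 * a"
  let ?v = "u * monom 1 3"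
  have a0: "a \<noteq> 0" using a by auto
  then have B0: "?B \<noteq> 0" by (simp add: monom_eq_0_iff)
  have dB: "degree ?B = degree a + 3"
    using a0 by (simp add: degree_mult_eq degree_monom_eq monom_eq_0_iff)
  define c where "c = ?v mod ?B"
  have "c = 0"
  proof (rule ccontr)
    assume c0: "c \<noteq> 0"
    have dc: "degree c < degree a + 3" 
      unfolding c_def dB[symmetric] by (rule degree_mod_less'[OF B0 c0[unfolded c_def]])
    have "lam (lead_coeff c * l) = 0" for l
    proof -
      define n where "n = degree a + 2 - degree c"
      have n: "degree c + n = degree a + 2" using dc by (simp add: n_def)
      have "monom 1 3 * monom l n \<in> R_set" by (rule conductor)
      then have "tau a (u * (monom 1 3 * monom l n)) = 0" by (rule u)
      then have t: "tau a (?v * monom l n) = 0" by (simp only: mult.assoc)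
      have "degree (c * monom l n) \<le> degree a + 2"
        using degree_mult_le[of c "monom l n"] degree_monom_le[of l n] n by linarith
      then have m: "(c * monom l n) mod ?B = c * monom l n"
        using dB by (intro mod_poly_less) simp
      have "(?v * monom l n) mod ?B = (c * monom l n) mod ?B"
        unfolding c_def by (rule mod_mult_left_eq[symmetric])
      then have "tau a (?v * monom l n) = lam (coeff (c * monom l n) (degree c + n))"
        unfolding tau_def m n by simp
      also have "\<dots> = lam (lead_coeff c * l)"
        using coeff_mult_bounded[of c "degree c" "monom l n" n] by (simp add: degree_monom_le)
      finally show ?thesis using t by simp
    qed
    then have "lead_coeff c = 0" by (rule lam_nondegenerate)
    with c0 show False by simp
  qed
  then have "?B dvd ?v" unfolding c_def by (rule mod_eq_0_iff_dvd[THEN iffD1])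
  then obtain q where "u * monom 1 3 = ?B * q" by (rule dvdE)
  then have "monom 1 3 * u = monom 1 3 * (a * q)" by (simp add: mult_ac)
  then have uq: "u = a * q" by (simp add: monom_eq_0_iff)
  have t: "lam (coeff (q * r) 2) = 0" if "r \<in> R_set" for r
    using u[OF that] tau_multiple[OF a, of "q * r"] by (simp add: uq mult.assoc)
  have "coeff q i \<in> R_coeffs i" for i
  proof -
    consider "i = 0" | "i = 1" | "i = 2" | "i \<ge> 3" by linarith
    then show ?thesis
    proof cases
      case 1
      have "lam (coeff q 0 * l) = 0" if "l \<in> L_upto 22" for l
        using t[of "monom l 2"] that by (simp add: monom_in_R R_coeffs_def mult.commute[of q] coeff_monom_mult mult.commute[of l])
      then have "coeff q 0 \<in> L_upto 0" using L_upto_perp[of 22 "coeff q 0"] by simp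
      then show ?thesis using 1 by (simp add: R_coeffs_def L_upto_0)
    next
      case 2
      have "lam (coeff q 1 * w) = 0" if "w \<in> W" for w
        using t[of "monom w 1"] that by (simp add: monom_in_R R_coeffs_def mult.commute[of q] coeff_monom_mult mult.commute[of w])
      then have "coeff q 1 \<in> W" by (rule W_perp)
      then show ?thesis using 2 by (simp add: R_coeffs_def)
    next
      case 3
      have "lam (coeff q 2) = 0" using t[OF R.one_in] by simp
      then show ?thesis using 3 by (simp add: R_coeffs_def L_upto_22_iff)
    next
      case 4
      then show ?thesis by (simp add: R_coeffs_def)
    qed
  qed
  then have "q \<in> R_set" by (rule R_setI)
  with uq that show thesis by blast
qed

section \<open>\<open>R\<close> is Gorenstein\<close>

abbreviation "fr a s \<equiv> to_fract a / (to_fract s :: L poly fract)"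

lemma fr_eq_iff: "s \<noteq> 0 \<Longrightarrow> u \<noteq> 0 \<Longrightarrow> fr a s = fr b u \<longleftrightarrow> a * u = b * s"
  by (simp add: frac_eq_eq flip: to_fract_mult)

lemma fract_cases: obtains p q where "q \<noteq> 0" "k = fr p q"
proof (cases k)
  case (Fract a b)
  then have "k = fr a b" by (simp add: to_fract_def divide_fract)
  with Fract that show thesis by blast
qed

text \<open>\<open>L[t] / b\<close> has finite dimension over \<open>\<rat>\<close>.\<close>

lemma linear_dependence_mod:
  fixes b :: "L poly" and s :: "nat \<Rightarrow> L poly"
  assumes "b \<noteq> 0"
  obtains n c i where "i \<le> n" "c i \<noteq> 0" "b dvd (\<Sum>i\<le>n. smult (scale_L (c i) 1) (s i))"
proof -
  let ?S = "{p :: L poly. degree p < degree b + 1}"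
  have sub: "P.subspace ?S"
    using bounded_degree_subspace[OF P.subspace_UNIV, of "degree b + 1"] by simp
  have deg: "degree p < degree b + 1" if "p \<in> ?S" for p using that by simp
  obtain F where F: "finite F" "F \<subseteq> ?S" "?S = P.span F"
    by (rule finite_spanning_set[OF sub deg])
  define m where "m i = s i mod b" for i
  have mS: "m i \<in> P.span F" for i
  proof -
    have "degree (m i) < degree b + 1"
      using degree_mod_less'[OF assms, of "s i"] by (cases "m i = 0") (auto simp: m_def)
    then have "m i \<in> ?S" by simp
    then show ?thesis unfolding F(3) .
  qed
  let ?n = "card F"
  have "\<exists>c i. i \<le> ?n \<and> c i \<noteq> 0 \<and> (\<Sum>i\<le>?n. smult (scale_L (c i) 1) (m i)) = 0"
  proof (cases "inj_on m {..?n}")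
    case False
    then obtain i j where ij: "i \<le> ?n" "j \<le> ?n" "i \<noteq> j" "m i = m j" by (auto simp: inj_on_def)
    define c :: "nat \<Rightarrow> rat" where "c = (\<lambda>k. if k = i then 1 else if k = j then - 1 else 0)"
    have "(\<Sum>k\<le>?n. smult (scale_L (c k) 1) (m k))
        = (\<Sum>k\<in>{i, j}. smult (scale_L (c k) 1) (m k))"
      by (rule sum.mono_neutral_right) (use ij in \<open>auto simp: c_def\<close>)
    also have "\<dots> = 0" using ij(3,4) by (simp add: c_def)
    finally show ?thesis using ij(1) by (intro exI[of _ c] exI[of _ i]) (simp add: c_def)
  next
    case True
    have fin: "finite (m ` {..?n})" by simp
    have "\<not> card (m ` {..?n}) \<le> card F" using True by (simp add: card_image)
    then have "P.dependent (m ` {..?n})"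
      using P.independent_span_bound[OF F(1), of "m ` {..?n}"] mS by blast
    then obtain u where u: "\<exists>v\<in>m ` {..?n}. u v \<noteq> 0"
      "(\<Sum>v\<in>m ` {..?n}. smult (scale_L (u v) 1) v) = 0"
      using P.dependent_finite[OF fin] by auto
    have "(\<Sum>i\<le>?n. smult (scale_L (u (m i)) 1) (m i)) = 0"
      using u(2) by (simp add: sum.reindex[OF True])
    then show ?thesis using u(1) by (intro exI[of _ "u \<circ> m"]) auto
  qed
  then obtain c i where c: "i \<le> ?n" "c i \<noteq> 0" "(\<Sum>i\<le>?n. smult (scale_L (c i) 1) (m i)) = 0" by blast
  have sm: "(\<Sum>i\<in>A. smult (scale_L (c i) 1) (s i)) mod b = (\<Sum>i\<in>A. smult (scale_L (c i) 1) (m i))" for A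
    by (induction A rule: infinite_finite_induct)
      (simp_all add: m_def poly_mod_add_left mod_smult_left)
  have "(\<Sum>i\<le>?n. smult (scale_L (c i) 1) (s i)) mod b = 0"
    unfolding sm by (rule c(3))
  then have "b dvd (\<Sum>i\<le>?n. smult (scale_L (c i) 1) (s i))" by (rule mod_eq_0_iff_dvd[THEN iffD1])
  with c(1,2) that show thesis by blast
qed

text \<open>A dependence between the powers of \<open>s\<close>, with the lowest power that occurs taken out as a factor.\<close>

lemma power_relation:
  assumes s: "s \<in> R_set" and b: "b \<noteq> 0"
  obtains i z c where "c \<noteq> 0" "z \<in> R_set" "b dvd s ^ i * (monom (scale_L c 1) 0 + s * z)"
proof -
  obtain n c i where c: "i \<le> n" "c i \<noteq> 0" "b dvd (\<Sum>i\<le>n. smult (scale_L (c i) 1) (s ^ i))"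
    by (rule linear_dependence_mod[OF b, of "\<lambda>i. s ^ i"])
  define i0 where "i0 = (LEAST i. c i \<noteq> 0)"
  have i0: "c i0 \<noteq> 0" using c(2) unfolding i0_def by (rule LeastI)
  have low: "c k = 0" if "k < i0" for k using not_less_Least that unfolding i0_def by blast
  have le: "i0 \<le> n" using c(1) Least_le[of "\<lambda>i. c i \<noteq> 0", OF c(2)] by (simp add: i0_def)
  define z where "z = (\<Sum>k\<in>{i0<..n}. smult (scale_L (c k) 1) (s ^ (k - Suc i0)))"
  have pow: "s ^ k \<in> R_set" for k by (induction k) (simp_all add: R.one_in R.mult_in s)
  have z: "z \<in> R_set" unfolding z_def by (intro R.sum_in smult_scale_in_R pow)
  have "(\<Sum>i\<le>n. smult (scale_L (c i) 1) (s ^ i)) = (\<Sum>i\<in>{i0..n}. smult (scale_L (c i) 1) (s ^ i))"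
    by (rule sum.mono_neutral_right) (auto simp: low not_le)
  also have "\<dots> = smult (scale_L (c i0) 1) (s ^ i0) + (\<Sum>k\<in>{i0<..n}. smult (scale_L (c k) 1) (s ^ k))"
    using le by (simp add: sum.head)
  also have "(\<Sum>k\<in>{i0<..n}. smult (scale_L (c k) 1) (s ^ k)) = s ^ i0 * (s * z)"
    unfolding z_def sum_distrib_left
  proof (rule sum.cong[OF refl])
    fix k assume "k \<in> {i0<..n}"
    then obtain m where "k = Suc (i0 + m)" using less_iff_Suc_add[of i0 k] by auto
    then show "smult (scale_L (c k) 1) (s ^ k) = s ^ i0 * (s * smult (scale_L (c k) 1) (s ^ (k - Suc i0)))"
      by (simp add: power_add mult_ac)
  qed
  also have "smult (scale_L (c i0) 1) (s ^ i0) = s ^ i0 * monom (scale_L (c i0) 1) 0"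
    by (simp add: monom_0)
  finally have "b dvd s ^ i0 * (monom (scale_L (c i0) 1) 0 + s * z)" using c(3) by (simp add: distrib_left)
  with i0 z that show thesis by blast
qed

locale localization_at =
  fixes P :: "L poly set"
  assumes max: "maximalideal P R_ring"
begin

definition "S = R_set - P"
definition "A' = {fr a s | a s. a \<in> R_set \<and> s \<in> S}"

lemma prime: "primeideal P R_ring"
  by (rule R.R.maximalideal_prime[OF max])

lemma P_ideal: "ideal P R_ring"
  using prime by (rule primeideal.axioms(1))

lemma S_R: "s \<in> S \<Longrightarrow> s \<in> R_set"
  by (simp add: S_def)

lemma S_nonzero: "s \<in> S \<Longrightarrow> s \<noteq> 0"
  using R.idealD(2)[OF P_ideal] by (auto simp: S_def)

lemma one_S: "1 \<in> S"
proof -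
  have "1 \<notin> P"
  proof
    assume "1 \<in> P"
    then have "carrier R_ring = P" using ideal.one_imp_carrier[OF P_ideal] by simp
    then show False using primeideal.I_notcarr[OF prime] by simp
  qed
  then show ?thesis by (simp add: S_def R.one_in)
qed

lemma mult_S: "s \<in> S \<Longrightarrow> u \<in> S \<Longrightarrow> s * u \<in> S"
  using primeideal.I_prime[OF prime, of s u] by (auto simp: S_def R.mult_in)

lemma power_S: "s \<in> S \<Longrightarrow> s ^ n \<in> S"
  by (induction n) (simp_all add: one_S mult_S)

lemma fr_in: "a \<in> R_set \<Longrightarrow> s \<in> S \<Longrightarrow> fr a s \<in> A'"
  by (auto simp: A'_def)

lemma to_fract_in: "a \<in> R_set \<Longrightarrow> to_fract a \<in> A'"
  using fr_in[OF _ one_S, of a] by simp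

sublocale A': concrete_ring A'
proof
  show "0 \<in> A'" "1 \<in> A'" using to_fract_in[OF R.zero_in] to_fract_in[OF R.one_in] by simp_all
  fix x assume "x \<in> A'"
  then obtain a s where x: "x = fr a s" "a \<in> R_set" "s \<in> S" by (auto simp: A'_def)
  have "- x = fr (- a) s" by (simp add: x)
  then show "- x \<in> A'" using fr_in[OF R.uminus_in x(3)] x(2) by simp
  fix y assume "y \<in> A'"
  then obtain b u where y: "y = fr b u" "b \<in> R_set" "u \<in> S" by (auto simp: A'_def)
  have "x + y = fr (a * u + b * s) (s * u)"
    using S_nonzero x(3) y(3) by (simp add: x y add_frac_eq mult.commute)
  then show "x + y \<in> A'"
    using fr_in[OF R.add_in[OF R.mult_in R.mult_in] mult_S, of a u b s s u] x y S_R by simp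
  have "x * y = fr (a * b) (s * u)" by (simp add: x y)
  then show "x * y \<in> A'" using fr_in[OF R.mult_in mult_S, of a b s u] x y by simp
qed

text \<open>The classes of pairs that make up the localization are the fibres of \<open>(b, u) \<mapsto> b / u\<close>.\<close>

definition cls :: "L poly fract \<Rightarrow> (L poly \<times> L poly) set" where
  "cls k = {(b, u). b \<in> R_set \<and> u \<in> S \<and> fr b u = k}"

lemma fraction_eq: "a \<in> R_set \<Longrightarrow> s \<in> S \<Longrightarrow> fraction R_ring S a s = cls (fr a s)"
proof -
  assume as: "a \<in> R_set" "s \<in> S"
  have "(\<exists>w\<in>S. w \<otimes>\<^bsub>R_ring\<^esub> (a \<otimes>\<^bsub>R_ring\<^esub> u \<ominus>\<^bsub>R_ring\<^esub> b \<otimes>\<^bsub>R_ring\<^esub> s) = \<zero>\<^bsub>R_ring\<^esub>) \<longleftrightarrow> fr b u = fr a s"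
    if "b \<in> R_set" "u \<in> S" for b u
  proof -
    have "a * u \<in> R_set" "b * s \<in> R_set" using as that S_R R.mult_in by auto
    then have "a \<otimes>\<^bsub>R_ring\<^esub> u \<ominus>\<^bsub>R_ring\<^esub> b \<otimes>\<^bsub>R_ring\<^esub> s = a * u - b * s" by simp
    moreover have "(\<exists>w\<in>S. w * (a * u - b * s) = 0) \<longleftrightarrow> a * u = b * s"
      using one_S S_nonzero by auto
    moreover have "fr b u = fr a s \<longleftrightarrow> b * s = a * u"
      using fr_eq_iff S_nonzero that as by simp
    ultimately show ?thesis by auto
  qed
  then show ?thesis by (auto simp: fraction_def cls_def)
qed

lemma cls_inj: "k \<in> A' \<Longrightarrow> cls k = cls l \<Longrightarrow> k = l"
proof -
  assume kl: "k \<in> A'" "cls k = cls l"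
  then obtain a s where "k = fr a s" "a \<in> R_set" "s \<in> S" unfolding A'_def by blast
  then have "(a, s) \<in> cls k" by (simp add: cls_def)
  then have "(a, s) \<in> cls l" using kl(2) by simp
  with \<open>k = fr a s\<close> show "k = l" by (simp add: cls_def)
qed

lemma cls_nonempty: "k \<in> A' \<Longrightarrow> \<exists>p. p \<in> cls k"
  by (auto simp: A'_def cls_def)

abbreviation "Loc \<equiv> localization R_ring S"

lemma Loc_carrier: "carrier Loc = cls ` A'"
proof -
  have "carrier Loc = {fraction R_ring S a s | a s. a \<in> R_set \<and> s \<in> S}"
    by (simp add: localization_def)
  also have "\<dots> = cls ` A'"
  proof (intro equalityI subsetI)
    fix X assume "X \<in> {fraction R_ring S a s | a s. a \<in> R_set \<and> s \<in> S}"
    then obtain a s where "X = fraction R_ring S a s" "a \<in> R_set" "s \<in> S" by blast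
    then have "X = cls (fr a s)" "fr a s \<in> A'" using fraction_eq fr_in by simp_all
    then show "X \<in> cls ` A'" by (rule image_eqI)
  next
    fix X assume "X \<in> cls ` A'"
    then obtain a s where "X = cls (fr a s)" "a \<in> R_set" "s \<in> S" unfolding A'_def by blast
    then have "X = fraction R_ring S a s" "a \<in> R_set" "s \<in> S" using fraction_eq by simp_all
    then show "X \<in> {fraction R_ring S a s | a s. a \<in> R_set \<and> s \<in> S}" by blast
  qed
  finally show ?thesis .
qed

lemma Loc_one: "\<one>\<^bsub>Loc\<^esub> = cls 1" and Loc_zero: "\<zero>\<^bsub>Loc\<^esub> = cls 0"
  using fraction_eq[OF R.one_in one_S] fraction_eq[OF R.zero_in one_S] by (simp_all add: localization_def)

lemma union_constant:
  assumes "\<And>p q. p \<in> X \<Longrightarrow> q \<in> Y \<Longrightarrow> f p q = Z" "\<exists>p. p \<in> X" "\<exists>q. q \<in> Y"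
  shows "(\<Union>p\<in>X. \<Union>q\<in>Y. f p q) = Z"
proof
  show "(\<Union>p\<in>X. \<Union>q\<in>Y. f p q) \<subseteq> Z"
    by (intro UN_least) (simp add: assms(1))
  obtain p q where "p \<in> X" "q \<in> Y" using assms(2,3) by blast
  then show "Z \<subseteq> (\<Union>p\<in>X. \<Union>q\<in>Y. f p q)" using assms(1)[of p q] by blast
qed

lemma Loc_mult: "k \<in> A' \<Longrightarrow> l \<in> A' \<Longrightarrow> cls k \<otimes>\<^bsub>Loc\<^esub> cls l = cls (k * l)"
proof -
  assume kl: "k \<in> A'" "l \<in> A'"
  have "(\<Union>p\<in>cls k. \<Union>q\<in>cls l. (case p of (a, s) \<Rightarrow> case q of (b, u) \<Rightarrow> fraction R_ring S (a * b) (s * u)))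
      = cls (k * l)"
  proof (rule union_constant[OF _ cls_nonempty[OF kl(1)] cls_nonempty[OF kl(2)]])
    fix p q assume "p \<in> cls k" "q \<in> cls l"
    then obtain a s b u where pq: "p = (a, s)" "q = (b, u)" "a \<in> R_set" "s \<in> S" "fr a s = k"
      "b \<in> R_set" "u \<in> S" "fr b u = l" by (auto simp: cls_def)
    have "fraction R_ring S (a * b) (s * u) = cls (fr (a * b) (s * u))"
      by (rule fraction_eq[OF R.mult_in[OF pq(3,6)] mult_S[OF pq(4,7)]])
    also have "fr (a * b) (s * u) = k * l" by (simp flip: pq(5,8))
    finally show "(case p of (a, s) \<Rightarrow> case q of (b, u) \<Rightarrow> fraction R_ring S (a * b) (s * u)) = cls (k * l)"
      by (simp add: pq(1,2))
  qed
  then show ?thesis by (simp add: localization_def case_prod_unfold)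
qed

lemma Loc_add: "k \<in> A' \<Longrightarrow> l \<in> A' \<Longrightarrow> cls k \<oplus>\<^bsub>Loc\<^esub> cls l = cls (k + l)"
proof -
  assume kl: "k \<in> A'" "l \<in> A'"
  have "(\<Union>p\<in>cls k. \<Union>q\<in>cls l. (case p of (a, s) \<Rightarrow> case q of (b, u) \<Rightarrow> fraction R_ring S (a * u + b * s) (s * u)))
      = cls (k + l)"
  proof (rule union_constant[OF _ cls_nonempty[OF kl(1)] cls_nonempty[OF kl(2)]])
    fix p q assume "p \<in> cls k" "q \<in> cls l"
    then obtain a s b u where pq: "p = (a, s)" "q = (b, u)" "a \<in> R_set" "s \<in> S" "fr a s = k"
      "b \<in> R_set" "u \<in> S" "fr b u = l" by (auto simp: cls_def)
    have "fraction R_ring S (a * u + b * s) (s * u) = cls (fr (a * u + b * s) (s * u))"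
      by (rule fraction_eq[OF R.add_in[OF R.mult_in[OF pq(3) S_R[OF pq(7)]] R.mult_in[OF pq(6) S_R[OF pq(4)]]]
          mult_S[OF pq(4,7)]])
    also have "fr (a * u + b * s) (s * u) = k + l"
      using S_nonzero[OF pq(4)] S_nonzero[OF pq(7)] by (simp add: add_frac_eq mult.commute flip: pq(5,8))
    finally show "(case p of (a, s) \<Rightarrow> case q of (b, u) \<Rightarrow> fraction R_ring S (a * u + b * s) (s * u)) = cls (k + l)"
      by (simp add: pq(1,2))
  qed
  then show ?thesis by (simp add: localization_def case_prod_unfold)
qed

text \<open>A subset of the field of fractions is recovered from the set of all fractions that lie in it.\<close>

definition emb :: "L poly fract set \<Rightarrow> ((L poly \<times> L poly) set \<times> nat) set" where
  "emb X = {({(p, q). q \<noteq> 0 \<and> fr p q \<in> X}, 0)}"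

lemma emb_inj: "inj emb"
proof (rule injI)
  fix X Y assume "emb X = emb Y"
  then have e: "{(p, q). q \<noteq> 0 \<and> fr p q \<in> X} = {(p, q). q \<noteq> 0 \<and> fr p q \<in> Y}" by (simp add: emb_def)
  show "X = Y"
  proof (rule Set.set_eqI)
    fix k
    obtain p q where "q \<noteq> 0" "k = fr p q" by (rule fract_cases)
    then have "k \<in> X \<longleftrightarrow> (p, q) \<in> {(p, q). q \<noteq> 0 \<and> fr p q \<in> X}"
      "k \<in> Y \<longleftrightarrow> (p, q) \<in> {(p, q). q \<noteq> 0 \<and> fr p q \<in> Y}" by auto
    then show "k \<in> X \<longleftrightarrow> k \<in> Y" unfolding e by simp
  qed
qed

sublocale FM: fraction_model A' Loc "inv_into A' cls" emb
proof
  have inj: "inj_on cls A'" by (rule inj_onI) (rule cls_inj)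
  have v: "inv_into A' cls (cls k) = k" if "k \<in> A'" for k by (rule inv_into_f_f[OF inj that])
  show "bij_betw (inv_into A' cls) (carrier Loc) A'"
    unfolding Loc_carrier using inj by (intro bij_betw_inv_into) (simp add: bij_betw_def)
  show "\<zero>\<^bsub>Loc\<^esub> \<in> carrier Loc \<and> inv_into A' cls \<zero>\<^bsub>Loc\<^esub> = 0"
    using v[OF A'.zero_in] A'.zero_in by (simp add: Loc_zero Loc_carrier)
  show "\<one>\<^bsub>Loc\<^esub> \<in> carrier Loc \<and> inv_into A' cls \<one>\<^bsub>Loc\<^esub> = 1"
    using v[OF A'.one_in] A'.one_in by (simp add: Loc_one Loc_carrier)
  show "inj emb" by (rule emb_inj)
  fix x y assume "x \<in> carrier Loc" "y \<in> carrier Loc"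
  then obtain k l where kl: "x = cls k" "k \<in> A'" "y = cls l" "l \<in> A'" by (auto simp: Loc_carrier)
  show "x \<oplus>\<^bsub>Loc\<^esub> y \<in> carrier Loc \<and>
      inv_into A' cls (x \<oplus>\<^bsub>Loc\<^esub> y) = inv_into A' cls x + inv_into A' cls y"
    using A'.add_in[OF kl(2,4)] kl by (simp add: Loc_add v Loc_carrier)
  show "x \<otimes>\<^bsub>Loc\<^esub> y \<in> carrier Loc \<and>
      inv_into A' cls (x \<otimes>\<^bsub>Loc\<^esub> y) = inv_into A' cls x * inv_into A' cls y"
    using A'.mult_in[OF kl(2,4)] kl by (simp add: Loc_mult v Loc_carrier)
qed

subsection \<open>Passing from \<open>R\<close> to its localization\<close>

context
  fixes a :: "L poly"
  assumes aR: "a \<in> R_set" and monic: "lead_coeff a = 1"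
begin

lemma a0: "a \<noteq> 0"
  using monic by auto

text \<open>The preimage of \<open>a A'\<close> under \<open>R \<rightarrow> A'\<close>.\<close>

definition "N = {r \<in> R_set. fr r a \<in> A'}"

lemma N_iff: "r \<in> N \<longleftrightarrow> r \<in> R_set \<and> (\<exists>s\<in>S. \<exists>b\<in>R_set. s * r = a * b)"
proof
  assume r: "r \<in> N"
  then obtain b s where "fr r a = fr b s" "b \<in> R_set" "s \<in> S" by (auto simp: N_def A'_def)
  moreover from this have "r * s = b * a" using fr_eq_iff[OF a0 S_nonzero] by blast
  ultimately show "r \<in> R_set \<and> (\<exists>s\<in>S. \<exists>b\<in>R_set. s * r = a * b)"
    using r by (metis (no_types, lifting) N_def mem_Collect_eq mult.commute)
next
  assume "r \<in> R_set \<and> (\<exists>s\<in>S. \<exists>b\<in>R_set. s * r = a * b)"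
  then obtain s b where sb: "r \<in> R_set" "s \<in> S" "b \<in> R_set" "s * r = a * b" by blast
  then have "fr r a = fr b s"
    using fr_eq_iff[OF a0 S_nonzero, of s r b] by (simp add: mult.commute)
  then show "r \<in> N" using sb fr_in by (simp add: N_def)
qed

lemma aR_N: "r \<in> R_set \<Longrightarrow> a * r \<in> N"
  unfolding N_iff using aR one_S R.mult_in by force

lemma N_subspace: "P.subspace N"
proof (rule P.subspaceI)
  show "0 \<in> N" using aR_N[OF R.zero_in] by simp
  fix x y assume x: "x \<in> N"
  show "smult (scale_L c 1) x \<in> N" for c
  proof -
    have eq: "fr (smult (scale_L c 1) x) a = to_fract (monom (scale_L c 1) 0) * fr x a"
      by (simp add: monom_0 flip: to_fract_mult)
    have "fr (smult (scale_L c 1) x) a \<in> A'"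
      unfolding eq by (rule A'.mult_in[OF to_fract_in[OF const_in_R]]) (use x in \<open>simp add: N_def\<close>)
    then show ?thesis using x smult_scale_in_R by (simp add: N_def)
  qed
  assume y: "y \<in> N"
  show "x + y \<in> N" using x y A'.add_in by (simp add: N_def R.add_in add_divide_distrib)
qed

text \<open>A single denominator clears all of \<open>N\<close>, because \<open>N\<close> modulo \<open>a R\<close> is finite-dimensional.\<close>

lemma common_denominator: obtains s where "s \<in> S" "\<And>r. r \<in> N \<Longrightarrow> \<exists>b\<in>R_set. s * r = a * b"
proof -
  let ?N = "{p \<in> N. degree p < degree a + 3}"
  obtain F where F: "finite F" "F \<subseteq> ?N" "?N = P.span F"
    using finite_spanning_set[OF bounded_degree_subspace[OF N_subspace, of "degree a + 3"]] by auto
  have "F \<subseteq> N" using F(2) by blast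
  with F(1) have "\<exists>s\<in>S. \<forall>r\<in>F. \<exists>b\<in>R_set. s * r = a * b"
  proof (induction F rule: finite_induct)
    case empty
    then show ?case using one_S by auto
  next
    case (insert x F)
    then obtain s where s: "s \<in> S" "\<And>r. r \<in> F \<Longrightarrow> \<exists>b\<in>R_set. s * r = a * b" by auto
    obtain u b where u: "u \<in> S" "b \<in> R_set" "u * x = a * b" using insert.prems N_iff by auto
    have "\<exists>b\<in>R_set. (s * u) * r = a * b" if r: "r \<in> insert x F" for r
    proof (cases "r = x")
      case True
      then have "(s * u) * r = a * (s * b)" using u(3) by (metis mult.assoc mult.left_commute)
      then show ?thesis using R.mult_in[OF S_R[OF s(1)] u(2)] by blast
    next
      case False
      then obtain b' where "b' \<in> R_set" "s * r = a * b'" using s(2) r by blast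
      then have "(s * u) * r = a * (u * b')" by (metis mult.assoc mult.commute)
      then show ?thesis using R.mult_in[OF S_R[OF u(1)] \<open>b' \<in> R_set\<close>] by blast
    qed
    then show ?case using mult_S[OF s(1) u(1)] by blast
  qed
  then obtain s where s: "s \<in> S" "\<And>r. r \<in> F \<Longrightarrow> \<exists>b\<in>R_set. s * r = a * b" by blast
  have sF: "\<exists>b\<in>R_set. s * r = a * b" if "r \<in> P.span F" for r
    using that
  proof (induction rule: P.span_induct_alt)
    case base
    show ?case using R.zero_in by (intro bexI[of _ 0]) auto
  next
    case (step c x y)
    then obtain b b' where b: "b \<in> R_set" "s * x = a * b" "b' \<in> R_set" "s * y = a * b'" using s(2) by blast
    then have "s * (smult (scale_L c 1) x + y) = a * (smult (scale_L c 1) b + b')" by (simp add: distrib_left)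
    then show ?case using R.add_in[OF smult_scale_in_R[OF b(1)] b(3)] by blast
  qed
  have "\<exists>b\<in>R_set. s * r = a * b" if r: "r \<in> N" for r
  proof -
    obtain q m where qm: "r = a * (monom 1 3 * q) + m" "degree m < degree a + 3" "monom 1 3 * q \<in> R_set"
      using division_in_R[OF a0] .
    have "m = r - a * (monom 1 3 * q)" by (simp add: qm(1))
    then have "m \<in> N" using P.subspace_diff[OF N_subspace r aR_N[OF qm(3)]] by simp
    then have "m \<in> P.span F" using qm(2) F(3) by blast
    then obtain b where b: "b \<in> R_set" "s * m = a * b" using sF by blast
    have "s * r = a * (s * (monom 1 3 * q) + b)" using b(2) by (simp add: qm(1) algebra_simps)
    then show ?thesis using R.add_in[OF R.mult_in[OF S_R[OF s(1)] qm(3)] b(1)] by blast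
  qed
  with s(1) that show thesis by blast
qed

text \<open>\<open>R \<rightarrow> A' / a A'\<close> is surjective: modulo \<open>a\<close> the powers of \<open>s\<close> are linearly dependent, and a relation
  of lowest order expresses \<open>1 / s\<close> as a polynomial in \<open>s\<close>.\<close>

lemma approximation_by_R:
  assumes "x \<in> A'"
  obtains y where "y \<in> R_set" "x - to_fract y \<in> (\<lambda>k. to_fract a * k) ` A'"
proof -
  obtain r s where x: "x = fr r s" "r \<in> R_set" "s \<in> S" using assms by (auto simp: A'_def)
  have b0: "monom 1 3 * a \<noteq> 0" using a0 by (simp add: monom_eq_0_iff)
  obtain i z c where c: "c \<noteq> 0" "z \<in> R_set" "monom 1 3 * a dvd s ^ i * (monom (scale_L c 1) 0 + s * z)"
    by (rule power_relation[OF S_R[OF x(3)] b0])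
  then obtain q where q: "s ^ i * (monom (scale_L c 1) 0 + s * z) = monom 1 3 * a * q" by (auto elim: dvdE)
  have s0: "to_fract s \<noteq> 0" using S_nonzero[OF x(3)] by simp
  let ?c = "to_fract (monom (scale_L c 1) 0)" and ?ci = "monom (scale_L (inverse c) 1) 0"
  have cc: "to_fract ?ci * ?c = 1"
  proof -
    have "?ci * monom (scale_L c 1) 0 = 1"
      using c(1) by (simp add: mult_monom flip: scale_L_one_mult)
    then show ?thesis by (metis to_fract_1 to_fract_mult)
  qed
  let ?k = "fr (monom 1 3 * q) (s ^ i)"
  have k: "?k \<in> A'" by (rule fr_in[OF conductor(1) power_S[OF x(3)]])
  have "to_fract (s ^ i) * (?c + to_fract s * to_fract z) = to_fract a * to_fract (monom 1 3 * q)"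
    using arg_cong[OF q, of to_fract] by (simp add: mult_ac)
  then have rel: "?c + to_fract s * to_fract z = to_fract a * ?k"
    using S_nonzero[OF power_S[OF x(3), of i]] by (simp add: field_simps)
  define y where "y = - (r * (?ci * z))"
  have "y \<in> R_set" unfolding y_def by (intro R.uminus_in R.mult_in x(2) const_in_R c(2))
  moreover have "x - to_fract y = to_fract a * (to_fract ?ci * x * ?k)"
  proof -
    have "x = to_fract ?ci * x * ?c" using cc by (simp add: mult_ac)
    also have "?c = to_fract a * ?k - to_fract s * to_fract z" using rel by (simp add: algebra_simps)
    finally have "x = to_fract ?ci * x * (to_fract a * ?k) - to_fract ?ci * (x * to_fract s) * to_fract z"
      by (simp add: algebra_simps)
    moreover have "x * to_fract s = to_fract r" using s0 by (simp add: x(1))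
    ultimately have "x = to_fract ?ci * x * (to_fract a * ?k) + to_fract y"
      by (simp add: y_def mult_ac)
    then show ?thesis by (simp add: algebra_simps)
  qed
  moreover have "to_fract ?ci * x * ?k \<in> A'"
    by (intro A'.mult_in to_fract_in const_in_R assms k)
  ultimately show thesis using that by blast
qed

text \<open>For a common denominator \<open>s\<close> as above, \<open>j \<mapsto> tau a (s * y j)\<close> is an honest functional that vanishes
  where all \<open>j \<mapsto> tau a (s * u * j)\<close> with \<open>u \<in> R\<close> do, by nondegeneracy. Hence it is a combination of such
  functionals, that is, one of them.\<close>

lemma hom_is_multiplication:
  assumes X: "ideal X R_ring" and y: "\<And>j. j \<in> X \<Longrightarrow> y j \<in> R_set"
    and add: "\<And>i j. i \<in> X \<Longrightarrow> j \<in> X \<Longrightarrow> y (i + j) - (y i + y j) \<in> N"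
    and mult: "\<And>r j. r \<in> R_set \<Longrightarrow> j \<in> X \<Longrightarrow> y (r * j) - r * y j \<in> N"
    and yN: "\<And>j. j \<in> X \<Longrightarrow> j \<in> N \<Longrightarrow> y j \<in> N"
  shows "\<exists>U\<in>R_set. \<forall>j\<in>X. y j - U * j \<in> N"
proof -
  obtain s where s: "s \<in> S" "\<And>r. r \<in> N \<Longrightarrow> \<exists>b\<in>R_set. s * r = a * b" by (rule common_denominator) blast
  have XR: "j \<in> R_set" if "j \<in> X" for j using R.idealD(1)[OF X] that by blast
  have tN: "tau a (s * r) = 0" if "r \<in> N" for r
    using s(2)[OF that] tau_vanishes[OF monic] by auto
  have N_tau: "r \<in> N" if r: "r \<in> R_set" and t: "\<And>u. u \<in> R_set \<Longrightarrow> tau a (s * r * u) = 0" for r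
  proof -
    obtain q where "s * r = a * q" "q \<in> R_set" by (rule tau_nondegenerate[OF monic t])
    then show ?thesis unfolding N_iff using r s(1) by blast
  qed
  let ?B = "{p \<in> R_set. degree p < degree a + 3}"
  obtain F where F: "finite F" "F \<subseteq> ?B" "?B = P.span F"
    using finite_spanning_set[OF bounded_degree_subspace[OF R_subspace, of "degree a + 3"]] by auto
  have FR: "u \<in> R_set" if "u \<in> F" for u using F(2) that by blast
  have "\<exists>c. \<forall>j\<in>X. tau a (s * y j) = (\<Sum>u\<in>F. c u * tau a (s * j * u))"
  proof (rule P.functional_combination[OF F(1) ideal_subspace[OF X]])
    show "tau a (s * (i + j) * u) = tau a (s * i * u) + tau a (s * j * u)" for i j u
      by (simp add: algebra_simps flip: tau_add)
    show "tau a (s * smult (scale_L c 1) j * u) = c * tau a (s * j * u)" for c j u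
      by (simp add: tau_smult)
    show "tau a (s * y (i + j)) = tau a (s * y i) + tau a (s * y j)" if "i \<in> X" "j \<in> X" for i j
      using tN[OF add[OF that]] by (simp add: right_diff_distrib distrib_left tau_diff tau_add)
    show "tau a (s * y (smult (scale_L c 1) j)) = c * tau a (s * y j)" if "j \<in> X" for c j
      using tN[OF mult[OF const_in_R that, of c]] by (simp add: monom_0 right_diff_distrib tau_diff tau_smult)
    fix j assume j: "j \<in> X" and z: "\<And>u. u \<in> F \<Longrightarrow> tau a (s * j * u) = 0"
    have zs: "tau a (s * j * u) = 0" if "u \<in> P.span F" for u
      using that
      by (induction rule: P.span_induct_alt) (simp_all add: tau_0 distrib_left tau_add tau_smult z)
    have "tau a (s * j * r) = 0" if r: "r \<in> R_set" for r
    proof -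
      obtain q m where qm: "r = a * (monom 1 3 * q) + m" "degree m < degree a + 3" "monom 1 3 * q \<in> R_set"
        using division_in_R[OF a0] .
      have "m = r - a * (monom 1 3 * q)" by (simp add: qm(1))
      then have "m \<in> R_set" using P.subspace_diff[OF R_subspace r R.mult_in[OF aR qm(3)]] by simp
      then have "tau a (s * j * m) = 0" using zs qm(2) F(3) by blast
      moreover have "tau a (s * j * (a * (monom 1 3 * q))) = 0"
        using tau_vanishes[OF monic R.mult_in[OF R.mult_in[OF S_R[OF s(1)] XR[OF j]] qm(3)]] by (simp add: mult_ac)
      ultimately show ?thesis by (simp only: qm(1) distrib_left tau_add)
    qed
    then have "j \<in> N" by (rule N_tau[OF XR[OF j]])
    then show "tau a (s * y j) = 0" by (intro tN yN j)
  qed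
  then obtain c where c: "\<And>j. j \<in> X \<Longrightarrow> tau a (s * y j) = (\<Sum>u\<in>F. c u * tau a (s * j * u))" by blast
  define U where "U = (\<Sum>u\<in>F. smult (scale_L (c u) 1) u)"
  have U: "U \<in> R_set" unfolding U_def by (intro R.sum_in smult_scale_in_R FR)
  have tau_sum: "tau a (p * (\<Sum>u\<in>G. smult (scale_L (c u) 1) u)) = (\<Sum>u\<in>G. c u * tau a (p * u))" for p G
    by (induction G rule: infinite_finite_induct) (simp_all add: tau_0 distrib_left tau_add tau_smult)
  have cU: "tau a (s * y j) = tau a (s * j * U)" if "j \<in> X" for j
    unfolding U_def tau_sum by (rule c[OF that])
  have "y j - U * j \<in> N" if j: "j \<in> X" for j
  proof (rule N_tau)
    show "y j - U * j \<in> R_set" by (rule P.subspace_diff[OF R_subspace y[OF j] R.mult_in[OF U XR[OF j]]])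
    fix r assume r: "r \<in> R_set"
    have "tau a (s * y (r * j)) = tau a (s * (r * y j))"
      using tN[OF mult[OF r j]] by (simp add: right_diff_distrib tau_diff)
    then have "tau a (s * (r * y j)) = tau a (s * (r * j) * U)" using cU[OF R.idealD(5)[OF X r j]] by simp
    then show "tau a (s * (y j - U * j) * r) = 0" by (simp add: left_diff_distrib right_diff_distrib tau_diff mult_ac)
  qed
  with U show ?thesis by blast
qed

end

text \<open>Dividing by a monic \<open>a\<close> in the given ideal turns a homomorphism into \<open>K / A'\<close> into a homomorphism
  into \<open>A' / a A'\<close>, and \<open>R\<close> maps onto the latter.\<close>

lemma baer_localization: "FM.baer_condition A'"
  unfolding FM.baer_condition_def
proof (intro allI impI)
  fix J :: "L poly fract set" and f
  assume JA: "J \<subseteq> A'" and J0: "0 \<in> J" and Jadd: "\<forall>x\<in>J. \<forall>y\<in>J. x + y \<in> J"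
    and Jmult: "\<forall>a\<in>A'. \<forall>x\<in>J. a * x \<in> J"
    and fadd: "\<forall>x\<in>J. \<forall>y\<in>J. f (x + y) - (f x + f y) \<in> A'"
    and fmult: "\<forall>a\<in>A'. \<forall>x\<in>J. f (a * x) - a * f x \<in> A'"
  note sD = FM.submodD[OF FM.submods(2)]
  show "\<exists>k. \<forall>x\<in>J. f x - x * k \<in> A'"
  proof (cases "J = {0}")
    case True
    have "f (0 + 0) - (f 0 + f 0) \<in> A'" using fadd J0 by blast
    then have "- (f (0 + 0) - (f 0 + f 0)) \<in> A'" by (rule A'.uminus_in)
    then show ?thesis using True by simp
  next
    case False
    then obtain x where x: "x \<in> J" "x \<noteq> 0" using J0 by blast
    then obtain r s where rs: "x = fr r s" "r \<in> R_set" "s \<in> S" using JA unfolding A'_def by blast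
    have "to_fract s * x \<in> J" using Jmult x(1) to_fract_in[OF S_R[OF rs(3)]] by blast
    then have rJ: "to_fract r \<in> J" using S_nonzero[OF rs(3)] by (simp add: rs(1))
    have r0: "r \<noteq> 0" using x(2) rs(1) by auto
    \<comment> \<open>a monomial factor of degree 3 keeps the product in \<open>R\<close> and makes it monic\<close>
    define b where "b = monom (inverse (lead_coeff r)) 3"
    define a where "a = b * r"
    have bR: "b \<in> R_set" using conductor(1)[of "monom (inverse (lead_coeff r)) 0"]
      by (simp add: b_def mult_monom)
    have monic: "lead_coeff a = 1"
      using r0 by (simp add: a_def b_def lead_coeff_mult degree_monom_eq)
    have aR: "a \<in> R_set" unfolding a_def by (rule R.mult_in[OF bR rs(2)])
    have "to_fract b * to_fract r \<in> J" using Jmult rJ to_fract_in[OF bR] by blast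
    then have aJ: "to_fract a \<in> J" by (simp add: a_def)
    have ne: "to_fract a \<noteq> 0" using monic by auto
    let ?a = "to_fract a" and ?N = "N a"
    \<comment> \<open>once the homomorphism vanishes at \<open>a\<close>, its values lie in \<open>a\<^sup>-\<^sup>1 A' / A'\<close>, which is a copy of \<open>A' / a A'\<close>\<close>
    define k0 where "k0 = f ?a / ?a"
    define g where "g x = f x - x * k0" for x
    have gadd: "g (x + y) - (g x + g y) \<in> A'" if "x \<in> J" "y \<in> J" for x y
      using fadd that by (simp add: g_def algebra_simps)
    have gmult: "g (c * x) - c * g x \<in> A'" if "c \<in> A'" "x \<in> J" for c x
      using fmult that by (simp add: g_def algebra_simps)
    have ga: "g ?a = 0" using ne by (simp add: g_def k0_def)
    have ag: "?a * g x \<in> A'" if xJ: "x \<in> J" for x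
    proof -
      have "g (?a * x) - ?a * g x \<in> A'" by (rule gmult[OF to_fract_in[OF aR] xJ])
      moreover have "g (x * ?a) - x * g ?a \<in> A'" by (rule gmult[OF subsetD[OF JA xJ] aJ])
      ultimately have "(g (x * ?a) - x * g ?a) - (g (?a * x) - ?a * g x) \<in> A'" by (rule sD(5)[rotated])
      then show ?thesis by (simp add: ga mult.commute)
    qed
    have "\<exists>y. y \<in> R_set \<and> g x - fr y a \<in> A'" if xJ: "x \<in> J" for x
    proof -
      obtain y where y: "y \<in> R_set" "?a * g x - to_fract y \<in> (\<lambda>k. ?a * k) ` A'"
        by (rule approximation_by_R[OF aR monic ag[OF xJ]])
      then obtain k where k: "k \<in> A'" "?a * g x - to_fract y = ?a * k" by blast
      then have "g x - fr y a = k" using ne by (simp add: field_simps)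
      with k y show ?thesis by blast
    qed
    then obtain y where y: "\<And>x. x \<in> J \<Longrightarrow> y x \<in> R_set" "\<And>x. x \<in> J \<Longrightarrow> g x - fr (y x) a \<in> A'" by metis
    define X where "X = {j \<in> R_set. to_fract j \<in> J}"
    have X_iff: "j \<in> X \<longleftrightarrow> j \<in> R_set \<and> to_fract j \<in> J" for j by (simp add: X_def)
    have X: "ideal X R_ring"
    proof (rule R.idealI)
      show "c * j \<in> X" if "c \<in> R_set" "j \<in> X" for c j
        using that Jmult to_fract_in[of c] by (simp add: X_iff R.mult_in)
      show "i + j \<in> X" if "i \<in> X" "j \<in> X" for i j
        using that Jadd by (simp add: X_iff R.add_in)
    qed (use R.zero_in J0 in \<open>auto simp: X_iff\<close>)
    have NA: "r \<in> ?N" if "r \<in> R_set" "fr r a \<in> A'" for r using that by (simp add: N_def[OF aR monic])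
    have RX: "j \<in> R_set" "to_fract j \<in> J" "y (to_fract j) \<in> R_set" "g (to_fract j) - fr (y (to_fract j)) a \<in> A'"
      if "j \<in> X" for j using that y by (auto simp: X_iff)
    note Rs = P.subspace_diff[OF R_subspace]
    have "\<exists>U\<in>R_set. \<forall>j\<in>X. y (to_fract j) - U * j \<in> ?N"
    proof (rule hom_is_multiplication[OF aR monic X, of "\<lambda>j. y (to_fract j)"])
      show "y (to_fract j) \<in> R_set" if "j \<in> X" for j by (rule RX(3)[OF that])
      show "y (to_fract (i + j)) - (y (to_fract i) + y (to_fract j)) \<in> ?N" if i: "i \<in> X" and j: "j \<in> X" for i j
      proof (rule NA)
        have ij: "i + j \<in> X" by (rule R.idealD(3)[OF X i j])
        show "y (to_fract (i + j)) - (y (to_fract i) + y (to_fract j)) \<in> R_set"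
          by (intro Rs R.add_in RX(3) i j ij)
        have "((g (to_fract (i + j)) - (g (to_fract i) + g (to_fract j))) - (g (to_fract (i + j)) - fr (y (to_fract (i + j))) a))
            + ((g (to_fract i) - fr (y (to_fract i)) a) + (g (to_fract j) - fr (y (to_fract j)) a)) \<in> A'"
          by (rule A'.add_in[OF sD(5)[OF gadd[OF RX(2)[OF i] RX(2)[OF j], folded to_fract_add] RX(4)[OF ij]]
                A'.add_in[OF RX(4)[OF i] RX(4)[OF j]]])
        then show "fr (y (to_fract (i + j)) - (y (to_fract i) + y (to_fract j))) a \<in> A'"
          by (simp add: diff_divide_distrib add_divide_distrib algebra_simps)
      qed
      show "y (to_fract (c * j)) - c * y (to_fract j) \<in> ?N" if c: "c \<in> R_set" and j: "j \<in> X" for c j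
      proof (rule NA)
        have cj: "c * j \<in> X" by (rule R.idealD(5)[OF X c j])
        show "y (to_fract (c * j)) - c * y (to_fract j) \<in> R_set"
          by (intro Rs R.mult_in RX(3) c j cj)
        have "((g (to_fract (c * j)) - to_fract c * g (to_fract j)) - (g (to_fract (c * j)) - fr (y (to_fract (c * j))) a))
            + to_fract c * (g (to_fract j) - fr (y (to_fract j)) a) \<in> A'"
          by (rule A'.add_in[OF sD(5)[OF gmult[OF to_fract_in[OF c] RX(2)[OF j], folded to_fract_mult] RX(4)[OF cj]]
                A'.mult_in[OF to_fract_in[OF c] RX(4)[OF j]]])
        then show "fr (y (to_fract (c * j)) - c * y (to_fract j)) a \<in> A'"
          by (simp add: diff_divide_distrib right_diff_distrib)
      qed
      show "y (to_fract j) \<in> ?N" if j: "j \<in> X" and jN: "j \<in> ?N" for j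
      proof (rule NA[OF RX(3)[OF j]])
        have jA: "fr j a \<in> A'" using jN by (simp add: N_def[OF aR monic])
        have "g (fr j a * ?a) - fr j a * g ?a \<in> A'" by (rule gmult[OF jA aJ])
        then have "g (to_fract j) \<in> A'" using ne by (simp add: ga)
        then have "g (to_fract j) - (g (to_fract j) - fr (y (to_fract j)) a) \<in> A'" by (rule sD(5)[OF _ RX(4)[OF j]])
        then show "fr (y (to_fract j)) a \<in> A'" by simp
      qed
    qed
    then obtain U where U: "U \<in> R_set" "\<And>j. j \<in> X \<Longrightarrow> y (to_fract j) - U * j \<in> ?N" by blast
    have main: "g (to_fract j) - to_fract j * fr U a \<in> A'" if j: "j \<in> X" for j
    proof -
      have "fr (y (to_fract j) - U * j) a \<in> A'" using U(2)[OF j] by (simp add: N_def[OF aR monic])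
      from A'.add_in[OF RX(4)[OF j] this] show ?thesis
        by (simp add: diff_divide_distrib mult.commute)
    qed
    have "f x - x * (k0 + fr U a) \<in> A'" if xJ: "x \<in> J" for x
    proof -
      obtain j s where x: "x = fr j s" "j \<in> R_set" "s \<in> S" using JA xJ unfolding A'_def by blast
      have s0: "to_fract s \<noteq> 0" using S_nonzero[OF x(3)] by simp
      have jx: "to_fract j = to_fract s * x" using s0 by (simp add: x(1))
      have "to_fract j \<in> J" unfolding jx using Jmult to_fract_in[OF S_R[OF x(3)]] xJ by blast
      then have "g (to_fract j) - to_fract j * fr U a \<in> A'" using main x(2) by (simp add: X_iff)
      moreover have "g (to_fract s * x) - to_fract s * g x \<in> A'" by (rule gmult[OF to_fract_in[OF S_R[OF x(3)]] xJ])
      ultimately have "(g (to_fract j) - to_fract j * fr U a) - (g (to_fract s * x) - to_fract s * g x) \<in> A'" by (rule sD(5))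
      then have "to_fract s * (g x - x * fr U a) \<in> A'" by (simp add: jx algebra_simps)
      then have "fr 1 s * (to_fract s * (g x - x * fr U a)) \<in> A'" by (rule A'.mult_in[OF fr_in[OF R.one_in x(3)]])
      then have "g x - x * fr U a \<in> A'" using s0 by simp
      then show ?thesis by (simp add: g_def algebra_simps)
    qed
    then show ?thesis by blast
  qed
qed

end

lemma gorenstein_R: "gorenstein_ring R_ring"
  unfolding gorenstein_ring_def
proof (intro conjI allI impI)
  show "cring R_ring" by (rule R.R.cring_axioms)
  show "noetherian_ring R_ring" by (rule noetherian_R)
  fix P assume "maximalideal P R_ring"
  then interpret localization_at P by (rule localization_at.intro)
  show "finite_self_injective_dimension (localization R_ring (carrier R_ring - P))"
    using FM.finite_dimension[OF baer_localization] by (simp add: S_def)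
qed

theorem mainTheorem3:
  shows "
    Factorial_Ring.irreducible L_modulus \<and>
    field (ring_of (UNIV :: L set)) \<and>
    dim_L (UNIV :: L set) = 24 \<and>
    dim_L V = 6 \<and>
    direct_sum_on {0, 1, 2 :: nat} (\<lambda>i. {\<alpha> ^ i * v | v. v \<in> V}) \<and>
    space_prod V V = L_upto 20 \<and>
    space_prod V (L_upto 21) = UNIV \<and>
    subring R_set L_poly_ring \<and>
    standard_graded_rat_algebra R_ring R_scalar R_component \<and>
    gorenstein_ring R_ring \<and>
    domain R_ring \<and>
    Polynomial.monom 1 1 \<in> R_set \<and>
    Polynomial.monom \<alpha> 1 \<in> R_set \<and>
    rigid_ideal R_ring I_ideal \<and>
    \<not> principalideal I_ideal R_ring \<and>
    maximalideal R_max_ideal R_ring \<and>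
    (let I = ideal_mod R_ring I_ideal; T = tensor_mod R_ring I (dual_mod R_ring I) in
       (\<forall>x\<in>carrier I. \<forall>f\<in>carrier (dual_mod R_ring I).
          evaluation_map R_ring I (pure_tensor R_ring I (dual_mod R_ring I) x f) = f x) \<and>
       evaluation_map R_ring I \<in> lin_maps R_ring T (ideal_mod R_ring R_max_ideal) \<and>
       bij_betw (evaluation_map R_ring I) (carrier T) R_max_ideal)"
  unfolding Let_def
  using irreducible_L_modulus field_L dim_L_UNIV dim_V V_direct_sum V_squared V_times_L_upto_21
    subring_R_set standard_graded_R gorenstein_R R_ring_domain monom_1_in_R monom_alpha_in_R
    rigid_I not_principal_I maximalideal_R_max_ideal evaluation_iso
  by (intro conjI)

end
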